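(* Let $\mathbb{G}$ be a Carnot group with horizontal layer $\mathfrak g_1$ of dimension $m$, let $\{e_1,\dots,e_m\}$ be an orthonormal basis of $\mathfrak g_1$, with associated left-invariant vector fields $X_1,\dots,X_m$ and right-invariant vector fields $\tilde X_1,\dots,\tilde X_m$, let $\Delta_H=\sum_{i=1}^m X_i^2$, and let $B_r=\{p\in\mathbb G\mid \rho(p)<r\}$, where $\rho$ is a fixed homogeneous norm on $\mathbb G$. Let $f\in C^2(B_r)$ be real-valued for a certain $r>0$, and suppose that for some $c\in\mathbb{R}$ we have $\Delta_H f=c$ in $B_r$ and $$|\tilde\nabla_H f|^2=\sum_{i=1}^m(\tilde X_i f)^2\le 1\quad\text{in } B_r.$$ If $|\tilde\nabla_H f(e)|^2=1$, where $e$ is the group identity, then $f$ depends only on the horizontal variables $z=(z_1,\dots,z_m)$, and in fact, for every $p\in B_r$ with logarithmic coordinates $(z,\sigma)$, $$f(p)=f(e)+\langle\nabla_z f(e),z\rangle.$$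
   Context: A Carnot group of step $k\ge1$ is a simply connected real Lie group $(\mathbb G,\circ)$ whose Lie algebra $\mathfrak g$ is stratified and $k$-nilpotent: there are vector spaces $\mathfrak g_1,\dots,\mathfrak g_k$ with $\mathfrak g=\mathfrak g_1\oplus\cdots\oplus\mathfrak g_k$, $[\mathfrak g_1,\mathfrak g_j]=\mathfrak g_{j+1}$ for $j=1,\dots,k-1$, and $[\mathfrak g_1,\mathfrak g_k]=\{0\}$. The Lie algebra $\mathfrak g$ is endowed with a scalar product $\langle\cdot,\cdot\rangle$ for which the layers $\mathfrak g_j$ are mutually orthogonal. Write $m=\dim\mathfrak g_1$; $\mathfrak g_1$ is called the horizontal layer. Dilations: on $\mathfrak g$ set $\Delta_\lambda(\xi_1+\cdots+\xi_k)=\lambda\xi_1+\cdots+\lambda^k\xi_k$ for $\xi_j\in\mathfrak g_j$, $\lambda>0$, and on $\mathbb G$ set $\delta_\lambda=\exp\circ\Delta_\lambda\circ\exp^{-1}$. A homogeneous norm (non-isotropic gauge centred at $e$) is a continuous function $\rho:\mathbb G\to[0,\infty)$, $C^\infty$ on $\mathbb G\setminus\{e\}$, such that $\rho(p^{-1})=\rho(p)$, $\rho(\delta_\lambda p)=\lambda\rho(p)$ for all $\lambda>0$, and $\rho(p)=0$ if and only if $p=e$. Vector fields: for the fixed orthonormal basis $\{e_1,\dots,e_m\}$ of $\mathfrak g_1$, $$X_i f(p)=\frac{d}{dt}f(p\circ\exp(te_i))\Big|_{t=0},\qquad \tilde X_i f(p)=\frac{d}{dt}f(\exp(te_i)\circ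 p)\Big|_{t=0}.$$ Logarithmic coordinates: a point $p\in\mathbb G$ is identified with the coordinates of $\exp^{-1}(p)\in\mathfrak g$ with respect to an orthonormal basis of $\mathfrak g$ adapted to the stratification and extending $\{e_1,\dots,e_m\}$. One writes $p\cong(z,\sigma)$, with $z=(z_1,\dots,z_m)$ the coordinates in $\mathfrak g_1$ relative to $\{e_1,\dots,e_m\}$ and $\sigma$ the coordinates in the remaining layers. $\nabla_z f(e)=(\partial_{z_1}f(e),\dots,\partial_{z_m}f(e))$, and $\langle\nabla_z f(e),z\rangle=\sum_{i=1}^m z_i\,\partial_{z_i}f(e)$. *)

theory Defs
  imports "HOL-Analysis.Analysis"
begin

text \<open>Meant for open \<open>S\<close> in a finite-dimensional space, where continuity of
  \<open>\<lambda>x. f' x v\<close> for every fixed direction \<open>v\<close> is continuity of the derivative.\<close>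

fun Ck_on :: "nat \<Rightarrow> 'a::euclidean_space set \<Rightarrow> ('a \<Rightarrow> 'b::real_normed_vector) \<Rightarrow> bool" where
  "Ck_on 0 S f \<longleftrightarrow> continuous_on S f"
| "Ck_on (Suc n) S f \<longleftrightarrow>
     (\<exists>f'. (\<forall>x\<in>S. (f has_derivative f' x) (at x)) \<and> (\<forall>v. Ck_on n S (\<lambda>x. f' x v)))"

definition smooth_on :: "'a::euclidean_space set \<Rightarrow> ('a \<Rightarrow> 'b::real_normed_vector) \<Rightarrow> bool" where
  "smooth_on S f \<longleftrightarrow> (\<forall>n. Ck_on n S f)"

text \<open>A chart is a pair \<open>(U, \<phi>)\<close> of an open set and a homeomorphism of \<open>U\<close> onto an open
  subset of the model space; the values of \<open>\<phi>\<close> outside \<open>U\<close> are irrelevant.\<close>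

type_synonym ('g, 'a) chart = "'g set \<times> ('g \<Rightarrow> 'a)"

definition smooth_atlas :: "('g::topological_space, 'a::euclidean_space) chart set \<Rightarrow> bool" where
  "smooth_atlas A \<longleftrightarrow>
     (\<Union>(U, \<phi>)\<in>A. U) = UNIV \<and>
     (\<forall>(U, \<phi>)\<in>A. open U \<and> open (\<phi> ` U) \<and> homeomorphism U (\<phi> ` U) \<phi> (inv_into U \<phi>)) \<and>
     (\<forall>(U, \<phi>)\<in>A. \<forall>(V, \<theta>)\<in>A. smooth_on (\<phi> ` (U \<inter> V)) (\<theta> \<circ> inv_into U \<phi>))"

definition manifold_Ck_on ::
  "('g::topological_space, 'a::euclidean_space) chart set \<Rightarrow> nat \<Rightarrow> 'g set \<Rightarrow>
   ('g \<Rightarrow> 'b::real_normed_vector) \<Rightarrow> bool" where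
  "manifold_Ck_on A n W f \<longleftrightarrow> (\<forall>(U, \<phi>)\<in>A. Ck_on n (\<phi> ` (U \<inter> W)) (f \<circ> inv_into U \<phi>))"

definition manifold_smooth_on ::
  "('g::topological_space, 'a::euclidean_space) chart set \<Rightarrow> 'g set \<Rightarrow>
   ('g \<Rightarrow> 'b::real_normed_vector) \<Rightarrow> bool" where
  "manifold_smooth_on A W f \<longleftrightarrow> (\<forall>n. manifold_Ck_on A n W f)"

text \<open>The group law is written additively, since that is the notation of the type class of
  topological groups; \<^class>\<open>topological_group_add\<close> does not assume commutativity.
  So \<open>p + q\<close>, \<open>- p\<close> and \<open>0\<close> are the product, the inverse and the identity.\<close>

locale lie_group =
  fixes A :: "('g::{topological_group_add, t2_space}, 'a::euclidean_space) chart set"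
  assumes atlas: "smooth_atlas A"
    and smooth_mult: "\<And>U \<phi> V \<theta> W \<psi>. (U, \<phi>) \<in> A \<Longrightarrow> (V, \<theta>) \<in> A \<Longrightarrow> (W, \<psi>) \<in> A \<Longrightarrow>
      smooth_on {(x, y). x \<in> \<phi> ` U \<and> y \<in> \<theta> ` V \<and> inv_into U \<phi> x + inv_into V \<theta> y \<in> W}
        (\<lambda>(x, y). \<psi> (inv_into U \<phi> x + inv_into V \<theta> y))"
    and smooth_inverse: "\<And>U \<phi> V \<theta>. (U, \<phi>) \<in> A \<Longrightarrow> (V, \<theta>) \<in> A \<Longrightarrow>
      smooth_on {x \<in> \<phi> ` U. - inv_into U \<phi> x \<in> V} (\<lambda>x. \<theta> (- inv_into U \<phi> x))"

definition left_inv_field :: "('a::real_vector \<Rightarrow> 'g::group_add) \<Rightarrow> 'a \<Rightarrow> ('g \<Rightarrow> real) \<Rightarrow> 'g \<Rightarrow> real" where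
  "left_inv_field Exp \<xi> f p = deriv (\<lambda>t. f (p + Exp (t *\<^sub>R \<xi>))) 0"

definition right_inv_field :: "('a::real_vector \<Rightarrow> 'g::group_add) \<Rightarrow> 'a \<Rightarrow> ('g \<Rightarrow> real) \<Rightarrow> 'g \<Rightarrow> real" where
  "right_inv_field Exp \<xi> f p = deriv (\<lambda>t. f (Exp (t *\<^sub>R \<xi>) + p)) 0"

text \<open>The model space \<open>'a\<close> is taken to be the Lie algebra itself, its inner product being the
  chosen scalar product. It is identified with the tangent space at the identity by
  sending \<open>\<xi>\<close> to the velocity at \<open>0\<close> of the one-parameter subgroup \<open>t \<mapsto> Exp (t \<xi>)\<close>
  (\<open>velocity\<close> says that this is a linear isomorphism, in one or equivalently every chart
  around \<open>0\<close>), so \<open>Exp\<close> is the exponential map, and is determined by that identification.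
  The Lie bracket is the commutator of left-invariant vector fields. Smoothness, injectivity
  and surjectivity of \<open>Exp\<close> are not assumed.\<close>

locale lie_group_with_algebra = lie_group A
  for A :: "('g::{topological_group_add, t2_space}, 'a::euclidean_space) chart set" +
  fixes Exp :: "'a \<Rightarrow> 'g"
    and bracket :: "'a \<Rightarrow> 'a \<Rightarrow> 'a"
  assumes one_parameter: "\<And>\<xi> s t. Exp ((s + t) *\<^sub>R \<xi>) = Exp (s *\<^sub>R \<xi>) + Exp (t *\<^sub>R \<xi>)"
    and velocity: "\<And>U \<phi>. (U, \<phi>) \<in> A \<Longrightarrow> 0 \<in> U \<Longrightarrow>
      \<exists>T. linear T \<and> bij T \<and>
        (\<forall>\<xi>. ((\<lambda>t. \<phi> (Exp (t *\<^sub>R \<xi>))) has_vector_derivative T \<xi>) (at 0))"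
    and bracket: "\<And>\<xi> \<eta> W f p. open W \<Longrightarrow> manifold_smooth_on A W f \<Longrightarrow> p \<in> W \<Longrightarrow>
      left_inv_field Exp (bracket \<xi> \<eta>) f p =
        left_inv_field Exp \<xi> (left_inv_field Exp \<eta> f) p -
        left_inv_field Exp \<eta> (left_inv_field Exp \<xi> f) p"

text \<open>\<open>V j\<close> is the layer \<open>\<gg>\<^sub>j\<close>; the sum of the layers is direct because they are mutually
  orthogonal.\<close>

locale carnot_group = lie_group_with_algebra A Exp bracket
  for A :: "('g::{topological_group_add, t2_space}, 'a::euclidean_space) chart set"
    and Exp :: "'a \<Rightarrow> 'g"
    and bracket :: "'a \<Rightarrow> 'a \<Rightarrow> 'a" +
  fixes k :: nat
    and V :: "nat \<Rightarrow> 'a set"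
  assumes simply_connected: "simply_connected (UNIV :: 'g set)"
    and step: "k \<ge> 1"
    and layer_subspace: "\<And>j. j \<in> {1..k} \<Longrightarrow> subspace (V j)"
    and layers_orthogonal: "\<And>i j x y. i \<in> {1..k} \<Longrightarrow> j \<in> {1..k} \<Longrightarrow> i \<noteq> j \<Longrightarrow>
      x \<in> V i \<Longrightarrow> y \<in> V j \<Longrightarrow> orthogonal x y"
    and layers_span: "span (\<Union>j\<in>{1..k}. V j) = UNIV"
    and layer_bracket: "\<And>j. j \<in> {1..<k} \<Longrightarrow>
      span {bracket x y | x y. x \<in> V 1 \<and> y \<in> V j} = V (j + 1)"
    and layer_bracket_last: "\<And>x y. x \<in> V 1 \<Longrightarrow> y \<in> V k \<Longrightarrow> bracket x y = 0"

definition algebra_dilation :: "nat \<Rightarrow> (nat \<Rightarrow> 'a::real_vector set) \<Rightarrow> real \<Rightarrow> 'a \<Rightarrow> 'a" where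
  "algebra_dilation k V s \<xi> =
     (THE \<eta>. \<exists>x. (\<forall>j\<in>{1..k}. x j \<in> V j) \<and> \<xi> = (\<Sum>j=1..k. x j) \<and> \<eta> = (\<Sum>j=1..k. s ^ j *\<^sub>R x j))"

text \<open>The group dilation \<open>\<delta>\<^sub>s\<close> is determined by \<open>\<delta>\<^sub>s (Exp \<xi>) = Exp (\<Delta>\<^sub>s \<xi>)\<close>; the homogeneity
  condition is written at the point \<open>p = Exp \<xi>\<close>, with \<open>\<xi>\<close> arbitrary.\<close>

definition homogeneous_norm ::
  "('g::{topological_group_add, t2_space}, 'a::euclidean_space) chart set \<Rightarrow> ('a \<Rightarrow> 'g) \<Rightarrow>
   nat \<Rightarrow> (nat \<Rightarrow> 'a set) \<Rightarrow> ('g \<Rightarrow> real) \<Rightarrow> bool" where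
  "homogeneous_norm A Exp k V \<rho> \<longleftrightarrow>
     continuous_on UNIV \<rho> \<and>
     (\<forall>p. \<rho> p \<ge> 0) \<and>
     manifold_smooth_on A (- {0}) \<rho> \<and>
     (\<forall>p. \<rho> (- p) = \<rho> p) \<and>
     (\<forall>s \<xi>. s > 0 \<longrightarrow> \<rho> (Exp (algebra_dilation k V s \<xi>)) = s * \<rho> (Exp \<xi>)) \<and>
     (\<forall>p. \<rho> p = 0 \<longleftrightarrow> p = 0)"

definition gauge_ball :: "('g \<Rightarrow> real) \<Rightarrow> real \<Rightarrow> 'g set" where
  "gauge_ball \<rho> r = {p. \<rho> p < r}"

definition horizontal_laplacian ::
  "('a::real_vector \<Rightarrow> 'g::group_add) \<Rightarrow> nat \<Rightarrow> (nat \<Rightarrow> 'a) \<Rightarrow> ('g \<Rightarrow> real) \<Rightarrow> 'g \<Rightarrow> real" where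
  "horizontal_laplacian Exp m e f p =
     (\<Sum>i=1..m. left_inv_field Exp (e i) (left_inv_field Exp (e i) f) p)"

definition right_gradient_sq ::
  "('a::real_vector \<Rightarrow> 'g::group_add) \<Rightarrow> nat \<Rightarrow> (nat \<Rightarrow> 'a) \<Rightarrow> ('g \<Rightarrow> real) \<Rightarrow> 'g \<Rightarrow> real" where
  "right_gradient_sq Exp m e f p = (\<Sum>i=1..m. (right_inv_field Exp (e i) f p)\<^sup>2)"

definition orthonormal_basis_of :: "'a::real_inner set \<Rightarrow> nat \<Rightarrow> (nat \<Rightarrow> 'a) \<Rightarrow> bool" where
  "orthonormal_basis_of S m e \<longleftrightarrow>
     (\<forall>i\<in>{1..m}. \<forall>j\<in>{1..m}. e i \<bullet> e j = (if i = j then 1 else 0)) \<and> span (e ` {1..m}) = S"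

text \<open>The logarithmic coordinates of \<open>p = Exp \<xi>\<close> are those of \<open>\<xi>\<close> in an orthonormal basis
  extending \<open>e 1, \<dots>, e m\<close>, so that \<open>z\<^sub>i = \<xi> \<bullet> e i\<close> whatever the extension. At the identity
  \<open>\<xi> = 0\<close>, the partial derivative along \<open>z\<^sub>i\<close> is that of \<open>f \<circ> Exp\<close> in the direction \<open>e i\<close>.\<close>

definition log_coord :: "(nat \<Rightarrow> 'a::real_inner) \<Rightarrow> nat \<Rightarrow> 'a \<Rightarrow> real" where
  "log_coord e i \<xi> = \<xi> \<bullet> e i"

definition log_partial_at_identity ::
  "('a::real_inner \<Rightarrow> 'g) \<Rightarrow> (nat \<Rightarrow> 'a) \<Rightarrow> nat \<Rightarrow> ('g \<Rightarrow> real) \<Rightarrow> real" where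
  "log_partial_at_identity Exp e i f = deriv (\<lambda>t. (f \<circ> Exp) (0 + t *\<^sub>R e i)) 0"

end

theory Submission
  imports Defs
begin

text \<open>Left-invariant and right-invariant fields commute, so \<open>u = 1 - (right derivative of f along
  the unit vector a)\<close>, where \<open>a\<close> is the right gradient of \<open>f\<close> at \<open>0\<close>, is nonnegative, vanishes at \<open>0\<close>
  and is harmonic in the limit of finite differences, for which \<open>C\<^sup>2\<close> suffices. Bony's form of the strong
  maximum principle makes its zero set open along horizontal lines, hence open. Where \<open>u = 0\<close> the horizontal
  right gradient is the constant \<open>a\<close>, so the derivatives along commutators vanish and \<open>f\<close> is locally affine
  in the horizontal coordinates. The dilations connect every point of the gauge ball to \<open>0\<close>.

  Since neither smoothness nor surjectivity of \<open>Exp\<close> is assumed, a continuous exponential map \<open>E\<close> is built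
  from the germs of the one-parameter subgroups, and the homogeneous norm then forces \<open>Exp = E\<close>.\<close>

subsection \<open>Functions of class C k\<close>

text \<open>The right derivative of \<open>f\<close> is only of class \<open>C\<^sup>1\<close>, so
  the horizontal Laplacian cannot be applied to \<open>u\<close> itself. The difference quotients
  \<open>w t\<close> are of class \<open>C\<^sup>2\<close>, and their Laplacian involves the
  difference of two values equal to \<open>c\<close>. They converge to \<open>u\<close> uniformly on
  small balls, which is enough because the strict inequalities in Hopf's argument survive a small
  perturbation.

  The obstacle with \<open>Exp\<close> is that \<open>velocity\<close> only sees the chart, whose
  values outside its domain are arbitrary. It says nothing about times at which a subgroup is
  outside that domain, so a one-parameter subgroup could a priori be discontinuous. Separability of
  the group supplies small times inside the domain, and along the subgroup of times obtained from
  them everything is continuous.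

  Surjectivity of \<open>E\<close> is reached without the Baker-Campbell-Hausdorff formula: the
  stratification makes the adjoint action unipotent, which gives local injectivity; invariance of
  domain gives an open range; and the dilations make the norm proper along \<open>E\<close>, which
  gives a closed one.\<close>

lemma Ck_on_subset: "Ck_on n S f \<Longrightarrow> S' \<subseteq> S \<Longrightarrow> Ck_on n S' f"
proof (induction n arbitrary: f)
  case 0
  then show ?case by (auto intro: continuous_on_subset)
next
  case (Suc n)
  then obtain f' where f': "\<forall>x\<in>S. (f has_derivative f' x) (at x)" "\<forall>v. Ck_on n S (\<lambda>x. f' x v)"
    by auto
  show ?case
    using f' Suc by (auto intro!: exI[of _ f'])
qed

lemma Ck_on_SucD: "Ck_on (Suc n) S f \<Longrightarrow> Ck_on n S f"
proof (induction n arbitrary: f)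
  case 0
  then obtain f' where f': "\<forall>x\<in>S. (f has_derivative f' x) (at x)" by auto
  then have "continuous_on S f"
    by (meson continuous_at_imp_continuous_on has_derivative_continuous)
  then show ?case by simp
next
  case (Suc n)
  then obtain f' where f': "\<forall>x\<in>S. (f has_derivative f' x) (at x)" "\<forall>v. Ck_on (Suc n) S (\<lambda>x. f' x v)"
    using Ck_on.simps(2)[of "Suc n" S f] by blast
  then show ?case using Suc.IH by auto
qed

lemma Ck_on_add:
  "Ck_on n S f \<Longrightarrow> Ck_on n S g \<Longrightarrow> Ck_on n S (\<lambda>x. f x + g x)"
proof (induction n arbitrary: f g)
  case 0
  then show ?case by (auto intro: continuous_intros)
next
  case (Suc n)
  from Suc.prems obtain f' g' where
    f': "\<forall>x\<in>S. (f has_derivative f' x) (at x)" "\<forall>v. Ck_on n S (\<lambda>x. f' x v)" and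
    g': "\<forall>x\<in>S. (g has_derivative g' x) (at x)" "\<forall>v. Ck_on n S (\<lambda>x. g' x v)" by auto
  show ?case
    using f' g' Suc.IH
    by (auto intro!: exI[of _ "\<lambda>x v. f' x v + g' x v"] has_derivative_add)
qed

lemma Ck_on_const: "Ck_on n S (\<lambda>x. c)"
proof (induction n arbitrary: c)
  case (Suc n)
  then show ?case by (auto intro!: exI[of _ "\<lambda>x v. 0"])
qed auto

lemma Ck_on_sum:
  "(\<And>i. i \<in> I \<Longrightarrow> Ck_on n S (f i)) \<Longrightarrow> Ck_on n S (\<lambda>x. \<Sum>i\<in>I. f i x)"
  by (induction I rule: infinite_finite_induct) (auto intro!: Ck_on_add Ck_on_const)

lemma Ck_on_linear:
  assumes "bounded_linear h"
  shows "Ck_on n S f \<Longrightarrow> Ck_on n S (\<lambda>x. h (f x))"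
proof (induction n arbitrary: f)
  case 0
  then show ?case using assms by (auto intro: bounded_linear.continuous_on)
next
  case (Suc n)
  then obtain f' where f': "\<forall>x\<in>S. (f has_derivative f' x) (at x)" "\<forall>v. Ck_on n S (\<lambda>x. f' x v)"
    by auto
  show ?case
    using f' Suc.IH
    by (auto intro!: exI[of _ "\<lambda>x v. h (f' x v)"] bounded_linear.has_derivative[OF assms])
qed

lemma Ck_on_scaleR:
  fixes a :: "'a::euclidean_space \<Rightarrow> real"
  shows "Ck_on n S a \<Longrightarrow> Ck_on n S f \<Longrightarrow> Ck_on n S (\<lambda>x. a x *\<^sub>R f x)"
proof (induction n arbitrary: f a)
  case 0
  then show ?case by (auto intro: continuous_intros)
next
  case (Suc n)
  from Suc.prems obtain a' f' where
    a': "\<forall>x\<in>S. (a has_derivative a' x) (at x)" "\<forall>v. Ck_on n S (\<lambda>x. a' x v)" and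
    f': "\<forall>x\<in>S. (f has_derivative f' x) (at x)" "\<forall>v. Ck_on n S (\<lambda>x. f' x v)" by auto
  have "Ck_on n S a" "Ck_on n S f" using Suc.prems Ck_on_SucD by blast+
  then have "\<forall>v. Ck_on n S (\<lambda>x. a x *\<^sub>R f' x v + a' x v *\<^sub>R f x)"
    using Suc.IH a' f' by (auto intro!: Ck_on_add)
  then show ?case
    using a' f' by (auto intro!: exI[of _ "\<lambda>x v. a x *\<^sub>R f' x v + a' x v *\<^sub>R f x"] has_derivative_scaleR)
qed

lemma linear_euclidean_expand:
  fixes h :: "'a::euclidean_space \<Rightarrow> 'b::real_vector"
  assumes "linear h"
  shows "h v = (\<Sum>b\<in>Basis. (v \<bullet> b) *\<^sub>R h b)"
proof -
  have "h v = h (\<Sum>b\<in>Basis. (v \<bullet> b) *\<^sub>R b)" by (simp add: euclidean_representation)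
  also have "\<dots> = (\<Sum>b\<in>Basis. (v \<bullet> b) *\<^sub>R h b)"
    using assms by (simp add: linear_sum linear_scale)
  finally show ?thesis .
qed

lemma Ck_on_compose:
  fixes f :: "'b::euclidean_space \<Rightarrow> 'c::real_normed_vector" and g :: "'a::euclidean_space \<Rightarrow> 'b"
  shows "Ck_on n S f \<Longrightarrow> Ck_on n S' g \<Longrightarrow> g ` S' \<subseteq> S \<Longrightarrow> Ck_on n S' (\<lambda>x. f (g x))"
proof (induction n arbitrary: f)
  case 0
  then show ?case by (auto intro: continuous_on_compose2)
next
  case (Suc n)
  from Suc.prems obtain f' g' where
    f': "\<forall>x\<in>S. (f has_derivative f' x) (at x)" "\<forall>v. Ck_on n S (\<lambda>x. f' x v)" and
    g': "\<forall>x\<in>S'. (g has_derivative g' x) (at x)" "\<forall>v. Ck_on n S' (\<lambda>x. g' x v)" by auto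
  \<comment> \<open>\<open>Ck_on\<close> controls a derivative in fixed directions only, while in
    the chain rule the direction \<open>g' x v\<close> moves with \<open>x\<close>. Expanding it in
    the basis leaves the fixed directions \<open>b\<close>, to which the induction hypothesis
    applies.\<close>
  define D where "D x v = (\<Sum>b\<in>Basis. (g' x v \<bullet> b) *\<^sub>R f' (g x) b)" for x v
  have gn: "Ck_on n S' g" using Suc.prems Ck_on_SucD by blast
  have "Ck_on n S' (\<lambda>x. D x v)" for v
    unfolding D_def
    by (intro Ck_on_sum Ck_on_scaleR Ck_on_linear[OF bounded_linear_inner_left] Suc.IH gn)
      (use f' g' Suc.prems in auto)
  moreover have "((\<lambda>x. f (g x)) has_derivative D x) (at x)" if "x \<in> S'" for x
  proof -
    have fd: "(f has_derivative f' (g x)) (at (g x))" using f' that Suc.prems by auto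
    have "D x = (\<lambda>v. f' (g x) (g' x v))"
      unfolding D_def
      by (intro ext linear_euclidean_expand[OF has_derivative_linear[OF fd], symmetric])
    then show ?thesis
      using has_derivative_compose[OF bspec[OF g'(1) that] fd] by simp
  qed
  ultimately show ?case by auto
qed

lemma Ck_on_id: "Ck_on n S (\<lambda>x. x)"
proof (cases n)
  case (Suc m)
  then show ?thesis by (auto intro!: exI[of _ "\<lambda>x v. v"] Ck_on_const)
qed auto

lemma Ck_on_Pair_const:
  "Ck_on n S (\<lambda>x. (x, c))" "Ck_on n S (\<lambda>x. (c, x))"
proof -
  have "Ck_on n S (\<lambda>x. (x, 0) + (0, c))"
    by (intro Ck_on_add Ck_on_const Ck_on_linear[of "\<lambda>x. (x, 0)"] Ck_on_id bounded_linear_intros)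
  then show "Ck_on n S (\<lambda>x. (x, c))" by simp
  have "Ck_on n S (\<lambda>x. (0, x) + (c, 0))"
    by (intro Ck_on_add Ck_on_const Ck_on_linear[of "\<lambda>x. (0, x)"] Ck_on_id bounded_linear_intros)
  then show "Ck_on n S (\<lambda>x. (c, x))" by simp
qed

lemma Ck_on_cong:
  assumes "open S" "\<And>x. x \<in> S \<Longrightarrow> f x = g x" "Ck_on n S f"
  shows "Ck_on n S g"
proof (cases n)
  case 0
  then show ?thesis using assms continuous_on_cong by auto
next
  case (Suc m)
  then obtain f' where f': "\<forall>x\<in>S. (f has_derivative f' x) (at x)" "\<forall>v. Ck_on m S (\<lambda>x. f' x v)"
    using assms by auto
  have "(g has_derivative f' x) (at x)" if "x \<in> S" for x
    using f' that assms has_derivative_transform_within_open by blast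
  then show ?thesis using f' Suc by auto
qed

section \<open>Second derivatives: minima and mixed partials\<close>

lemma second_derivative_test:
  fixes g :: "real \<Rightarrow> real"
  assumes d1: "\<forall>\<^sub>F s in nhds 0. (g has_real_derivative g' s) (at s)"
    and d2: "(g' has_real_derivative g2) (at 0)"
    and mn: "\<forall>\<^sub>F s in nhds 0. g 0 \<le> g s"
  shows "g2 \<ge> 0"
proof (rule ccontr)
  assume "\<not> g2 \<ge> 0"
  then have neg: "g2 < 0" by simp
  obtain d where d: "d > 0" "\<And>s. \<bar>s\<bar> < d \<Longrightarrow> (g has_real_derivative g' s) (at s) \<and> g 0 \<le> g s"
    using eventually_conj[OF d1 mn] by (auto simp: eventually_nhds_metric dist_real_def)
  \<comment> \<open>The derivative vanishes at the minimum, so a negative \<open>g2\<close> makes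
    \<open>g'\<close> negative just to the right of \<open>0\<close>, and the mean value theorem
    then puts \<open>g h\<close> below \<open>g 0\<close>.\<close>
  have g0: "g' 0 = 0"
    by (rule DERIV_local_min[of g "g' 0" 0 d]) (use d in auto)
  obtain d' where d': "d' > 0" "\<And>h. 0 < h \<Longrightarrow> h < d' \<Longrightarrow> g' 0 > g' (0 + h)"
    using DERIV_neg_dec_right[OF d2 neg] by auto
  define h where "h = min d d' / 2"
  have h: "h > 0" "h < d" "h < d'" using d d' by (auto simp: h_def)
  have "\<exists>z. 0 < z \<and> z < h \<and> g h - g 0 = (h - 0) * g' z"
    by (rule MVT2) (use d h in auto)
  then obtain z where z: "0 < z" "z < h" "g h - g 0 = h * g' z" by auto
  have "g' z < 0" using d'(2)[of z] z h g0 by auto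
  then have "h * g' z < 0" using h by (simp add: mult_pos_neg)
  then show False using d(2)[of h] h z by auto
qed

text \<open>The mean value theorem is applied to \<open>\<phi> h - \<phi> 0\<close> in the second
  variable only, so differentiability of \<open>\<phi>t\<close> at the single point
  \<open>(0, 0)\<close> suffices. The quotient is symmetric in the two variables, which is what
  yields equality of mixed derivatives.\<close>

lemma second_difference_tendsto:
  fixes \<phi> \<phi>t :: "real \<Rightarrow> real \<Rightarrow> real"
  assumes d: "d > 0" "\<And>s t. \<bar>s\<bar> < d \<Longrightarrow> \<bar>t\<bar> < d \<Longrightarrow> (\<phi> s has_real_derivative \<phi>t s t) (at t)"
    and D: "((\<lambda>(s, t). \<phi>t s t) has_derivative D) (at (0, 0))"
  shows "((\<lambda>h. (\<phi> h h - \<phi> h 0 - \<phi> 0 h + \<phi> 0 0) / h\<^sup>2) \<longlongrightarrow> D (1, 0)) (at_right 0)"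
proof (rule tendstoI)
  fix e :: real assume e: "e > 0"
  define e' where "e' = e / 4"
  have e': "e' > 0" using e by (simp add: e'_def)
  interpret D: bounded_linear D using D by (rule has_derivative_bounded_linear)
  obtain \<delta> where \<delta>: "\<delta> > 0" "\<And>s t. norm (s, t) < \<delta> \<Longrightarrow> \<bar>\<phi>t s t - \<phi>t 0 0 - D (s, t)\<bar> \<le> e' * norm (s, t)"
    using D e' unfolding has_derivative_at_alt by (force simp: zero_prod_def[symmetric])
  have "dist ((\<phi> h h - \<phi> h 0 - \<phi> 0 h + \<phi> 0 0) / h\<^sup>2) (D (1, 0)) < e"
    if h: "0 < h" "h < min d (\<delta> / 2)" for h
  proof -
    have "\<exists>z. 0 < z \<and> z < h \<and> (\<phi> h h - \<phi> 0 h) - (\<phi> h 0 - \<phi> 0 0) = (h - 0) * (\<phi>t h z - \<phi>t 0 z)"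
      using h d by (intro MVT2) (auto intro!: DERIV_diff)
    then obtain z where z: "0 < z" "z < h"
      and k: "\<phi> h h - \<phi> h 0 - \<phi> 0 h + \<phi> 0 0 = h * (\<phi>t h z - \<phi>t 0 z)" by (auto simp: algebra_simps)
    have n1: "norm (h, z) \<le> 2 * h" using norm_Pair_le[of h z] z by simp
    have n2: "norm (0::real, z) \<le> h" using norm_Pair_le[of "0::real" z] z by simp
    have "\<bar>\<phi>t h z - \<phi>t 0 0 - D (h, z)\<bar> \<le> e' * (2 * h)"
      using \<delta>(2)[of h z] n1 h e' by (smt (verit) mult_left_mono min_less_iff_conj field_sum_of_halves)
    moreover have "\<bar>\<phi>t 0 z - \<phi>t 0 0 - D (0, z)\<bar> \<le> e' * h"
      using \<delta>(2)[of 0 z] n2 h e' by (smt (verit) mult_left_mono min_less_iff_conj field_sum_of_halves)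
    moreover have "D (h, z) - D (0, z) = h * D (1, 0)"
      using D.diff[of "(h, z)" "(0, z)"] D.scaleR[of h "(1, 0)"] by simp
    ultimately have "\<bar>\<phi>t h z - \<phi>t 0 z - h * D (1, 0)\<bar> \<le> 3 * e' * h" by argo
    then have "\<bar>(\<phi>t h z - \<phi>t 0 z) / h - D (1, 0)\<bar> \<le> 3 * e'"
      using h by (simp add: field_simps abs_le_iff)
    moreover have "(\<phi> h h - \<phi> h 0 - \<phi> 0 h + \<phi> 0 0) / h\<^sup>2 = (\<phi>t h z - \<phi>t 0 z) / h"
      using h unfolding k by (simp add: power2_eq_square)
    ultimately show ?thesis using e by (simp add: dist_real_def e'_def)
  qed
  then show "\<forall>\<^sub>F h in at_right 0. dist ((\<phi> h h - \<phi> h 0 - \<phi> 0 h + \<phi> 0 0) / h\<^sup>2) (D (1, 0)) < e"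
    using d(1) \<delta>(1) unfolding eventually_at_right_field by (intro exI[of _ "min d (\<delta> / 2)"]) auto
qed

text \<open>The two orders of differentiation are limits of the same symmetric second difference.
  The form is the one suited to a group law: \<open>A\<close> and \<open>B\<close> are derivatives
  of the partial differentials along the two slices through \<open>(x0, y0)\<close>.\<close>

lemma mixed_partials_symmetric:
  fixes F :: "'a::euclidean_space \<times> 'b::euclidean_space \<Rightarrow> 'c::euclidean_space"
  assumes S: "open S" "(x0, y0) \<in> S"
    and dF: "\<And>z. z \<in> S \<Longrightarrow> (F has_derivative F' z) (at z)"
    and C1: "\<And>u. Ck_on 1 S (\<lambda>z. F' z u)"
    and dv: "((\<lambda>x. F' (x, y0) (0, w)) has_derivative A) (at x0)"
    and dw: "((\<lambda>y. F' (x0, y) (v, 0)) has_derivative B) (at y0)"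
  shows "A v = B w"
proof (rule euclidean_eqI)
  fix c :: 'c assume "c \<in> Basis"
  define p where "p s t = (x0 + s *\<^sub>R v, y0 + t *\<^sub>R w)" for s t
  define \<phi> where "\<phi> s t = F (p s t) \<bullet> c" for s t
  define P where "P s t = F' (p s t) (0, w) \<bullet> c" for s t
  define Q where "Q s t = F' (p s t) (v, 0) \<bullet> c" for s t
  have pd: "((\<lambda>(s, t). p s t) has_derivative (\<lambda>(s, t). (s *\<^sub>R v, t *\<^sub>R w))) (at z)" for z
    unfolding p_def case_prod_unfold by (auto intro!: derivative_eq_intros)
  have p0: "p 0 0 = (x0, y0)" by (simp add: p_def)
  have "open ((\<lambda>(s, t). p s t) -` S)"
    by (intro open_vimage S) (auto simp: p_def case_prod_unfold intro!: continuous_intros)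
  moreover have "(0, 0) \<in> ((\<lambda>(s, t). p s t) -` S)" using S p0 by simp
  ultimately obtain d where d: "d > 0" "ball (0, 0) d \<subseteq> ((\<lambda>(s, t). p s t) -` S)"
    by (meson open_contains_ball)
  have dS: "p s t \<in> S" if "\<bar>s\<bar> < d / 2" "\<bar>t\<bar> < d / 2" for s t
  proof -
    have "norm (s, t) < d" using norm_Pair_le[of s t] that by simp
    then have "(s, t) \<in> ball (0, 0) d"
      by (simp only: mem_ball_0 zero_prod_def[symmetric])
    then show ?thesis using d(2) by auto
  qed
  have d\<phi>t: "(\<phi> s has_real_derivative P s t) (at t)" if "\<bar>s\<bar> < d / 2" "\<bar>t\<bar> < d / 2" for s t
  proof -
    have "((\<lambda>t. p s t) has_derivative (\<lambda>h. (0, h *\<^sub>R w))) (at t)"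
      unfolding p_def by (auto intro!: derivative_eq_intros)
    from has_derivative_compose[OF this dF[OF dS[OF that]]]
    have "((\<lambda>t. F (p s t)) has_derivative (\<lambda>h. F' (p s t) (0, h *\<^sub>R w))) (at t)" .
    then have "(\<phi> s has_derivative (\<lambda>h. F' (p s t) (0, h *\<^sub>R w) \<bullet> c)) (at t)"
      unfolding \<phi>_def by (rule has_derivative_inner_left)
    moreover have "F' (p s t) (0, h *\<^sub>R w) \<bullet> c = P s t * h" for h
      using linear_scale[OF has_derivative_linear[OF dF[OF dS[OF that]]], of h "(0, w)"]
      by (simp add: P_def)
    ultimately show ?thesis by (simp add: has_field_derivative_def)
  qed
  have d\<phi>s: "((\<lambda>s. \<phi> s t) has_real_derivative Q s t) (at s)" if "\<bar>s\<bar> < d / 2" "\<bar>t\<bar> < d / 2" for s t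
  proof -
    have "((\<lambda>s. p s t) has_derivative (\<lambda>h. (h *\<^sub>R v, 0))) (at s)"
      unfolding p_def by (auto intro!: derivative_eq_intros)
    from has_derivative_compose[OF this dF[OF dS[OF that]]]
    have "((\<lambda>s. F (p s t)) has_derivative (\<lambda>h. F' (p s t) (h *\<^sub>R v, 0))) (at s)" .
    then have "((\<lambda>s. \<phi> s t) has_derivative (\<lambda>h. F' (p s t) (h *\<^sub>R v, 0) \<bullet> c)) (at s)"
      unfolding \<phi>_def by (rule has_derivative_inner_left)
    moreover have "F' (p s t) (h *\<^sub>R v, 0) \<bullet> c = Q s t * h" for h
      using linear_scale[OF has_derivative_linear[OF dF[OF dS[OF that]]], of h "(v, 0)"]
      by (simp add: Q_def)
    ultimately show ?thesis by (simp add: has_field_derivative_def)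
  qed
  obtain P' where P': "((\<lambda>z. F' z (0, w)) has_derivative P') (at (x0, y0))"
    using C1[of "(0, w)"] S by (auto simp: One_nat_def)
  obtain Q' where Q': "((\<lambda>z. F' z (v, 0)) has_derivative Q') (at (x0, y0))"
    using C1[of "(v, 0)"] S by (auto simp: One_nat_def)
  have swap: "((\<lambda>(t, s). (s, t)) has_derivative (\<lambda>(t, s). (s, t))) (at (0::real, 0::real))"
    unfolding case_prod_unfold by (auto intro!: derivative_eq_intros)
  have "((\<lambda>(s, t). P s t) has_derivative (\<lambda>(s, t). P' (s *\<^sub>R v, t *\<^sub>R w) \<bullet> c)) (at (0, 0))"
    using has_derivative_inner_left[OF has_derivative_compose[OF pd[of "(0,0)"], of "\<lambda>z. F' z (0, w)" P'], of c] P' p0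
    by (simp add: case_prod_unfold P_def)
  from second_difference_tendsto[OF _ d\<phi>t this, of "d / 2"]
  have l1: "((\<lambda>h. (\<phi> h h - \<phi> h 0 - \<phi> 0 h + \<phi> 0 0) / h\<^sup>2) \<longlongrightarrow> P' (v, 0) \<bullet> c) (at_right 0)"
    using d by simp
  have "((\<lambda>(s, t). Q s t) has_derivative (\<lambda>(s, t). Q' (s *\<^sub>R v, t *\<^sub>R w) \<bullet> c)) (at (0, 0))"
    using has_derivative_inner_left[OF has_derivative_compose[OF pd[of "(0,0)"], of "\<lambda>z. F' z (v, 0)" Q'], of c] Q' p0
    by (simp add: case_prod_unfold Q_def)
  from has_derivative_compose[OF swap, of "\<lambda>(s, t). Q s t" "\<lambda>(s, t). Q' (s *\<^sub>R v, t *\<^sub>R w) \<bullet> c"] this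
  have "((\<lambda>(t, s). Q s t) has_derivative (\<lambda>(t, s). Q' (s *\<^sub>R v, t *\<^sub>R w) \<bullet> c)) (at (0, 0))"
    by (simp add: case_prod_unfold)
  from second_difference_tendsto[where \<phi> = "\<lambda>t s. \<phi> s t" and \<phi>t = "\<lambda>t s. Q s t", OF _ d\<phi>s this, of "d / 2"]
  have l2: "((\<lambda>h. (\<phi> h h - \<phi> h 0 - \<phi> 0 h + \<phi> 0 0) / h\<^sup>2) \<longlongrightarrow> Q' (0, w) \<bullet> c) (at_right 0)"
    using d by (simp add: algebra_simps)
  have "P' (v, 0) \<bullet> c = Q' (0, w) \<bullet> c"
    by (rule tendsto_unique[OF _ l1 l2]) simp
  moreover have "A = (\<lambda>h. P' (h, 0))"
  proof -
    have "((\<lambda>x. (x, y0)) has_derivative (\<lambda>h. (h, 0))) (at x0)" by (auto intro!: derivative_eq_intros)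
    from has_derivative_compose[OF this, of "\<lambda>z. F' z (0, w)" P'] P'
    show ?thesis using dv has_derivative_unique by blast
  qed
  moreover have "B = (\<lambda>h. Q' (0, h))"
  proof -
    have "((\<lambda>y. (x0, y)) has_derivative (\<lambda>h. (0, h))) (at y0)" by (auto intro!: derivative_eq_intros)
    from has_derivative_compose[OF this, of "\<lambda>z. F' z (v, 0)" Q'] Q'
    show ?thesis using dw has_derivative_unique by blast
  qed
  ultimately show "A v \<bullet> c = B w \<bullet> c" by simp
qed

subsection \<open>A chart around the identity\<close>

lemma (in lie_group) chartD:
  assumes "(V, \<theta>) \<in> A"
  shows "open V" "open (\<theta> ` V)" "homeomorphism V (\<theta> ` V) \<theta> (inv_into V \<theta>)"
    "continuous_on V \<theta>" "continuous_on (\<theta> ` V) (inv_into V \<theta>)"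
    "\<And>p. p \<in> V \<Longrightarrow> inv_into V \<theta> (\<theta> p) = p"
    "\<And>x. x \<in> \<theta> ` V \<Longrightarrow> \<theta> (inv_into V \<theta> x) = x"
    "\<And>x. x \<in> \<theta> ` V \<Longrightarrow> inv_into V \<theta> x \<in> V"
proof -
  show *: "open V" "open (\<theta> ` V)" "homeomorphism V (\<theta> ` V) \<theta> (inv_into V \<theta>)"
    using bspec[OF atlas[unfolded smooth_atlas_def, THEN conjunct2, THEN conjunct1] assms] by simp_all
  show "continuous_on V \<theta>" "continuous_on (\<theta> ` V) (inv_into V \<theta>)"
    "\<And>p. p \<in> V \<Longrightarrow> inv_into V \<theta> (\<theta> p) = p"
    "\<And>x. x \<in> \<theta> ` V \<Longrightarrow> \<theta> (inv_into V \<theta> x) = x"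
    using *(3) unfolding homeomorphism_def by auto
  show "\<And>x. x \<in> \<theta> ` V \<Longrightarrow> inv_into V \<theta> x \<in> V" by (rule inv_into_into)
qed

lemma (in lie_group) chart_ex: "\<exists>V \<theta>. (V, \<theta>) \<in> A \<and> p \<in> V"
proof -
  have "p \<in> (\<Union>(U, \<phi>)\<in>A. U)" using atlas unfolding smooth_atlas_def by simp
  then show ?thesis by auto
qed

locale lie_chart = lie_group A
  for A :: "('g::{topological_group_add, t2_space}, 'a::euclidean_space) chart set" +
  fixes U :: "'g set" and \<phi> :: "'g \<Rightarrow> 'a"
  assumes chart: "(U, \<phi>) \<in> A" and zero_U: "0 \<in> U"
begin

definition \<psi> :: "'a \<Rightarrow> 'g" where "\<psi> = inv_into U \<phi>"
definition x0 :: 'a where "x0 = \<phi> 0"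
definition N0 :: "'a set" where "N0 = \<phi> ` U"

lemma open_U: "open U" and open_N0: "open N0"
  and cont_\<phi>: "continuous_on U \<phi>" and cont_\<psi>: "continuous_on N0 \<psi>"
  and \<psi>_\<phi> [simp]: "p \<in> U \<Longrightarrow> \<psi> (\<phi> p) = p"
  and \<phi>_\<psi> [simp]: "x \<in> N0 \<Longrightarrow> \<phi> (\<psi> x) = x"
  and \<psi>_U: "x \<in> N0 \<Longrightarrow> \<psi> x \<in> U"
  and \<phi>_N0: "p \<in> U \<Longrightarrow> \<phi> p \<in> N0"
  using chartD[OF chart] by (auto simp: N0_def \<psi>_def)

lemma x0_N0: "x0 \<in> N0" and \<psi>_x0 [simp]: "\<psi> x0 = 0"
  using zero_U by (auto simp: x0_def \<phi>_N0)

lemma isCont_\<psi>: "x \<in> N0 \<Longrightarrow> isCont \<psi> x"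
  using cont_\<psi> open_N0 continuous_on_eq_continuous_at by blast

lemma isCont_\<phi>: "p \<in> U \<Longrightarrow> isCont \<phi> p"
  using cont_\<phi> open_U continuous_on_eq_continuous_at by blast

lemma open_\<psi>_preimage:
  assumes "continuous_on N0 h" "open W"
  shows "open {x \<in> N0. h x \<in> W}"
proof -
  have "open (N0 \<inter> h -` W)" by (rule continuous_open_preimage[OF assms(1) open_N0 assms(2)])
  moreover have "N0 \<inter> h -` W = {x \<in> N0. h x \<in> W}" by auto
  ultimately show ?thesis by simp
qed

text \<open>\<open>smooth_mult\<close> only concerns products of two points read in charts, so
  \<open>p + \<psi> x + q\<close> is formed in two multiplications with one factor frozen: by
  \<open>p\<close> on the left, landing in a chart around \<open>p\<close>, then by \<open>q\<close>
  on the right, landing in a chart around \<open>p + q\<close>.\<close>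

lemma translate_Ck:
  fixes f :: "'g \<Rightarrow> 'b::real_normed_vector"
  assumes W: "open W" and f: "manifold_Ck_on A n W f" and pq: "p + q \<in> W"
  shows "\<exists>N. open N \<and> x0 \<in> N \<and> N \<subseteq> N0 \<and> (\<forall>x\<in>N. p + \<psi> x + q \<in> W) \<and>
    Ck_on n N (\<lambda>x. f (p + \<psi> x + q))"
proof -
  obtain V1 \<theta>1 where c1: "(V1, \<theta>1) \<in> A" "p \<in> V1" using chart_ex by blast
  obtain Vq \<theta>q where cq: "(Vq, \<theta>q) \<in> A" "q \<in> Vq" using chart_ex by blast
  obtain V2 \<theta>2 where c2: "(V2, \<theta>2) \<in> A" "p + q \<in> V2" using chart_ex by blast
  note C1 = chartD[OF c1(1)] and Cq = chartD[OF cq(1)] and C2 = chartD[OF c2(1)]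
  define N where "N = {x \<in> N0. p + \<psi> x \<in> V1} \<inter> {x \<in> N0. p + \<psi> x + q \<in> V2 \<inter> W}"
  have "open N" unfolding N_def
    by (intro open_Int open_\<psi>_preimage continuous_intros cont_\<psi> C1 C2 W)
  moreover have "x0 \<in> N" using c1 c2 pq x0_N0 by (simp add: N_def)
  moreover have "N \<subseteq> N0" "\<forall>x\<in>N. p + \<psi> x + q \<in> W" by (auto simp: N_def)
  moreover have "Ck_on n N (\<lambda>x. f (p + \<psi> x + q))"
  proof -
    have "Ck_on n {(y, x). y \<in> \<theta>1 ` V1 \<and> x \<in> \<phi> ` U \<and> inv_into V1 \<theta>1 y + inv_into U \<phi> x \<in> V1}
      (\<lambda>(y, x). \<theta>1 (inv_into V1 \<theta>1 y + inv_into U \<phi> x))"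
      using smooth_mult[OF c1(1) chart c1(1)] unfolding smooth_on_def by blast
    moreover have "Pair (\<theta>1 p) ` N \<subseteq> {(y, x). y \<in> \<theta>1 ` V1 \<and> x \<in> \<phi> ` U \<and> inv_into V1 \<theta>1 y + inv_into U \<phi> x \<in> V1}"
      using c1 C1(6)[OF c1(2)] by (auto simp: N_def N0_def \<psi>_def)
    ultimately have "Ck_on n N (\<lambda>x. (\<lambda>(y, x). \<theta>1 (inv_into V1 \<theta>1 y + inv_into U \<phi> x)) (\<theta>1 p, x))"
      by (rule Ck_on_compose[OF _ Ck_on_Pair_const(2)])
    then have k1: "Ck_on n N (\<lambda>x. \<theta>1 (p + \<psi> x))"
      by (simp add: C1(6)[OF c1(2)] \<psi>_def)
    define N1 where "N1 = {y \<in> \<theta>1 ` V1. inv_into V1 \<theta>1 y + q \<in> V2}"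
    have "Ck_on n {(y, x). y \<in> \<theta>1 ` V1 \<and> x \<in> \<theta>q ` Vq \<and> inv_into V1 \<theta>1 y + inv_into Vq \<theta>q x \<in> V2}
      (\<lambda>(y, x). \<theta>2 (inv_into V1 \<theta>1 y + inv_into Vq \<theta>q x))"
      using smooth_mult[OF c1(1) cq(1) c2(1)] unfolding smooth_on_def by blast
    moreover have "(\<lambda>x. (x, \<theta>q q)) ` N1 \<subseteq> {(y, x). y \<in> \<theta>1 ` V1 \<and> x \<in> \<theta>q ` Vq \<and> inv_into V1 \<theta>1 y + inv_into Vq \<theta>q x \<in> V2}"
      using cq Cq(6)[OF cq(2)] by (auto simp: N1_def)
    ultimately have "Ck_on n N1 (\<lambda>x. (\<lambda>(y, x). \<theta>2 (inv_into V1 \<theta>1 y + inv_into Vq \<theta>q x)) (x, \<theta>q q))"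
      by (rule Ck_on_compose[OF _ Ck_on_Pair_const(1)])
    then have k2: "Ck_on n N1 (\<lambda>y. \<theta>2 (inv_into V1 \<theta>1 y + q))"
      by (simp add: Cq(6)[OF cq(2)])
    have k3: "Ck_on n (\<theta>2 ` (V2 \<inter> W)) (f \<circ> inv_into V2 \<theta>2)"
      using f c2 unfolding manifold_Ck_on_def by blast
    have i1: "inv_into V1 \<theta>1 (\<theta>1 (p + \<psi> x)) = p + \<psi> x" if "x \<in> N" for x
      by (rule C1(6)) (use that in \<open>simp add: N_def\<close>)
    have i2: "inv_into V2 \<theta>2 (\<theta>2 (p + \<psi> x + q)) = p + \<psi> x + q" if "x \<in> N" for x
      by (rule C2(6)) (use that in \<open>simp add: N_def\<close>)
    have "(\<lambda>x. \<theta>1 (p + \<psi> x)) ` N \<subseteq> N1"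
      unfolding N1_def using i1 by (auto simp: N_def)
    then have k12: "Ck_on n N (\<lambda>x. \<theta>2 (inv_into V1 \<theta>1 (\<theta>1 (p + \<psi> x)) + q))"
      by (rule Ck_on_compose[OF k2 k1])
    have "(\<lambda>x. \<theta>2 (inv_into V1 \<theta>1 (\<theta>1 (p + \<psi> x)) + q)) ` N \<subseteq> \<theta>2 ` (V2 \<inter> W)"
      using i1 by (auto simp: N_def)
    then have "Ck_on n N (\<lambda>x. (f \<circ> inv_into V2 \<theta>2) (\<theta>2 (inv_into V1 \<theta>1 (\<theta>1 (p + \<psi> x)) + q)))"
      by (rule Ck_on_compose[OF k3 k12])
    then show ?thesis
      by (rule Ck_on_cong[OF \<open>open N\<close>, rotated]) (simp add: i1 i2)
  qed
  ultimately show ?thesis by blast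
qed

section \<open>The group law in the chart and its differential\<close>

definition F :: "'a \<times> 'a \<Rightarrow> 'a" where "F = (\<lambda>(x, y). \<phi> (\<psi> x + \<psi> y))"
definition DF :: "('a \<times> 'a) set" where "DF = {(x, y). x \<in> N0 \<and> y \<in> N0 \<and> \<psi> x + \<psi> y \<in> U}"
definition F' :: "'a \<times> 'a \<Rightarrow> 'a \<times> 'a \<Rightarrow> 'a" where "F' z = frechet_derivative F (at z)"
text \<open>For \<open>x\<close> in \<open>N0\<close>, \<open>L x\<close> and \<open>R x\<close> are
  the differentials at the identity of left and right translation by \<open>\<psi> x\<close>. Thus
  \<open>\<lambda>x. L x v\<close> is the left-invariant field, and \<open>\<lambda>x. R x v\<close>
  the right-invariant field, with value \<open>v\<close> at the identity.\<close>

definition L :: "'a \<Rightarrow> 'a \<Rightarrow> 'a" where "L x v = F' (x, x0) (0, v)"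
definition R :: "'a \<Rightarrow> 'a \<Rightarrow> 'a" where "R x v = F' (x0, x) (v, 0)"

lemma open_DF: "open DF"
proof -
  have "continuous_on (N0 \<times> N0) (\<lambda>z. \<psi> (fst z) + \<psi> (snd z))"
    by (intro continuous_intros continuous_on_compose2[OF cont_\<psi>]) auto
  then have "open ((N0 \<times> N0) \<inter> (\<lambda>z. \<psi> (fst z) + \<psi> (snd z)) -` U)"
    by (intro continuous_open_preimage open_Times open_N0 open_U)
  moreover have "(N0 \<times> N0) \<inter> (\<lambda>z. \<psi> (fst z) + \<psi> (snd z)) -` U = DF" by (auto simp: DF_def)
  ultimately show ?thesis by simp
qed

lemma F_Ck: "Ck_on n DF F"
  unfolding F_def DF_def N0_def \<psi>_def
  using smooth_mult[OF chart chart chart, unfolded smooth_on_def] by (rule spec)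

lemma F_deriv: "z \<in> DF \<Longrightarrow> (F has_derivative F' z) (at z)"
  and F'_C1: "Ck_on 1 DF (\<lambda>z. F' z u)"
proof -
  obtain G where G: "\<forall>z\<in>DF. (F has_derivative G z) (at z)" "\<forall>u. Ck_on 1 DF (\<lambda>z. G z u)"
    using F_Ck[of "Suc 1"] unfolding Ck_on.simps(2)[of 1] by (elim exE conjE)
  have eq: "G z = F' z" if "z \<in> DF" for z
    using G that by (simp add: F'_def frechet_derivative_at)
  then show "z \<in> DF \<Longrightarrow> (F has_derivative F' z) (at z)" using G(1) eq[of z] by simp
  show "Ck_on 1 DF (\<lambda>z. F' z u)"
    by (rule Ck_on_cong[OF open_DF _ G(2)[rule_format, of u]]) (simp add: eq)
qed

lemma DF_left: "x \<in> N0 \<Longrightarrow> (x, x0) \<in> DF" and DF_right: "x \<in> N0 \<Longrightarrow> (x0, x) \<in> DF"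
  using x0_N0 by (auto simp: DF_def \<psi>_U)

lemma L_deriv: assumes "x \<in> N0" shows "((\<lambda>y. F (x, y)) has_derivative L x) (at x0)"
proof -
  have "((\<lambda>y. (x, y)) has_derivative (\<lambda>h. (0, h))) (at x0)" by (auto intro!: derivative_eq_intros)
  from has_derivative_compose[OF this F_deriv[OF DF_left[OF assms]]]
  show ?thesis by (simp add: L_def[abs_def])
qed

lemma R_deriv: assumes "x \<in> N0" shows "((\<lambda>y. F (y, x)) has_derivative R x) (at x0)"
proof -
  have "((\<lambda>y. (y, x)) has_derivative (\<lambda>h. (h, 0))) (at x0)" by (auto intro!: derivative_eq_intros)
  from has_derivative_compose[OF this F_deriv[OF DF_right[OF assms]]]
  show ?thesis by (simp add: R_def[abs_def])
qed

lemma L_linear: "x \<in> N0 \<Longrightarrow> linear (L x)" and R_linear: "x \<in> N0 \<Longrightarrow> linear (R x)"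
  using L_deriv R_deriv has_derivative_linear by blast+

lemma L_x0 [simp]: "L x0 v = v" and R_x0 [simp]: "R x0 v = v"
proof -
  have "((\<lambda>y. F (x0, y)) has_derivative (\<lambda>h. h)) (at x0)"
    by (rule has_derivative_transform_within_open[OF has_derivative_ident open_N0 x0_N0])
      (auto simp: F_def)
  then show "L x0 v = v" using fun_cong[OF has_derivative_unique[OF L_deriv[OF x0_N0]]] by blast
  have "((\<lambda>y. F (y, x0)) has_derivative (\<lambda>h. h)) (at x0)"
    by (rule has_derivative_transform_within_open[OF has_derivative_ident open_N0 x0_N0])
      (auto simp: F_def)
  then show "R x0 v = v" using fun_cong[OF has_derivative_unique[OF R_deriv[OF x0_N0]]] by blast
qed

lemma L_C1: "Ck_on 1 N0 (\<lambda>x. L x v)" and R_C1: "Ck_on 1 N0 (\<lambda>x. R x v)"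
proof -
  have "(\<lambda>x. (x, x0)) ` N0 \<subseteq> DF" using DF_left by auto
  from Ck_on_compose[OF F'_C1 Ck_on_Pair_const(1) this]
  show "Ck_on 1 N0 (\<lambda>x. L x v)" unfolding L_def .
  have "(\<lambda>x. (x0, x)) ` N0 \<subseteq> DF" using DF_right by auto
  from Ck_on_compose[OF F'_C1 Ck_on_Pair_const(2) this]
  show "Ck_on 1 N0 (\<lambda>x. R x v)" unfolding R_def .
qed

lemma F'_x0: "F' (x0, x0) (v, w) = v + w"
proof -
  have "F' (x0, x0) (v, w) = F' (x0, x0) ((v, 0) + (0, w))" by simp
  also have "\<dots> = F' (x0, x0) (v, 0) + F' (x0, x0) (0, w)"
    by (rule linear_add[OF has_derivative_linear[OF F_deriv[OF DF_left[OF x0_N0]]]])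
  also have "\<dots> = v + w" using L_x0 R_x0 by (simp add: L_def R_def)
  finally show ?thesis .
qed

text \<open>Differentiating \<open>L\<close> or \<open>R\<close> in the base point gives the same
  mixed second derivative of the group law at the identity. This will express the derivative of
  \<open>R\<close> through that of \<open>L\<close>.\<close>

lemma L_R_mixed:
  assumes "((\<lambda>x. L x w) has_derivative A') (at x0)" "((\<lambda>x. R x v) has_derivative B') (at x0)"
  shows "A' v = B' w"
proof (rule mixed_partials_symmetric[OF open_DF DF_left[OF x0_N0], where A = A' and B = B' and v = v and w = w])
  show "((\<lambda>x. F' (x, x0) (0, w)) has_derivative A') (at x0)"
    "((\<lambda>x. F' (x0, x) (v, 0)) has_derivative B') (at x0)"
    using assms by (simp_all add: L_def R_def)
qed (fact F_deriv, fact F'_C1)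

end

subsection \<open>Homomorphisms from the real line\<close>

lemma topological_group_nbhd:
  fixes W :: "'g::{topological_group_add, t2_space} set"
  assumes "open W" "0 \<in> W"
  obtains N where "open N" "0 \<in> N"
    "\<And>x y. x \<in> N \<Longrightarrow> y \<in> N \<Longrightarrow> x + y \<in> W \<and> - x + y \<in> W \<and> x - y \<in> W \<and> x \<in> W"
proof -
  define P where "P = ((\<lambda>z. fst z + snd z) -` W \<inter> (\<lambda>z. - fst z + snd z) -` W
      \<inter> (\<lambda>z. fst z - snd z) -` W \<inter> (\<lambda>z. fst z) -` W :: ('g \<times> 'g) set)"
  have "open P" unfolding P_def diff_conv_add_uminus
    by (intro open_Int open_vimage assms continuous_intros)
  moreover have "(0, 0) \<in> P" using assms by (simp add: P_def)
  ultimately obtain N1 N2 where N: "open N1" "open N2" "(0, 0) \<in> N1 \<times> N2" "N1 \<times> N2 \<subseteq> P"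
    by (rule open_prod_elim)
  show thesis
  proof (rule that[of "N1 \<inter> N2"])
    fix x y assume "x \<in> N1 \<inter> N2" "y \<in> N1 \<inter> N2"
    then have "(x, y) \<in> P" using N by auto
    then show "x + y \<in> W \<and> - x + y \<in> W \<and> x - y \<in> W \<and> x \<in> W" by (simp add: P_def)
  qed (use N in auto)
qed

text \<open>A purely algebraic notion, because continuity of the given one-parameter subgroups is
  what has to be proved.\<close>

definition line_hom :: "(real \<Rightarrow> 'g::group_add) \<Rightarrow> bool" where
  "line_hom \<alpha> \<longleftrightarrow> (\<forall>s t. \<alpha> (s + t) = \<alpha> s + \<alpha> t)"

lemma line_hom_add: "line_hom \<alpha> \<Longrightarrow> \<alpha> (s + t) = \<alpha> s + \<alpha> t"
  and line_hom_0: "line_hom \<alpha> \<Longrightarrow> \<alpha> 0 = 0"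
  and line_hom_minus: "line_hom \<alpha> \<Longrightarrow> \<alpha> (- t) = - \<alpha> t"
  and line_hom_diff: "line_hom \<alpha> \<Longrightarrow> \<alpha> (s - t) = \<alpha> s - \<alpha> t"
  and line_hom_diff': "line_hom \<alpha> \<Longrightarrow> \<alpha> (s - t) = - \<alpha> t + \<alpha> s"
proof -
  assume *: "line_hom \<alpha>"
  show add: "\<alpha> (s + t) = \<alpha> s + \<alpha> t" for s t using * by (simp add: line_hom_def)
  have "\<alpha> 0 + \<alpha> 0 = \<alpha> 0 + 0" using add[of 0 0] by simp
  then show 0: "\<alpha> 0 = 0" by (rule add_left_imp_eq)
  show m: "\<alpha> (- t) = - \<alpha> t" for t using add[of "- t" t] 0 by (simp add: eq_neg_iff_add_eq_0)
  show "\<alpha> (s - t) = \<alpha> s - \<alpha> t" using add[of s "- t"] m by simp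
  show "\<alpha> (s - t) = - \<alpha> t + \<alpha> s" using add[of "- t" s] m by simp
qed

definition real_subgroup :: "real set \<Rightarrow> bool" where
  "real_subgroup H \<longleftrightarrow> 0 \<in> H \<and> (\<forall>s\<in>H. \<forall>t\<in>H. s + t \<in> H) \<and> (\<forall>s\<in>H. - s \<in> H)"

lemma real_subgroup_mult:
  assumes H: "real_subgroup H" "s \<in> H"
  shows "of_int m * s \<in> H"
proof -
  have nat: "of_nat n * s \<in> H" for n
    by (induction n) (use H in \<open>auto simp: real_subgroup_def algebra_simps\<close>)
  show ?thesis
  proof (cases m rule: int_cases)
    case (neg n)
    have "- (of_nat (Suc n) * s) \<in> H" using H nat[of "Suc n"] by (simp only: real_subgroup_def)
    then show ?thesis by (simp only: neg of_int_minus of_int_of_nat_eq mult_minus_left)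
  qed (use nat in auto)
qed

lemma line_hom_eq_subgroup:
  assumes "line_hom \<alpha>" "line_hom \<beta>"
  shows "real_subgroup {t. \<alpha> t = \<beta> t}"
  using assms by (simp add: real_subgroup_def line_hom_add line_hom_0 line_hom_minus)

text \<open>Integer multiples of a small positive element of \<open>H\<close> come close to every
  \<open>t\<close>. Approximation from below keeps \<open>t - h\<close> nonnegative, which matters
  when roots of that difference are taken.\<close>

lemma real_subgroup_approx:
  fixes t :: real
  assumes H: "real_subgroup H" "\<And>e. e > 0 \<Longrightarrow> \<exists>\<tau>\<in>H. 0 < \<tau> \<and> \<tau> < e" and e: "e > 0"
  shows "\<exists>h\<in>H. h \<le> t \<and> t < h + e"
proof -
  obtain \<tau> where \<tau>: "\<tau> \<in> H" "0 < \<tau>" "\<tau> < e" using H(2)[OF e] by blast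
  have "of_int \<lfloor>t / \<tau>\<rfloor> * \<tau> \<in> H" by (rule real_subgroup_mult[OF H(1) \<tau>(1)])
  moreover have "of_int \<lfloor>t / \<tau>\<rfloor> * \<tau> \<le> t"
    using \<tau> by (intro floor_divide_lower)
  moreover have "t < of_int \<lfloor>t / \<tau>\<rfloor> * \<tau> + \<tau>"
    using floor_divide_upper[OF \<tau>(2), of t] by (simp add: algebra_simps)
  ultimately show ?thesis using \<tau> by (intro bexI[of _ "of_int \<lfloor>t / \<tau>\<rfloor> * \<tau>"]) auto
qed

text \<open>A pigeonhole argument: label each time by points of \<open>Q\<close> close to the two
  curves. There are uncountably many times between \<open>0\<close> and \<open>e\<close> but only
  countably many labels, so two times share theirs, and their difference brings both homomorphisms
  into \<open>W\<close>. This works for discontinuous homomorphisms as well.\<close>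

lemma common_small_time:
  fixes \<alpha> \<beta> :: "real \<Rightarrow> 'g::{topological_group_add, t2_space}"
  assumes \<alpha>: "line_hom \<alpha>" and \<beta>: "line_hom \<beta>" and Q: "countable Q" "closure Q = (UNIV :: 'g set)"
    and W: "open W" "0 \<in> W" and e: "e > 0"
  shows "\<exists>\<tau>. 0 < \<tau> \<and> \<tau> < e \<and> \<alpha> \<tau> \<in> W \<and> \<beta> \<tau> \<in> W"
proof -
  obtain N where N: "open N" "0 \<in> N" "\<And>x y. x \<in> N \<Longrightarrow> y \<in> N \<Longrightarrow> - x + y \<in> W"
    using topological_group_nbhd[OF W] by metis
  have "\<exists>q\<in>Q. - q + g \<in> N" for g
  proof -
    have "open ((\<lambda>q. - q + g) -` N)" by (intro open_vimage N continuous_intros)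
    moreover have "g \<in> (\<lambda>q. - q + g) -` N" using N by simp
    moreover have "g \<in> closure Q" using Q by simp
    ultimately have "Q \<inter> (\<lambda>q. - q + g) -` N \<noteq> {}" unfolding closure_iff_nhds_not_empty by blast
    then show ?thesis by blast
  qed
  then obtain q where q: "\<And>g. q g \<in> Q" "\<And>g. - q g + g \<in> N" by metis
  define k where "k t = (q (\<alpha> t), q (\<beta> t))" for t
  have "\<not> inj_on k {0<..<e}"
  proof
    assume "inj_on k {0<..<e}"
    moreover have "k ` {0<..<e} \<subseteq> Q \<times> Q" using q by (auto simp: k_def)
    then have "countable (k ` {0<..<e})" by (rule countable_subset) (intro countable_SIGMA Q)
    ultimately have "countable {0<..<e}" using countable_image_inj_on by blast
    then show False using uncountable_open_interval[of 0 e] e by blast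
  qed
  then obtain s t where st: "s \<in> {0<..<e}" "t \<in> {0<..<e}" "k s = k t" "s < t"
    unfolding inj_on_def by (metis linorder_neqE_linordered_idom)
  have d: "- x + y \<in> W" if "q x = q y" for x y
    using N(3)[OF q(2)[of x] q(2)[of y]] that by (simp add: minus_add add.assoc)
  show ?thesis
    using st d[of "\<alpha> s" "\<alpha> t"] d[of "\<beta> s" "\<beta> t"]
    by (intro exI[of _ "t - s"]) (auto simp: k_def line_hom_diff'[OF \<alpha>] line_hom_diff'[OF \<beta>])
qed

text \<open>A set of times closed under small differences is the trace near \<open>0\<close> of a
  genuine subgroup. The extension adds integer multiples of one small \<open>\<tau>\<close> in
  \<open>S\<close> to elements of \<open>S\<close> of size at most \<open>\<tau>\<close>; near
  \<open>0\<close> the integer part stays below \<open>d\<close>, so nothing outside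
  \<open>S\<close> is created there.\<close>

lemma real_local_subgroup_extend:
  assumes d: "d > 0" and S: "S \<subseteq> {-d<..<d}"
    and minus: "\<And>s t. s \<in> S \<Longrightarrow> t \<in> S \<Longrightarrow> \<bar>s - t\<bar> < d \<Longrightarrow> s - t \<in> S"
    and small: "\<And>e. e > 0 \<Longrightarrow> \<exists>\<tau>\<in>S. 0 < \<tau> \<and> \<tau> < e"
  obtains H where "real_subgroup H" "S \<subseteq> H" "\<And>t. t \<in> H \<Longrightarrow> \<bar>t\<bar> < d / 2 \<Longrightarrow> t \<in> S"
proof -
  obtain \<tau> where \<tau>: "\<tau> \<in> S" "0 < \<tau>" "\<tau> < d / 4" using small[of "d / 4"] d by auto
  have S0: "0 \<in> S" using minus[OF \<tau>(1) \<tau>(1)] d by simp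
  have neg: "- s \<in> S" if "s \<in> S" for s using minus[OF S0 that] subsetD[OF S that] by auto
  have plus: "s + t \<in> S" if "s \<in> S" "t \<in> S" "\<bar>s + t\<bar> < d" for s t
    using minus[OF that(1) neg[OF that(2)]] that by simp
  have mul_nat: "of_nat n * \<tau> < d \<Longrightarrow> of_nat n * \<tau> \<in> S" for n
  proof (induction n)
    case (Suc n)
    have "of_nat (Suc n) * \<tau> = of_nat n * \<tau> + \<tau>" by (simp add: algebra_simps)
    moreover have "0 \<le> of_nat n * \<tau>" using \<tau> by simp
    ultimately show ?case using Suc plus[of "of_nat n * \<tau>" \<tau>] \<tau> by simp
  qed (use S0 in simp)
  have mul: "of_int m * \<tau> \<in> S" if "\<bar>of_int m * \<tau>\<bar> < d" for m
  proof (cases "m \<ge> 0")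
    case True
    then show ?thesis using mul_nat[of "nat m"] that by simp
  next
    case False
    then have "of_nat (nat (- m)) * \<tau> \<in> S" using mul_nat[of "nat (- m)"] that \<tau> by simp
    then show ?thesis using neg[of "of_nat (nat (- m)) * \<tau>"] False by simp
  qed
  define H where "H = {of_int m * \<tau> + s | m s. s \<in> S \<and> \<bar>s\<bar> \<le> \<tau>}"
  \<comment> \<open>The range \<open>2 * \<tau>\<close> leaves room for the sum of two remainders;
    an excess over \<open>\<tau>\<close> is moved into the integer part.\<close>
  have HI: "of_int m * \<tau> + s \<in> H" if s: "s \<in> S" "\<bar>s\<bar> \<le> 2 * \<tau>" for m s
  proof -
    consider "\<bar>s\<bar> \<le> \<tau>" | "s > \<tau>" | "s < - \<tau>" by linarith
    then show ?thesis
    proof cases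
      case 1
      then show ?thesis using s by (auto simp: H_def)
    next
      case 2
      have "of_int m * \<tau> + s = of_int (m + 1) * \<tau> + (s - \<tau>)" by (simp add: algebra_simps)
      moreover have "s - \<tau> \<in> S" using minus[OF s(1) \<tau>(1)] s 2 \<tau> by simp
      moreover have "\<bar>s - \<tau>\<bar> \<le> \<tau>" using 2 s \<tau> by linarith
      ultimately show ?thesis unfolding H_def by blast
    next
      case 3
      have "of_int m * \<tau> + s = of_int (m - 1) * \<tau> + (s + \<tau>)" by (simp add: algebra_simps)
      moreover have "s + \<tau> \<in> S" using plus[OF s(1) \<tau>(1)] s 3 \<tau> by simp
      moreover have "\<bar>s + \<tau>\<bar> \<le> \<tau>" using 3 s \<tau> by linarith
      ultimately show ?thesis unfolding H_def by blast
    qed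
  qed
  show thesis
  proof (rule that)
    show "real_subgroup H"
      unfolding real_subgroup_def
    proof (intro conjI ballI)
      show "0 \<in> H" using HI[OF S0, of 0] \<tau> by simp
      fix a assume "a \<in> H"
      then obtain m s where a: "a = of_int m * \<tau> + s" "s \<in> S" "\<bar>s\<bar> \<le> \<tau>" by (auto simp: H_def)
      have "- a = of_int (- m) * \<tau> + (- s)" by (simp add: a)
      then show "- a \<in> H" using HI[OF neg[OF a(2)], of "- m"] a by simp
      fix b assume "b \<in> H"
      then obtain n t where b: "b = of_int n * \<tau> + t" "t \<in> S" "\<bar>t\<bar> \<le> \<tau>" by (auto simp: H_def)
      have "a + b = of_int (m + n) * \<tau> + (s + t)" by (simp add: a b algebra_simps)
      moreover have "\<bar>s + t\<bar> \<le> 2 * \<tau>" using a b by linarith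
      then have "of_int (m + n) * \<tau> + (s + t) \<in> H" using \<tau> by (intro HI plus a b) linarith+
      ultimately show "a + b \<in> H" by (simp only:)
    qed
    show "S \<subseteq> H"
    proof
      fix s assume s: "s \<in> S"
      define m where "m = (if s \<ge> 0 then \<lfloor>s / \<tau>\<rfloor> else - \<lfloor>- s / \<tau>\<rfloor>)"
      have fl: "0 \<le> of_int \<lfloor>u / \<tau>\<rfloor> * \<tau>" "of_int \<lfloor>u / \<tau>\<rfloor> * \<tau> \<le> u" "u - of_int \<lfloor>u / \<tau>\<rfloor> * \<tau> \<le> \<tau>" if "u \<ge> 0" for u
      proof -
        show "0 \<le> of_int \<lfloor>u / \<tau>\<rfloor> * \<tau>" using that \<tau> by simp
        show "of_int \<lfloor>u / \<tau>\<rfloor> * \<tau> \<le> u"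
          using \<tau> by (intro floor_divide_lower)
        show "u - of_int \<lfloor>u / \<tau>\<rfloor> * \<tau> \<le> \<tau>"
          using floor_divide_upper[OF \<tau>(2), of u] by (simp add: algebra_simps)
      qed
      have m: "\<bar>of_int m * \<tau>\<bar> \<le> \<bar>s\<bar>" "\<bar>s - of_int m * \<tau>\<bar> \<le> \<tau>"
        using fl[of s] fl[of "- s"] by (auto simp: m_def)
      have "of_int m * \<tau> \<in> S" using mul[of m] m subsetD[OF S s] by auto
      then have "s - of_int m * \<tau> \<in> S" using minus[OF s] m \<tau> by simp
      then show "s \<in> H" using HI[of "s - of_int m * \<tau>" m] m \<tau> by simp
    qed
    fix t assume t: "t \<in> H" "\<bar>t\<bar> < d / 2"
    then obtain m s where a: "t = of_int m * \<tau> + s" "s \<in> S" "\<bar>s\<bar> \<le> \<tau>" by (auto simp: H_def)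
    have "\<bar>of_int m * \<tau>\<bar> < d" using a t \<tau> by linarith
    moreover have "\<bar>of_int m * \<tau> + s\<bar> < d" using t a d by linarith
    ultimately show "t \<in> S" using plus[OF mul a(2), of m] a(1) by simp
  qed
qed

text \<open>A homomorphism that is only controlled at the times when it is in the chart \<open>U\<close>
  coincides with a continuous one on a dense subgroup. The chart values of the exponential
  map are junk outside \<open>U\<close>, so its continuity along lines is not available at the outset.\<close>

lemma line_hom_continuous_extension:
  fixes \<alpha> :: "real \<Rightarrow> 'g::{topological_group_add, t2_space}" and U K K0 :: "'g set"
  assumes \<alpha>: "line_hom \<alpha>" and U: "open U" "0 \<in> U"
    and K: "compact K" "open K0" "0 \<in> K0" "K0 \<subseteq> K"
    and star: "\<And>W. open W \<Longrightarrow> 0 \<in> W \<Longrightarrow> \<exists>d>0. \<forall>t. \<bar>t\<bar> < d \<and> \<alpha> t \<in> U \<longrightarrow> \<alpha> t \<in> W"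
    and small: "\<And>e. e > 0 \<Longrightarrow> \<exists>\<tau>. 0 < \<tau> \<and> \<tau> < e \<and> \<alpha> \<tau> \<in> U"
  shows "\<exists>\<gamma>. line_hom \<gamma> \<and> (\<gamma> \<longlongrightarrow> 0) (nhds 0) \<and> (\<exists>d>0. \<forall>t. \<bar>t\<bar> < d \<and> \<alpha> t \<in> U \<longrightarrow> \<alpha> t = \<gamma> t)"
proof -
  \<comment> \<open>Elements of \<open>N1\<close> have their differences in \<open>U\<close>, so the
    set \<open>S\<close> of good times becomes closed under small differences.\<close>
  obtain N1 where N1: "open N1" "0 \<in> N1" "\<And>x y. x \<in> N1 \<Longrightarrow> y \<in> N1 \<Longrightarrow> x - y \<in> U"
    using topological_group_nbhd[OF U] by metis
  obtain d where d: "d > 0" "\<And>t. \<bar>t\<bar> < d \<Longrightarrow> \<alpha> t \<in> U \<Longrightarrow> \<alpha> t \<in> N1"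
    using star[OF N1(1,2)] by blast
  define S where "S = {t. \<bar>t\<bar> < d \<and> \<alpha> t \<in> U}"
  have "\<exists>\<tau>\<in>S. 0 < \<tau> \<and> \<tau> < e" if "e > 0" for e
  proof -
    obtain \<tau> where "0 < \<tau>" "\<tau> < min e d" "\<alpha> \<tau> \<in> U" using small[of "min e d"] \<open>e > 0\<close> d(1) by auto
    then show ?thesis by (intro bexI[of _ \<tau>]) (simp_all add: S_def)
  qed
  note Ssmall = this
  have "s - t \<in> S" if "s \<in> S" "t \<in> S" "\<bar>s - t\<bar> < d" for s t
    using that N1(3)[OF d(2) d(2), of s t] by (simp add: S_def line_hom_diff[OF \<alpha>])
  moreover have "S \<subseteq> {-d<..<d}" by (auto simp: S_def)
  ultimately obtain H where H: "real_subgroup H" "S \<subseteq> H" "\<And>t. t \<in> H \<Longrightarrow> \<bar>t\<bar> < d / 2 \<Longrightarrow> t \<in> S"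
    using real_local_subgroup_extend[OF d(1), of S] Ssmall by metis
  have Hsmall: "\<exists>\<tau>\<in>H. 0 < \<tau> \<and> \<tau> < e" if "e > 0" for e
    using Ssmall[OF that] H(2) by (meson subsetD)
  have Hdiff: "h' - h \<in> H" if "h \<in> H" "h' \<in> H" for h h'
    using H(1) that unfolding real_subgroup_def by (metis diff_conv_add_uminus)
  \<comment> \<open>Along \<open>H\<close> the homomorphism is uniformly continuous: small elements
    of \<open>H\<close> belong to \<open>S\<close>, and there \<open>star\<close> applies.\<close>
  have cauchy: "\<exists>e>0. \<forall>h\<in>H. \<forall>h'\<in>H. \<bar>h' - h\<bar> < e \<longrightarrow> - \<alpha> h + \<alpha> h' \<in> W" if W: "open W" "0 \<in> W" for W
  proof -
    obtain e where e: "e > 0" "\<And>t. \<bar>t\<bar> < e \<Longrightarrow> \<alpha> t \<in> U \<Longrightarrow> \<alpha> t \<in> W" using star[OF W] by blast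
    have "- \<alpha> h + \<alpha> h' \<in> W" if "h \<in> H" "h' \<in> H" "\<bar>h' - h\<bar> < min e (d / 2)" for h h'
    proof -
      have "h' - h \<in> S" using H(3)[OF Hdiff[OF that(1,2)]] that by simp
      then show ?thesis using e(2)[of "h' - h"] that by (simp add: S_def line_hom_diff'[OF \<alpha>])
    qed
    then show ?thesis using e(1) d(1) by (intro exI[of _ "min e (d / 2)"]) simp
  qed
  \<comment> \<open>The filter \<open>G t\<close> describes convergence to \<open>t\<close> inside
    the dense subgroup \<open>H\<close>; the extension is the limit of \<open>\<alpha>\<close> along
    it.\<close>
  define G where "G t = inf (nhds t) (principal H)" for t :: real
  have evG: "eventually P (G t) \<longleftrightarrow> (\<exists>e>0. \<forall>h\<in>H. \<bar>h - t\<bar> < e \<longrightarrow> P h)" for P t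
    by (auto simp: G_def eventually_inf_principal eventually_nhds_metric dist_real_def)
  have Gbot: "G t \<noteq> bot" for t
  proof -
    have "\<not> eventually (\<lambda>_. False) (G t)"
      unfolding evG using real_subgroup_approx[OF H(1) Hsmall, of _ t]
      by (smt (verit, best))
    then show ?thesis by (metis eventually_bot)
  qed
  have ex: "\<exists>g. (\<alpha> \<longlongrightarrow> g) (G t)" for t
  proof -
    obtain e where e: "e > 0" "\<And>h h'. h \<in> H \<Longrightarrow> h' \<in> H \<Longrightarrow> \<bar>h' - h\<bar> < e \<Longrightarrow> - \<alpha> h + \<alpha> h' \<in> K0"
      using cauchy[OF K(2,3)] by blast
    obtain h0 where h0: "h0 \<in> H" "h0 \<le> t" "t < h0 + e / 2"
      using real_subgroup_approx[OF H(1) Hsmall, of "e / 2" t] e(1) by auto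
    define k where "k h = - \<alpha> h0 + \<alpha> h" for h
    have "eventually (\<lambda>h. k h \<in> K) (G t)"
      unfolding evG k_def
    proof (intro exI[of _ "e / 2"] conjI ballI impI)
      fix h assume h: "h \<in> H" "\<bar>h - t\<bar> < e / 2"
      have "\<bar>h - h0\<bar> < e" using h h0 by linarith
      then show "- \<alpha> h0 + \<alpha> h \<in> K" using e(2)[OF h0(1) h(1)] K(4) by blast
    qed (use e(1) in simp)
    then have "eventually (\<lambda>x. x \<in> K) (filtermap k (G t))" by (simp add: eventually_filtermap)
    moreover have "filtermap k (G t) \<noteq> bot" using Gbot by (simp add: filtermap_bot_iff)
    ultimately obtain x where x: "inf (nhds x) (filtermap k (G t)) \<noteq> bot"
      using K(1) unfolding compact_filter by blast
    \<comment> \<open>Compactness of \<open>K\<close> only provides a cluster point \<open>x\<close>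
      of the differences; the Cauchy property turns it into a limit.\<close>
    have "(\<alpha> \<longlongrightarrow> \<alpha> h0 + x) (G t)"
    proof (rule topological_tendstoI)
      fix W assume W: "open W" "\<alpha> h0 + x \<in> W"
      have "open ((\<lambda>y. \<alpha> h0 + x + y) -` W)" "0 \<in> (\<lambda>y. \<alpha> h0 + x + y) -` W"
        using W by (auto intro!: open_vimage continuous_intros)
      then obtain N where N: "open N" "0 \<in> N"
        "\<And>y z. y \<in> N \<Longrightarrow> z \<in> N \<Longrightarrow> y + z \<in> (\<lambda>y. \<alpha> h0 + x + y) -` W"
        using topological_group_nbhd by metis
      obtain \<delta> where \<delta>: "\<delta> > 0" "\<And>h h'. h \<in> H \<Longrightarrow> h' \<in> H \<Longrightarrow> \<bar>h' - h\<bar> < \<delta> \<Longrightarrow> - \<alpha> h + \<alpha> h' \<in> N"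
        using cauchy[OF N(1,2)] by blast
      have "\<exists>h\<in>H. \<bar>h - t\<bar> < \<delta> / 2 \<and> - x + k h \<in> N"
      proof (rule ccontr)
        assume "\<not> ?thesis"
        then have "eventually (\<lambda>h. - x + k h \<notin> N) (G t)"
          unfolding evG using \<delta>(1) by (intro exI[of _ "\<delta> / 2"]) auto
        then have 1: "eventually (\<lambda>y. - x + y \<notin> N) (filtermap k (G t))" by (simp add: eventually_filtermap)
        have "open ((\<lambda>y. - x + y) -` N)" "x \<in> (\<lambda>y. - x + y) -` N"
          using N by (auto intro!: open_vimage continuous_intros)
        then have 2: "eventually (\<lambda>y. - x + y \<in> N) (nhds x)"
          unfolding eventually_nhds by (intro exI[of _ "(\<lambda>y. - x + y) -` N"]) auto
        have "eventually (\<lambda>y. False) (inf (nhds x) (filtermap k (G t)))"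
          unfolding eventually_inf using 1 2 by blast
        then show False using x by (simp add: trivial_limit_def)
      qed
      then obtain h where h: "h \<in> H" "\<bar>h - t\<bar> < \<delta> / 2" "- x + k h \<in> N" by blast
      have "\<alpha> h' \<in> W" if "h' \<in> H" "\<bar>h' - t\<bar> < \<delta> / 2" for h'
      proof -
        have "\<bar>h' - h\<bar> < \<delta>" using h(2) that(2) by linarith
        then have "- \<alpha> h + \<alpha> h' \<in> N" by (rule \<delta>(2)[OF h(1) that(1)])
        from N(3)[OF h(3) this] show ?thesis by (simp add: k_def add.assoc)
      qed
      then show "eventually (\<lambda>h. \<alpha> h \<in> W) (G t)" unfolding evG using \<delta>(1) by (intro exI[of _ "\<delta> / 2"]) auto
    qed
    then show ?thesis by blast
  qed
  define \<gamma> where "\<gamma> t = (SOME g. (\<alpha> \<longlongrightarrow> g) (G t))" for t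
  have lim: "(\<alpha> \<longlongrightarrow> \<gamma> t) (G t)" for t unfolding \<gamma>_def using ex by (rule someI_ex)
  have eq: "\<alpha> h = \<gamma> h" if h: "h \<in> H" for h
  proof (rule tendsto_unique[OF Gbot _ lim])
    show "(\<alpha> \<longlongrightarrow> \<alpha> h) (G h)"
    proof (rule topological_tendstoI)
      fix W assume W: "open W" "\<alpha> h \<in> W"
      have "open ((\<lambda>y. \<alpha> h + y) -` W)" "0 \<in> (\<lambda>y. \<alpha> h + y) -` W"
        using W by (auto intro!: open_vimage continuous_intros)
      from cauchy[OF this] obtain e where e: "e > 0"
        "\<And>h'. h' \<in> H \<Longrightarrow> \<bar>h' - h\<bar> < e \<Longrightarrow> \<alpha> h + (- \<alpha> h + \<alpha> h') \<in> W" using h by blast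
      then show "eventually (\<lambda>h. \<alpha> h \<in> W) (G h)"
        unfolding evG by (intro exI[of _ e]) (simp add: add.assoc[symmetric])
    qed
  qed
  have "line_hom \<gamma>"
    unfolding line_hom_def
  proof (intro allI)
    fix s t
    \<comment> \<open>Additivity passes to the limit in two independent variables, one tending to
      \<open>s\<close> and the other to \<open>t\<close>.\<close>
    define P where "P = G s \<times>\<^sub>F G t"
    have P: "P \<noteq> bot" using Gbot by (simp add: P_def prod_filter_eq_bot)
    have f: "filterlim fst (G s) P" "filterlim snd (G t) P"
      unfolding P_def by (rule filterlim_fst filterlim_snd)+
    have a: "((\<lambda>z. \<alpha> (fst z) + \<alpha> (snd z)) \<longlongrightarrow> \<gamma> s + \<gamma> t) P"
      by (intro tendsto_add filterlim_compose[OF lim] f)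
    have "filterlim (\<lambda>z. fst z + snd z) (G (s + t)) P"
      unfolding filterlim_iff
    proof (intro allI impI)
      fix Pr assume "eventually Pr (G (s + t))"
      then obtain e where e: "e > 0" "\<And>h. h \<in> H \<Longrightarrow> \<bar>h - (s + t)\<bar> < e \<Longrightarrow> Pr h" unfolding evG by blast
      have ev: "eventually (\<lambda>h. h \<in> H \<and> \<bar>h - s\<bar> < e / 2) (G s)" "eventually (\<lambda>h. h \<in> H \<and> \<bar>h - t\<bar> < e / 2) (G t)"
        unfolding evG using e(1) by (auto intro!: exI[of _ "e / 2"])
      have "eventually (\<lambda>z. (fst z \<in> H \<and> \<bar>fst z - s\<bar> < e / 2) \<and> (snd z \<in> H \<and> \<bar>snd z - t\<bar> < e / 2)) P"
        by (rule eventually_conj[OF eventually_compose_filterlim[OF ev(1) f(1)] eventually_compose_filterlim[OF ev(2) f(2)]])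
      then show "eventually (\<lambda>z. Pr (fst z + snd z)) P"
      proof (rule eventually_mono)
        fix z assume z: "(fst z \<in> H \<and> \<bar>fst z - s\<bar> < e / 2) \<and> (snd z \<in> H \<and> \<bar>snd z - t\<bar> < e / 2)"
        then have "fst z + snd z \<in> H" using H(1) by (simp add: real_subgroup_def)
        moreover have "\<bar>fst z + snd z - (s + t)\<bar> < e" using z by linarith
        ultimately show "Pr (fst z + snd z)" using e(2) by blast
      qed
    qed
    from filterlim_compose[OF lim this]
    have "((\<lambda>z. \<alpha> (fst z) + \<alpha> (snd z)) \<longlongrightarrow> \<gamma> (s + t)) P" by (simp add: line_hom_add[OF \<alpha>])
    from tendsto_unique[OF P this a] show "\<gamma> (s + t) = \<gamma> s + \<gamma> t" .
  qed
  moreover have "(\<gamma> \<longlongrightarrow> 0) (nhds 0)"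
  proof (rule topological_tendstoI)
    fix W :: "'g set" assume W: "open W" "0 \<in> W"
    obtain N where N: "open N" "0 \<in> N" "\<And>x y. x \<in> N \<Longrightarrow> y \<in> N \<Longrightarrow> x - y \<in> W"
      using topological_group_nbhd[OF W] by metis
    have H0: "0 \<in> H" using H(1) by (simp add: real_subgroup_def)
    obtain e where e: "e > 0" "\<And>h. h \<in> H \<Longrightarrow> \<bar>h\<bar> < e \<Longrightarrow> \<alpha> h \<in> N"
      using cauchy[OF N(1,2)] H0 line_hom_0[OF \<alpha>] by (metis add_0 diff_zero minus_zero)
    have "\<gamma> t \<in> W" if "\<bar>t\<bar> < e / 2" for t
    proof -
      have "open ((\<lambda>y. - \<gamma> t + y) -` N)" "\<gamma> t \<in> (\<lambda>y. - \<gamma> t + y) -` N"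
        using N by (auto intro!: open_vimage continuous_intros)
      from topological_tendstoD[OF lim this]
      have "eventually (\<lambda>h. - \<gamma> t + \<alpha> h \<in> N) (G t)" by simp
      moreover have "eventually (\<lambda>h. \<alpha> h \<in> N) (G t)"
        unfolding evG
      proof (intro exI[of _ "e / 2"] conjI ballI impI)
        fix h assume h: "h \<in> H" "\<bar>h - t\<bar> < e / 2"
        then have "\<bar>h\<bar> < e" using that by linarith
        then show "\<alpha> h \<in> N" using e(2) h(1) by blast
      qed (use e(1) in simp)
      ultimately have "eventually (\<lambda>h. - \<gamma> t + \<alpha> h \<in> N \<and> \<alpha> h \<in> N) (G t)" by (rule eventually_conj)
      then obtain h where h: "- \<gamma> t + \<alpha> h \<in> N" "\<alpha> h \<in> N"
        using Gbot eventually_happens by blast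
      have "\<alpha> h - (- \<gamma> t + \<alpha> h) = \<gamma> t"
        by (simp add: diff_conv_add_uminus minus_add add.assoc[symmetric] del: add_uminus_conv_diff)
      then show ?thesis using N(3)[OF h(2,1)] by simp
    qed
    then show "eventually (\<lambda>t. \<gamma> t \<in> W) (nhds 0)"
      unfolding eventually_nhds_metric using e(1) by (intro exI[of _ "e / 2"]) (auto simp: dist_real_def)
  qed
  moreover have "\<exists>d>0. \<forall>t. \<bar>t\<bar> < d \<and> \<alpha> t \<in> U \<longrightarrow> \<alpha> t = \<gamma> t"
    using d(1) H(2) eq by (intro exI[of _ d]) (auto simp: S_def)
  ultimately show ?thesis by blast
qed

subsection \<open>The continuous exponential map\<close>

lemma clopen_UNIV:
  assumes "connected (UNIV :: 'g::topological_space set)" "open C" "closed C" "C \<noteq> {}"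
  shows "C = (UNIV :: 'g set)"
  using connectedD[OF assms(1,2), of "- C"] assms(3,4) by (auto simp: open_Compl)

lemma Ck_on_1_lipschitz:
  fixes f :: "'a::euclidean_space \<Rightarrow> 'b::real_normed_vector"
  assumes f: "Ck_on 1 S f" and c: "cball x r \<subseteq> S"
  shows "\<exists>B>0. \<forall>y\<in>cball x r. \<forall>z\<in>cball x r. norm (f y - f z) \<le> B * norm (y - z)"
proof -
  obtain f' where f': "\<forall>x\<in>S. (f has_derivative f' x) (at x)" "\<forall>v. continuous_on S (\<lambda>x. f' x v)"
    using f by (auto simp: One_nat_def)
  have "\<exists>M. \<forall>y\<in>cball x r. norm (f' y b) \<le> M" for b
  proof -
    have "compact ((\<lambda>y. f' y b) ` cball x r)"
      by (intro compact_continuous_image continuous_on_subset[OF f'(2)[rule_format] c] compact_cball)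
    then show ?thesis unfolding image_image using compact_imp_bounded bounded_iff by (metis (no_types, lifting) image_eqI)
  qed
  then obtain M where M: "\<And>b y. y \<in> cball x r \<Longrightarrow> norm (f' y b) \<le> M b" by metis
  define B where "B = (\<Sum>b\<in>Basis. \<bar>M b\<bar>) + 1"
  have B: "B > 0" unfolding B_def by (intro add_nonneg_pos sum_nonneg) auto
  have "norm (f' y h) \<le> B * norm h" if y: "y \<in> cball x r" for y h
  proof -
    have lin: "linear (f' y)" using f'(1) y c has_derivative_linear by blast
    have "norm (f' y h) \<le> (\<Sum>b\<in>Basis. norm ((h \<bullet> b) *\<^sub>R f' y b))"
      unfolding linear_euclidean_expand[OF lin, of h] by (rule norm_sum)
    also have "\<dots> \<le> (\<Sum>b\<in>Basis. norm h * \<bar>M b\<bar>)"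
    proof (rule sum_mono)
      fix b :: 'a assume "b \<in> Basis"
      then have "\<bar>h \<bullet> b\<bar> \<le> norm h" by (rule Basis_le_norm)
      moreover have "norm (f' y b) \<le> \<bar>M b\<bar>" using M[OF y, of b] by linarith
      ultimately show "norm ((h \<bullet> b) *\<^sub>R f' y b) \<le> norm h * \<bar>M b\<bar>" by (simp add: mult_mono)
    qed
    also have "\<dots> \<le> B * norm h" unfolding B_def by (simp add: sum_distrib_left[symmetric] algebra_simps)
    finally show ?thesis .
  qed
  then have on: "onorm (f' y) \<le> B" if "y \<in> cball x r" for y
    using that by (intro onorm_le) (auto simp: mult.commute)
  have "norm (f y - f z) \<le> B * norm (y - z)" if "y \<in> cball x r" "z \<in> cball x r" for y z
    by (rule differentiable_bound[OF convex_cball, of x r f f'])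
      (use that on has_derivative_at_withinI[OF bspec[OF f'(1) subsetD[OF c]]] in auto)
  then show ?thesis using B by blast
qed

section \<open>Velocities and one-parameter subgroups in the chart\<close>

context lie_chart begin

text \<open>The limit in the group is part of the notion because \<open>\<phi>\<close> is arbitrary
  outside \<open>U\<close>: differentiability of \<open>\<phi> (c h)\<close> alone would not keep
  the curve inside the chart. By the separation axiom it also forces \<open>c 0 = 0\<close>.\<close>

definition vel :: "(real \<Rightarrow> 'g) \<Rightarrow> 'a \<Rightarrow> bool" where
  "vel c v \<longleftrightarrow> (c \<longlongrightarrow> 0) (nhds 0) \<and> ((\<lambda>h. \<phi> (c h)) has_vector_derivative v) (at 0)"

lemma vel_0: assumes "vel c v" shows "c 0 = 0"
proof (rule ccontr)
  assume "c 0 \<noteq> 0"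
  then obtain W where W: "open W" "0 \<in> W" "c 0 \<notin> W" using t1_space by metis
  then have "eventually (\<lambda>h. c h \<in> W) (nhds 0)" using assms topological_tendstoD[of c 0 "nhds 0" W] by (simp add: vel_def)
  then show False using W eventually_nhds_x_imp_x by blast
qed

lemma vel_in_U: "vel c v \<Longrightarrow> eventually (\<lambda>h. c h \<in> U) (nhds 0)"
  unfolding vel_def using open_U zero_U topological_tendstoD by blast

lemma vel_unique: "vel c v \<Longrightarrow> vel c w \<Longrightarrow> v = w"
  unfolding vel_def using vector_derivative_unique_at by blast

text \<open>The chain rule in the chart. The result depends on the curve only through its velocity,
  so \<open>c\<close> can later be exchanged for any curve with the same one.\<close>

lemma deriv_along:
  assumes f: "((\<lambda>x. f (p + \<psi> x + q)) has_derivative D) (at x0)" and c: "vel c v"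
  shows "((\<lambda>h. f (p + c h + q)) has_vector_derivative D v) (at 0)"
proof -
  have "((\<lambda>h. \<phi> (c h)) has_derivative (\<lambda>h. h *\<^sub>R v)) (at 0)"
    using c by (simp add: vel_def has_vector_derivative_def)
  moreover have "\<phi> (c 0) = x0" using vel_0[OF c] by (simp add: x0_def)
  ultimately have "((\<lambda>h. f (p + \<psi> (\<phi> (c h)) + q)) has_derivative (\<lambda>h. D (h *\<^sub>R v))) (at 0)"
    using has_derivative_compose[of "\<lambda>h. \<phi> (c h)" "\<lambda>h. h *\<^sub>R v" 0 UNIV, of "\<lambda>x. f (p + \<psi> x + q)" D] f by simp
  moreover have "D (h *\<^sub>R v) = h *\<^sub>R D v" for h by (rule linear_scale[OF has_derivative_linear[OF f]])
  ultimately have *: "((\<lambda>h. f (p + \<psi> (\<phi> (c h)) + q)) has_vector_derivative D v) (at 0)"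
    by (simp add: has_vector_derivative_def)
  obtain W where W: "open W" "0 \<in> W" "\<And>h. h \<in> W \<Longrightarrow> c h \<in> U"
    using vel_in_U[OF c] unfolding eventually_nhds by blast
  show ?thesis
    by (rule has_vector_derivative_transform_within_open[OF * W(1,2)]) (simp add: W(3))
qed

lemma left_chart_deriv:
  assumes "p \<in> U"
  shows "((\<lambda>x. \<phi> (p + \<psi> x + 0)) has_derivative L (\<phi> p)) (at x0)"
  using L_deriv[OF \<phi>_N0[OF assms]] assms by (simp add: F_def)

lemma right_chart_deriv:
  assumes "p \<in> U"
  shows "((\<lambda>x. \<phi> (0 + \<psi> x + p)) has_derivative R (\<phi> p)) (at x0)"
  using R_deriv[OF \<phi>_N0[OF assms]] assms by (simp add: F_def)

lemma shift_vector_derivative: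
  assumes "((\<lambda>h. g (t + h)) has_vector_derivative v) (at 0)"
  shows "(g has_vector_derivative v) (at t)"
proof -
  have "((\<lambda>s. s - t) has_derivative (\<lambda>h. h)) (at t)" by (auto intro!: derivative_eq_intros)
  from has_derivative_compose[OF this, of "\<lambda>h. g (t + h)" "\<lambda>h. h *\<^sub>R v"] assms
  show ?thesis by (simp add: has_vector_derivative_def)
qed

lemma line_hom_tendsto:
  fixes \<gamma> :: "real \<Rightarrow> 'g"
  assumes "line_hom \<gamma>" "(\<gamma> \<longlongrightarrow> 0) (nhds 0)"
  shows "continuous_on S \<gamma>"
proof -
  have "isCont \<gamma> t" for t
  proof -
    have "filterlim (\<lambda>s. s - t) (nhds (t - t)) (nhds t)" by (intro tendsto_intros filterlim_ident)
    then have "((\<lambda>s. \<gamma> t + \<gamma> (s - t)) \<longlongrightarrow> \<gamma> t + 0) (nhds t)"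
      by (intro tendsto_add tendsto_const filterlim_compose[OF assms(2)]) simp
    then have "(\<gamma> \<longlongrightarrow> \<gamma> t) (nhds t)" using line_hom_add[OF assms(1)] by (simp flip: line_hom_add[OF assms(1)])
    then show ?thesis unfolding isCont_def tendsto_at_iff_tendsto_nhds .
  qed
  then show ?thesis by (simp add: continuous_at_imp_continuous_on)
qed

definition flow :: "(real \<Rightarrow> 'g) \<Rightarrow> 'a \<Rightarrow> bool" where
  "flow \<gamma> v \<longleftrightarrow> line_hom \<gamma> \<and> vel \<gamma> v"

lemma flow_cont: "flow \<gamma> v \<Longrightarrow> continuous_on S \<gamma>"
  using line_hom_tendsto by (auto simp: flow_def vel_def)

text \<open>Since \<open>\<gamma> (t + h) = \<gamma> t + \<gamma> h\<close>, a one-parameter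
  subgroup is an integral curve of the left-invariant field with value \<open>v\<close> at the
  identity, wherever it is in the chart.\<close>

lemma flow_chart_deriv:
  assumes \<gamma>: "flow \<gamma> v" and t: "\<gamma> t \<in> U"
  shows "((\<lambda>s. \<phi> (\<gamma> s)) has_vector_derivative L (\<phi> (\<gamma> t)) v) (at t)"
proof (rule shift_vector_derivative)
  have "vel \<gamma> v" using \<gamma> by (simp add: flow_def)
  from deriv_along[OF left_chart_deriv[OF t] this]
  show "((\<lambda>h. \<phi> (\<gamma> (t + h))) has_vector_derivative L (\<phi> (\<gamma> t)) v) (at 0)"
    using \<gamma> by (simp add: flow_def line_hom_add)
qed

lemma flow_scale:
  assumes \<gamma>: "flow \<gamma> v"
  shows "flow (\<lambda>t. \<gamma> (c * t)) (c *\<^sub>R v)"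
proof -
  have h: "line_hom \<gamma>" "vel \<gamma> v" using \<gamma> by (auto simp: flow_def)
  have "filterlim (\<lambda>t. c * t) (nhds (c * 0)) (nhds 0)" by (intro tendsto_intros filterlim_ident)
  then have "((\<lambda>t. \<gamma> (c * t)) \<longlongrightarrow> 0) (nhds 0)"
    using h(2) by (auto simp: vel_def intro: filterlim_compose)
  moreover have "((\<lambda>t. \<phi> (\<gamma> (c * t))) has_vector_derivative c *\<^sub>R v) (at 0)"
  proof -
    have "((\<lambda>t. c * t) has_derivative (\<lambda>h. c * h)) (at 0)" by (auto intro!: derivative_eq_intros)
    from has_derivative_compose[OF this, of "\<lambda>h. \<phi> (\<gamma> h)" "\<lambda>h. h *\<^sub>R v"] h(2)
    show ?thesis by (simp add: has_vector_derivative_def vel_def mult.commute)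
  qed
  ultimately show ?thesis
    using h(1) by (simp add: flow_def vel_def line_hom_def distrib_left)
qed

lemma L_bounds:
  "\<exists>r>0. \<exists>C>0. cball x0 r \<subseteq> N0 \<and>
    (\<forall>x\<in>cball x0 r. \<forall>v. norm (L x v) \<le> C * norm v) \<and>
    (\<forall>x\<in>cball x0 r. \<forall>y\<in>cball x0 r. \<forall>v. norm (L x v - L y v) \<le> C * norm (x - y) * norm v)"
proof -
  obtain r where r: "r > 0" "cball x0 r \<subseteq> N0"
    using open_N0 x0_N0 open_contains_cball by blast
  obtain B where B: "\<And>b. B b > 0" "\<And>b y z. y \<in> cball x0 r \<Longrightarrow> z \<in> cball x0 r \<Longrightarrow> norm (L y b - L z b) \<le> B b * norm (y - z)"
    using Ck_on_1_lipschitz[OF L_C1 r(2)] by metis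
  define M where "M = (\<Sum>b\<in>Basis. B b)"
  have M: "M \<ge> 0" unfolding M_def using B(1) by (intro sum_nonneg) (simp add: less_imp_le)
  have lip: "norm (L x v - L y v) \<le> M * norm (x - y) * norm v"
    if xy: "x \<in> cball x0 r" "y \<in> cball x0 r" for x y v
  proof -
    have lin: "linear (\<lambda>v. L x v - L y v)"
      using L_linear xy r(2) by (intro linear_compose_sub) auto
    have "norm (L x v - L y v) \<le> (\<Sum>b\<in>Basis. norm ((v \<bullet> b) *\<^sub>R (L x b - L y b)))"
      by (subst linear_euclidean_expand[OF lin, of v]) (rule norm_sum)
    also have "\<dots> \<le> (\<Sum>b\<in>Basis. norm v * (B b * norm (x - y)))"
    proof (rule sum_mono)
      fix b :: 'a assume "b \<in> Basis"
      then have "\<bar>v \<bullet> b\<bar> \<le> norm v" by (rule Basis_le_norm)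
      then show "norm ((v \<bullet> b) *\<^sub>R (L x b - L y b)) \<le> norm v * (B b * norm (x - y))"
        using B(2)[OF xy, of b] by (simp add: mult_mono)
    qed
    also have "\<dots> = M * norm (x - y) * norm v"
      unfolding M_def by (simp add: sum_distrib_left sum_distrib_right mult_ac)
    finally show ?thesis .
  qed
  define C where "C = M * r + M + 1"
  have C: "C > 0" "M \<le> C" using M r(1) by (simp_all add: C_def add_nonneg_pos)
  have "norm (L x v) \<le> C * norm v" if x: "x \<in> cball x0 r" for x v
  proof -
    have "norm (L x v) \<le> norm (L x v - L x0 v) + norm v"
      using norm_triangle_sub[of "L x v" v] by simp
    also have "norm (L x v - L x0 v) \<le> M * norm (x - x0) * norm v"
      using lip[OF x, of x0] r(1) by simp
    also have "M * norm (x - x0) * norm v \<le> M * r * norm v"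
      using x M by (intro mult_right_mono mult_left_mono) (auto simp: dist_norm norm_minus_commute)
    finally have "norm (L x v) \<le> (M * r + 1) * norm v" by (simp add: algebra_simps)
    also have "\<dots> \<le> C * norm v" using M by (intro mult_right_mono) (auto simp: C_def)
    finally show ?thesis .
  qed
  moreover have "norm (L x v - L y v) \<le> C * norm (x - y) * norm v"
    if "x \<in> cball x0 r" "y \<in> cball x0 r" for x y v
  proof -
    have "M * norm (x - y) * norm v \<le> C * norm (x - y) * norm v"
      using C(2) by (intro mult_right_mono) auto
    then show ?thesis using lip[OF that, of v] by linarith
  qed
  ultimately show ?thesis using r C(1) by blast
qed

text \<open>The curves solve the differential equation given by \<open>L\<close>, so the mean value
  inequality and the bounds on \<open>L\<close> give everything. The constants are uniform in the
  curve, which is what makes \<open>E\<close> continuous and injective at \<open>0\<close>.\<close>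

lemma flow_estimates:
  "\<exists>C>0. \<exists>\<epsilon>>0.
    (\<forall>\<gamma> v t. flow \<gamma> v \<longrightarrow> norm v < \<epsilon> \<longrightarrow> 0 \<le> t \<longrightarrow> t \<le> 1 \<longrightarrow>
      \<gamma> t \<in> U \<and> norm (\<phi> (\<gamma> t) - x0 - t *\<^sub>R v) \<le> C * (norm v)\<^sup>2) \<and>
    (\<forall>\<gamma> v \<gamma>' v' t. flow \<gamma> v \<longrightarrow> flow \<gamma>' v' \<longrightarrow> norm v < \<epsilon> \<longrightarrow> norm v' < \<epsilon> \<longrightarrow> 0 \<le> t \<longrightarrow> t \<le> 1 \<longrightarrow>
      norm (\<phi> (\<gamma> t) - \<phi> (\<gamma>' t)) \<le> C * norm (v - v'))"
proof -
  obtain r C where r: "r > 0" "cball x0 r \<subseteq> N0" and C: "C > 0"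
    and L1: "\<And>x v. x \<in> cball x0 r \<Longrightarrow> norm (L x v) \<le> C * norm v"
    and L2: "\<And>x y v. x \<in> cball x0 r \<Longrightarrow> y \<in> cball x0 r \<Longrightarrow> norm (L x v - L y v) \<le> C * norm (x - y) * norm v"
    using L_bounds by blast
  \<comment> \<open>The first bound makes the speed \<open>C * norm v\<close> smaller than
    \<open>r\<close>, so time \<open>1\<close> is too short to leave the ball; the second makes it
    at most \<open>1 / 2\<close>, so that the difference of two curves can be absorbed.\<close>
  define \<epsilon> where "\<epsilon> = min (r / (2 * C)) (1 / (2 * C))"
  have \<epsilon>: "\<epsilon> > 0" using r C by (simp add: \<epsilon>_def)
  have \<epsilon>1: "C * norm v < r" "C * norm v \<le> 1 / 2" if "norm v < \<epsilon>" for v :: 'a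
  proof -
    have "norm v < r / (2 * C)" "norm v < 1 / (2 * C)" using that by (auto simp: \<epsilon>_def)
    then have "2 * (C * norm v) < r" "2 * (C * norm v) < 1" using C by (simp_all add: field_simps)
    moreover have "0 \<le> C * norm v" using C by simp
    ultimately show "C * norm v < r" "C * norm v \<le> 1 / 2" by linarith+
  qed
  define B where "B = {p \<in> U. \<phi> p \<in> ball x0 r}"
  have B: "open B" unfolding B_def
    using continuous_open_preimage[OF cont_\<phi> open_U open_ball[of x0 r]] by (simp add: Int_def vimage_def)
  have sub: "ball x0 r \<subseteq> cball x0 r" by (rule ball_subset_cball)
  have grow: "norm (\<phi> (\<gamma> s) - x0) \<le> C * norm v * s"
    if \<gamma>: "flow \<gamma> v" and s: "0 \<le> s" and in_B: "\<And>u. 0 \<le> u \<Longrightarrow> u \<le> s \<Longrightarrow> \<gamma> u \<in> B" for \<gamma> v s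
  proof -
    have "norm (\<phi> (\<gamma> s) - \<phi> (\<gamma> 0)) \<le> C * norm v * norm (s - 0)"
    proof (rule differentiable_bound[of "{0..s}" "\<lambda>u. \<phi> (\<gamma> u)" "\<lambda>u h. h *\<^sub>R L (\<phi> (\<gamma> u)) v"])
      fix u assume u: "u \<in> {0..s}"
      then have uB: "\<gamma> u \<in> B" using in_B by simp
      then show "((\<lambda>u. \<phi> (\<gamma> u)) has_derivative (\<lambda>h. h *\<^sub>R L (\<phi> (\<gamma> u)) v)) (at u within {0..s})"
        using flow_chart_deriv[OF \<gamma>, of u] by (auto simp: B_def has_vector_derivative_def intro: has_derivative_at_withinI)
      have "norm (L (\<phi> (\<gamma> u)) v) \<le> C * norm v" using L1 uB sub by (auto simp: B_def)
      then show "onorm (\<lambda>h. h *\<^sub>R L (\<phi> (\<gamma> u)) v) \<le> C * norm v"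
        by (intro onorm_le) (simp add: mult.commute mult_left_mono)
    qed (use s in auto)
    then show ?thesis using \<gamma> s by (simp add: flow_def line_hom_0 x0_def)
  qed
  have stay: "\<gamma> t \<in> B" if \<gamma>: "flow \<gamma> v" and v: "norm v < \<epsilon>" and t: "0 \<le> t" "t \<le> 1" for \<gamma> v t
  proof (rule ccontr)
    assume out: "\<gamma> t \<notin> B"
    define Z where "Z = {u \<in> {0..1}. \<gamma> u \<notin> B}"
    have "closed Z"
    proof -
      have "closed ({0..1} \<inter> \<gamma> -` (- B))"
        by (intro continuous_closed_preimage flow_cont[OF \<gamma>]) (use B in auto)
      moreover have "{0..1} \<inter> \<gamma> -` (- B) = Z" by (auto simp: Z_def)
      ultimately show ?thesis by simp
    qed
    moreover have "bounded Z" by (rule bounded_subset[of "{0..1}"]) (auto simp: Z_def)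
    ultimately have "compact Z" by (simp add: compact_eq_bounded_closed)
    moreover have "Z \<noteq> {}" using out t by (auto simp: Z_def)
    ultimately obtain t1 where t1: "t1 \<in> Z" "\<And>u. u \<in> Z \<Longrightarrow> t1 \<le> u" using compact_attains_inf[of Z] by metis
    have before: "\<gamma> u \<in> B" if "0 \<le> u" "u < t1" for u
      using t1 that by (force simp: Z_def)
    have "\<gamma> 0 \<in> B" using \<gamma> r zero_U by (simp add: flow_def line_hom_0 B_def x0_def)
    then have t1pos: "0 < t1" "t1 \<le> 1" using t1(1) by (auto simp: Z_def order_le_less)
    \<comment> \<open>At the first exit time \<open>t1\<close> the chart value of
      \<open>\<gamma>\<close> may be meaningless. Before \<open>t1\<close> the curve is therefore
      trapped in a compact, hence closed, subset \<open>K\<close> of the group that lies in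
      \<open>B\<close>, and continuity puts \<open>\<gamma> t1\<close> into
      \<open>K\<close>.\<close>
    define K where "K = \<psi> ` cball x0 (C * norm v)"
    have sub': "cball x0 (C * norm v) \<subseteq> ball x0 r" using \<epsilon>1[OF v] by auto
    have "compact K" unfolding K_def
      by (intro compact_continuous_image continuous_on_subset[OF cont_\<psi>] compact_cball) (use sub' sub r in blast)
    then have "closed K" by (rule compact_imp_closed)
    have "\<gamma> u \<in> K" if u: "0 \<le> u" "u < t1" for u
    proof -
      have "norm (\<phi> (\<gamma> u) - x0) \<le> C * norm v * u"
        using grow[OF \<gamma> u(1)] before u by simp
      also have "\<dots> \<le> C * norm v * 1" using u t1pos C by (intro mult_left_mono) auto
      finally have "\<phi> (\<gamma> u) \<in> cball x0 (C * norm v)" by (simp add: dist_norm norm_minus_commute)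
      moreover have "\<gamma> u = \<psi> (\<phi> (\<gamma> u))" using before[OF u] by (simp add: B_def)
      ultimately show ?thesis unfolding K_def by blast
    qed
    then have "eventually (\<lambda>u. \<gamma> u \<in> K) (at_left t1)"
      unfolding eventually_at_left_field using t1pos by (intro exI[of _ 0]) auto
    moreover have "(\<gamma> \<longlongrightarrow> \<gamma> t1) (at_left t1)"
    proof -
      have "isCont \<gamma> t1" using flow_cont[OF \<gamma>, of UNIV] by (simp add: continuous_on_eq_continuous_at)
      then show ?thesis unfolding isCont_def by (rule tendsto_mono[OF at_le, rotated]) simp
    qed
    ultimately have "\<gamma> t1 \<in> K"
      using Lim_in_closed_set[OF \<open>closed K\<close>, of \<gamma> "at_left t1"] by simp
    then obtain x where x: "x \<in> cball x0 (C * norm v)" "\<gamma> t1 = \<psi> x" by (auto simp: K_def)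
    then have "x \<in> ball x0 r" using sub' by blast
    moreover then have "x \<in> N0" using sub r by blast
    ultimately have "\<gamma> t1 \<in> B" using x by (simp add: B_def \<psi>_U)
    then show False using t1(1) by (simp add: Z_def)
  qed
  have in_cball: "\<phi> (\<gamma> t) \<in> cball x0 r" "\<gamma> t \<in> U"
    if "flow \<gamma> v" "norm v < \<epsilon>" "0 \<le> t" "t \<le> 1" for \<gamma> v t
    using stay[OF that] by (auto simp: B_def)
  have bound: "norm (\<phi> (\<gamma> t) - x0 - t *\<^sub>R v) \<le> (C * C + 2 * C) * (norm v)\<^sup>2"
    if \<gamma>: "flow \<gamma> v" and v: "norm v < \<epsilon>" and t: "0 \<le> t" "t \<le> 1" for \<gamma> v t
  proof -
    define g where "g u = \<phi> (\<gamma> u) - u *\<^sub>R v" for u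
    have "norm (g t - g 0) \<le> (C * C * (norm v)\<^sup>2) * norm (t - 0)"
    proof (rule differentiable_bound[of "{0..t}" g "\<lambda>u h. h *\<^sub>R (L (\<phi> (\<gamma> u)) v - v)"])
      fix u assume u: "u \<in> {0..t}"
      then have u1: "0 \<le> u" "u \<le> 1" using t by auto
      have "((\<lambda>u. u *\<^sub>R v) has_vector_derivative 1 *\<^sub>R v) (at u)"
        by (auto simp: has_vector_derivative_def intro!: derivative_eq_intros)
      then have "(g has_vector_derivative L (\<phi> (\<gamma> u)) v - 1 *\<^sub>R v) (at u)"
        unfolding g_def
        by (intro has_vector_derivative_diff flow_chart_deriv[OF \<gamma>] in_cball[OF \<gamma> v] u1)
      then show "(g has_derivative (\<lambda>h. h *\<^sub>R (L (\<phi> (\<gamma> u)) v - v))) (at u within {0..t})"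
        by (auto simp: has_vector_derivative_def intro: has_derivative_at_withinI)
      have "norm (L (\<phi> (\<gamma> u)) v - L x0 v) \<le> C * norm (\<phi> (\<gamma> u) - x0) * norm v"
        using L2[OF in_cball(1)[OF \<gamma> v u1], of x0] r by simp
      also have "norm (\<phi> (\<gamma> u) - x0) \<le> C * norm v * u"
        using grow[OF \<gamma>, of u] stay[OF \<gamma> v] u1 by simp
      also have "C * norm v * u \<le> C * norm v * 1" using u1 C by (intro mult_left_mono) auto
      finally have "norm (L (\<phi> (\<gamma> u)) v - v) \<le> C * C * (norm v)\<^sup>2"
        using C by (simp add: power2_eq_square mult_ac mult_left_mono mult_right_mono)
      then show "onorm (\<lambda>h. h *\<^sub>R (L (\<phi> (\<gamma> u)) v - v)) \<le> C * C * (norm v)\<^sup>2"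
        by (intro onorm_le) (simp add: mult.commute mult_left_mono)
    qed (use t in auto)
    also have "(C * C * (norm v)\<^sup>2) * norm (t - 0) \<le> (C * C * (norm v)\<^sup>2) * 1"
      using t C by (intro mult_left_mono) auto
    also have "\<dots> \<le> (C * C + 2 * C) * (norm v)\<^sup>2" using C by (simp add: algebra_simps)
    finally show ?thesis using \<gamma> by (simp add: g_def flow_def line_hom_0 x0_def algebra_simps)
  qed
  have comp: "norm (\<phi> (\<gamma> t) - \<phi> (\<gamma>' t)) \<le> (C * C + 2 * C) * norm (v - v')"
    if \<gamma>: "flow \<gamma> v" "flow \<gamma>' v'" and v: "norm v < \<epsilon>" "norm v' < \<epsilon>" and t: "0 \<le> t" "t \<le> 1"
    for \<gamma> v \<gamma>' v' t
  proof -
    define g where "g u = \<phi> (\<gamma> u) - \<phi> (\<gamma>' u)" for u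
    have gd: "(g has_vector_derivative L (\<phi> (\<gamma> u)) v - L (\<phi> (\<gamma>' u)) v') (at u)" if u1: "0 \<le> u" "u \<le> 1" for u
      unfolding g_def
      by (intro derivative_intros flow_chart_deriv \<gamma> in_cball[OF \<gamma>(1) v(1)] in_cball[OF \<gamma>(2) v(2)] u1)
    then have "continuous_on {0..1} g"
      by (intro continuous_at_imp_continuous_on ballI) (auto intro: has_vector_derivative_continuous)
    then obtain s where s: "s \<in> {0..1}" "\<And>u. u \<in> {0..1} \<Longrightarrow> norm (g u) \<le> norm (g s)"
      using continuous_attains_sup[of "{0..1}" "\<lambda>u. norm (g u)"] continuous_on_norm[of "{0..1}" g] by fastforce
    \<comment> \<open>At every time the speed of \<open>g\<close> is at most half of the maximum
      \<open>norm (g s)\<close> plus \<open>C * norm (v - v')\<close>. Integrated up to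
      \<open>s\<close>, the half of the maximum is absorbed on the left.\<close>
    define K where "K = norm (g s) / 2 + C * norm (v - v')"
    have K: "K \<ge> 0" using C by (simp add: K_def)
    have "norm (g s - g 0) \<le> K * norm (s - 0)"
    proof (rule differentiable_bound[of "{0..s}" g "\<lambda>u h. h *\<^sub>R (L (\<phi> (\<gamma> u)) v - L (\<phi> (\<gamma>' u)) v')"])
      fix u assume u: "u \<in> {0..s}"
      then have u1: "0 \<le> u" "u \<le> 1" using s by auto
      show "(g has_derivative (\<lambda>h. h *\<^sub>R (L (\<phi> (\<gamma> u)) v - L (\<phi> (\<gamma>' u)) v'))) (at u within {0..s})"
        using gd[OF u1] by (auto simp: has_vector_derivative_def intro: has_derivative_at_withinI)
      note i = in_cball(1)[OF \<gamma>(1) v(1) u1] in_cball(1)[OF \<gamma>(2) v(2) u1]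
      have lin: "L (\<phi> (\<gamma>' u)) (v - v') = L (\<phi> (\<gamma>' u)) v - L (\<phi> (\<gamma>' u)) v'"
        using L_linear[of "\<phi> (\<gamma>' u)"] i r by (intro linear_diff) blast
      have "norm (L (\<phi> (\<gamma> u)) v - L (\<phi> (\<gamma>' u)) v')
          \<le> norm (L (\<phi> (\<gamma> u)) v - L (\<phi> (\<gamma>' u)) v) + norm (L (\<phi> (\<gamma>' u)) (v - v'))"
        unfolding lin using norm_triangle_ineq[of "L (\<phi> (\<gamma> u)) v - L (\<phi> (\<gamma>' u)) v" "L (\<phi> (\<gamma>' u)) v - L (\<phi> (\<gamma>' u)) v'"] by simp
      also have "\<dots> \<le> C * norm (g u) * norm v + C * norm (v - v')"
        using L2[OF i, of v] L1[OF i(2), of "v - v'"] by (simp add: g_def)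
      also have "C * norm (g u) * norm v = (C * norm v) * norm (g u)" by simp
      also have "\<dots> \<le> (1 / 2) * norm (g s)"
        using \<epsilon>1(2)[OF v(1)] s(2)[of u] u1 C by (intro mult_mono) auto
      finally have "norm (L (\<phi> (\<gamma> u)) v - L (\<phi> (\<gamma>' u)) v') \<le> K" by (simp add: K_def)
      then show "onorm (\<lambda>h. h *\<^sub>R (L (\<phi> (\<gamma> u)) v - L (\<phi> (\<gamma>' u)) v')) \<le> K"
        by (intro onorm_le) (simp add: mult.commute[of K] mult_left_mono)
    qed (use s in auto)
    also have "K * norm (s - 0) \<le> K * 1" using s K by (intro mult_left_mono) auto
    finally have "norm (g s) \<le> K" using \<gamma> by (simp add: g_def flow_def line_hom_0)
    then have "norm (g s) \<le> 2 * C * norm (v - v')" by (simp add: K_def)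
    also have "\<dots> \<le> (C * C + 2 * C) * norm (v - v')" using C by (intro mult_right_mono) auto
    finally show ?thesis using s(2)[of t] t by (simp add: g_def)
  qed
  show ?thesis
    using bound comp in_cball(2) C \<epsilon>
    by (intro exI[of _ "C * C + 2 * C"] conjI exI[of _ \<epsilon>]) (auto intro: add_pos_pos)
qed

text \<open>With equal velocities the Lipschitz estimate gives equality at the time
  \<open>t / n\<close>, for \<open>n\<close> so large that it applies; the homomorphism property
  carries the equality to \<open>t\<close>.\<close>

lemma flow_unique:
  assumes "flow \<gamma> v" "flow \<gamma>' v"
  shows "\<gamma> = \<gamma>'"
proof
  fix t
  obtain C \<epsilon> where e: "\<epsilon> > 0" and *:
    "\<And>\<gamma> v t. flow \<gamma> v \<Longrightarrow> norm v < \<epsilon> \<Longrightarrow> 0 \<le> t \<Longrightarrow> t \<le> 1 \<Longrightarrow> \<gamma> t \<in> U"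
    "\<And>\<gamma> v \<gamma>' v' t. flow \<gamma> v \<Longrightarrow> flow \<gamma>' v' \<Longrightarrow> norm v < \<epsilon> \<Longrightarrow> norm v' < \<epsilon> \<Longrightarrow> 0 \<le> t \<Longrightarrow> t \<le> 1 \<Longrightarrow>
      norm (\<phi> (\<gamma> t) - \<phi> (\<gamma>' t)) \<le> C * norm (v - v')"
    using flow_estimates by metis
  obtain n :: nat where n: "real n > (norm (t *\<^sub>R v) + 1) / \<epsilon>" using reals_Archimedean2 by blast
  have "(norm (t *\<^sub>R v) + 1) / \<epsilon> > 0" using e by (intro divide_pos_pos add_nonneg_pos) auto
  then have n0: "real n > 0" using n by linarith
  have small: "norm ((t / real n) *\<^sub>R v) < \<epsilon>"
  proof -
    have "norm (t *\<^sub>R v) + 1 < \<epsilon> * real n" using n e by (simp add: field_simps)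
    then have "norm (t *\<^sub>R v) < \<epsilon> * real n" by linarith
    then show ?thesis using n0 by (simp add: field_simps)
  qed
  note f = flow_scale[OF assms(1), of "t / real n"] flow_scale[OF assms(2), of "t / real n"]
  have "norm (\<phi> (\<gamma> (t / real n * 1)) - \<phi> (\<gamma>' (t / real n * 1))) \<le> C * norm ((t / real n) *\<^sub>R v - (t / real n) *\<^sub>R v)"
    by (rule *(2)[OF f small small]) auto
  then have "\<phi> (\<gamma> (t / real n)) = \<phi> (\<gamma>' (t / real n))" by simp
  moreover have "\<gamma> (t / real n) \<in> U" "\<gamma>' (t / real n) \<in> U"
    using *(1)[OF f(1) small, of 1] *(1)[OF f(2) small, of 1] by auto
  ultimately have "\<gamma> (t / real n) = \<gamma>' (t / real n)" by (metis \<psi>_\<phi>)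
  then have "of_int (int n) * (t / real n) \<in> {t. \<gamma> t = \<gamma>' t}"
    using assms by (intro real_subgroup_mult line_hom_eq_subgroup) (auto simp: flow_def)
  then show "\<gamma> t = \<gamma>' t" using n0 by simp
qed

end

section \<open>The one-parameter subgroups of \<open>Exp\<close> and their continuous
  version\<close>

locale lie_algebra_chart = lie_group_with_algebra A Exp bracket + lie_chart A U \<phi>
  for A :: "('g::{topological_group_add, t2_space}, 'a::euclidean_space) chart set"
    and Exp :: "'a \<Rightarrow> 'g" and bracket :: "'a \<Rightarrow> 'a \<Rightarrow> 'a" and U :: "'g set" and \<phi> :: "'g \<Rightarrow> 'a" +
  assumes connected_G: "connected (UNIV :: 'g set)"
begin

text \<open>Finite sums of a countable dense set of the chart domain form a countable set. Its
  closure absorbs translates of \<open>U\<close>, hence is open and closed, and connectedness makes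
  it everything. The pigeonhole argument for small times rests on this.\<close>

lemma countable_dense: "\<exists>Q. countable Q \<and> closure Q = (UNIV :: 'g set)"
proof -
  obtain D :: "'a set" where D: "countable D" "\<And>X. open X \<Longrightarrow> X \<noteq> {} \<Longrightarrow> \<exists>d\<in>D. d \<in> X"
    using countable_dense_setE by metis
  define Q0 where "Q0 = \<psi> ` D"
  define Q where "Q = sum_list ` lists Q0"
  have "countable Q" unfolding Q_def Q0_def by (intro countable_image countable_lists D)
  have step: "q + u \<in> Q" if qu: "q \<in> Q" "u \<in> Q0" for q u
  proof -
    obtain xs where xs: "xs \<in> lists Q0" "q = sum_list xs" using qu(1) unfolding Q_def by blast
    have "xs @ [u] \<in> lists Q0" "sum_list (xs @ [u]) = q + u" using xs qu by auto
    then show ?thesis unfolding Q_def by (metis imageI)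
  qed
  have near: "c + u \<in> closure Q" if c: "c \<in> closure Q" and u: "u \<in> U" for c u
    unfolding closure_iff_nhds_not_empty
  proof (intro allI impI)
    fix X V assume X: "V \<subseteq> X" "open V" "c + u \<in> V"
    have "open ((\<lambda>z. fst z + snd z) -` V)" by (intro open_vimage X continuous_intros)
    moreover have "(c, u) \<in> (\<lambda>z. fst z + snd z) -` V" using X by simp
    ultimately obtain V1 V2 where V: "open V1" "open V2" "(c, u) \<in> V1 \<times> V2" "V1 \<times> V2 \<subseteq> (\<lambda>z. fst z + snd z) -` V"
      by (rule open_prod_elim)
    have "Q \<inter> V1 \<noteq> {}" using c V unfolding closure_iff_nhds_not_empty by blast
    then obtain q where q: "q \<in> Q" "q \<in> V1" by blast
    have "open {x \<in> N0. \<psi> x \<in> V2}" by (rule open_\<psi>_preimage[OF cont_\<psi> V(2)])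
    moreover have "\<phi> u \<in> {x \<in> N0. \<psi> x \<in> V2}" using u V by (simp add: \<phi>_N0)
    ultimately obtain d where d: "d \<in> D" "d \<in> N0" "\<psi> d \<in> V2" using D(2) by blast
    have "q + \<psi> d \<in> V" using V q d by auto
    moreover have "q + \<psi> d \<in> Q" using step[OF q(1)] d by (simp add: Q0_def)
    ultimately show "Q \<inter> X \<noteq> {}" using X by blast
  qed
  have "open (closure Q)"
  proof (subst open_subopen, intro ballI)
    fix c assume c: "c \<in> closure Q"
    have "open ((\<lambda>y. - c + y) -` U)" by (intro open_vimage open_U continuous_intros)
    moreover have "c \<in> (\<lambda>y. - c + y) -` U" using zero_U by simp
    moreover have "(\<lambda>y. - c + y) -` U \<subseteq> closure Q"
    proof
      fix y assume "y \<in> (\<lambda>y. - c + y) -` U"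
      then show "y \<in> closure Q" using near[OF c, of "- c + y"] by (simp add: add.assoc[symmetric])
    qed
    ultimately show "\<exists>T. open T \<and> c \<in> T \<and> T \<subseteq> closure Q" by blast
  qed
  moreover have "closure Q \<noteq> {}"
  proof -
    have "sum_list [] \<in> Q" unfolding Q_def by (intro imageI) simp
    then show ?thesis using closure_subset by blast
  qed
  ultimately have "closure Q = UNIV" using clopen_UNIV[OF connected_G] closed_closure by blast
  then show ?thesis using \<open>countable Q\<close> by blast
qed

definition T :: "'a \<Rightarrow> 'a" where
  "T = (SOME T. linear T \<and> bij T \<and> (\<forall>\<xi>. ((\<lambda>t. \<phi> (Exp (t *\<^sub>R \<xi>))) has_vector_derivative T \<xi>) (at 0)))"

lemma T_linear: "linear T" and T_bij: "bij T"
  and T_velocity: "((\<lambda>t. \<phi> (Exp (t *\<^sub>R \<xi>))) has_vector_derivative T \<xi>) (at 0)"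
  using someI_ex[OF velocity[OF chart zero_U]] unfolding T_def[symmetric] by auto

lemma T_inj: "T \<xi> = T \<eta> \<Longrightarrow> \<xi> = \<eta>"
  using T_bij by (simp add: bij_def inj_def)

lemma Exp_line_hom: "line_hom (\<lambda>t. Exp (t *\<^sub>R \<xi>))"
  by (simp add: line_hom_def one_parameter)

lemma Exp_0 [simp]: "Exp 0 = 0"
  using line_hom_0[OF Exp_line_hom[of 0]] by simp

text \<open>Differentiability at \<open>0\<close> gives continuity of the chart values there, and
  these values determine the point only at times when it lies in \<open>U\<close>.\<close>

lemma Exp_star:
  assumes W: "open W" "0 \<in> W"
  shows "\<exists>d>0. \<forall>t. \<bar>t\<bar> < d \<and> Exp (t *\<^sub>R \<xi>) \<in> U \<longrightarrow> Exp (t *\<^sub>R \<xi>) \<in> W"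
proof -
  have "isCont (\<lambda>t. \<phi> (Exp (t *\<^sub>R \<xi>))) 0" using T_velocity by (rule has_vector_derivative_continuous)
  then have "((\<lambda>t. \<phi> (Exp (t *\<^sub>R \<xi>))) \<longlongrightarrow> x0) (nhds 0)"
    using tendsto_at_iff_tendsto_nhds[of "\<lambda>t. \<phi> (Exp (t *\<^sub>R \<xi>))" 0] by (simp add: isCont_def x0_def)
  moreover have "open {x \<in> N0. \<psi> x \<in> W}" by (rule open_\<psi>_preimage[OF cont_\<psi> W(1)])
  moreover have "x0 \<in> {x \<in> N0. \<psi> x \<in> W}" using W x0_N0 by simp
  ultimately have "eventually (\<lambda>t. \<phi> (Exp (t *\<^sub>R \<xi>)) \<in> {x \<in> N0. \<psi> x \<in> W}) (nhds 0)"
    using topological_tendstoD by blast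
  then obtain d where d: "d > 0" "\<And>t. \<bar>t\<bar> < d \<Longrightarrow> \<psi> (\<phi> (Exp (t *\<^sub>R \<xi>))) \<in> W"
    by (auto simp: eventually_nhds_metric dist_real_def)
  have "Exp (t *\<^sub>R \<xi>) \<in> W" if "\<bar>t\<bar> < d" "Exp (t *\<^sub>R \<xi>) \<in> U" for t
    using d(2)[OF that(1)] that(2) by simp
  then show ?thesis using d(1) by blast
qed

lemma Exp_small:
  assumes "e > 0"
  shows "\<exists>\<tau>. 0 < \<tau> \<and> \<tau> < e \<and> Exp (\<tau> *\<^sub>R \<xi>) \<in> U \<and> Exp (\<tau> *\<^sub>R \<eta>) \<in> U"
  using common_small_time[OF Exp_line_hom Exp_line_hom _ _ open_U zero_U assms] countable_dense by blast

definition gam :: "'a \<Rightarrow> real \<Rightarrow> 'g" where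
  "gam \<xi> = (SOME \<gamma>. line_hom \<gamma> \<and> (\<gamma> \<longlongrightarrow> 0) (nhds 0) \<and>
    (\<exists>d>0. \<forall>t. \<bar>t\<bar> < d \<and> Exp (t *\<^sub>R \<xi>) \<in> U \<longrightarrow> Exp (t *\<^sub>R \<xi>) = \<gamma> t))"

lemma gam_hom: "line_hom (gam \<xi>)" and gam_tendsto: "(gam \<xi> \<longlongrightarrow> 0) (nhds 0)"
  and gam_eq: "\<exists>d>0. \<forall>t. \<bar>t\<bar> < d \<and> Exp (t *\<^sub>R \<xi>) \<in> U \<longrightarrow> Exp (t *\<^sub>R \<xi>) = gam \<xi> t"
proof -
  obtain r where r: "r > 0" "cball x0 r \<subseteq> N0" using open_N0 x0_N0 open_contains_cball by blast
  have "compact (\<psi> ` cball x0 r)"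
    by (intro compact_continuous_image continuous_on_subset[OF cont_\<psi> r(2)] compact_cball)
  moreover have "open {p \<in> U. \<phi> p \<in> ball x0 r}"
    using continuous_open_preimage[OF cont_\<phi> open_U open_ball[of x0 r]] by (simp add: Int_def vimage_def)
  moreover have "0 \<in> {p \<in> U. \<phi> p \<in> ball x0 r}" using r zero_U by (simp add: x0_def)
  moreover have "{p \<in> U. \<phi> p \<in> ball x0 r} \<subseteq> \<psi> ` cball x0 r"
  proof
    fix p assume "p \<in> {p \<in> U. \<phi> p \<in> ball x0 r}"
    then have "p = \<psi> (\<phi> p)" "\<phi> p \<in> cball x0 r" by auto
    then show "p \<in> \<psi> ` cball x0 r" by blast
  qed
  ultimately have "\<exists>\<gamma>. line_hom \<gamma> \<and> (\<gamma> \<longlongrightarrow> 0) (nhds 0) \<and>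
      (\<exists>d>0. \<forall>t. \<bar>t\<bar> < d \<and> Exp (t *\<^sub>R \<xi>) \<in> U \<longrightarrow> Exp (t *\<^sub>R \<xi>) = \<gamma> t)"
    using Exp_star Exp_small[of _ \<xi> \<xi>]
    by (intro line_hom_continuous_extension[OF Exp_line_hom open_U zero_U]) blast+
  from someI_ex[OF this]
  show "line_hom (gam \<xi>)" "(gam \<xi> \<longlongrightarrow> 0) (nhds 0)"
    "\<exists>d>0. \<forall>t. \<bar>t\<bar> < d \<and> Exp (t *\<^sub>R \<xi>) \<in> U \<longrightarrow> Exp (t *\<^sub>R \<xi>) = gam \<xi> t"
    unfolding gam_def by auto
qed

text \<open>A subgroup of the reals with arbitrarily small positive elements, hence dense. It is the
  link between \<open>Exp\<close> and its continuous version until both are shown to be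
  equal.\<close>

definition Hgam :: "'a \<Rightarrow> real set" where "Hgam \<xi> = {t. Exp (t *\<^sub>R \<xi>) = gam \<xi> t}"

lemma Hgam_subgroup: "real_subgroup (Hgam \<xi>)"
  unfolding Hgam_def by (rule line_hom_eq_subgroup[OF Exp_line_hom gam_hom])

text \<open>One small time serves two vectors at once, as needed to compare a vector with its
  dilation.\<close>

lemma Hgam_Int_small:
  assumes "e > 0" shows "\<exists>\<tau>\<in>Hgam \<xi> \<inter> Hgam \<eta>. 0 < \<tau> \<and> \<tau> < e"
proof -
  obtain d1 where d1: "d1 > 0" "\<And>t. \<bar>t\<bar> < d1 \<Longrightarrow> Exp (t *\<^sub>R \<xi>) \<in> U \<Longrightarrow> Exp (t *\<^sub>R \<xi>) = gam \<xi> t"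
    using gam_eq by blast
  obtain d2 where d2: "d2 > 0" "\<And>t. \<bar>t\<bar> < d2 \<Longrightarrow> Exp (t *\<^sub>R \<eta>) \<in> U \<Longrightarrow> Exp (t *\<^sub>R \<eta>) = gam \<eta> t"
    using gam_eq by blast
  obtain \<tau> where t: "0 < \<tau>" "\<tau> < min e (min d1 d2)" "Exp (\<tau> *\<^sub>R \<xi>) \<in> U" "Exp (\<tau> *\<^sub>R \<eta>) \<in> U"
    using Exp_small[of "min e (min d1 d2)"] assms d1(1) d2(1) by (metis min_less_iff_conj)
  then show ?thesis using d1(2)[of \<tau>] d2(2)[of \<tau>] by (intro bexI[of _ \<tau>]) (auto simp: Hgam_def)
qed

lemma Hgam_approx:
  assumes "e > 0" shows "\<exists>h\<in>Hgam \<xi>. h \<le> t \<and> t < h + e"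
proof (rule real_subgroup_approx[OF Hgam_subgroup _ assms])
  show "\<exists>\<tau>\<in>Hgam \<xi>. 0 < \<tau> \<and> \<tau> < e" if "e > 0" for e
    using Hgam_Int_small[OF that, of \<xi> \<xi>] by blast
qed

text \<open>The first-order bound is known for \<open>Exp\<close>, hence for
  \<open>gam \<xi>\<close> at small times of the dense set \<open>Hgam \<xi>\<close>. The defect
  \<open>k\<close> is continuous, so a positive value would persist on an interval, which contains
  such a time.\<close>

lemma gam_flow: "flow (gam \<xi>) (T \<xi>)"
proof -
  have "((\<lambda>h. \<phi> (gam \<xi> h)) has_derivative (\<lambda>h. h *\<^sub>R T \<xi>)) (at 0)"
    unfolding has_derivative_at_alt
  proof (intro conjI allI impI)
    show "bounded_linear (\<lambda>h. h *\<^sub>R T \<xi>)" by (rule bounded_linear_scaleR_left)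
    fix e :: real assume e: "e > 0"
    have x0: "\<phi> (gam \<xi> 0) = x0" "\<phi> (Exp (0 *\<^sub>R \<xi>)) = x0" by (simp_all add: line_hom_0[OF gam_hom] x0_def)
    obtain d1 where d1: "d1 > 0" "\<And>t. \<bar>t\<bar> < d1 \<Longrightarrow> norm (\<phi> (Exp (t *\<^sub>R \<xi>)) - x0 - t *\<^sub>R T \<xi>) \<le> e * \<bar>t\<bar>"
      using T_velocity[of \<xi>] e unfolding has_vector_derivative_def has_derivative_at_alt by (auto simp: x0_def)
    obtain d2 where d2: "d2 > 0" "\<And>t. \<bar>t\<bar> < d2 \<Longrightarrow> gam \<xi> t \<in> U"
      using topological_tendstoD[OF gam_tendsto open_U zero_U] by (auto simp: eventually_nhds_metric dist_real_def)
    define d where "d = min d1 d2"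
    define k where "k t = norm (\<phi> (gam \<xi> t) - x0 - t *\<^sub>R T \<xi>) - e * \<bar>t\<bar>" for t
    have "k t \<le> 0" if t: "\<bar>t\<bar> < d" for t
    proof (rule ccontr)
      assume "\<not> k t \<le> 0"
      have "continuous_on {-d<..<d} k"
        unfolding k_def
        by (intro continuous_intros continuous_on_compose2[OF cont_\<phi>] line_hom_tendsto gam_hom gam_tendsto)
          (auto simp: d_def intro!: d2)
      moreover have "t \<in> {-d<..<d}" using t by auto
      ultimately have "isCont k t" using continuous_on_eq_continuous_at[OF open_greaterThanLessThan] by blast
      then have "eventually (\<lambda>s. k s > 0) (nhds t)"
        unfolding isCont_def tendsto_at_iff_tendsto_nhds using \<open>\<not> k t \<le> 0\<close> by (intro order_tendstoD) auto
      then obtain \<delta> where \<delta>: "\<delta> > 0" "\<And>s. \<bar>s - t\<bar> < \<delta> \<Longrightarrow> k s > 0"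
        by (auto simp: eventually_nhds_metric dist_real_def)
      obtain h where h: "h \<in> Hgam \<xi>" "h \<le> t" "t < h + min \<delta> (d - \<bar>t\<bar>)"
        using Hgam_approx[of "min \<delta> (d - \<bar>t\<bar>)" \<xi> t] \<delta>(1) t by auto
      then have "\<bar>h - t\<bar> < \<delta>" "\<bar>h\<bar> < d1" by (auto simp: d_def)
      then have "k h > 0" "k h \<le> 0" using \<delta>(2) d1(2)[of h] h(1) by (simp_all add: k_def Hgam_def)
      then show False by simp
    qed
    then show "\<exists>d>0. \<forall>y. norm (y - 0) < d \<longrightarrow> norm (\<phi> (gam \<xi> y) - \<phi> (gam \<xi> 0) - (y - 0) *\<^sub>R T \<xi>) \<le> e * norm (y - 0)"
      using d1(1) d2(1) by (intro exI[of _ d]) (auto simp: d_def k_def x0)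
  qed
  then show ?thesis
    using gam_hom gam_tendsto by (simp add: flow_def vel_def has_vector_derivative_def)
qed

definition E :: "'a \<Rightarrow> 'g" where "E \<xi> = gam \<xi> 1"

lemma gam_E: "gam \<xi> t = E (t *\<^sub>R \<xi>)"
proof -
  have "flow (\<lambda>s. gam \<xi> (t * s)) (T (t *\<^sub>R \<xi>))"
    using flow_scale[OF gam_flow, of \<xi> t] linear_scale[OF T_linear] by simp
  from flow_unique[OF this gam_flow] have "gam (t *\<^sub>R \<xi>) 1 = gam \<xi> (t * 1)" by metis
  then show ?thesis by (simp add: E_def)
qed

lemma E_flow: "flow (\<lambda>t. E (t *\<^sub>R \<xi>)) (T \<xi>)"
  using gam_flow[of \<xi>] by (simp add: gam_E[abs_def])

lemma E_vel: "vel (\<lambda>t. E (t *\<^sub>R \<xi>)) (T \<xi>)"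
  and E_hom: "line_hom (\<lambda>t. E (t *\<^sub>R \<xi>))"
  using E_flow[of \<xi>] by (auto simp: flow_def)

lemma E_add: "E ((s + t) *\<^sub>R \<xi>) = E (s *\<^sub>R \<xi>) + E (t *\<^sub>R \<xi>)"
  using line_hom_add[OF E_hom] .

lemma E_0 [simp]: "E 0 = 0" using line_hom_0[OF E_hom[of 0]] by simp

lemma E_minus: "E (- \<xi>) = - E \<xi>"
  using line_hom_minus[OF E_hom[of \<xi>], of 1] by simp

lemma E_line_cont: "continuous_on S (\<lambda>t. E (t *\<^sub>R \<xi>))"
  using flow_cont[OF E_flow] .

lemma flow_eq_E: "flow \<gamma> (T \<xi>) \<Longrightarrow> \<gamma> t = E (t *\<^sub>R \<xi>)"
  using flow_unique[OF _ E_flow] by metis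

lemma E_estimates:
  "\<exists>C>0. \<exists>\<epsilon>>0.
    (\<forall>\<xi> t. norm (T \<xi>) < \<epsilon> \<longrightarrow> E \<xi> \<in> U \<and> norm (\<phi> (E \<xi>) - x0 - T \<xi>) \<le> C * (norm (T \<xi>))\<^sup>2) \<and>
    (\<forall>\<xi> \<eta>. norm (T \<xi>) < \<epsilon> \<longrightarrow> norm (T \<eta>) < \<epsilon> \<longrightarrow> norm (\<phi> (E \<xi>) - \<phi> (E \<eta>)) \<le> C * norm (T \<xi> - T \<eta>))"
proof -
  obtain C \<epsilon> where C: "C > 0" "\<epsilon> > 0"
    and 1: "\<forall>\<gamma> v t. flow \<gamma> v \<longrightarrow> norm v < \<epsilon> \<longrightarrow> 0 \<le> t \<longrightarrow> t \<le> 1 \<longrightarrow>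
      \<gamma> t \<in> U \<and> norm (\<phi> (\<gamma> t) - x0 - t *\<^sub>R v) \<le> C * (norm v)\<^sup>2"
    and 2: "\<forall>\<gamma> v \<gamma>' v' t. flow \<gamma> v \<longrightarrow> flow \<gamma>' v' \<longrightarrow> norm v < \<epsilon> \<longrightarrow> norm v' < \<epsilon> \<longrightarrow> 0 \<le> t \<longrightarrow> t \<le> 1 \<longrightarrow>
      norm (\<phi> (\<gamma> t) - \<phi> (\<gamma>' t)) \<le> C * norm (v - v')"
    using flow_estimates by blast
  have "E \<xi> \<in> U \<and> norm (\<phi> (E \<xi>) - x0 - T \<xi>) \<le> C * (norm (T \<xi>))\<^sup>2" if "norm (T \<xi>) < \<epsilon>" for \<xi>
    using 1[rule_format, OF E_flow[of \<xi>] that, of 1] by simp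
  moreover have "norm (\<phi> (E \<xi>) - \<phi> (E \<eta>)) \<le> C * norm (T \<xi> - T \<eta>)"
    if "norm (T \<xi>) < \<epsilon>" "norm (T \<eta>) < \<epsilon>" for \<xi> \<eta>
    using 2[rule_format, OF E_flow[of \<xi>] E_flow[of \<eta>] that, of 1] by simp
  ultimately show ?thesis using C by blast
qed

text \<open>The Lipschitz bound gives continuity in the chart. If \<open>E \<xi> = 0\<close>, the
  second-order bound reads \<open>norm (T \<xi>) \<le> C * (norm (T \<xi>))\<^sup>2\<close>, which
  is impossible for small nonzero vectors.\<close>

lemma E_cont_near_0: "\<exists>\<epsilon>>0. continuous_on (ball 0 \<epsilon>) E \<and> E ` ball 0 \<epsilon> \<subseteq> U \<and>
    (\<forall>\<xi>\<in>ball 0 \<epsilon>. E \<xi> = 0 \<longrightarrow> \<xi> = 0)"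
proof -
  obtain C \<epsilon> where C: "C > 0" "\<epsilon> > 0"
    and 1: "\<And>\<xi>. norm (T \<xi>) < \<epsilon> \<Longrightarrow> E \<xi> \<in> U"
    and 3: "\<And>\<xi>. norm (T \<xi>) < \<epsilon> \<Longrightarrow> norm (\<phi> (E \<xi>) - x0 - T \<xi>) \<le> C * (norm (T \<xi>))\<^sup>2"
    and 2: "\<And>\<xi> \<eta>. norm (T \<xi>) < \<epsilon> \<Longrightarrow> norm (T \<eta>) < \<epsilon> \<Longrightarrow> norm (\<phi> (E \<xi>) - \<phi> (E \<eta>)) \<le> C * norm (T \<xi> - T \<eta>)"
    using E_estimates by metis
  obtain B where B: "B > 0" "\<And>\<xi>. norm (T \<xi>) \<le> B * norm \<xi>"
    using linear_bounded_pos[OF T_linear] by blast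
  define \<delta> where "\<delta> = min (\<epsilon> / B) (1 / (2 * C * B))"
  have \<delta>: "\<delta> > 0" using C B by (simp add: \<delta>_def)
  have small: "norm (T \<xi>) < \<epsilon>" "C * norm (T \<xi>) < 1" if "\<xi> \<in> ball 0 \<delta>" for \<xi> :: 'a
  proof -
    have "norm \<xi> < \<epsilon> / B" "norm \<xi> < 1 / (2 * C * B)" using that by (auto simp: \<delta>_def)
    then have "B * norm \<xi> < \<epsilon>" "2 * (C * (B * norm \<xi>)) < 1" using B C by (simp_all add: field_simps)
    moreover have "C * norm (T \<xi>) \<le> C * (B * norm \<xi>)" using B(2) C by (intro mult_left_mono) auto
    moreover have "0 \<le> C * norm (T \<xi>)" using C by simp
    ultimately show "norm (T \<xi>) < \<epsilon>" "C * norm (T \<xi>) < 1" using B(2)[of \<xi>] by linarith+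
  qed
  have "continuous_on (ball 0 \<delta>) (\<lambda>\<xi>. \<phi> (E \<xi>))"
  proof (rule lipschitz_on_continuous_on)
    show "(C * B)-lipschitz_on (ball 0 \<delta>) (\<lambda>\<xi>. \<phi> (E \<xi>))"
    proof (rule lipschitz_onI)
      fix \<xi> \<eta> :: 'a assume *: "\<xi> \<in> ball 0 \<delta>" "\<eta> \<in> ball 0 \<delta>"
      have "norm (\<phi> (E \<xi>) - \<phi> (E \<eta>)) \<le> C * norm (T (\<xi> - \<eta>))"
        using 2[of \<xi> \<eta>] small * by (simp add: linear_diff[OF T_linear])
      also have "\<dots> \<le> C * (B * norm (\<xi> - \<eta>))" using B(2) C by (intro mult_left_mono) auto
      finally show "dist (\<phi> (E \<xi>)) (\<phi> (E \<eta>)) \<le> C * B * dist \<xi> \<eta>" by (simp add: dist_norm)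
    qed (use B C in simp)
  qed
  moreover have U: "E \<xi> \<in> U" if "\<xi> \<in> ball 0 \<delta>" for \<xi> :: 'a using 1 small that by blast
  ultimately have "continuous_on (ball 0 \<delta>) (\<lambda>\<xi>. \<psi> (\<phi> (E \<xi>)))"
    by (intro continuous_on_compose2[OF cont_\<psi>]) (auto simp: \<phi>_N0)
  then have "continuous_on (ball 0 \<delta>) E"
    by (rule continuous_on_eq) (use U in simp)
  moreover have "\<xi> = 0" if "\<xi> \<in> ball 0 \<delta>" "E \<xi> = 0" for \<xi> :: 'a
  proof (rule ccontr)
    assume "\<xi> \<noteq> 0"
    then have "T \<xi> \<noteq> 0" using T_inj[of \<xi> 0] linear_0[OF T_linear] by metis
    have "norm (T \<xi>) \<le> C * (norm (T \<xi>))\<^sup>2" using 3[OF small(1)[OF that(1)]] that(2) by (simp add: x0_def)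
    also have "\<dots> = (C * norm (T \<xi>)) * norm (T \<xi>)" by (simp add: power2_eq_square)
    also have "\<dots> < 1 * norm (T \<xi>)" using small(2)[OF that(1)] \<open>T \<xi> \<noteq> 0\<close> by (intro mult_strict_right_mono) auto
    finally show False by simp
  qed
  ultimately show ?thesis using U \<delta> by blast
qed

lemma E_cont: "continuous_on S E"
proof -
  obtain \<epsilon> where \<epsilon>: "\<epsilon> > 0" "continuous_on (ball 0 \<epsilon>) E" using E_cont_near_0 by blast
  \<comment> \<open>Continuity spreads from a neighbourhood of \<open>0\<close> because
    \<open>E \<xi>\<close> is an \<open>n\<close>-fold sum of the value of \<open>E\<close> at
    \<open>(1 / n) *\<^sub>R \<xi>\<close>.\<close>
  have pow: "E (real n *\<^sub>R \<xi>) = (((+) (E \<xi>)) ^^ n) 0" for n \<xi>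
  proof (induction n)
    case (Suc n)
    have "E (real (Suc n) *\<^sub>R \<xi>) = E ((1 + real n) *\<^sub>R \<xi>)" by (simp add: algebra_simps)
    then show ?case using Suc E_add[of 1 "real n" \<xi>] by simp
  qed simp
  have contp: "continuous_on X (\<lambda>\<xi>. (((+) (g \<xi>)) ^^ n) (0::'g))" if "continuous_on X g" for n and g :: "'a \<Rightarrow> 'g" and X
    by (induction n) (auto intro!: continuous_intros that)
  have "isCont E \<xi>" for \<xi>
  proof -
    obtain n :: nat where n: "real n > (norm \<xi> + 1) / \<epsilon>" using reals_Archimedean2 by blast
    have "(norm \<xi> + 1) / \<epsilon> > 0" using \<epsilon>(1) by (intro divide_pos_pos add_nonneg_pos) auto
    then have n0: "real n > 0" using n by linarith
    have "norm \<xi> + 1 < real n * \<epsilon>" using n \<epsilon>(1) by (simp add: field_simps)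
    then have \<xi>: "\<xi> \<in> ball 0 (real n * \<epsilon>)" by simp
    have "continuous_on (ball 0 (real n * \<epsilon>)) (\<lambda>\<xi>. E ((1 / real n) *\<^sub>R \<xi>))"
      by (rule continuous_on_compose2[OF \<epsilon>(2)]) (use n0 in \<open>auto intro!: continuous_intros simp: field_simps\<close>)
    from contp[OF this, of n] have "continuous_on (ball 0 (real n * \<epsilon>)) (\<lambda>\<xi>. E (real n *\<^sub>R ((1 / real n) *\<^sub>R \<xi>)))"
      unfolding pow .
    then have "continuous_on (ball 0 (real n * \<epsilon>)) E" using n0 by simp
    then show ?thesis using \<xi> by (simp add: continuous_on_eq_continuous_at)
  qed
  then show ?thesis by (simp add: continuous_at_imp_continuous_on)
qed

end

subsection \<open>The adjoint representation\<close>

text \<open>Inversion of maps close to the identity without speaking of inverses: from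
  \<open>M t (a t) = g t\<close> and \<open>M t\<close> tending to the identity,
  \<open>a t - g t\<close> is of smaller order than \<open>t\<close>. So \<open>a\<close> inherits
  the derivative of \<open>g\<close>, although nothing about its continuity is known
  beforehand.\<close>

lemma has_vector_derivative_near_identity:
  fixes M :: "real \<Rightarrow> 'a::real_normed_vector \<Rightarrow> 'a" and \<delta> :: "real \<Rightarrow> real"
  assumes M: "\<forall>\<^sub>F t in nhds 0. norm (M t (a t) - a t) \<le> \<delta> t * norm (a t) \<and> M t (a t) = g t"
    and \<delta>: "(\<delta> \<longlongrightarrow> 0) (nhds 0)"
    and g: "(g has_vector_derivative G) (at 0)" "g 0 = 0"
  shows "(a has_vector_derivative G) (at 0)"
proof -
  have \<delta>': "\<forall>\<^sub>F t in nhds 0. \<delta> t < 1 / 2 \<and> \<delta> t > - 1"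
    using order_tendstoD(2)[OF \<delta>, of "1 / 2"] order_tendstoD(1)[OF \<delta>, of "- 1"] by (simp add: eventually_conj)
  have est: "\<forall>\<^sub>F t in nhds 0. norm (a t - g t) \<le> 2 * \<bar>\<delta> t\<bar> * norm (g t)"
    using M \<delta>'
  proof eventually_elim
    case (elim t)
    then have 1: "norm (a t - g t) \<le> \<delta> t * norm (a t)" by (metis norm_minus_commute)
    have "\<delta> t * norm (a t) \<le> 1 / 2 * norm (a t)" using elim by (intro mult_right_mono) auto
    moreover have "norm (a t) \<le> norm (a t - g t) + norm (g t)" using norm_triangle_sub[of "a t" "g t"] by simp
    ultimately have "norm (a t) \<le> 2 * norm (g t)" using 1 by linarith
    then have "\<bar>\<delta> t\<bar> * norm (a t) \<le> \<bar>\<delta> t\<bar> * (2 * norm (g t))" by (intro mult_left_mono) auto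
    moreover have "\<delta> t * norm (a t) \<le> \<bar>\<delta> t\<bar> * norm (a t)" by (intro mult_right_mono) auto
    ultimately show ?case using 1 by linarith
  qed
  have a0: "a 0 = 0" using eventually_nhds_x_imp_x[OF est] g by simp
  have gb: "\<exists>d>0. \<forall>t. \<bar>t\<bar> < d \<longrightarrow> norm (g t) \<le> (norm G + 1) * \<bar>t\<bar>"
  proof -
    obtain d where d: "d > 0" "\<And>t. \<bar>t\<bar> < d \<Longrightarrow> norm (g t - t *\<^sub>R G) \<le> 1 * \<bar>t\<bar>"
      using g zero_less_one unfolding has_vector_derivative_def has_derivative_at_alt by (metis diff_zero real_norm_def)
    have "norm (g t) \<le> (norm G + 1) * \<bar>t\<bar>" if "\<bar>t\<bar> < d" for t
      using norm_triangle_sub[of "g t" "t *\<^sub>R G"] d(2)[OF that] by (simp add: algebra_simps)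
    then show ?thesis using d(1) by blast
  qed
  have "((\<lambda>t. a t - g t) has_derivative (\<lambda>h. h *\<^sub>R 0)) (at 0)"
    unfolding has_derivative_at_alt
  proof (intro conjI allI impI)
    fix e :: real assume e: "e > 0"
    define e' where "e' = e / (2 * (norm G + 1))"
    have G: "norm G + 1 > 0" by (simp add: add_nonneg_pos)
    have e': "e' > 0" using e G by (simp add: e'_def)
    obtain d1 where d1: "d1 > 0" "\<And>t. \<bar>t\<bar> < d1 \<Longrightarrow> norm (g t) \<le> (norm G + 1) * \<bar>t\<bar>" using gb by blast
    have "\<forall>\<^sub>F t in nhds 0. \<bar>\<delta> t\<bar> < e'"
      using tendstoD[OF \<delta> e'] by (simp add: dist_real_def)
    with est have "\<forall>\<^sub>F t in nhds 0. norm (a t - g t) \<le> 2 * e' * norm (g t)"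
    proof eventually_elim
      case (elim t)
      have "2 * \<bar>\<delta> t\<bar> * norm (g t) \<le> 2 * e' * norm (g t)" using elim by (intro mult_right_mono) auto
      then show ?case using elim by linarith
    qed
    then obtain d2 where d2: "d2 > 0" "\<And>t. \<bar>t\<bar> < d2 \<Longrightarrow> norm (a t - g t) \<le> 2 * e' * norm (g t)"
      by (auto simp: eventually_nhds_metric dist_real_def)
    have "norm (a t - g t) \<le> e * \<bar>t\<bar>" if "\<bar>t\<bar> < min d1 d2" for t
    proof -
      have "norm (a t - g t) \<le> 2 * e' * norm (g t)" using d2 that by simp
      moreover have "2 * e' * norm (g t) \<le> 2 * e' * ((norm G + 1) * \<bar>t\<bar>)" using d1(2)[of t] that e' by (intro mult_left_mono) auto
      moreover have "2 * (e / (2 * K)) * (K * \<bar>t\<bar>) = e * \<bar>t\<bar>" if "K > 0" for K :: real using that by simp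
      then have "2 * e' * ((norm G + 1) * \<bar>t\<bar>) = e * \<bar>t\<bar>" unfolding e'_def using G by blast
      ultimately show ?thesis by linarith
    qed
    then show "\<exists>d>0. \<forall>y. norm (y - 0) < d \<longrightarrow> norm (a y - g y - (a 0 - g 0) - (y - 0) *\<^sub>R 0) \<le> e * norm (y - 0)"
      using d1(1) d2(1) a0 g(2) by (intro exI[of _ "min d1 d2"]) auto
  qed auto
  then have "((\<lambda>t. a t - g t) has_vector_derivative 0) (at 0)" by (simp add: has_vector_derivative_def)
  from has_vector_derivative_add[OF this g(1)] show ?thesis by simp
qed

lemma (in lie_chart) chart_manifold: "manifold_Ck_on A n U \<phi>"
proof -
  have "\<forall>(V, \<theta>)\<in>A. \<forall>(W, \<eta>)\<in>A. smooth_on (\<theta> ` (V \<inter> W)) (\<eta> \<circ> inv_into V \<theta>)"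
    using atlas unfolding smooth_atlas_def by (elim conjE)
  then have "smooth_on (\<theta> ` (V \<inter> U)) (\<phi> \<circ> inv_into V \<theta>)" if "(V, \<theta>) \<in> A" for V \<theta>
    using bspec[OF bspec[OF _ that, of "\<lambda>z. case z of (V, \<theta>) \<Rightarrow> \<forall>(W, \<eta>)\<in>A. smooth_on (\<theta> ` (V \<inter> W)) (\<eta> \<circ> inv_into V \<theta>)", simplified] chart] by simp
  then show ?thesis unfolding manifold_Ck_on_def smooth_on_def by auto
qed

lemma (in lie_chart) chart_inner_smooth: "manifold_smooth_on A U (\<lambda>p. \<phi> p \<bullet> b)"
  unfolding manifold_smooth_on_def manifold_Ck_on_def
proof (intro allI ballI, clarify)
  fix n V \<theta> assume "(V, \<theta>) \<in> A"
  then have "Ck_on n (\<theta> ` (V \<inter> U)) (\<phi> \<circ> inv_into V \<theta>)"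
    using chart_manifold[of n] by (auto simp: manifold_Ck_on_def)
  from Ck_on_linear[OF bounded_linear_inner_left this, of b]
  show "Ck_on n (\<theta> ` (V \<inter> U)) ((\<lambda>p. \<phi> p \<bullet> b) \<circ> inv_into V \<theta>)" by (simp add: o_def)
qed

lemma (in lie_chart) translate_deriv:
  assumes "open W" "manifold_Ck_on A (Suc n) W f" "p + q \<in> W"
  shows "\<exists>D. ((\<lambda>x. f (p + \<psi> x + q)) has_derivative D) (at x0)"
  using translate_Ck[OF assms] by auto

context lie_algebra_chart begin

text \<open>The adjoint representation, with \<open>T\<close> carrying the Lie algebra to the
  tangent space of the chart.\<close>

definition Ad :: "'g \<Rightarrow> 'a \<Rightarrow> 'a" where
  "Ad p \<eta> = inv T (frechet_derivative (\<lambda>x. \<phi> (p + \<psi> x + - p)) (at x0) (T \<eta>))"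

lemma T_inv [simp]: "T (inv T v) = v" "inv T (T \<eta>) = \<eta>"
  using T_bij by (simp_all add: bij_def surj_f_inv_f inv_f_f)

lemma inv_T_linear: "linear (inv T)"
  using T_linear T_bij by (metis bij_def inj_linear_imp_inv_linear)

lemma conj_deriv:
  "((\<lambda>x. \<phi> (p + \<psi> x + - p)) has_derivative (\<lambda>v. T (Ad p (inv T v)))) (at x0)"
proof -
  obtain D where D: "((\<lambda>x. \<phi> (p + \<psi> x + - p)) has_derivative D) (at x0)"
    using translate_deriv[OF open_U chart_manifold, of p "- p"] zero_U by auto
  then have "frechet_derivative (\<lambda>x. \<phi> (p + \<psi> x + - p)) (at x0) = D" by (rule frechet_derivative_at[symmetric])
  then have "D = (\<lambda>v. T (Ad p (inv T v)))" by (simp add: Ad_def)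
  then show ?thesis using D by simp
qed

lemma Ad_linear: "linear (Ad p)"
proof -
  have "linear (\<lambda>v. T (Ad p (inv T v)))" using conj_deriv by (rule has_derivative_linear)
  then have "linear (inv T \<circ> (\<lambda>v. T (Ad p (inv T v))) \<circ> T)"
    using inv_T_linear T_linear by (intro linear_compose)
  then show ?thesis by (simp add: o_def)
qed

lemma conj_flow: "flow (\<lambda>s. p + E (s *\<^sub>R \<eta>) + - p) (T (Ad p \<eta>))"
  unfolding flow_def vel_def
proof (intro conjI)
  show "line_hom (\<lambda>s. p + E (s *\<^sub>R \<eta>) + - p)" by (simp add: line_hom_def E_add add.assoc del: add_uminus_conv_diff)
  have "((\<lambda>s. p + E (s *\<^sub>R \<eta>) + - p) \<longlongrightarrow> p + 0 + - p) (nhds 0)"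
    using E_vel[of \<eta>] by (intro tendsto_intros) (auto simp: vel_def)
  then show "((\<lambda>s. p + E (s *\<^sub>R \<eta>) + - p) \<longlongrightarrow> 0) (nhds 0)" by simp
  show "((\<lambda>h. \<phi> (p + E (h *\<^sub>R \<eta>) + - p)) has_vector_derivative T (Ad p \<eta>)) (at 0)"
    using deriv_along[OF conj_deriv E_vel, of p \<eta>] by (simp del: add_uminus_conv_diff)
qed

lemma Ad_conj: "p + E (s *\<^sub>R \<eta>) + - p = E (s *\<^sub>R Ad p \<eta>)"
  using flow_eq_E[OF conj_flow] .

lemma Ad_swap: "p + E (s *\<^sub>R \<eta>) = E (s *\<^sub>R Ad p \<eta>) + p"
  by (simp add: Ad_conj[symmetric] add.assoc del: add_uminus_conv_diff)

lemma E_lines_eqD: "(\<And>s. E (s *\<^sub>R \<xi>) = E (s *\<^sub>R \<eta>)) \<Longrightarrow> \<xi> = \<eta>"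
  using vel_unique[OF E_vel[of \<xi>], of "T \<eta>"] E_vel[of \<eta>] T_inj by simp

lemma Ad_add: "Ad (p + q) \<eta> = Ad p (Ad q \<eta>)"
proof (rule E_lines_eqD)
  fix s
  have "E (s *\<^sub>R Ad (p + q) \<eta>) = p + (q + E (s *\<^sub>R \<eta>) + - q) + - p"
    unfolding Ad_conj[symmetric] by (simp add: minus_add add.assoc del: add_uminus_conv_diff)
  then show "E (s *\<^sub>R Ad (p + q) \<eta>) = E (s *\<^sub>R Ad p (Ad q \<eta>))" by (simp only: Ad_conj)
qed

lemma Ad_0 [simp]: "Ad 0 \<eta> = \<eta>"
  by (rule E_lines_eqD) (simp add: Ad_conj[symmetric] del: add_uminus_conv_diff)

lemma Ad_E_self: "Ad (E (t *\<^sub>R \<xi>)) \<xi> = \<xi>"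
proof (rule E_lines_eqD)
  fix s
  have "E (t *\<^sub>R \<xi>) + E (s *\<^sub>R \<xi>) = E (s *\<^sub>R \<xi>) + E (t *\<^sub>R \<xi>)"
    using E_add[of t s \<xi>] E_add[of s t \<xi>] by (simp add: add.commute)
  then show "E (s *\<^sub>R Ad (E (t *\<^sub>R \<xi>)) \<xi>) = E (s *\<^sub>R \<xi>)"
    unfolding Ad_conj[symmetric] by (simp add: add.assoc del: add_uminus_conv_diff)
qed

text \<open>Both sides differentiate the same curve, by \<open>Ad_swap\<close>. This is the equation
  from which \<open>Ad\<close> will be differentiated.\<close>

lemma R_Ad: "p \<in> U \<Longrightarrow> R (\<phi> p) (T (Ad p \<eta>)) = L (\<phi> p) (T \<eta>)"
proof -
  assume p: "p \<in> U"
  have 1: "((\<lambda>h. \<phi> (p + E (h *\<^sub>R \<eta>) + 0)) has_vector_derivative L (\<phi> p) (T \<eta>)) (at 0)"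
    by (rule deriv_along[OF left_chart_deriv[OF p] E_vel])
  have 2: "((\<lambda>h. \<phi> (0 + E (h *\<^sub>R Ad p \<eta>) + p)) has_vector_derivative R (\<phi> p) (T (Ad p \<eta>))) (at 0)"
    by (rule deriv_along[OF right_chart_deriv[OF p] E_vel])
  have "(\<lambda>h. \<phi> (p + E (h *\<^sub>R \<eta>) + 0)) = (\<lambda>h. \<phi> (0 + E (h *\<^sub>R Ad p \<eta>) + p))"
    by (simp add: Ad_swap)
  then show ?thesis using 1 2 vector_derivative_unique_at by metis
qed

definition dL :: "'a \<Rightarrow> 'a \<Rightarrow> 'a" where "dL v = frechet_derivative (\<lambda>x. L x v) (at x0)"

lemma dL: "((\<lambda>x. L x v) has_derivative dL v) (at x0)"
proof -
  obtain D where D: "((\<lambda>x. L x v) has_derivative D) (at x0)" using L_C1[of v] x0_N0 by (auto simp: One_nat_def)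
  then show ?thesis by (simp add: dL_def frechet_derivative_at[symmetric])
qed

lemma dR: "((\<lambda>x. R x v) has_derivative (\<lambda>w. dL w v)) (at x0)"
proof -
  obtain D where D: "((\<lambda>x. R x v) has_derivative D) (at x0)" using R_C1[of v] x0_N0 by (auto simp: One_nat_def)
  have "D = (\<lambda>w. dL w v)" using L_R_mixed[OF dL D] by (intro ext) simp
  then show ?thesis using D by simp
qed

text \<open>The bracket of left-invariant fields, computed from the first derivatives of
  \<open>L\<close> at the identity. It involves only the group law and \<open>T\<close> and is
  bilinear by construction; agreement with \<open>bracket\<close> is shown where \<open>Exp\<close>
  and \<open>E\<close> coincide on the lines involved.\<close>

definition C :: "'a \<Rightarrow> 'a \<Rightarrow> 'a" where
  "C \<xi> \<eta> = inv T (dL (T \<eta>) (T \<xi>) - dL (T \<xi>) (T \<eta>))"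

lemma C_linear_left: "linear (\<lambda>\<xi>. C \<xi> \<eta>)" and C_linear_right: "linear (C \<xi>)"
proof -
  have 1: "linear (dL v)" "linear (\<lambda>w. dL w v)" for v
    using dL dR has_derivative_linear by blast+
  have "linear (\<lambda>\<xi>. dL v (T \<xi>))" "linear (\<lambda>\<xi>. dL (T \<xi>) v)" for v
    using linear_compose[OF T_linear 1(1)] linear_compose[OF T_linear 1(2)] by (simp_all add: o_def)
  then have "linear (\<lambda>\<xi>. dL v (T \<xi>) - dL (T \<xi>) v)" "linear (\<lambda>\<eta>. dL (T \<eta>) v - dL v (T \<eta>))" for v
    by (auto intro: linear_compose_sub)
  from linear_compose[OF this(1) inv_T_linear] linear_compose[OF this(2) inv_T_linear]
  show "linear (\<lambda>\<xi>. C \<xi> \<eta>)" "linear (C \<xi>)" unfolding C_def[abs_def] by (simp_all add: o_def)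
qed

text \<open>Differentiation of \<open>R_Ad\<close> at the identity. The unknown \<open>Ad\<close>
  sits inside \<open>R\<close>, which tends to the identity there, so
  \<open>has_vector_derivative_near_identity\<close> applies to the increment
  \<open>a t\<close>.\<close>

lemma Ad_deriv_0: "((\<lambda>t. Ad (E (t *\<^sub>R \<xi>)) \<eta>) has_vector_derivative C \<xi> \<eta>) (at 0)"
proof -
  define x where "x t = \<phi> (E (t *\<^sub>R \<xi>))" for t
  have x0: "x 0 = x0" by (simp add: x_def x0_def)
  have xd: "(x has_derivative (\<lambda>h. h *\<^sub>R T \<xi>)) (at 0)"
    using E_vel[of \<xi>] by (simp add: vel_def x_def[abs_def] has_vector_derivative_def)
  have d: "((\<lambda>t. L (x t) v) has_vector_derivative dL v (T \<xi>)) (at 0)"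
    "((\<lambda>t. R (x t) v) has_vector_derivative dL (T \<xi>) v) (at 0)" for v
    using has_derivative_compose[OF xd, of "\<lambda>x. L x v" "dL v"] dL[of v]
      has_derivative_compose[OF xd, of "\<lambda>x. R x v" "\<lambda>w. dL w v"] dR[of v]
    by (auto simp: x0 has_vector_derivative_def linear_scale[OF has_derivative_linear[OF dL]]
        linear_scale[OF has_derivative_linear[OF dR]])
  define \<delta> where "\<delta> t = (\<Sum>b\<in>Basis. norm (R (x t) b - b))" for t
  have \<delta>: "(\<delta> \<longlongrightarrow> 0) (nhds 0)"
  proof -
    have "isCont (\<lambda>t. R (x t) b) 0" for b using d(2) by (rule has_vector_derivative_continuous)
    then have "isCont \<delta> 0" unfolding \<delta>_def by (intro continuous_intros)
    moreover have "\<delta> 0 = 0" by (simp add: \<delta>_def x0)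
    ultimately show ?thesis using tendsto_at_iff_tendsto_nhds[of \<delta> 0] by (simp add: isCont_def)
  qed
  define a where "a t = T (Ad (E (t *\<^sub>R \<xi>)) \<eta>) - T \<eta>" for t
  define g where "g t = L (x t) (T \<eta>) - R (x t) (T \<eta>)" for t
  have "(a has_vector_derivative (dL (T \<eta>) (T \<xi>) - dL (T \<xi>) (T \<eta>))) (at 0)"
  proof (rule has_vector_derivative_near_identity[where M = "\<lambda>t. R (x t)" and \<delta> = \<delta> and g = g])
    show "(g has_vector_derivative (dL (T \<eta>) (T \<xi>) - dL (T \<xi>) (T \<eta>))) (at 0)"
      unfolding g_def by (intro has_vector_derivative_diff d)
    show "g 0 = 0" by (simp add: g_def x0)
    show "\<forall>\<^sub>F t in nhds 0. norm (R (x t) (a t) - a t) \<le> \<delta> t * norm (a t) \<and> R (x t) (a t) = g t"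
      using vel_in_U[OF E_vel[of \<xi>]]
    proof eventually_elim
      case (elim t)
      have N: "x t \<in> N0" using elim by (simp add: x_def \<phi>_N0)
      have "R (x t) (a t) = g t"
        unfolding a_def g_def linear_diff[OF R_linear[OF N]] using R_Ad[OF elim] by (simp add: x_def)
      moreover have "norm (R (x t) v - v) \<le> \<delta> t * norm v" for v
      proof -
        have lin: "linear (\<lambda>v. R (x t) v - v)" using R_linear[OF N] by (intro linear_compose_sub linear_ident)
        have "norm (R (x t) v - v) \<le> (\<Sum>b\<in>Basis. norm ((v \<bullet> b) *\<^sub>R (R (x t) b - b)))"
          by (subst linear_euclidean_expand[OF lin, of v]) (rule norm_sum)
        also have "\<dots> \<le> (\<Sum>b\<in>Basis. norm v * norm (R (x t) b - b))"
        proof (rule sum_mono)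
          fix b :: 'a assume "b \<in> Basis"
          then show "norm ((v \<bullet> b) *\<^sub>R (R (x t) b - b)) \<le> norm v * norm (R (x t) b - b)"
            using Basis_le_norm[of b v] by (simp add: mult_right_mono)
        qed
        finally show ?thesis by (simp add: \<delta>_def sum_distrib_left mult.commute)
      qed
      ultimately show ?case by metis
    qed
  qed (fact \<delta>)
  then have "((\<lambda>t. a t + T \<eta>) has_vector_derivative (dL (T \<eta>) (T \<xi>) - dL (T \<xi>) (T \<eta>)) + 0) (at 0)"
    by (intro has_vector_derivative_add has_vector_derivative_const)
  from bounded_linear.has_vector_derivative[OF linear_conv_bounded_linear[THEN iffD1, OF inv_T_linear] this]
  show ?thesis by (simp add: a_def C_def)
qed

lemma Ad_deriv: "((\<lambda>t. Ad (E (t *\<^sub>R \<xi>)) \<eta>) has_vector_derivative Ad (E (t *\<^sub>R \<xi>)) (C \<xi> \<eta>)) (at t)"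
proof (rule shift_vector_derivative)
  have "((\<lambda>h. Ad (E (t *\<^sub>R \<xi>)) (Ad (E (h *\<^sub>R \<xi>)) \<eta>)) has_vector_derivative Ad (E (t *\<^sub>R \<xi>)) (C \<xi> \<eta>)) (at 0)"
    using linear_conv_bounded_linear[THEN iffD1, OF Ad_linear] Ad_deriv_0 by (rule bounded_linear.has_vector_derivative)
  then show "((\<lambda>h. Ad (E ((t + h) *\<^sub>R \<xi>)) \<eta>) has_vector_derivative Ad (E (t *\<^sub>R \<xi>)) (C \<xi> \<eta>)) (at 0)"
    by (simp add: E_add Ad_add)
qed

text \<open>The bracket axiom is tested on the coordinate functions
  \<open>\<phi> p \<bullet> b\<close> at the identity. It is stated with \<open>Exp\<close>, whence
  the assumptions along three lines.\<close>

lemma bracket_eq_C: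
  assumes good: "\<And>t. Exp (t *\<^sub>R \<xi>) = E (t *\<^sub>R \<xi>)" "\<And>t. Exp (t *\<^sub>R \<eta>) = E (t *\<^sub>R \<eta>)"
    "\<And>t. Exp (t *\<^sub>R bracket \<xi> \<eta>) = E (t *\<^sub>R bracket \<xi> \<eta>)"
  shows "bracket \<xi> \<eta> = C \<xi> \<eta>"
proof -
  have *: "T (bracket \<xi> \<eta>) \<bullet> b = (dL (T \<eta>) (T \<xi>) - dL (T \<xi>) (T \<eta>)) \<bullet> b" for b
  proof -
    define f where "f p = \<phi> p \<bullet> b" for p
    have 1: "left_inv_field Exp \<zeta> f p = L (\<phi> p) (T \<zeta>) \<bullet> b"
      if "p \<in> U" and g: "\<And>t. Exp (t *\<^sub>R \<zeta>) = E (t *\<^sub>R \<zeta>)" for p \<zeta>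
    proof -
      have "((\<lambda>t. \<phi> (p + E (t *\<^sub>R \<zeta>) + 0)) has_vector_derivative L (\<phi> p) (T \<zeta>)) (at 0)"
        by (rule deriv_along[OF left_chart_deriv[OF that(1)] E_vel])
      from bounded_linear.has_vector_derivative[OF bounded_linear_inner_left this, of b]
      have "((\<lambda>t. f (p + E (t *\<^sub>R \<zeta>))) has_real_derivative L (\<phi> p) (T \<zeta>) \<bullet> b) (at 0)"
        by (simp add: f_def has_real_derivative_iff_has_vector_derivative)
      then show ?thesis unfolding left_inv_field_def g by (rule DERIV_imp_deriv)
    qed
    have 2: "left_inv_field Exp \<xi>' (left_inv_field Exp \<eta>' f) 0 = dL (T \<eta>') (T \<xi>') \<bullet> b"
      if g: "\<And>t. Exp (t *\<^sub>R \<xi>') = E (t *\<^sub>R \<xi>')" "\<And>t. Exp (t *\<^sub>R \<eta>') = E (t *\<^sub>R \<eta>')" for \<xi>' \<eta>'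
    proof -
      have "((\<lambda>t. \<phi> (E (t *\<^sub>R \<xi>'))) has_derivative (\<lambda>h. h *\<^sub>R T \<xi>')) (at 0)"
        using E_vel[of \<xi>'] by (simp add: vel_def has_vector_derivative_def)
      from has_derivative_compose[OF this, of "\<lambda>x. L x (T \<eta>')" "dL (T \<eta>')"] dL[of "T \<eta>'"]
      have "((\<lambda>t. L (\<phi> (E (t *\<^sub>R \<xi>'))) (T \<eta>')) has_vector_derivative dL (T \<eta>') (T \<xi>')) (at 0)"
        by (simp add: has_vector_derivative_def linear_scale[OF has_derivative_linear[OF dL]] x0_def)
      from bounded_linear.has_vector_derivative[OF bounded_linear_inner_left this, of b]
      have *: "((\<lambda>t. L (\<phi> (E (t *\<^sub>R \<xi>'))) (T \<eta>') \<bullet> b) has_vector_derivative dL (T \<eta>') (T \<xi>') \<bullet> b) (at 0)" .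
      obtain W where W: "open W" "0 \<in> W" "\<And>h. h \<in> W \<Longrightarrow> E (h *\<^sub>R \<xi>') \<in> U"
        using vel_in_U[OF E_vel[of \<xi>']] unfolding eventually_nhds by blast
      have "((\<lambda>t. left_inv_field Exp \<eta>' f (0 + Exp (t *\<^sub>R \<xi>'))) has_vector_derivative dL (T \<eta>') (T \<xi>') \<bullet> b) (at 0)"
        by (rule has_vector_derivative_transform_within_open[OF * W(1,2)]) (simp add: g(1) 1[OF W(3) g(2)])
      then show ?thesis
        unfolding left_inv_field_def[of Exp \<xi>' "left_inv_field Exp \<eta>' f"]
        by (intro DERIV_imp_deriv) (simp add: has_real_derivative_iff_has_vector_derivative)
    qed
    have "left_inv_field Exp (bracket \<xi> \<eta>) f 0 = left_inv_field Exp \<xi> (left_inv_field Exp \<eta> f) 0 -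
        left_inv_field Exp \<eta> (left_inv_field Exp \<xi> f) 0"
      by (rule bracket[OF open_U _ zero_U]) (unfold f_def, rule chart_inner_smooth)
    then show ?thesis
      using 1[OF zero_U good(3)] 2[OF good(1,2)] 2[OF good(2,1)]
      by (simp add: x0_def[symmetric] inner_diff_left)
  qed
  then have "T (bracket \<xi> \<eta>) = dL (T \<eta>) (T \<xi>) - dL (T \<xi>) (T \<eta>)" by (rule euclidean_eqI)
  then show ?thesis unfolding C_def using T_inv(2) by metis
qed

end

subsection \<open>The stratification\<close>

locale carnot_chart = carnot_group A Exp bracket k V + lie_algebra_chart A Exp bracket U \<phi>
  for A :: "('g::{topological_group_add, t2_space}, 'a::euclidean_space) chart set"
    and Exp :: "'a \<Rightarrow> 'g" and bracket :: "'a \<Rightarrow> 'a \<Rightarrow> 'a" and k :: nat and V :: "nat \<Rightarrow> 'a set"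
    and U :: "'g set" and \<phi> :: "'g \<Rightarrow> 'a" +
  fixes \<rho> :: "'g \<Rightarrow> real"
  assumes norm_\<rho>: "homogeneous_norm A Exp k V \<rho>"
begin

lemma layer_sum_zero:
  assumes "\<And>j. j \<in> {1..k} \<Longrightarrow> x j \<in> V j" "(\<Sum>j=1..k. x j) = 0" "i \<in> {1..k}"
  shows "x i = 0"
proof -
  have "0 = (\<Sum>j=1..k. x j) \<bullet> x i" using assms(2) by simp
  also have "\<dots> = (\<Sum>j=1..k. x j \<bullet> x i)" by (rule inner_sum_left)
  also have "\<dots> = (\<Sum>j=1..k. if j = i then x i \<bullet> x i else 0)"
  proof (rule sum.cong[OF refl])
    fix j assume "j \<in> {1..k}"
    then show "x j \<bullet> x i = (if j = i then x i \<bullet> x i else 0)"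
      using layers_orthogonal[of j i "x j" "x i"] assms(1)[of j] assms(1)[OF assms(3)] assms(3)
      by (auto simp: orthogonal_def)
  qed
  also have "\<dots> = x i \<bullet> x i" using assms(3) by simp
  finally show ?thesis by simp
qed

lemma layer_decomp_unique:
  assumes "\<And>j. j \<in> {1..k} \<Longrightarrow> x j \<in> V j" "\<And>j. j \<in> {1..k} \<Longrightarrow> y j \<in> V j"
    and "(\<Sum>j=1..k. x j) = (\<Sum>j=1..k. y j)" "i \<in> {1..k}"
  shows "x i = y i"
proof -
  have "x i - y i = 0"
    by (rule layer_sum_zero[of "\<lambda>j. x j - y j"])
      (use assms layer_subspace in \<open>auto simp: sum_subtractf intro: subspace_diff\<close>)
  then show ?thesis by simp
qed

lemma layer_decomp: "\<exists>x. (\<forall>j\<in>{1..k}. x j \<in> V j) \<and> \<xi> = (\<Sum>j=1..k. x j)"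
proof -
  define S where "S = {\<xi>. \<exists>x. (\<forall>j\<in>{1..k}. x j \<in> V j) \<and> \<xi> = (\<Sum>j=1..k. x j)}"
  have "subspace S"
    unfolding subspace_def
  proof (intro conjI ballI allI)
    show "0 \<in> S" unfolding S_def using layer_subspace by (auto intro!: exI[of _ "\<lambda>j. 0"] subspace_0)
    fix a assume "a \<in> S"
    then have "\<exists>x. (\<forall>j\<in>{1..k}. x j \<in> V j) \<and> a = (\<Sum>j=1..k. x j)" by (simp add: S_def)
    then obtain x where x: "\<And>j. j \<in> {1..k} \<Longrightarrow> x j \<in> V j" "a = (\<Sum>j=1..k. x j)" by metis
    show "c *\<^sub>R a \<in> S" for c
      unfolding S_def using x layer_subspace
      by (auto intro!: exI[of _ "\<lambda>j. c *\<^sub>R x j"] subspace_scale simp: scaleR_sum_right)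
    fix b assume "b \<in> S"
    then have "\<exists>y. (\<forall>j\<in>{1..k}. y j \<in> V j) \<and> b = (\<Sum>j=1..k. y j)" by (simp add: S_def)
    then obtain y where y: "\<And>j. j \<in> {1..k} \<Longrightarrow> y j \<in> V j" "b = (\<Sum>j=1..k. y j)" by metis
    show "a + b \<in> S"
      unfolding S_def using x y layer_subspace
      by (auto intro!: exI[of _ "\<lambda>j. x j + y j"] subspace_add simp: sum.distrib)
  qed
  moreover have "V i \<subseteq> S" if i: "i \<in> {1..k}" for i
  proof
    fix v assume v: "v \<in> V i"
    have "v = (\<Sum>j=1..k. if j = i then v else 0)" using i by simp
    moreover have "\<forall>j\<in>{1..k}. (if j = i then v else 0) \<in> V j" using v layer_subspace by (auto intro: subspace_0)
    ultimately show "v \<in> S" unfolding S_def by (intro CollectI exI[of _ "\<lambda>j. if j = i then v else 0"]) blast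
  qed
  then have "(\<Union>j\<in>{1..k}. V j) \<subseteq> S" by blast
  ultimately have "span (\<Union>j\<in>{1..k}. V j) \<subseteq> S" by (intro span_minimal)
  then have "\<xi> \<in> S" using layers_span by blast
  then show ?thesis by (simp add: S_def)
qed

lemma algebra_dilation_sum:
  assumes "\<And>j. j \<in> {1..k} \<Longrightarrow> x j \<in> V j"
  shows "algebra_dilation k V s (\<Sum>j=1..k. x j) = (\<Sum>j=1..k. s ^ j *\<^sub>R x j)"
  unfolding algebra_dilation_def
proof (rule the_equality)
  show "\<exists>x'. (\<forall>j\<in>{1..k}. x' j \<in> V j) \<and> (\<Sum>j=1..k. x j) = (\<Sum>j=1..k. x' j) \<and>
      (\<Sum>j=1..k. s ^ j *\<^sub>R x j) = (\<Sum>j=1..k. s ^ j *\<^sub>R x' j)"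
    using assms by (intro exI[of _ x]) simp
  fix \<eta> assume "\<exists>x'. (\<forall>j\<in>{1..k}. x' j \<in> V j) \<and> (\<Sum>j=1..k. x j) = (\<Sum>j=1..k. x' j) \<and>
      \<eta> = (\<Sum>j=1..k. s ^ j *\<^sub>R x' j)"
  then obtain x' where x': "\<And>j. j \<in> {1..k} \<Longrightarrow> x' j \<in> V j" "(\<Sum>j=1..k. x j) = (\<Sum>j=1..k. x' j)"
    "\<eta> = (\<Sum>j=1..k. s ^ j *\<^sub>R x' j)" by blast
  have "x' j = x j" if "j \<in> {1..k}" for j
    using layer_decomp_unique[OF x'(1) assms x'(2)[symmetric] that] by simp
  then show "\<eta> = (\<Sum>j=1..k. s ^ j *\<^sub>R x j)" unfolding x'(3) by (intro sum.cong) auto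
qed

abbreviation \<Delta> :: "real \<Rightarrow> 'a \<Rightarrow> 'a" where "\<Delta> s \<xi> \<equiv> algebra_dilation k V s \<xi>"

lemma dilation_layer:
  assumes "i \<in> {1..k}" "\<xi> \<in> V i"
  shows "\<Delta> s \<xi> = s ^ i *\<^sub>R \<xi>"
proof -
  define x where "x j = (if j = i then \<xi> else 0)" for j
  have "\<And>j. j \<in> {1..k} \<Longrightarrow> x j \<in> V j" using assms layer_subspace by (auto simp: x_def intro: subspace_0)
  from algebra_dilation_sum[OF this, of s]
  have "\<Delta> s (\<Sum>j=1..k. x j) = (\<Sum>j=1..k. if j = i then s ^ i *\<^sub>R \<xi> else 0)"
    by (simp add: x_def if_distrib cong: sum.cong if_cong)
  then show ?thesis using assms by (simp add: x_def)
qed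

lemma \<rho>_cont: "continuous_on S \<rho>" and \<rho>_nonneg: "\<rho> p \<ge> 0"
  and \<rho>_Exp_dilation: "s > 0 \<Longrightarrow> \<rho> (Exp (\<Delta> s \<xi>)) = s * \<rho> (Exp \<xi>)"
  and \<rho>_eq_0: "\<rho> p = 0 \<longleftrightarrow> p = 0"
  using norm_\<rho> unfolding homogeneous_norm_def by (auto intro: continuous_on_subset)

lemma \<rho>_tendsto: "(f \<longlongrightarrow> p) Q \<Longrightarrow> ((\<lambda>x. \<rho> (f x)) \<longlongrightarrow> \<rho> p) Q"
  using \<rho>_cont[of UNIV] isCont_tendsto_compose[of p \<rho> f Q] by (simp add: continuous_on_eq_continuous_at)

text \<open>On a single layer a dilation is a multiplication, so the norm of \<open>Exp\<close> at
  \<open>u *\<^sub>R \<xi>\<close> is \<open>root i u\<close> times that at \<open>\<xi>\<close> and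
  tends to \<open>0\<close> with \<open>u\<close>. Approximating \<open>t\<close> from below by
  times at which \<open>Exp\<close> and \<open>E\<close> agree shows that their difference at
  \<open>t\<close> has norm \<open>0\<close>.\<close>

lemma Exp_eq_E_layer:
  assumes i: "i \<in> {1..k}" and \<xi>: "\<xi> \<in> V i"
  shows "Exp (t *\<^sub>R \<xi>) = E (t *\<^sub>R \<xi>)"
proof -
  have i0: "i > 0" using i by simp
  have \<rho>E: "\<rho> (Exp (u *\<^sub>R \<xi>)) = root i u * \<rho> (Exp \<xi>)" if "u \<ge> 0" for u
  proof (cases "u = 0")
    case True
    then show ?thesis using \<rho>_eq_0[of 0] by simp
  next
    case False
    then have "root i u > 0" using that i0 by simp
    from \<rho>_Exp_dilation[OF this, of \<xi>] show ?thesis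
      using that i0 by (simp add: dilation_layer[OF i \<xi>] real_root_pow_pos2)
  qed
  have "\<exists>h. h \<in> Hgam \<xi> \<and> h \<le> t \<and> t < h + inverse (real (Suc n))" for n
    using Hgam_approx[of "inverse (real (Suc n))" \<xi> t] by auto
  then obtain h where h: "\<And>n. h n \<in> Hgam \<xi>" "\<And>n. h n \<le> t" "\<And>n. t < h n + inverse (real (Suc n))" by metis
  have u0: "(\<lambda>n. t - h n) \<longlonglongrightarrow> 0"
  proof (rule tendsto_sandwich[of "\<lambda>n. 0" _ _ "\<lambda>n. inverse (real (Suc n))"])
    show "\<forall>\<^sub>F n in sequentially. t - h n \<le> inverse (real (Suc n))"
      using h(3) by (intro always_eventually allI) (simp add: less_imp_le less_diff_eq algebra_simps)
  qed (use h(2) LIMSEQ_inverse_real_of_nat in auto)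
  then have hlim: "h \<longlonglongrightarrow> t" using tendsto_diff[OF tendsto_const[of t] u0] by simp
  have "(\<lambda>n. \<rho> (Exp ((t - h n) *\<^sub>R \<xi>))) \<longlonglongrightarrow> 0"
  proof -
    have "(\<lambda>n. root i (t - h n) * \<rho> (Exp \<xi>)) \<longlonglongrightarrow> root i 0 * \<rho> (Exp \<xi>)"
      by (intro tendsto_intros u0)
    then show ?thesis using h(2) i0 by (simp add: \<rho>E)
  qed
  moreover have "(\<lambda>n. \<rho> (Exp ((t - h n) *\<^sub>R \<xi>))) \<longlonglongrightarrow> \<rho> (Exp (t *\<^sub>R \<xi>) - E (t *\<^sub>R \<xi>))"
  proof (rule \<rho>_tendsto)
    have "Exp ((t - h n) *\<^sub>R \<xi>) = Exp (t *\<^sub>R \<xi>) - E (h n *\<^sub>R \<xi>)" for n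
      using h(1)[of n] line_hom_diff[OF Exp_line_hom, of t "h n" \<xi>] by (simp add: Hgam_def gam_E)
    moreover have "(\<lambda>n. E (h n *\<^sub>R \<xi>)) \<longlonglongrightarrow> E (t *\<^sub>R \<xi>)"
      using E_line_cont[of UNIV \<xi>] hlim isCont_tendsto_compose[of t "\<lambda>t. E (t *\<^sub>R \<xi>)" h sequentially]
      by (simp add: continuous_on_eq_continuous_at)
    then have "(\<lambda>n. Exp (t *\<^sub>R \<xi>) + - E (h n *\<^sub>R \<xi>)) \<longlonglongrightarrow> Exp (t *\<^sub>R \<xi>) + - E (t *\<^sub>R \<xi>)"
      by (intro tendsto_intros)
    ultimately show "(\<lambda>n. Exp ((t - h n) *\<^sub>R \<xi>)) \<longlonglongrightarrow> Exp (t *\<^sub>R \<xi>) - E (t *\<^sub>R \<xi>)" by simp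
  qed
  ultimately have "\<rho> (Exp (t *\<^sub>R \<xi>) - E (t *\<^sub>R \<xi>)) = 0" using LIMSEQ_unique by blast
  then show ?thesis by (simp add: \<rho>_eq_0)
qed

lemma layer1: "1 \<in> {1..k}" using step by simp

text \<open>All vectors involved lie in single layers, where \<open>Exp\<close> and \<open>E\<close>
  agree, so the stratification carries over from \<open>bracket\<close> to \<open>C\<close>.\<close>

lemma C_layer:
  assumes x: "x \<in> V 1" and j: "j \<in> {1..k}" and y: "y \<in> V j"
  shows "bracket x y = C x y" "j < k \<Longrightarrow> C x y \<in> V (j + 1)" "j = k \<Longrightarrow> C x y = 0"
proof -
  have br: "bracket x y \<in> V (j + 1)" if "j < k"
    using layer_bracket[of j] that j x y span_base[of "bracket x y" "{bracket x y |x y. x \<in> V 1 \<and> y \<in> V j}"] by auto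
  have br0: "bracket x y = 0" if "j = k" using layer_bracket_last[OF x] y that by simp
  show eq: "bracket x y = C x y"
  proof (rule bracket_eq_C)
    show "Exp (t *\<^sub>R x) = E (t *\<^sub>R x)" for t by (rule Exp_eq_E_layer[OF layer1 x])
    show "Exp (t *\<^sub>R y) = E (t *\<^sub>R y)" for t by (rule Exp_eq_E_layer[OF j y])
    show "Exp (t *\<^sub>R bracket x y) = E (t *\<^sub>R bracket x y)" for t
    proof (cases "j < k")
      case True
      then show ?thesis using Exp_eq_E_layer[OF _ br] j by simp
    next
      case False
      then show ?thesis using br0 j by simp
    qed
  qed
  show "j < k \<Longrightarrow> C x y \<in> V (j + 1)" "j = k \<Longrightarrow> C x y = 0" using br br0 eq by auto
qed

lemma layer_Suc_span:
  assumes "j \<in> {1..<k}"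
  shows "V (j + 1) = span {C x y | x y. x \<in> V 1 \<and> y \<in> V j}"
proof -
  have "{C x y | x y. x \<in> V 1 \<and> y \<in> V j} = {bracket x y | x y. x \<in> V 1 \<and> y \<in> V j}"
    using C_layer(1)[of _ j] assms by force
  then show ?thesis using layer_bracket[OF assms] by simp
qed

section \<open>The descending filtration and unipotency of the adjoint action\<close>

definition tail :: "nat \<Rightarrow> 'a set" where "tail j = span (\<Union>i\<in>{j..k}. V i)"

lemma tail_subspace: "subspace (tail j)" by (simp add: tail_def)

lemma tail_1: "tail 1 = UNIV" using layers_span by (simp add: tail_def)

lemma tail_end: "j > k \<Longrightarrow> tail j = {0}" by (simp add: tail_def)

lemma tail_mono: "i \<le> j \<Longrightarrow> tail j \<subseteq> tail i"
  unfolding tail_def by (intro span_mono UN_mono) auto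

lemma layer_tail: "i \<in> {j..k} \<Longrightarrow> V i \<subseteq> tail j"
  unfolding tail_def using span_superset[of "\<Union>i\<in>{j..k}. V i"] by blast

lemma C_tail:
  assumes x: "x \<in> V 1" and j: "j \<ge> 1" and w: "w \<in> tail j"
  shows "C x w \<in> tail (j + 1)"
proof -
  have "w \<in> span (\<Union>i\<in>{j..k}. V i)" using w by (simp add: tail_def)
  then show ?thesis
  proof (induction rule: span_induct)
    case base
    then show ?case
      using linear_subspace_vimage[OF C_linear_right tail_subspace] by (simp add: vimage_def)
  next
    case (step w)
    then obtain i where i: "i \<in> {j..k}" "w \<in> V i" by blast
    then have "i \<in> {1..k}" using j by simp
    note C = C_layer[OF x this i(2)]
    show ?case
    proof (cases "i < k")
      case True
      then show ?thesis using C(2) layer_tail[of "i + 1" "j + 1"] i by auto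
    next
      case False
      then show ?thesis using C(3) i subspace_0[OF tail_subspace] by simp
    qed
  qed
qed

text \<open>A mean value theorem for subspaces: paired with the component \<open>b\<close>
  orthogonal to \<open>S\<close>, the curve minus \<open>t *\<^sub>R c\<close> has derivative zero
  and is constant.\<close>

lemma derivative_in_subspace:
  fixes y :: "real \<Rightarrow> 'a"
  assumes S: "subspace S" and y: "\<And>t. (y has_vector_derivative y' t) (at t)" "\<And>t. y' t - c \<in> S"
  shows "y 1 - y 0 - c \<in> S"
proof -
  obtain a b where ab: "a \<in> span S" "\<And>w. w \<in> span S \<Longrightarrow> orthogonal b w" "y 1 - y 0 - c = a + b"
    using orthogonal_subspace_decomp_exists[of S "y 1 - y 0 - c"] by metis
  have sp: "span S = S" using S by (simp add: span_eq_iff)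
  define g where "g t = (y t - t *\<^sub>R c) \<bullet> b" for t
  have "(g has_real_derivative 0) (at t)" for t
  proof -
    have "((\<lambda>t. t *\<^sub>R c) has_vector_derivative c) (at t)"
      by (auto simp: has_vector_derivative_def intro!: derivative_eq_intros)
    from bounded_linear.has_vector_derivative[OF bounded_linear_inner_left has_vector_derivative_diff[OF y(1) this], of b]
    have "(g has_vector_derivative (y' t - c) \<bullet> b) (at t)" by (simp add: g_def[abs_def])
    moreover have "(y' t - c) \<bullet> b = 0" using ab(2)[of "y' t - c"] y(2) sp by (simp add: orthogonal_def inner_commute)
    ultimately show ?thesis by (simp add: has_real_derivative_iff_has_vector_derivative)
  qed
  then have "g 1 = g 0" using DERIV_isconst_all by blast
  then have "(y 1 - y 0 - c) \<bullet> b = 0" by (simp add: g_def inner_diff_left)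
  moreover have "a \<bullet> b = 0" using ab(1,2) by (simp add: orthogonal_def inner_commute)
  ultimately have "b \<bullet> b = 0" using ab(3) by (simp add: inner_add_left)
  then show ?thesis using ab sp by simp
qed

text \<open>Unipotency with respect to the filtration: \<open>Ad q\<close> induces the identity on
  each quotient of \<open>tail j\<close> by \<open>tail (j + 1)\<close>.\<close>

definition unip :: "'g \<Rightarrow> bool" where
  "unip q \<longleftrightarrow> (\<forall>j\<ge>1. \<forall>w\<in>tail j. Ad q w - w \<in> tail (j + 1))"

lemma unip_E: assumes x: "x \<in> V 1" shows "unip (E x)"
proof -
  have "\<forall>x\<in>V 1. \<forall>w\<in>tail j. Ad (E x) w - w \<in> tail (j + 1)" if "j \<ge> 1" for j
    using that
  \<comment> \<open>Descending induction on \<open>j\<close>: by \<open>Ad_deriv\<close> the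
    derivative of the adjoint curve of \<open>w\<close> is the adjoint curve of
    \<open>C x w\<close>, which starts one step further in the filtration and stays there by the
    induction hypothesis.\<close>
  proof (induction "k + 1 - j" arbitrary: j)
    case 0
    then have "tail j = {0}" by (intro tail_end) simp
    then show ?case using linear_0[OF Ad_linear] subspace_0[OF tail_subspace] by simp
  next
    case (Suc n)
    have IH: "Ad (E x) w - w \<in> tail (j + 1 + 1)" if "x \<in> V 1" "w \<in> tail (j + 1)" for x w
      using Suc(1)[of "j + 1"] Suc(2,3) that by simp
    have IH': "Ad (E x) w \<in> tail (j + 1)" if "x \<in> V 1" "w \<in> tail (j + 1)" for x w
    proof -
      have "Ad (E x) w - w \<in> tail (j + 1)" using IH[OF that] tail_mono[of "j + 1" "j + 1 + 1"] by auto
      from subspace_add[OF tail_subspace this that(2)] show ?thesis by simp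
    qed
    show ?case
    proof (intro ballI)
      fix x w assume x: "x \<in> V 1" and w: "w \<in> tail j"
      have "Ad (E (1 *\<^sub>R x)) w - Ad (E (0 *\<^sub>R x)) w - 0 \<in> tail (j + 1)"
      proof (rule derivative_in_subspace[OF tail_subspace Ad_deriv])
        fix t
        have "Ad (E (t *\<^sub>R x)) (C x w) \<in> tail (j + 1)"
          by (intro IH' C_tail x w Suc subspace_scale[OF layer_subspace[OF layer1]])
        then show "Ad (E (t *\<^sub>R x)) (C x w) - 0 \<in> tail (j + 1)" by simp
      qed
      then show "Ad (E x) w - w \<in> tail (j + 1)" by simp
    qed
  qed
  then show ?thesis using x unfolding unip_def by blast
qed

lemma unip_add: "unip p \<Longrightarrow> unip q \<Longrightarrow> unip (p + q)"
  unfolding unip_def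
proof (intro allI impI ballI)
  fix j :: nat and w
  assume p: "\<forall>j\<ge>1. \<forall>w\<in>tail j. Ad p w - w \<in> tail (j + 1)" and q: "\<forall>j\<ge>1. \<forall>w\<in>tail j. Ad q w - w \<in> tail (j + 1)"
    and j: "j \<ge> 1" and w: "w \<in> tail j"
  have 1: "Ad q w - w \<in> tail (j + 1)" using q j w by blast
  then have "Ad q w - w \<in> tail j" using tail_mono[of j "j + 1"] by auto
  from subspace_add[OF tail_subspace this w] have "Ad q w \<in> tail j" by simp
  then have "Ad p (Ad q w) - Ad q w \<in> tail (j + 1)" using p j by blast
  from subspace_add[OF tail_subspace this 1] show "Ad (p + q) w - w \<in> tail (j + 1)" by (simp add: Ad_add)
qed

lemma unip_0: "unip 0"
  unfolding unip_def using subspace_0[OF tail_subspace] by simp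

end

subsection \<open>Accessibility by horizontal curves\<close>

context lie_algebra_chart begin

text \<open>The differential of the group law at the identity is addition, by
  \<open>F'_x0\<close>.\<close>

lemma product_chart_derivative:
  fixes g1 g2 :: "'b::real_normed_vector \<Rightarrow> 'g"
  assumes g1: "(g1 \<longlongrightarrow> 0) (nhds 0)" "((\<lambda>w. \<phi> (g1 w)) has_derivative D1) (at 0)"
    and g2: "(g2 \<longlongrightarrow> 0) (nhds 0)" "((\<lambda>w. \<phi> (g2 w)) has_derivative D2) (at 0)"
    and z: "g1 0 = 0" "g2 0 = 0"
  shows "((\<lambda>w. \<phi> (g1 w + g2 w)) has_derivative (\<lambda>w. D1 w + D2 w)) (at 0)"
proof -
  have "((\<lambda>w. (\<phi> (g1 w), \<phi> (g2 w))) has_derivative (\<lambda>w. (D1 w, D2 w))) (at 0)"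
    by (rule has_derivative_Pair[OF g1(2) g2(2)])
  moreover have "(F has_derivative F' (x0, x0)) (at (\<phi> (g1 0), \<phi> (g2 0)))"
    using F_deriv[OF DF_left[OF x0_N0]] z by (simp add: x0_def)
  ultimately have "((\<lambda>w. F (\<phi> (g1 w), \<phi> (g2 w))) has_derivative (\<lambda>w. F' (x0, x0) (D1 w, D2 w))) (at 0)"
    by (rule has_derivative_compose)
  then have *: "((\<lambda>w. F (\<phi> (g1 w), \<phi> (g2 w))) has_derivative (\<lambda>w. D1 w + D2 w)) (at 0)"
    by (simp add: F'_x0)
  have "eventually (\<lambda>w. g1 w \<in> U \<and> g2 w \<in> U) (nhds 0)"
    using topological_tendstoD[OF g1(1) open_U zero_U] topological_tendstoD[OF g2(1) open_U zero_U]
    by (rule eventually_conj)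
  then obtain W where W: "open W" "0 \<in> W" "\<And>w. w \<in> W \<Longrightarrow> g1 w \<in> U \<and> g2 w \<in> U"
    unfolding eventually_nhds by blast
  show ?thesis
    by (rule has_derivative_transform_within_open[OF * W(1,2)]) (use W(3) in \<open>simp add: F_def\<close>)
qed

lemma product_of_flows:
  fixes r :: "'b \<Rightarrow> 'c::real_normed_vector \<Rightarrow> real" and u :: "'b \<Rightarrow> 'a"
  assumes r: "\<And>b. bounded_linear (r b)"
  shows "((\<lambda>w. sum_list (map (\<lambda>b. E (r b w *\<^sub>R u b)) bs)) \<longlongrightarrow> 0) (nhds 0) \<and>
    ((\<lambda>w. \<phi> (sum_list (map (\<lambda>b. E (r b w *\<^sub>R u b)) bs))) has_derivative
      (\<lambda>w. T (sum_list (map (\<lambda>b. r b w *\<^sub>R u b) bs)))) (at 0)"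
proof (induction bs)
  case Nil
  then show ?case by (simp add: linear_0[OF T_linear])
next
  case (Cons b bs)
  have lim: "((\<lambda>w. r b w) \<longlongrightarrow> 0) (nhds 0)"
  proof -
    have "isCont (r b) 0" using r by (rule linear_continuous_at)
    then show ?thesis using tendsto_at_iff_tendsto_nhds[of "r b" 0] bounded_linear.linear[OF r, of b, THEN linear_0]
      by (simp add: isCont_def)
  qed
  have r0: "r b 0 = 0" using bounded_linear.linear[OF r, of b, THEN linear_0] .
  have g1: "((\<lambda>w. E (r b w *\<^sub>R u b)) \<longlongrightarrow> 0) (nhds 0)"
    using filterlim_compose[OF _ lim, of "\<lambda>t. E (t *\<^sub>R u b)" "nhds 0"] E_vel[of "u b"] by (simp add: vel_def)
  have "((\<lambda>t. \<phi> (E (t *\<^sub>R u b))) has_derivative (\<lambda>h. h *\<^sub>R T (u b))) (at (r b 0))"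
    using E_vel[of "u b"] by (simp add: vel_def has_vector_derivative_def r0)
  from has_derivative_compose[OF bounded_linear_imp_has_derivative[OF r] this]
  have g1': "((\<lambda>w. \<phi> (E (r b w *\<^sub>R u b))) has_derivative (\<lambda>w. T (r b w *\<^sub>R u b))) (at 0)"
    by (simp add: linear_scale[OF T_linear])
  have z: "sum_list (map (\<lambda>b. E (r b 0 *\<^sub>R u b)) bs) = 0"
    by (induction bs) (simp_all add: bounded_linear.linear[OF r, THEN linear_0])
  from product_chart_derivative[OF g1 g1' conjunct1[OF Cons] conjunct2[OF Cons] _ z] r0
  have "((\<lambda>w. \<phi> (E (r b w *\<^sub>R u b) + sum_list (map (\<lambda>b. E (r b w *\<^sub>R u b)) bs))) has_derivative
      (\<lambda>w. T (r b w *\<^sub>R u b) + T (sum_list (map (\<lambda>b. r b w *\<^sub>R u b) bs)))) (at 0)" by simp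
  moreover have "((\<lambda>w. E (r b w *\<^sub>R u b) + sum_list (map (\<lambda>b. E (r b w *\<^sub>R u b)) bs)) \<longlongrightarrow> 0 + 0) (nhds 0)"
    by (intro tendsto_add g1 conjunct1[OF Cons])
  ultimately show ?case by (simp add: linear_add[OF T_linear])
qed

end

context carnot_chart begin

definition steps :: "real \<Rightarrow> 'g set" where "steps \<epsilon> = {E x | x. x \<in> V 1 \<and> norm x < \<epsilon>}"

text \<open>Both the number and the size of the letters are bounded: for fixed \<open>n\<close> a
  small \<open>\<epsilon>\<close> keeps words close to the identity, while for a suitable
  \<open>n\<close> every positive \<open>\<epsilon>\<close> still covers a neighbourhood of
  it.\<close>

definition words :: "nat \<Rightarrow> real \<Rightarrow> 'g set" where
  "words n \<epsilon> = {sum_list l | l. length l \<le> n \<and> set l \<subseteq> steps \<epsilon>}"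

lemma words_0: "0 \<in> words n \<epsilon>"
  unfolding words_def by (intro CollectI exI[of _ "[]"]) simp

lemma words_add: "p \<in> words n \<epsilon> \<Longrightarrow> q \<in> words m \<epsilon> \<Longrightarrow> p + q \<in> words (n + m) \<epsilon>"
proof -
  assume "p \<in> words n \<epsilon>" "q \<in> words m \<epsilon>"
  then obtain l l' where "p = sum_list l" "length l \<le> n" "set l \<subseteq> steps \<epsilon>"
    "q = sum_list l'" "length l' \<le> m" "set l' \<subseteq> steps \<epsilon>" unfolding words_def by blast
  then show ?thesis unfolding words_def by (intro CollectI exI[of _ "l @ l'"]) simp
qed

lemma words_mono: "n \<le> m \<Longrightarrow> words n \<epsilon> \<subseteq> words m \<epsilon>"
  unfolding words_def by force

lemma steps_words: "x \<in> V 1 \<Longrightarrow> norm x < \<epsilon> \<Longrightarrow> E x \<in> words 1 \<epsilon>"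
  unfolding words_def steps_def by (intro CollectI exI[of _ "[E x]"]) auto

lemma words_minus: "p \<in> words n \<epsilon> \<Longrightarrow> - p \<in> words n \<epsilon>"
proof -
  assume "p \<in> words n \<epsilon>"
  then obtain l where l: "p = sum_list l" "length l \<le> n" "set l \<subseteq> steps \<epsilon>" unfolding words_def by blast
  have "- sum_list l = sum_list (map uminus (rev l))"
    by (induction l) (simp_all add: minus_add)
  moreover have "- g \<in> steps \<epsilon>" if gs: "g \<in> steps \<epsilon>" for g
  proof -
    obtain x where x: "g = E x" "x \<in> V 1" "norm x < \<epsilon>" using gs unfolding steps_def by blast
    have "- x \<in> V 1" using subspace_neg[OF layer_subspace[OF layer1] x(2)] .
    then show ?thesis unfolding steps_def using x by (intro CollectI exI[of _ "- x"]) (simp add: E_minus)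
  qed
  ultimately show ?thesis
    unfolding words_def using l by (intro CollectI exI[of _ "map uminus (rev l)"]) auto
qed

lemma words_sum_list: "(\<And>b. b \<in> set bs \<Longrightarrow> g b \<in> words n \<epsilon>) \<Longrightarrow> sum_list (map g bs) \<in> words (length bs * n) \<epsilon>"
proof (induction bs)
  case (Cons b bs)
  then have "g b + sum_list (map g bs) \<in> words (n + length bs * n) \<epsilon>" by (intro words_add) auto
  then show ?case by simp
qed (simp add: words_0)

lemma small_words:
  assumes "open W" "0 \<in> W"
  shows "\<exists>\<epsilon>>0. words n \<epsilon> \<subseteq> W"
  using assms
proof (induction n arbitrary: W)
  case 0
  then show ?case by (intro exI[of _ 1]) (auto simp: words_def)
next
  case (Suc n)
  obtain N where N: "open N" "0 \<in> N" "\<And>x y. x \<in> N \<Longrightarrow> y \<in> N \<Longrightarrow> x + y \<in> W"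
    using topological_group_nbhd[OF Suc.prems] by metis
  obtain \<epsilon>1 where e1: "\<epsilon>1 > 0" "words n \<epsilon>1 \<subseteq> N" using Suc.IH[OF N(1,2)] by blast
  have "open (E -` N)" by (intro open_vimage N E_cont)
  moreover have "0 \<in> E -` N" using N by simp
  ultimately obtain \<epsilon>2 where e2: "\<epsilon>2 > 0" "ball 0 \<epsilon>2 \<subseteq> E -` N" by (meson open_contains_ball)
  have "words (Suc n) (min \<epsilon>1 \<epsilon>2) \<subseteq> W"
  proof
    fix p assume "p \<in> words (Suc n) (min \<epsilon>1 \<epsilon>2)"
    then obtain l where l: "p = sum_list l" "length l \<le> Suc n" "set l \<subseteq> steps (min \<epsilon>1 \<epsilon>2)"
      unfolding words_def by blast
    show "p \<in> W"
    proof (cases l)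
      case Nil
      then show ?thesis using l Suc.prems by simp
    next
      case (Cons g l')
      then have "g \<in> steps (min \<epsilon>1 \<epsilon>2)" using l by simp
      then have "g \<in> N" using e2 by (auto simp: steps_def)
      moreover have "set l' \<subseteq> steps \<epsilon>1" using l Cons by (auto simp: steps_def)
      then have "sum_list l' \<in> words n \<epsilon>1" unfolding words_def using l Cons by auto
      ultimately show ?thesis using N(3) e1 l Cons by auto
    qed
  qed
  then show ?case using e1 e2 by (intro exI[of _ "min \<epsilon>1 \<epsilon>2"]) simp
qed

lemma derivative_in_subspace_0:
  fixes y :: "real \<Rightarrow> 'a"
  assumes S: "subspace S" and y: "(y has_vector_derivative c) (at 0)" and e: "e > 0"
    and yS: "\<And>t. \<bar>t\<bar> < e \<Longrightarrow> y t \<in> S"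
  shows "c \<in> S"
proof -
  obtain a b where ab: "a \<in> span S" "\<And>w. w \<in> span S \<Longrightarrow> orthogonal b w" "c = a + b"
    using orthogonal_subspace_decomp_exists[of S c] by metis
  have sp: "span S = S" using S by (simp add: span_eq_iff)
  have "((\<lambda>t. y t \<bullet> b) has_vector_derivative c \<bullet> b) (at 0)"
    by (rule bounded_linear.has_vector_derivative[OF bounded_linear_inner_left y])
  moreover have "((\<lambda>t. y t \<bullet> b) has_vector_derivative 0) (at 0)"
  proof (rule has_vector_derivative_transform_within_open[OF has_vector_derivative_const, of "{-e<..<e}"])
    fix t assume "t \<in> {-e<..<e}"
    then have "\<bar>t\<bar> < e" by auto
    from yS[OF this] have "y t \<in> span S" by (rule span_base)
    from ab(2)[OF this] show "0 = y t \<bullet> b" by (simp add: orthogonal_def inner_commute[of b])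
  qed (use e in auto)
  ultimately have "c \<bullet> b = 0" using vector_derivative_unique_at by blast
  moreover have "a \<bullet> b = 0" using ab(1,2) by (simp add: orthogonal_def inner_commute)
  ultimately have "b \<bullet> b = 0" using ab(3) by (simp add: inner_add_left)
  then show ?thesis using ab sp by simp
qed

text \<open>Differentiating the adjoint action along horizontal words produces all iterated brackets.\<close>

lemma words_Ad_span:
  assumes \<epsilon>: "\<epsilon> > 0"
  shows "span {Ad q x | q x. q \<in> words k \<epsilon> \<and> x \<in> V 1} = (UNIV :: 'a set)"
proof -
  define Q where "Q n = span {Ad q x | q x. q \<in> words n \<epsilon> \<and> x \<in> V 1}" for n
  have Qmono: "Q n \<subseteq> Q m" if "n \<le> m" for n m
    unfolding Q_def using words_mono[OF that] by (intro span_mono) blast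
  have AdQ: "Ad (E y) w \<in> Q (Suc n)" if y: "y \<in> V 1" "norm y < \<epsilon>" and w: "w \<in> Q n" for y w n
  proof -
    have "w \<in> span {Ad q x | q x. q \<in> words n \<epsilon> \<and> x \<in> V 1}" using w by (simp add: Q_def)
    then show ?thesis
    proof (induction rule: span_induct)
      case base
      have "subspace (Q (Suc n))" by (simp add: Q_def)
      from linear_subspace_vimage[OF Ad_linear this] show ?case by (simp add: vimage_def)
    next
      case (step w)
      then obtain q x where q: "w = Ad q x" "q \<in> words n \<epsilon>" "x \<in> V 1" by blast
      have "E y + q \<in> words (Suc n) \<epsilon>" using words_add[OF steps_words[OF y] q(2)] by simp
      moreover have "Ad (E y) w = Ad (E y + q) x" by (simp add: q Ad_add)
      ultimately show ?case unfolding Q_def using q(3) by (intro span_base) blast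
    qed
  qed
  \<comment> \<open>\<open>C y w\<close> is the derivative at \<open>0\<close> of a curve in the
    subspace \<open>Q (Suc n)\<close>, hence belongs to it: one more letter gives one more
    bracket.\<close>
  have CQ: "C y w \<in> Q (Suc n)" if y: "y \<in> V 1" and w: "w \<in> Q n" for y w n
  proof (rule derivative_in_subspace_0[OF _ Ad_deriv_0])
    show "subspace (Q (Suc n))" by (simp add: Q_def)
    show "\<epsilon> / (norm y + 1) > 0" using \<epsilon> by (intro divide_pos_pos add_nonneg_pos) auto
    fix t assume t: "\<bar>t\<bar> < \<epsilon> / (norm y + 1)"
    have n1: "norm y + 1 > 0" by (simp add: add_nonneg_pos)
    have "\<bar>t\<bar> * norm y \<le> \<bar>t\<bar> * (norm y + 1)" by (intro mult_left_mono) auto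
    also have "\<dots> < \<epsilon>" using t n1 by (simp add: pos_less_divide_eq)
    finally have "norm (t *\<^sub>R y) < \<epsilon>" by simp
    then show "Ad (E (t *\<^sub>R y)) w \<in> Q (Suc n)"
      using AdQ[OF subspace_scale[OF layer_subspace[OF layer1] y] _ w] by blast
  qed
  \<comment> \<open>Layer \<open>j\<close> is spanned by brackets of depth \<open>j - 1\<close>, so
    words of length \<open>j - 1\<close> suffice for it and length \<open>k\<close> covers all
    layers.\<close>
  have layer: "V j \<subseteq> Q (j - 1)" if "j \<in> {1..k}" for j
    using that
  proof (induction j)
    case (Suc j)
    show ?case
    proof (cases "j = 0")
      case True
      show ?thesis
      proof
        fix x assume "x \<in> V (Suc j)"
        then have "x \<in> V 1" using True by simp
        moreover have "x = Ad 0 x" by simp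
        ultimately show "x \<in> Q (Suc j - 1)"
          unfolding Q_def using words_0 by (intro span_base CollectI exI[of _ 0] exI[of _ x]) blast
      qed
    next
      case False
      then have j: "j \<in> {1..<k}" "j \<in> {1..k}" using Suc.prems by auto
      have "{C x y | x y. x \<in> V 1 \<and> y \<in> V j} \<subseteq> Q j"
        using CQ[of _ _ "j - 1"] Suc.IH[OF j(2)] False by auto
      then have "span {C x y | x y. x \<in> V 1 \<and> y \<in> V j} \<subseteq> Q j"
        by (intro span_minimal) (simp_all add: Q_def)
      then show ?thesis using layer_Suc_span[OF j(1)] by simp
    qed
  qed simp
  have "(\<Union>j\<in>{1..k}. V j) \<subseteq> Q k"
  proof (rule UN_least)
    fix j assume j: "j \<in> {1..k}"
    then have "j - 1 \<le> k" by (simp add: le_diff_conv)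
    then show "V j \<subseteq> Q k" using layer[OF j] Qmono by blast
  qed
  then have "span (\<Union>j\<in>{1..k}. V j) \<subseteq> Q k" by (intro span_minimal) (simp_all add: Q_def)
  then show ?thesis using layers_span by (auto simp: Q_def)
qed

text \<open>Choose a basis of vectors \<open>Ad q x\<close> with \<open>q\<close> a word of length
  at most \<open>k\<close>. By \<open>Ad_conj\<close> their exponential lines consist of words of
  length at most \<open>k + 1 + k\<close>, and one factor per basis vector gives the stated length.
  The product map \<open>P\<close> is continuous and has the invertible derivative \<open>T\<close>
  at \<open>0\<close>; since it is not shown to be continuously differentiable, an open mapping
  theorem for maps differentiable at one point takes the place of the inverse function
  theorem.\<close>

lemma words_nbhd:
  assumes \<epsilon>: "\<epsilon> > 0"
  shows "\<exists>N. open N \<and> 0 \<in> N \<and> N \<subseteq> words (DIM('a) * (k + 1 + k)) \<epsilon>"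
proof -
  define B0 where "B0 = {Ad q x | q x. q \<in> words k \<epsilon> \<and> x \<in> V 1}"
  obtain B where B: "B \<subseteq> B0" "independent B" "B0 \<subseteq> span B" "card B = dim B0"
    using basis_exists by blast
  have spanB: "span B = UNIV"
  proof -
    have "span B0 \<subseteq> span B" using B(3) by (intro span_minimal) auto
    moreover have "span B0 = UNIV" using words_Ad_span[OF \<epsilon>] by (simp only: B0_def)
    ultimately show ?thesis by blast
  qed
  have finB: "finite B" using B(2) by (rule independent_imp_finite)
  have cardB: "card B = DIM('a)" using dim_eq_card_independent[OF B(2)] dim_span[of B] spanB by simp
  obtain bs where bs: "set bs = B" "distinct bs" using finite_distinct_list[OF finB] by blast
  have len: "length bs = DIM('a)" using bs cardB distinct_card by metis
  define r where "r b w = representation B w b" for b w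
  have rlin: "bounded_linear (r b)" for b
    unfolding linear_conv_bounded_linear[symmetric] r_def
    by (rule linearI) (simp_all add: representation_add[OF B(2)] representation_scale[OF B(2)] spanB)
  have "\<exists>q x. b = Ad q x \<and> q \<in> words k \<epsilon> \<and> x \<in> V 1" if "b \<in> B" for b
    using B(1) that unfolding B0_def by blast
  then obtain q x where qx: "\<And>b. b \<in> B \<Longrightarrow> b = Ad (q b) (x b)" "\<And>b. b \<in> B \<Longrightarrow> q b \<in> words k \<epsilon>"
    "\<And>b. b \<in> B \<Longrightarrow> x b \<in> V 1" by metis
  define P where "P w = sum_list (map (\<lambda>b. E (r b w *\<^sub>R b)) bs)" for w
  have sumr: "sum_list (map (\<lambda>b. r b w *\<^sub>R b) bs) = w" for w
  proof -
    have "sum_list (map (\<lambda>b. r b w *\<^sub>R b) bs) = (\<Sum>b\<in>B. r b w *\<^sub>R b)"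
      using sum_list_distinct_conv_sum_set[OF bs(2)] bs(1) by metis
    also have "\<dots> = w" unfolding r_def by (rule sum_representation_eq[OF B(2)]) (simp_all add: spanB finB)
    finally show ?thesis .
  qed
  have Pd: "((\<lambda>w. \<phi> (P w)) has_derivative T) (at 0)"
    using conjunct2[OF product_of_flows[where r = r and u = "\<lambda>b. b" and bs = bs, OF rlin]] unfolding P_def sumr .
  have Pcont: "continuous_on UNIV P"
  proof -
    have "continuous_on UNIV (\<lambda>w. sum_list (map (\<lambda>b. E (r b w *\<^sub>R b)) cs))" for cs
    proof (induction cs)
      case (Cons c cs)
      have "continuous_on UNIV (\<lambda>w. E (r c w *\<^sub>R c))"
        by (rule continuous_on_compose2[OF E_cont[of UNIV]]) (auto intro!: continuous_on_scaleR continuous_on_const linear_continuous_on[OF rlin])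
      then show ?case using Cons by (auto intro!: continuous_intros)
    qed simp
    then show ?thesis by (simp add: P_def[abs_def])
  qed
  define S where "S = {w. P w \<in> U}"
  have "open S" using open_vimage[OF open_U Pcont] by (simp add: S_def vimage_def)
  have P0: "P 0 = 0" unfolding P_def
    by (induction bs) (simp_all add: bounded_linear.linear[OF rlin, THEN linear_0])
  then have "0 \<in> S" using zero_U by (simp add: S_def)
  define S' where "S' = S \<inter> (\<Inter>b\<in>B. {w. \<bar>r b w\<bar> * norm (x b) < \<epsilon>})"
  have "open {w. \<bar>r b w\<bar> * norm (x b) < \<epsilon>}" for b
    by (intro open_Collect_less continuous_intros linear_continuous_on rlin)
  then have "open S'" unfolding S'_def using finB \<open>open S\<close> by (intro open_Int open_INT) auto
  have "0 \<in> S'" unfolding S'_def using \<open>0 \<in> S\<close> \<epsilon> bounded_linear.linear[OF rlin, THEN linear_0] by simp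
  have PW: "P w \<in> words (DIM('a) * (k + 1 + k)) \<epsilon>" if w: "w \<in> S'" for w
  proof -
    have "E (r b w *\<^sub>R b) \<in> words (k + 1 + k) \<epsilon>" if b: "b \<in> set bs" for b
    proof -
      have bB: "b \<in> B" using b bs by simp
      have "E (r b w *\<^sub>R b) = q b + E (r b w *\<^sub>R x b) + - q b"
        using Ad_conj[of "q b" "r b w" "x b"] qx(1)[OF bB] by simp
      moreover have "E (r b w *\<^sub>R x b) \<in> words 1 \<epsilon>"
        using w bB by (intro steps_words subspace_scale[OF layer_subspace[OF layer1]] qx(3)) (auto simp: S'_def)
      ultimately show ?thesis
        using words_add[OF words_add[OF qx(2)[OF bB]] words_minus[OF qx(2)[OF bB]]] by metis
    qed
    then have "sum_list (map (\<lambda>b. E (r b w *\<^sub>R b)) bs) \<in> words (length bs * (k + 1 + k)) \<epsilon>"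
      by (rule words_sum_list)
    then show ?thesis unfolding P_def len by blast
  qed
  have "continuous_on S (\<lambda>w. \<phi> (P w))"
    by (rule continuous_on_compose2[OF cont_\<phi> continuous_on_subset[OF Pcont]]) (auto simp: S_def)
  have "\<phi> (P 0) \<in> interior ((\<lambda>w. \<phi> (P w)) ` S')"
  proof (rule sussmann_open_mapping[OF \<open>open S\<close> \<open>continuous_on S (\<lambda>w. \<phi> (P w))\<close> \<open>0 \<in> S\<close> Pd])
    show "bounded_linear (inv T)" using inv_T_linear by (simp add: linear_conv_bounded_linear)
    show "T \<circ> inv T = id" by (simp add: fun_eq_iff)
    show "0 \<in> interior S'" using \<open>open S'\<close> \<open>0 \<in> S'\<close> by (simp add: interior_open)
  qed (auto simp: S'_def)
  define M where "M = interior ((\<lambda>w. \<phi> (P w)) ` S')"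
  define N where "N = U \<inter> \<phi> -` M"
  have "open N" unfolding N_def M_def by (intro continuous_open_preimage cont_\<phi> open_U open_interior)
  moreover have "0 \<in> N" using \<open>\<phi> (P 0) \<in> _\<close> zero_U P0 by (simp add: N_def M_def)
  moreover have "N \<subseteq> words (DIM('a) * (k + 1 + k)) \<epsilon>"
  proof
    fix p assume p: "p \<in> N"
    then have "\<phi> p \<in> (\<lambda>w. \<phi> (P w)) ` S'" using interior_subset by (auto simp: N_def M_def)
    then obtain w where w: "w \<in> S'" "\<phi> p = \<phi> (P w)" by blast
    have "P w \<in> U" using w by (simp add: S'_def S_def)
    moreover have "p \<in> U" using p by (simp add: N_def)
    ultimately have "p = P w" using w(2) by (metis \<psi>_\<phi>)
    then show "p \<in> words (DIM('a) * (k + 1 + k)) \<epsilon>" using PW[OF w(1)] by simp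
  qed
  ultimately show ?thesis by blast
qed

text \<open>A neighbourhood of \<open>p\<close> is covered by words of bounded length with letters
  so small that all initial parts stay in \<open>W\<close>; invariance is then applied letter by
  letter.\<close>

lemma horizontally_invariant_open:
  assumes W: "open W" and Z: "Z \<subseteq> W"
    and inv: "\<And>p x. p \<in> Z \<Longrightarrow> x \<in> V 1 \<Longrightarrow> (\<And>s. 0 \<le> s \<Longrightarrow> s \<le> 1 \<Longrightarrow> p + E (s *\<^sub>R x) \<in> W) \<Longrightarrow> p + E x \<in> Z"
  shows "open Z"
proof (subst open_subopen, intro ballI)
  fix p assume p: "p \<in> Z"
  define n where "n = DIM('a) * (k + 1 + k)"
  have "open ((\<lambda>y. p + y) -` W)" "0 \<in> (\<lambda>y. p + y) -` W"
    using p Z W by (auto intro!: open_vimage continuous_intros)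
  then obtain \<epsilon> where \<epsilon>: "\<epsilon> > 0" "words n \<epsilon> \<subseteq> (\<lambda>y. p + y) -` W" using small_words by metis
  have inZ: "p + sum_list l \<in> Z" if "set l \<subseteq> steps \<epsilon>" "length l \<le> n" for l
    using that
  proof (induction l rule: rev_induct)
    case (snoc g l)
    then have IH: "p + sum_list l \<in> Z" by simp
    obtain x where x: "g = E x" "x \<in> V 1" "norm x < \<epsilon>" using snoc.prems unfolding steps_def by auto
    have "(p + sum_list l) + E x \<in> Z"
    proof (rule inv[OF IH x(2)])
      fix s :: real assume s: "0 \<le> s" "s \<le> 1"
      have "norm (s *\<^sub>R x) \<le> 1 * norm x" using s by (simp add: mult_left_le_one_le)
      then have "E (s *\<^sub>R x) \<in> words 1 \<epsilon>"
        using x by (intro steps_words subspace_scale[OF layer_subspace[OF layer1]]) auto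
      \<comment> \<open>The initial part has at most \<open>n - 1\<close> letters, which leaves one
        for the partial step, so the whole segment stays in \<open>W\<close>.\<close>
      moreover have "sum_list l \<in> words (n - 1) \<epsilon>" using snoc.prems unfolding words_def by auto
      ultimately have "sum_list l + E (s *\<^sub>R x) \<in> words (n - 1 + 1) \<epsilon>" by (intro words_add)
      moreover have "n - 1 + 1 = n" using snoc.prems by simp
      ultimately show "p + sum_list l + E (s *\<^sub>R x) \<in> W" using \<epsilon>(2) by (auto simp: add.assoc)
    qed
    then show ?case using x by (simp add: add.assoc)
  qed (use p in simp)
  obtain N where N: "open N" "0 \<in> N" "N \<subseteq> words n \<epsilon>" using words_nbhd[OF \<epsilon>(1)] unfolding n_def by blast
  have "open ((\<lambda>y. - p + y) -` N)" "p \<in> (\<lambda>y. - p + y) -` N"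
    using N by (auto intro!: open_vimage continuous_intros)
  moreover have "(\<lambda>y. - p + y) -` N \<subseteq> Z"
  proof
    fix y assume "y \<in> (\<lambda>y. - p + y) -` N"
    then have "- p + y \<in> words n \<epsilon>" using N by auto
    then obtain l where l: "- p + y = sum_list l" "length l \<le> n" "set l \<subseteq> steps \<epsilon>" unfolding words_def by blast
    have "p + (- p + y) \<in> Z" unfolding l(1) by (rule inZ[OF l(3,2)])
    then show "y \<in> Z" by (simp add: add.assoc[symmetric])
  qed
  ultimately show "\<exists>T. open T \<and> p \<in> T \<and> T \<subseteq> Z" by blast
qed

text \<open>The set reached by horizontal words is open by horizontal invariance, and so is its
  complement because steps can be reversed; connectedness does the rest. It serves as an induction
  principle for the group.\<close>

lemma horizontal_generate:
  assumes "P 0" "\<And>p x. P p \<Longrightarrow> x \<in> V 1 \<Longrightarrow> P (p + E x)"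
  shows "P p"
proof -
  define Z where "Z = {sum_list (map E l) | l. set l \<subseteq> V 1}"
  have step: "p + E x \<in> Z" if px: "p \<in> Z" "x \<in> V 1" for p x
  proof -
    obtain l where "p = sum_list (map E l)" "set l \<subseteq> V 1" using px(1) unfolding Z_def by blast
    then show ?thesis unfolding Z_def using px(2) by (intro CollectI exI[of _ "l @ [x]"]) simp
  qed
  have "open Z" by (rule horizontally_invariant_open[of UNIV]) (auto intro: step)
  moreover have "open (- Z)"
  proof (rule horizontally_invariant_open[of UNIV])
    fix p x assume p: "p \<in> - Z" and x: "x \<in> V 1"
    show "p + E x \<in> - Z"
    proof
      assume "p + E x \<in> Z"
      from step[OF this subspace_neg[OF layer_subspace[OF layer1] x]]
      have "p \<in> Z" by (simp add: E_minus add.assoc)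
      then show False using p by simp
    qed
  qed auto
  moreover have "sum_list (map E []) \<in> Z" unfolding Z_def by (intro CollectI exI[of _ "[]"]) simp
  then have "Z \<noteq> {}" by blast
  ultimately have "Z = UNIV" using clopen_UNIV[OF connected_G, of Z] by (simp add: closed_def)
  have "P (sum_list (map E l))" if "set l \<subseteq> V 1" for l
    using that by (induction l rule: rev_induct) (use assms in auto)
  moreover have "p \<in> Z" using \<open>Z = UNIV\<close> by simp
  then obtain l where "p = sum_list (map E l)" "set l \<subseteq> V 1" unfolding Z_def by blast
  ultimately show ?thesis by simp
qed

lemma unip_all: "unip p"
  by (rule horizontal_generate[of unip]) (intro unip_0 unip_add unip_E; assumption)+

subsection \<open>Continuity and surjectivity of the exponential map\<close>

lemma dilation_decomp:
  obtains x where "\<And>j. j \<in> {1..k} \<Longrightarrow> x j \<in> V j" "\<xi> = (\<Sum>j=1..k. x j)"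
    "\<And>s. \<Delta> s \<xi> = (\<Sum>j=1..k. s ^ j *\<^sub>R x j)"
proof -
  obtain x where x: "\<forall>j\<in>{1..k}. x j \<in> V j" "\<xi> = (\<Sum>j=1..k. x j)" using layer_decomp by blast
  have "\<Delta> s \<xi> = (\<Sum>j=1..k. s ^ j *\<^sub>R x j)" for s
    using algebra_dilation_sum[of x s] x by simp
  then show thesis using that x by blast
qed

lemma dilation_scale: "\<Delta> s (t *\<^sub>R \<xi>) = t *\<^sub>R \<Delta> s \<xi>"
proof -
  obtain x where x: "\<And>j. j \<in> {1..k} \<Longrightarrow> x j \<in> V j" "\<xi> = (\<Sum>j=1..k. x j)"
    "\<And>s. \<Delta> s \<xi> = (\<Sum>j=1..k. s ^ j *\<^sub>R x j)" using dilation_decomp[of \<xi>] by metis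
  have "\<Delta> s (\<Sum>j=1..k. t *\<^sub>R x j) = (\<Sum>j=1..k. s ^ j *\<^sub>R (t *\<^sub>R x j))"
    by (rule algebra_dilation_sum) (use x(1) layer_subspace in \<open>auto intro: subspace_scale\<close>)
  then show ?thesis using x(2,3) by (simp add: scaleR_sum_right mult.commute)
qed

lemma dilation_cont: "continuous_on S (\<lambda>s. \<Delta> s \<xi>)"
proof -
  obtain x where "\<And>s. \<Delta> s \<xi> = (\<Sum>j=1..k. s ^ j *\<^sub>R x j)" using dilation_decomp[of \<xi>] by metis
  then show ?thesis by (simp add: continuous_intros)
qed

lemma dilation_0: "\<Delta> 0 \<xi> = 0" and dilation_1: "\<Delta> 1 \<xi> = \<xi>"
proof -
  obtain x where "\<xi> = (\<Sum>j=1..k. x j)" "\<And>s. \<Delta> s \<xi> = (\<Sum>j=1..k. s ^ j *\<^sub>R x j)" using dilation_decomp[of \<xi>] by metis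
  then show "\<Delta> 0 \<xi> = 0" "\<Delta> 1 \<xi> = \<xi>" by (auto intro!: sum.neutral)
qed

lemma inner_layer_sum:
  assumes "\<And>j. j \<in> {1..k} \<Longrightarrow> x j \<in> V j"
  shows "(\<Sum>j=1..k. a j *\<^sub>R x j) \<bullet> (\<Sum>j=1..k. x j) = (\<Sum>j=1..k. a j * (x j \<bullet> x j))"
proof -
  have "(\<Sum>j=1..k. a j *\<^sub>R x j) \<bullet> (\<Sum>j=1..k. x j) = (\<Sum>j=1..k. \<Sum>i=1..k. a j * (x j \<bullet> x i))"
    by (simp add: inner_sum_left inner_sum_right) (rule sum.swap)
  also have "\<dots> = (\<Sum>j=1..k. \<Sum>i=1..k. if i = j then a j * (x j \<bullet> x j) else 0)"
    by (intro sum.cong refl) (use assms layers_orthogonal in \<open>auto simp: orthogonal_def\<close>)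
  finally show ?thesis by simp
qed

text \<open>Pair the dilated vector with \<open>\<xi>\<close>: by orthogonality of the layers the
  result is a sum of squared components with weights \<open>s ^ j\<close>, none smaller than
  \<open>s ^ k\<close>.\<close>

lemma norm_dilation_ge:
  assumes s: "0 \<le> s" "s \<le> 1"
  shows "s ^ k * norm \<xi> \<le> norm (\<Delta> s \<xi>)"
proof (cases "\<xi> = 0")
  case False
  obtain x where x: "\<And>j. j \<in> {1..k} \<Longrightarrow> x j \<in> V j" "\<xi> = (\<Sum>j=1..k. x j)"
    "\<And>s. \<Delta> s \<xi> = (\<Sum>j=1..k. s ^ j *\<^sub>R x j)" using dilation_decomp[of \<xi>] by metis
  have "s ^ k * (norm \<xi>)\<^sup>2 = (\<Sum>j=1..k. s ^ k * (x j \<bullet> x j))"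
    using inner_layer_sum[of x "\<lambda>j. 1"] x(1,2) by (simp add: power2_norm_eq_inner sum_distrib_left)
  also have "\<dots> \<le> (\<Sum>j=1..k. s ^ j * (x j \<bullet> x j))"
    using s by (intro sum_mono mult_right_mono power_decreasing) auto
  also have "\<dots> = \<Delta> s \<xi> \<bullet> \<xi>" using inner_layer_sum[of x "\<lambda>j. s ^ j"] x by simp
  also have "\<dots> \<le> norm (\<Delta> s \<xi>) * norm \<xi>" by (rule norm_cauchy_schwarz)
  finally show ?thesis using False by (simp add: power2_eq_square mult.assoc[symmetric])
qed simp

text \<open>Homogeneity is given for \<open>Exp\<close>. It passes to \<open>E\<close> along times
  \<open>h\<close> tending to \<open>1\<close> at which both maps agree, for \<open>\<xi>\<close> as
  well as for its dilation.\<close>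

lemma \<rho>_E_dilation:
  assumes s: "s > 0"
  shows "\<rho> (E (\<Delta> s \<xi>)) = s * \<rho> (E \<xi>)"
proof -
  define H where "H = Hgam \<xi> \<inter> Hgam (\<Delta> s \<xi>)"
  have H: "real_subgroup H" using Hgam_subgroup by (auto simp: H_def real_subgroup_def)
  have "\<exists>h. h \<in> H \<and> h \<le> 1 \<and> 1 < h + inverse (real (Suc n))" for n
    using real_subgroup_approx[OF H Hgam_Int_small[of _ \<xi> "\<Delta> s \<xi>", folded H_def], of "inverse (real (Suc n))" 1] by auto
  then obtain h where h: "\<And>n. h n \<in> H" "\<And>n. h n \<le> 1" "\<And>n. 1 < h n + inverse (real (Suc n))" by metis
  have "(\<lambda>n. 1 - h n) \<longlonglongrightarrow> 0"
  proof (rule tendsto_sandwich[of "\<lambda>n. 0" _ _ "\<lambda>n. inverse (real (Suc n))"])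
    show "\<forall>\<^sub>F n in sequentially. 1 - h n \<le> inverse (real (Suc n))"
      using h(3) by (intro always_eventually allI) (simp add: less_imp_le less_diff_eq algebra_simps)
  qed (use h(2) LIMSEQ_inverse_real_of_nat in auto)
  then have hlim: "h \<longlonglongrightarrow> 1" using tendsto_diff[OF tendsto_const[of 1], of "\<lambda>n. 1 - h n" 0] by simp
  have lim: "(\<lambda>n. \<rho> (E (h n *\<^sub>R \<eta>))) \<longlonglongrightarrow> \<rho> (E (1 *\<^sub>R \<eta>))" for \<eta>
    by (intro \<rho>_tendsto isCont_tendsto_compose[OF _ hlim, of "\<lambda>t. E (t *\<^sub>R \<eta>)"])
      (use E_line_cont[of UNIV \<eta>] in \<open>simp add: continuous_on_eq_continuous_at\<close>)
  have "\<rho> (E (h n *\<^sub>R \<Delta> s \<xi>)) = s * \<rho> (E (h n *\<^sub>R \<xi>))" for n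
  proof -
    have "E (h n *\<^sub>R \<Delta> s \<xi>) = Exp (\<Delta> s (h n *\<^sub>R \<xi>))" "E (h n *\<^sub>R \<xi>) = Exp (h n *\<^sub>R \<xi>)"
      using h(1)[of n] by (simp_all add: H_def Hgam_def gam_E dilation_scale)
    then show ?thesis using \<rho>_Exp_dilation[OF s] by simp
  qed
  then have "(\<lambda>n. s * \<rho> (E (h n *\<^sub>R \<xi>))) \<longlonglongrightarrow> \<rho> (E (\<Delta> s \<xi>))" using lim[of "\<Delta> s \<xi>"] by simp
  moreover have "(\<lambda>n. s * \<rho> (E (h n *\<^sub>R \<xi>))) \<longlonglongrightarrow> s * \<rho> (E \<xi>)"
    using lim[of \<xi>] by (intro tendsto_mult_left) simp
  ultimately show ?thesis by (rule LIMSEQ_unique)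
qed

lemma E_injective_near_0: "\<exists>\<epsilon>>0. \<forall>\<xi>. norm \<xi> < \<epsilon> \<and> E \<xi> = 0 \<longrightarrow> \<xi> = 0"
  using E_cont_near_0 by fastforce

text \<open>The dilation curve runs from \<open>0\<close> to \<open>\<eta>\<close>, so it crosses
  the sphere of radius \<open>r\<close>, on which \<open>\<rho> (E \<xi>)\<close> has a positive
  minimum by compactness.\<close>

lemma \<rho>_lower_bound:
  assumes r: "r > 0" and inj: "\<And>\<xi>. norm \<xi> = r \<Longrightarrow> E \<xi> \<noteq> 0"
  shows "\<exists>c>0. \<forall>\<eta>. norm \<eta> \<ge> r \<longrightarrow> (\<exists>s. 0 < s \<and> s \<le> 1 \<and> norm (\<Delta> s \<eta>) = r \<and> c \<le> s * \<rho> (E \<eta>))"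
proof -
  have "sphere (0::'a) r \<noteq> {}" using r by (simp add: sphere_eq_empty)
  moreover have "continuous_on (sphere 0 r) (\<lambda>\<xi>. \<rho> (E \<xi>))"
    by (rule continuous_on_compose2[OF \<rho>_cont[of UNIV] E_cont]) simp
  ultimately obtain \<xi>0 where \<xi>0: "\<xi>0 \<in> sphere 0 r" "\<And>\<xi>. \<xi> \<in> sphere 0 r \<Longrightarrow> \<rho> (E \<xi>0) \<le> \<rho> (E \<xi>)"
    using continuous_attains_inf[OF compact_sphere, of "0::'a" r "\<lambda>\<xi>. \<rho> (E \<xi>)"] by blast
  have "\<rho> (E \<xi>0) \<noteq> 0" using inj[of \<xi>0] \<xi>0(1) by (simp add: \<rho>_eq_0)
  then have c: "\<rho> (E \<xi>0) > 0" using \<rho>_nonneg[of "E \<xi>0"] by simp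
  have "\<exists>s. 0 < s \<and> s \<le> 1 \<and> norm (\<Delta> s \<eta>) = r \<and> \<rho> (E \<xi>0) \<le> s * \<rho> (E \<eta>)" if \<eta>: "norm \<eta> \<ge> r" for \<eta>
  proof -
    have "\<exists>s\<ge>0. s \<le> 1 \<and> norm (\<Delta> s \<eta>) = r"
      using IVT'[of "\<lambda>s. norm (\<Delta> s \<eta>)" 0 r 1] r \<eta> continuous_on_norm[OF dilation_cont[of "{0..1}" \<eta>]]
      by (simp add: dilation_0 dilation_1)
    then obtain s where s: "0 \<le> s" "s \<le> 1" "norm (\<Delta> s \<eta>) = r" by blast
    have "s \<noteq> 0" using s r by (auto simp: dilation_0)
    then have s0: "s > 0" using s by simp
    have "\<rho> (E \<xi>0) \<le> \<rho> (E (\<Delta> s \<eta>))" using s by (intro \<xi>0) simp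
    then show ?thesis using s s0 \<rho>_E_dilation[OF s0] by auto
  qed
  then show ?thesis using c by blast
qed

lemma \<rho>_E_proper: "\<exists>B. \<forall>\<eta>. \<rho> (E \<eta>) \<le> M \<longrightarrow> norm \<eta> \<le> B"
proof -
  obtain \<epsilon> where \<epsilon>: "\<epsilon> > 0" "\<And>\<xi>. norm \<xi> < \<epsilon> \<Longrightarrow> E \<xi> = 0 \<Longrightarrow> \<xi> = 0" using E_injective_near_0 by blast
  define r where "r = \<epsilon> / 2"
  have r: "r > 0" "r < \<epsilon>" using \<epsilon>(1) by (auto simp: r_def)
  have "E \<xi> \<noteq> 0" if "norm \<xi> = r" for \<xi> using \<epsilon>(2)[of \<xi>] that r by auto
  from \<rho>_lower_bound[OF r(1) this]
  obtain c where c: "c > 0" "\<And>\<eta>. norm \<eta> \<ge> r \<Longrightarrow> \<exists>s. 0 < s \<and> s \<le> 1 \<and> norm (\<Delta> s \<eta>) = r \<and> c \<le> s * \<rho> (E \<eta>)" by blast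
  define M' where "M' = max M 1"
  \<comment> \<open>The crossing parameter is at least \<open>c / M'\<close>, and
    \<open>s ^ k * norm \<eta> \<le> r\<close> then bounds \<open>norm \<eta>\<close>. Taking
    \<open>M'\<close> at least \<open>1\<close> makes the division possible.\<close>
  have "norm \<eta> \<le> max r (r / (c / M') ^ k)" if \<eta>: "\<rho> (E \<eta>) \<le> M" for \<eta>
  proof (cases "norm \<eta> \<ge> r")
    case True
    then obtain s where s: "0 < s" "s \<le> 1" "norm (\<Delta> s \<eta>) = r" "c \<le> s * \<rho> (E \<eta>)" using c(2) by blast
    have "s * \<rho> (E \<eta>) \<le> s * M'" using \<eta> s by (intro mult_left_mono) (auto simp: M'_def)
    then have "c / M' \<le> s" using s(4) by (simp add: M'_def field_simps)
    moreover have cM: "0 < c / M'" using c by (simp add: M'_def)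
    ultimately have "(c / M') ^ k \<le> s ^ k" by (intro power_mono) auto
    then have "(c / M') ^ k * norm \<eta> \<le> s ^ k * norm \<eta>" by (intro mult_right_mono) auto
    also have "\<dots> \<le> r" using norm_dilation_ge[of s \<eta>] s by simp
    finally have "norm \<eta> \<le> r / (c / M') ^ k" using cM by (simp add: pos_le_divide_eq mult.commute)
    then show ?thesis by simp
  qed simp
  then show ?thesis by blast
qed

text \<open>As \<open>E a = E b\<close>, the element \<open>E a\<close> commutes with the line of
  \<open>b\<close>, so \<open>Ad (E a) b = b\<close>. Unipotency upgrades this to
  \<open>C a b = 0\<close>; then the two lines commute, and their pointwise difference is the
  one-parameter subgroup of \<open>a - b\<close>.\<close>

lemma E_eq_imp_diff:
  assumes eq: "E a = E b"
  shows "E (a - b) = 0"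
proof -
  have Adb: "Ad (E a) b = b" using Ad_E_self[of 1 b] by (simp add: eq)
  have c0: "C a b = 0"
  proof (rule ccontr)
    assume c: "C a b \<noteq> 0"
    \<comment> \<open>Take the last filtration step \<open>j\<close> containing
      \<open>C a b\<close>. Modulo \<open>tail (j + 1)\<close> the adjoint curve of \<open>b\<close>
      has the constant derivative \<open>C a b\<close>, so its return to \<open>b\<close> at time
      \<open>1\<close> pushes \<open>C a b\<close> one step further.\<close>
    define J where "J = {j. 1 \<le> j \<and> C a b \<in> tail j}"
    have "j \<le> k" if "j \<in> J" for j
      using tail_end[of j] that c by (cases "k < j") (simp_all add: J_def)
    then have "J \<subseteq> {..k}" by blast
    then have fin: "finite J" by (rule finite_subset) simp
    have ne: "J \<noteq> {}" using tail_1 by (auto simp: J_def)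
    define j where "j = Max J"
    have j: "j \<in> J" "j + 1 \<notin> J" using Max_in[OF fin ne] Max_ge[OF fin, of "j + 1"] by (auto simp: j_def)
    have "Ad (E (1 *\<^sub>R a)) b - Ad (E (0 *\<^sub>R a)) b - C a b \<in> tail (j + 1)"
    proof (rule derivative_in_subspace[OF tail_subspace Ad_deriv])
      show "Ad (E (t *\<^sub>R a)) (C a b) - C a b \<in> tail (j + 1)" for t
        using unip_all[of "E (t *\<^sub>R a)"] j(1) by (auto simp: unip_def J_def)
    qed
    then have "- C a b \<in> tail (j + 1)" using Adb by simp
    then have "C a b \<in> tail (j + 1)" using subspace_neg[OF tail_subspace] by fastforce
    then show False using j by (simp add: J_def)
  qed
  have "Ad (E (t *\<^sub>R a)) b = b" for t
  proof -
    have "C (t *\<^sub>R a) b = 0" using linear_scale[OF C_linear_left, of t a b] c0 by simp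
    then have "Ad (E (1 *\<^sub>R t *\<^sub>R a)) b - Ad (E (0 *\<^sub>R t *\<^sub>R a)) b - 0 \<in> {0}"
      by (intro derivative_in_subspace[OF subspace_single_0 Ad_deriv]) (simp add: linear_0[OF Ad_linear])
    then show ?thesis by simp
  qed
  then have comm: "E (t *\<^sub>R a) + E (s *\<^sub>R b) = E (s *\<^sub>R b) + E (t *\<^sub>R a)" for s t
    using Ad_swap[of "E (t *\<^sub>R a)" s b] by simp
  define \<gamma> where "\<gamma> t = E (t *\<^sub>R a) + E (t *\<^sub>R (- b))" for t
  have "flow \<gamma> (T (a - b))"
    unfolding flow_def
  proof
    show "line_hom \<gamma>"
      unfolding line_hom_def
    proof (intro allI)
      fix s t
      have "\<gamma> (s + t) = E (s *\<^sub>R a) + (E (t *\<^sub>R a) + E (- s *\<^sub>R b)) + E (t *\<^sub>R (- b))"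
        by (simp add: \<gamma>_def E_add add.assoc del: scaleR_minus_right) simp
      also have "\<dots> = \<gamma> s + \<gamma> t" unfolding comm[of t "- s"] by (simp add: \<gamma>_def add.assoc)
      finally show "\<gamma> (s + t) = \<gamma> s + \<gamma> t" .
    qed
    have v: "((\<lambda>t. E (t *\<^sub>R u)) \<longlongrightarrow> 0) (nhds 0)" "((\<lambda>t. \<phi> (E (t *\<^sub>R u))) has_derivative (\<lambda>h. h *\<^sub>R T u)) (at 0)" for u
      using E_vel[of u] by (auto simp: vel_def has_vector_derivative_def)
    have "((\<lambda>t. \<phi> (\<gamma> t)) has_derivative (\<lambda>h. h *\<^sub>R T a + h *\<^sub>R T (- b))) (at 0)"
      unfolding \<gamma>_def by (intro product_chart_derivative v) simp_all
    moreover have "(\<lambda>h. h *\<^sub>R T a + h *\<^sub>R T (- b)) = (\<lambda>h. h *\<^sub>R T (a - b))"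
      by (simp add: linear_diff[OF T_linear] linear_neg[OF T_linear] scaleR_diff_right)
    moreover have "(\<gamma> \<longlongrightarrow> 0 + 0) (nhds 0)" unfolding \<gamma>_def by (intro tendsto_add v)
    ultimately show "vel \<gamma> (T (a - b))" by (simp add: vel_def has_vector_derivative_def)
  qed
  from flow_eq_E[OF this, of 1] have "E a + E (- b) = E (a - b)" by (simp add: \<gamma>_def)
  then show ?thesis using eq by (simp add: E_minus)
qed

text \<open>The range is open by invariance of domain: equal values force
  \<open>E (v - w) = 0\<close>, and near \<open>0\<close> the map \<open>E\<close> vanishes only at
  \<open>0\<close>. It is closed because a bound on \<open>\<rho>\<close> confines the arguments to
  a compact ball.\<close>

lemma E_surj: "range E = UNIV"
proof (rule clopen_UNIV[OF connected_G])
  obtain \<epsilon> where \<epsilon>: "\<epsilon> > 0" "\<And>\<xi>. norm \<xi> < \<epsilon> \<Longrightarrow> E \<xi> = 0 \<Longrightarrow> \<xi> = 0" using E_injective_near_0 by blast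
  show "open (range E)"
  proof (subst open_subopen, intro ballI)
    fix p assume "p \<in> range E"
    then obtain \<eta> where \<eta>: "p = E \<eta>" by blast
    define h where "h v = - p + E (\<eta> + v)" for v
    have hc: "continuous_on S h" for S unfolding h_def
      by (intro continuous_intros continuous_on_compose2[OF E_cont[of UNIV]]) auto
    have "open (h -` U)" by (rule open_vimage[OF open_U hc])
    moreover have "0 \<in> h -` U" using zero_U by (simp add: h_def \<eta>)
    ultimately obtain \<delta> where \<delta>: "\<delta> > 0" "ball 0 \<delta> \<subseteq> h -` U" by (meson open_contains_ball)
    define D where "D = ball (0::'a) (min \<delta> (\<epsilon> / 2))"
    have DU: "h ` D \<subseteq> U" using \<delta> by (auto simp: D_def)
    have "continuous_on D (\<lambda>v. \<phi> (h v))"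
      by (rule continuous_on_compose2[OF cont_\<phi> hc DU])
    moreover have "inj_on (\<lambda>v. \<phi> (h v)) D"
    proof (rule inj_onI)
      fix v w assume vw: "v \<in> D" "w \<in> D" "\<phi> (h v) = \<phi> (h w)"
      then have "h v = h w" using DU by (metis \<psi>_\<phi> image_subset_iff)
      then have "E (\<eta> + v) = E (\<eta> + w)" unfolding h_def by (rule add_left_imp_eq)
      from E_eq_imp_diff[OF this] have "E (v - w) = 0" by simp
      moreover have "norm (v - w) < \<epsilon>" using vw(1,2) norm_triangle_ineq4[of v w] by (simp add: D_def)
      ultimately show "v = w" using \<epsilon>(2) by fastforce
    qed
    moreover have "open D" by (simp add: D_def)
    ultimately have "open ((\<lambda>v. \<phi> (h v)) ` D)" by (intro invariance_of_domain)
    then have "open (U \<inter> \<phi> -` ((\<lambda>v. \<phi> (h v)) ` D))" by (intro continuous_open_preimage cont_\<phi> open_U)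
    then have "open ((\<lambda>y. - p + y) -` (U \<inter> \<phi> -` ((\<lambda>v. \<phi> (h v)) ` D)))"
      by (intro open_vimage continuous_intros)
    moreover have "p \<in> (\<lambda>y. - p + y) -` (U \<inter> \<phi> -` ((\<lambda>v. \<phi> (h v)) ` D))"
    proof -
      have "h 0 = 0" "0 \<in> D" using \<delta> \<epsilon> by (auto simp: h_def \<eta> D_def)
      then show ?thesis using zero_U by (auto intro!: image_eqI[of _ _ 0])
    qed
    moreover have "(\<lambda>y. - p + y) -` (U \<inter> \<phi> -` ((\<lambda>v. \<phi> (h v)) ` D)) \<subseteq> range E"
    proof
      fix y assume y: "y \<in> (\<lambda>y. - p + y) -` (U \<inter> \<phi> -` ((\<lambda>v. \<phi> (h v)) ` D))"
      then obtain v where v: "v \<in> D" "\<phi> (- p + y) = \<phi> (h v)" by auto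
      then have "- p + y = h v" using y DU by (metis IntD1 \<psi>_\<phi> image_subset_iff vimageD)
      then have "y = E (\<eta> + v)" unfolding h_def by (rule add_left_imp_eq)
      then show "y \<in> range E" by blast
    qed
    ultimately show "\<exists>T. open T \<and> p \<in> T \<and> T \<subseteq> range E" by blast
  qed
  have "closure (range E) \<subseteq> range E"
  proof
    fix g assume g: "g \<in> closure (range E)"
    obtain B where B: "\<And>\<eta>. \<rho> (E \<eta>) \<le> \<rho> g + 1 \<Longrightarrow> norm \<eta> \<le> B" using \<rho>_E_proper by blast
    have "compact (E ` cball 0 B)" by (intro compact_continuous_image E_cont compact_cball)
    then have cl: "closed (E ` cball 0 B)" by (rule compact_imp_closed)
    have "g \<in> closure (E ` cball 0 B)"
      unfolding closure_iff_nhds_not_empty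
    proof (intro allI impI)
      fix X W assume W: "W \<subseteq> X" "open W" "g \<in> W"
      have "open (W \<inter> \<rho> -` {..<\<rho> g + 1})" by (intro open_Int W open_vimage \<rho>_cont) simp
      moreover have "g \<in> W \<inter> \<rho> -` {..<\<rho> g + 1}" using W by simp
      ultimately have "range E \<inter> (W \<inter> \<rho> -` {..<\<rho> g + 1}) \<noteq> {}" using g unfolding closure_iff_nhds_not_empty by blast
      then obtain \<eta> where \<eta>: "E \<eta> \<in> W" "\<rho> (E \<eta>) < \<rho> g + 1" by blast
      then have "\<eta> \<in> cball 0 B" using B[of \<eta>] by simp
      then show "E ` cball 0 B \<inter> X \<noteq> {}" using W \<eta> by blast
    qed
    then show "g \<in> range E" using cl by auto
  qed
  then show "closed (range E)" using closure_subset_eq by blast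
qed simp

text \<open>Outside a small ball of the Lie algebra the lower bound applies with a parameter
  \<open>s \<le> 1\<close>, so \<open>\<rho>\<close> is at least \<open>c\<close> there;
  surjectivity of \<open>E\<close> makes this a statement about all points of the group.\<close>

lemma \<rho>_small:
  assumes W: "open W" "0 \<in> W"
  shows "\<exists>\<delta>>0. \<forall>p. \<rho> p < \<delta> \<longrightarrow> p \<in> W"
proof -
  obtain \<epsilon> where \<epsilon>: "\<epsilon> > 0" "\<And>\<xi>. norm \<xi> < \<epsilon> \<Longrightarrow> E \<xi> = 0 \<Longrightarrow> \<xi> = 0" using E_injective_near_0 by blast
  have "open (E -` W)" by (rule open_vimage[OF W(1) E_cont])
  moreover have "0 \<in> E -` W" using W by simp
  ultimately obtain d where d: "d > 0" "ball 0 d \<subseteq> E -` W" by (meson open_contains_ball)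
  define r where "r = min d \<epsilon> / 2"
  have r: "r > 0" "r < \<epsilon>" "r < d" using \<epsilon>(1) d(1) by (auto simp: r_def)
  have "E \<xi> \<noteq> 0" if "norm \<xi> = r" for \<xi> using \<epsilon>(2)[of \<xi>] that r by auto
  from \<rho>_lower_bound[OF r(1) this]
  obtain c where c: "c > 0" "\<And>\<eta>. norm \<eta> \<ge> r \<Longrightarrow> \<exists>s. 0 < s \<and> s \<le> 1 \<and> norm (\<Delta> s \<eta>) = r \<and> c \<le> s * \<rho> (E \<eta>)" by blast
  have "p \<in> W" if p: "\<rho> p < c" for p
  proof -
    obtain \<eta> where \<eta>: "p = E \<eta>" using E_surj by blast
    have "norm \<eta> < r"
    proof (rule ccontr)
      assume "\<not> norm \<eta> < r"
      then obtain s where s: "0 < s" "s \<le> 1" "c \<le> s * \<rho> (E \<eta>)" using c(2)[of \<eta>] by auto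
      have "s * \<rho> (E \<eta>) \<le> 1 * \<rho> (E \<eta>)" using s \<rho>_nonneg by (intro mult_right_mono) auto
      then show False using s p \<eta> by simp
    qed
    then have "\<eta> \<in> ball 0 d" using r by simp
    then show ?thesis using d \<eta> by auto
  qed
  then show ?thesis using c(1) by blast
qed

text \<open>For \<open>h\<close> in \<open>Hgam \<xi>\<close> close to \<open>1\<close>, the value
  of \<open>Exp\<close> at \<open>(1 - h) *\<^sub>R \<xi>\<close> equals
  \<open>Exp \<xi> - E (h *\<^sub>R \<xi>)\<close>, which is still in \<open>U\<close>, and its time
  is small. Hence \<open>1 - h\<close> belongs to the subgroup \<open>Hgam \<xi>\<close>, and so
  does \<open>1\<close>.\<close>

lemma Exp_eq_E_if_close:
  assumes close: "Exp \<xi> - E \<xi> \<in> U"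
  shows "Exp \<xi> = E \<xi>"
proof -
  obtain d where d: "d > 0" "\<And>t. \<bar>t\<bar> < d \<Longrightarrow> Exp (t *\<^sub>R \<xi>) \<in> U \<Longrightarrow> Exp (t *\<^sub>R \<xi>) = gam \<xi> t"
    using gam_eq by blast
  define g where "g h = Exp \<xi> + - E (h *\<^sub>R \<xi>)" for h
  have "isCont g 1"
  proof -
    have "continuous_on UNIV g" unfolding g_def by (intro continuous_intros E_line_cont)
    then show ?thesis by (simp add: continuous_on_eq_continuous_at)
  qed
  then have "(g \<longlongrightarrow> g 1) (nhds 1)" unfolding isCont_def tendsto_at_iff_tendsto_nhds .
  moreover have "g 1 \<in> U" using close by (simp add: g_def)
  ultimately have "eventually (\<lambda>h. g h \<in> U) (nhds 1)" using open_U topological_tendstoD by blast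
  then obtain e where e: "e > 0" "\<And>h. \<bar>h - 1\<bar> < e \<Longrightarrow> g h \<in> U"
    by (auto simp: eventually_nhds_metric dist_real_def)
  obtain h where h: "h \<in> Hgam \<xi>" "h \<le> 1" "1 < h + min d e"
    using Hgam_approx[of "min d e" \<xi> 1] d(1) e(1) by auto
  have gh: "g h = Exp ((1 - h) *\<^sub>R \<xi>)"
    using h(1) line_hom_diff[OF Exp_line_hom, of 1 h \<xi>] by (simp add: g_def Hgam_def gam_E)
  have "\<bar>h - 1\<bar> < e" "\<bar>1 - h\<bar> < d" using h by auto
  then have "1 - h \<in> Hgam \<xi>" using d(2)[of "1 - h"] e(2)[of h] by (simp add: gh Hgam_def)
  then have "(1 - h) + h \<in> Hgam \<xi>" using Hgam_subgroup h(1) by (simp only: real_subgroup_def)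
  then show ?thesis by (simp add: Hgam_def gam_E)
qed

text \<open>A strong contraction brings \<open>Exp\<close> and \<open>E\<close> of the dilated
  vector so close to \<open>0\<close> that \<open>Exp_eq_E_if_close\<close> applies; homogeneity
  scales the equality of norms back.\<close>

lemma \<rho>_Exp: "\<rho> (Exp \<xi>) = \<rho> (E \<xi>)"
proof -
  obtain N where N: "open N" "0 \<in> N" "\<And>x y. x \<in> N \<Longrightarrow> y \<in> N \<Longrightarrow> x - y \<in> U"
    using topological_group_nbhd[OF open_U zero_U] by metis
  obtain \<delta> where \<delta>: "\<delta> > 0" "\<And>p. \<rho> p < \<delta> \<Longrightarrow> p \<in> N" using \<rho>_small[OF N(1,2)] by blast
  define M where "M = \<rho> (Exp \<xi>) + \<rho> (E \<xi>) + 1"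
  have M: "M > 0" using \<rho>_nonneg[of "Exp \<xi>"] \<rho>_nonneg[of "E \<xi>"] by (simp add: M_def)
  define s where "s = \<delta> / M"
  have s: "s > 0" using M \<delta>(1) by (simp add: s_def)
  have "s * \<rho> (Exp \<xi>) < s * M" "s * \<rho> (E \<xi>) < s * M"
    using \<rho>_nonneg[of "Exp \<xi>"] \<rho>_nonneg[of "E \<xi>"] s by (auto simp: M_def)
  moreover have "s * M = \<delta>" using M by (simp add: s_def)
  ultimately have "Exp (\<Delta> s \<xi>) \<in> N" "E (\<Delta> s \<xi>) \<in> N"
    using \<delta>(2) \<rho>_Exp_dilation[OF s, of \<xi>] \<rho>_E_dilation[OF s, of \<xi>] by auto
  then have "Exp (\<Delta> s \<xi>) = E (\<Delta> s \<xi>)" by (intro Exp_eq_E_if_close N)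
  then show ?thesis using \<rho>_Exp_dilation[OF s, of \<xi>] \<rho>_E_dilation[OF s, of \<xi>] s by simp
qed

text \<open>Equality of norms shows that \<open>Exp\<close> really stays in the chart at small times
  of each line. Some reciprocal of a positive integer is therefore in \<open>Hgam \<xi>\<close>, and
  with it \<open>1\<close>.\<close>

lemma Exp_eq_E: "Exp = E"
proof
  fix \<xi>
  obtain d where d: "d > 0" "\<And>t. \<bar>t\<bar> < d \<Longrightarrow> Exp (t *\<^sub>R \<xi>) \<in> U \<Longrightarrow> Exp (t *\<^sub>R \<xi>) = gam \<xi> t"
    using gam_eq by blast
  obtain \<delta> where \<delta>: "\<delta> > 0" "\<And>p. \<rho> p < \<delta> \<Longrightarrow> p \<in> U" using \<rho>_small[OF open_U zero_U] by blast
  have "((\<lambda>t. \<rho> (E (t *\<^sub>R \<xi>))) \<longlongrightarrow> \<rho> 0) (nhds 0)"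
    using E_vel[of \<xi>] by (intro \<rho>_tendsto) (simp add: vel_def)
  moreover have "\<rho> 0 = 0" by (simp add: \<rho>_eq_0)
  ultimately have "eventually (\<lambda>t. \<rho> (E (t *\<^sub>R \<xi>)) < \<delta>) (nhds 0)" using \<delta>(1) order_tendstoD(2) by metis
  then obtain e where e: "e > 0" "\<And>t. \<bar>t\<bar> < e \<Longrightarrow> \<rho> (E (t *\<^sub>R \<xi>)) < \<delta>"
    by (auto simp: eventually_nhds_metric dist_real_def)
  obtain n where n: "inverse (real (Suc n)) < min d e" using reals_Archimedean[of "min d e"] d(1) e(1) by auto
  define t where "t = inverse (real (Suc n))"
  have t: "0 < t" "t < d" "t < e" using n by (auto simp: t_def)
  then have "t \<in> Hgam \<xi>" using d(2)[of t] \<delta>(2) e(2)[of t] \<rho>_Exp by (simp add: Hgam_def)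
  from real_subgroup_mult[OF Hgam_subgroup this, of "int (Suc n)"]
  have "1 \<in> Hgam \<xi>" by (simp add: t_def)
  then show "Exp \<xi> = E \<xi>" by (simp add: Hgam_def gam_E)
qed

subsection \<open>Invariant vector fields in charts\<close>

lemma Exp_E: "Exp \<xi> = E \<xi>"
  by (rule fun_cong[OF Exp_eq_E])

lemma left_inv_field_E: "left_inv_field Exp \<xi> f p = deriv (\<lambda>t. f (p + E (t *\<^sub>R \<xi>))) 0"
proof -
  have "(\<lambda>t. f (p + Exp (t *\<^sub>R \<xi>))) = (\<lambda>t. f (p + E (t *\<^sub>R \<xi>)))"
    by (rule ext) (rule arg_cong[OF Exp_E])
  then show ?thesis unfolding left_inv_field_def by (rule arg_cong)
qed

lemma right_inv_field_E: "right_inv_field Exp \<xi> f p = deriv (\<lambda>t. f (E (t *\<^sub>R \<xi>) + p)) 0"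
proof -
  have "(\<lambda>t. f (Exp (t *\<^sub>R \<xi>) + p)) = (\<lambda>t. f (E (t *\<^sub>R \<xi>) + p))"
    by (rule ext) (rule arg_cong[OF Exp_E])
  then show ?thesis unfolding right_inv_field_def by (rule arg_cong)
qed

lemma L_Ck: assumes "n \<le> 1" shows "Ck_on n N0 (\<lambda>x. L x v)"
proof (cases "n = 0")
  case True
  then show ?thesis using Ck_on_SucD[OF L_C1[of v, unfolded One_nat_def]] by (simp only:)
next
  case False
  then have "n = 1" using assms by simp
  then show ?thesis using L_C1 by (simp only:)
qed

lemma R_Ck: assumes "n \<le> 1" shows "Ck_on n N0 (\<lambda>x. R x v)"
proof (cases "n = 0")
  case True
  then show ?thesis using Ck_on_SucD[OF R_C1[of v, unfolded One_nat_def]] by (simp only:)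
next
  case False
  then have "n = 1" using assms by simp
  then show ?thesis using R_C1 by (simp only:)
qed

text \<open>With \<open>h\<close> the translated chart expression of \<open>f\<close>, the field is
  \<open>h' x (L x (T \<xi>))\<close>. Expanding \<open>L x (T \<xi>)\<close> in the basis gives its
  regularity, up to the order recorded in \<open>L_C1\<close>.\<close>

lemma left_chart_fields:
  fixes f :: "'g \<Rightarrow> real"
  assumes n: "n \<le> 1" and B: "open B" and f: "manifold_Ck_on A (Suc n) B f" and p: "p \<in> B"
  shows "\<exists>N. open N \<and> x0 \<in> N \<and> N \<subseteq> N0 \<and> (\<forall>x\<in>N. p + \<psi> x \<in> B) \<and>
    (\<forall>\<xi>. Ck_on n N (\<lambda>x. left_inv_field Exp \<xi> f (p + \<psi> x))) \<and>
    (\<forall>\<xi>. \<forall>x\<in>N. ((\<lambda>t. f (p + \<psi> x + E (t *\<^sub>R \<xi>))) has_real_derivative left_inv_field Exp \<xi> f (p + \<psi> x)) (at 0))"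
proof -
  have p0: "p + 0 \<in> B" using p by simp
  obtain N where N: "open N" "x0 \<in> N" "N \<subseteq> N0" "\<forall>x\<in>N. p + \<psi> x \<in> B" "Ck_on (Suc n) N (\<lambda>x. f (p + \<psi> x))"
    using translate_Ck[OF B f p0] by auto
  define h where "h x = f (p + \<psi> x)" for x
  obtain h' where h': "\<And>x. x \<in> N \<Longrightarrow> (h has_derivative h' x) (at x)" "\<And>v. Ck_on n N (\<lambda>x. h' x v)"
    using N(5) by (auto simp: h_def[abs_def])
  have d: "((\<lambda>t. f (p + \<psi> x + E (t *\<^sub>R \<xi>))) has_real_derivative h' x (L x (T \<xi>))) (at 0)" if x: "x \<in> N" for x \<xi>
  proof -
    have xN: "x \<in> N0" using x N by blast
    have "((\<lambda>t. \<phi> (E (t *\<^sub>R \<xi>))) has_derivative (\<lambda>t. t *\<^sub>R T \<xi>)) (at 0)"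
      using E_vel[of \<xi>] by (simp add: vel_def has_vector_derivative_def)
    from has_derivative_compose[OF this, of "\<lambda>y. F (x, y)" "L x"] L_deriv[OF xN]
    have 1: "((\<lambda>t. F (x, \<phi> (E (t *\<^sub>R \<xi>)))) has_derivative (\<lambda>t. L x (t *\<^sub>R T \<xi>))) (at 0)"
      by (simp add: x0_def[symmetric])
    have "F (x, \<phi> (E (0 *\<^sub>R \<xi>))) = x" using xN by (simp add: F_def x0_def[symmetric])
    then have "((\<lambda>t. h (F (x, \<phi> (E (t *\<^sub>R \<xi>))))) has_derivative (\<lambda>t. h' x (L x (t *\<^sub>R T \<xi>)))) (at 0)"
      using has_derivative_compose[OF 1, of h "h' x"] h'(1)[OF x] by simp
    moreover have "h' x (L x (t *\<^sub>R T \<xi>)) = h' x (L x (T \<xi>)) * t" for t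
      using linear_scale[OF L_linear[OF xN]] linear_scale[OF has_derivative_linear[OF h'(1)[OF x]]] by simp
    ultimately have 2: "((\<lambda>t. h (F (x, \<phi> (E (t *\<^sub>R \<xi>))))) has_derivative (\<lambda>t. h' x (L x (T \<xi>)) * t)) (at 0)"
      by simp
    have "open ((\<lambda>t. \<psi> x + E (t *\<^sub>R \<xi>)) -` U \<inter> (\<lambda>t. E (t *\<^sub>R \<xi>)) -` U)"
      by (intro open_Int open_vimage open_U continuous_intros E_line_cont)
    moreover have "0 \<in> (\<lambda>t. \<psi> x + E (t *\<^sub>R \<xi>)) -` U \<inter> (\<lambda>t. E (t *\<^sub>R \<xi>)) -` U"
      using zero_U \<psi>_U[OF xN] by simp
    ultimately have "((\<lambda>t. f (p + \<psi> x + E (t *\<^sub>R \<xi>))) has_derivative (\<lambda>t. h' x (L x (T \<xi>)) * t)) (at 0)"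
      by (rule has_derivative_transform_within_open[OF 2]) (auto simp: F_def h_def add.assoc)
    then show ?thesis by (simp add: has_field_derivative_def)
  qed
  have eq: "left_inv_field Exp \<xi> f (p + \<psi> x) = h' x (L x (T \<xi>))" if "x \<in> N" for x \<xi>
    unfolding left_inv_field_E using d[OF that] by (rule DERIV_imp_deriv)
  have "Ck_on n N (\<lambda>x. left_inv_field Exp \<xi> f (p + \<psi> x))" for \<xi>
  proof (rule Ck_on_cong[OF N(1)])
    show "Ck_on n N (\<lambda>x. \<Sum>b\<in>Basis. (L x (T \<xi>) \<bullet> b) *\<^sub>R h' x b)"
      by (intro Ck_on_sum Ck_on_scaleR Ck_on_linear[OF bounded_linear_inner_left] h'(2)
          Ck_on_subset[OF L_Ck[OF n] N(3)])
    show "(\<Sum>b\<in>Basis. (L x (T \<xi>) \<bullet> b) *\<^sub>R h' x b) = left_inv_field Exp \<xi> f (p + \<psi> x)" if "x \<in> N" for x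
      unfolding eq[OF that] by (rule linear_euclidean_expand[OF has_derivative_linear[OF h'(1)[OF that]], symmetric])
  qed
  then show ?thesis using N d eq by (intro exI[of _ N]) simp
qed

lemma right_chart_fields:
  fixes f :: "'g \<Rightarrow> real"
  assumes n: "n \<le> 1" and B: "open B" and f: "manifold_Ck_on A (Suc n) B f" and p: "p \<in> B"
  shows "\<exists>N. open N \<and> x0 \<in> N \<and> N \<subseteq> N0 \<and> (\<forall>x\<in>N. \<psi> x + p \<in> B) \<and>
    (\<forall>\<xi>. Ck_on n N (\<lambda>x. right_inv_field Exp \<xi> f (\<psi> x + p))) \<and>
    (\<forall>x\<in>N. linear (\<lambda>\<xi>. right_inv_field Exp \<xi> f (\<psi> x + p))) \<and>
    (\<forall>\<xi>. \<forall>x\<in>N. ((\<lambda>t. f (E (t *\<^sub>R \<xi>) + (\<psi> x + p))) has_real_derivative right_inv_field Exp \<xi> f (\<psi> x + p)) (at 0))"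
proof -
  have p0: "0 + p \<in> B" using p by simp
  obtain N where N: "open N" "x0 \<in> N" "N \<subseteq> N0" "\<forall>x\<in>N. \<psi> x + p \<in> B" "Ck_on (Suc n) N (\<lambda>x. f (\<psi> x + p))"
    using translate_Ck[OF B f p0] by auto
  define h where "h x = f (\<psi> x + p)" for x
  obtain h' where h': "\<And>x. x \<in> N \<Longrightarrow> (h has_derivative h' x) (at x)" "\<And>v. Ck_on n N (\<lambda>x. h' x v)"
    using N(5) by (auto simp: h_def[abs_def])
  have d: "((\<lambda>t. f (E (t *\<^sub>R \<xi>) + (\<psi> x + p))) has_real_derivative h' x (R x (T \<xi>))) (at 0)" if x: "x \<in> N" for x \<xi>
  proof -
    have xN: "x \<in> N0" using x N by blast
    have "((\<lambda>t. \<phi> (E (t *\<^sub>R \<xi>))) has_derivative (\<lambda>t. t *\<^sub>R T \<xi>)) (at 0)"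
      using E_vel[of \<xi>] by (simp add: vel_def has_vector_derivative_def)
    from has_derivative_compose[OF this, of "\<lambda>y. F (y, x)" "R x"] R_deriv[OF xN]
    have 1: "((\<lambda>t. F (\<phi> (E (t *\<^sub>R \<xi>)), x)) has_derivative (\<lambda>t. R x (t *\<^sub>R T \<xi>))) (at 0)"
      by (simp add: x0_def[symmetric])
    have "F (\<phi> (E (0 *\<^sub>R \<xi>)), x) = x" using xN by (simp add: F_def x0_def[symmetric])
    then have "((\<lambda>t. h (F (\<phi> (E (t *\<^sub>R \<xi>)), x))) has_derivative (\<lambda>t. h' x (R x (t *\<^sub>R T \<xi>)))) (at 0)"
      using has_derivative_compose[OF 1, of h "h' x"] h'(1)[OF x] by simp
    moreover have "h' x (R x (t *\<^sub>R T \<xi>)) = h' x (R x (T \<xi>)) * t" for t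
      using linear_scale[OF R_linear[OF xN]] linear_scale[OF has_derivative_linear[OF h'(1)[OF x]]] by simp
    ultimately have 2: "((\<lambda>t. h (F (\<phi> (E (t *\<^sub>R \<xi>)), x))) has_derivative (\<lambda>t. h' x (R x (T \<xi>)) * t)) (at 0)"
      by simp
    have "open ((\<lambda>t. E (t *\<^sub>R \<xi>) + \<psi> x) -` U \<inter> (\<lambda>t. E (t *\<^sub>R \<xi>)) -` U)"
      by (intro open_Int open_vimage open_U continuous_intros E_line_cont)
    moreover have "0 \<in> (\<lambda>t. E (t *\<^sub>R \<xi>) + \<psi> x) -` U \<inter> (\<lambda>t. E (t *\<^sub>R \<xi>)) -` U"
      using zero_U \<psi>_U[OF xN] by simp
    ultimately have "((\<lambda>t. f (E (t *\<^sub>R \<xi>) + (\<psi> x + p))) has_derivative (\<lambda>t. h' x (R x (T \<xi>)) * t)) (at 0)"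
      by (rule has_derivative_transform_within_open[OF 2]) (auto simp: F_def h_def add.assoc)
    then show ?thesis by (simp add: has_field_derivative_def)
  qed
  have eq: "right_inv_field Exp \<xi> f (\<psi> x + p) = h' x (R x (T \<xi>))" if "x \<in> N" for x \<xi>
    unfolding right_inv_field_E using d[OF that] by (rule DERIV_imp_deriv)
  have "Ck_on n N (\<lambda>x. right_inv_field Exp \<xi> f (\<psi> x + p))" for \<xi>
  proof (rule Ck_on_cong[OF N(1)])
    show "Ck_on n N (\<lambda>x. \<Sum>b\<in>Basis. (R x (T \<xi>) \<bullet> b) *\<^sub>R h' x b)"
      by (intro Ck_on_sum Ck_on_scaleR Ck_on_linear[OF bounded_linear_inner_left] h'(2)
          Ck_on_subset[OF R_Ck[OF n] N(3)])
    show "(\<Sum>b\<in>Basis. (R x (T \<xi>) \<bullet> b) *\<^sub>R h' x b) = right_inv_field Exp \<xi> f (\<psi> x + p)" if "x \<in> N" for x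
      unfolding eq[OF that] by (rule linear_euclidean_expand[OF has_derivative_linear[OF h'(1)[OF that]], symmetric])
  qed
  moreover have "linear (\<lambda>\<xi>. right_inv_field Exp \<xi> f (\<psi> x + p))" if "x \<in> N" for x
  proof -
    have "linear (R x)" using N(3) that by (intro R_linear) blast
    from linear_compose[OF linear_compose[OF T_linear this] has_derivative_linear[OF h'(1)[OF that]]]
    show ?thesis unfolding eq[OF that] by (simp add: o_def)
  qed
  ultimately show ?thesis using N d eq by (intro exI[of _ N]) simp
qed

lemma left_field_deriv:
  fixes f :: "'g \<Rightarrow> real"
  assumes B: "open B" and f: "manifold_Ck_on A 2 B f" and p: "p + E (t *\<^sub>R \<xi>) \<in> B"
  shows "((\<lambda>t. f (p + E (t *\<^sub>R \<xi>))) has_real_derivative left_inv_field Exp \<xi> f (p + E (t *\<^sub>R \<xi>))) (at t)"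
    and "((\<lambda>t. left_inv_field Exp \<xi> f (p + E (t *\<^sub>R \<xi>))) has_real_derivative
      left_inv_field Exp \<xi> (left_inv_field Exp \<xi> f) (p + E (t *\<^sub>R \<xi>))) (at t)"
proof -
  define q where "q = p + E (t *\<^sub>R \<xi>)"
  have f2: "manifold_Ck_on A (Suc 1) B f" using f by (simp only: Suc_1)
  have q: "q \<in> B" using p by (simp only: q_def)
  have sh: "p + E ((t + h) *\<^sub>R \<xi>) = q + E (h *\<^sub>R \<xi>)" for h by (simp add: q_def E_add add.assoc)
  have shift: "(g has_real_derivative D) (at t)" if "((\<lambda>h. g (t + h)) has_real_derivative D) (at 0)" for g D
    using shift_vector_derivative[of g t D] that by (simp add: has_real_derivative_iff_has_vector_derivative)
  obtain N where N: "open N" "x0 \<in> N" "N \<subseteq> N0"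
    "\<forall>\<xi>. Ck_on 1 N (\<lambda>x. left_inv_field Exp \<xi> f (q + \<psi> x))"
    "\<forall>\<xi>. \<forall>x\<in>N. ((\<lambda>t. f (q + \<psi> x + E (t *\<^sub>R \<xi>))) has_real_derivative left_inv_field Exp \<xi> f (q + \<psi> x)) (at 0)"
    using left_chart_fields[OF le_refl B f2 q] by (elim exE conjE)
  show "((\<lambda>t. f (p + E (t *\<^sub>R \<xi>))) has_real_derivative left_inv_field Exp \<xi> f (p + E (t *\<^sub>R \<xi>))) (at t)"
  proof (rule shift)
    have "((\<lambda>h. f (q + E (h *\<^sub>R \<xi>))) has_real_derivative left_inv_field Exp \<xi> f q) (at 0)"
      using N(5)[rule_format, OF N(2), of \<xi>] by simp
    then show "((\<lambda>h. f (p + E ((t + h) *\<^sub>R \<xi>))) has_real_derivative left_inv_field Exp \<xi> f (p + E (t *\<^sub>R \<xi>))) (at 0)"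
      unfolding sh by (simp only: q_def)
  qed
  obtain D where D: "((\<lambda>x. left_inv_field Exp \<xi> f (q + \<psi> x + 0)) has_derivative D) (at x0)"
    using N(4)[rule_format, of \<xi>] N(2) by (auto simp: One_nat_def)
  from deriv_along[where f = "left_inv_field Exp \<xi> f" and p = q and q = 0, OF D E_vel[of \<xi>]]
  have *: "((\<lambda>h. left_inv_field Exp \<xi> f (q + E (h *\<^sub>R \<xi>))) has_real_derivative D (T \<xi>)) (at 0)"
    by (simp add: has_real_derivative_iff_has_vector_derivative)
  then have "left_inv_field Exp \<xi> (left_inv_field Exp \<xi> f) q = D (T \<xi>)"
    unfolding left_inv_field_E[of \<xi> "left_inv_field Exp \<xi> f"] by (rule DERIV_imp_deriv)
  with * show "((\<lambda>t. left_inv_field Exp \<xi> f (p + E (t *\<^sub>R \<xi>))) has_real_derivative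
      left_inv_field Exp \<xi> (left_inv_field Exp \<xi> f) (p + E (t *\<^sub>R \<xi>))) (at t)"
    by (intro shift) (simp only: sh q_def[symmetric])
qed

lemma right_field_deriv:
  fixes f :: "'g \<Rightarrow> real"
  assumes B: "open B" and f: "manifold_Ck_on A 2 B f" and p: "E (t *\<^sub>R \<xi>) + p \<in> B"
  shows "((\<lambda>t. f (E (t *\<^sub>R \<xi>) + p)) has_real_derivative right_inv_field Exp \<xi> f (E (t *\<^sub>R \<xi>) + p)) (at t)"
proof -
  define q where "q = E (t *\<^sub>R \<xi>) + p"
  have f2: "manifold_Ck_on A (Suc 1) B f" using f by (simp only: Suc_1)
  have q: "q \<in> B" using p by (simp only: q_def)
  have sh: "E ((t + h) *\<^sub>R \<xi>) + p = E (h *\<^sub>R \<xi>) + q" for h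
    unfolding q_def using E_add[of h t \<xi>] by (simp add: add.assoc add.commute[of t h])
  obtain N where N: "x0 \<in> N"
    "\<forall>\<xi>. \<forall>x\<in>N. ((\<lambda>t. f (E (t *\<^sub>R \<xi>) + (\<psi> x + q))) has_real_derivative right_inv_field Exp \<xi> f (\<psi> x + q)) (at 0)"
    using right_chart_fields[OF le_refl B f2 q] by (elim exE conjE)
  have "((\<lambda>h. f (E (h *\<^sub>R \<xi>) + q)) has_real_derivative right_inv_field Exp \<xi> f q) (at 0)"
    using N(2)[rule_format, OF N(1), of \<xi>] by simp
  then have "((\<lambda>h. f (E ((t + h) *\<^sub>R \<xi>) + p)) has_vector_derivative right_inv_field Exp \<xi> f q) (at 0)"
    unfolding sh by (simp only: has_real_derivative_iff_has_vector_derivative)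
  from shift_vector_derivative[where g = "\<lambda>t. f (E (t *\<^sub>R \<xi>) + p)", OF this]
  show ?thesis by (simp only: has_real_derivative_iff_has_vector_derivative q_def)
qed

lemma right_field_linear:
  fixes f :: "'g \<Rightarrow> real"
  assumes B: "open B" and f: "manifold_Ck_on A 2 B f" and p: "p \<in> B"
  shows "linear (\<lambda>\<xi>. right_inv_field Exp \<xi> f p)"
proof -
  have f2: "manifold_Ck_on A (Suc 1) B f" using f by (simp only: Suc_1)
  obtain N where N: "x0 \<in> N" "\<forall>x\<in>N. linear (\<lambda>\<xi>. right_inv_field Exp \<xi> f (\<psi> x + p))"
    using right_chart_fields[OF le_refl B f2 p] by (elim exE conjE)
  show ?thesis using bspec[OF N(2,1)] by simp
qed

lemma right_field_cont:
  fixes f :: "'g \<Rightarrow> real"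
  assumes B: "open B" and f: "manifold_Ck_on A 2 B f"
  shows "continuous_on B (right_inv_field Exp \<xi> f)"
proof (rule continuous_at_imp_continuous_on, rule ballI)
  fix p assume p: "p \<in> B"
  have f2: "manifold_Ck_on A (Suc 1) B f" using f by (simp only: Suc_1)
  obtain N where N: "open N" "x0 \<in> N" "N \<subseteq> N0" "\<forall>\<xi>. Ck_on 1 N (\<lambda>x. right_inv_field Exp \<xi> f (\<psi> x + p))"
    using right_chart_fields[OF le_refl B f2 p] by (elim exE conjE)
  have "continuous_on N (\<lambda>x. right_inv_field Exp \<xi> f (\<psi> x + p))"
    using Ck_on_SucD[OF N(4)[rule_format, of \<xi>, unfolded One_nat_def]] by simp
  then have c1: "isCont (\<lambda>x. right_inv_field Exp \<xi> f (\<psi> x + p)) x0"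
    using N by (simp add: continuous_on_eq_continuous_at)
  have "((\<lambda>q. q + - p) \<longlongrightarrow> p + - p) (at p)" by (intro tendsto_intros)
  then have lim: "((\<lambda>q. q + - p) \<longlongrightarrow> 0) (at p)" by simp
  have "((\<lambda>q. \<phi> (q + - p)) \<longlongrightarrow> x0) (at p)"
    using isCont_tendsto_compose[OF isCont_\<phi>[OF zero_U] lim] by (simp add: x0_def)
  from isCont_tendsto_compose[OF c1 this]
  have *: "((\<lambda>q. right_inv_field Exp \<xi> f (\<psi> (\<phi> (q + - p)) + p)) \<longlongrightarrow> right_inv_field Exp \<xi> f p) (at p)"
    by simp
  have "eventually (\<lambda>q. q + - p \<in> U) (at p)" by (rule topological_tendstoD[OF lim open_U zero_U])
  then have "eventually (\<lambda>q. right_inv_field Exp \<xi> f (\<psi> (\<phi> (q + - p)) + p) = right_inv_field Exp \<xi> f q) (at p)"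
    by eventually_elim (simp add: add.assoc del: add_uminus_conv_diff)
  from Lim_transform_eventually[OF * this] show "isCont (right_inv_field Exp \<xi> f) p" by (simp add: isCont_def)
qed

text \<open>Exchange \<open>c\<close> for the exponential line with the same velocity, then move
  \<open>p\<close> across it; this costs \<open>Ad p\<close>.\<close>

lemma curve_deriv_eq_field:
  fixes f :: "'g \<Rightarrow> real"
  assumes B: "open B" and f: "manifold_Ck_on A 2 B f" and p: "p + q \<in> B" and c: "vel c (T \<eta>)"
  shows "((\<lambda>h. f (p + c h + q)) has_real_derivative right_inv_field Exp (Ad p \<eta>) f (p + q)) (at 0)"
proof -
  have f2: "manifold_Ck_on A (Suc 1) B f" using f by (simp only: Suc_1)
  obtain D where D: "((\<lambda>x. f (p + \<psi> x + q)) has_derivative D) (at x0)"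
    using translate_deriv[OF B f2 p] by blast
  have 1: "((\<lambda>h. f (p + c h + q)) has_real_derivative D (T \<eta>)) (at 0)"
    using deriv_along[where f = f and p = p and q = q, OF D c] by (simp add: has_real_derivative_iff_has_vector_derivative)
  have 2: "((\<lambda>h. f (p + E (h *\<^sub>R \<eta>) + q)) has_real_derivative D (T \<eta>)) (at 0)"
    using deriv_along[where f = f and p = p and q = q, OF D E_vel] by (simp add: has_real_derivative_iff_has_vector_derivative)
  have "((\<lambda>h. f (E (h *\<^sub>R Ad p \<eta>) + (p + q))) has_real_derivative right_inv_field Exp (Ad p \<eta>) f (p + q)) (at 0)"
    using right_field_deriv[OF B f, of 0 "Ad p \<eta>" "p + q"] p by simp
  then have "((\<lambda>h. f (p + E (h *\<^sub>R \<eta>) + q)) has_real_derivative right_inv_field Exp (Ad p \<eta>) f (p + q)) (at 0)"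
    unfolding Ad_swap by (simp add: add.assoc)
  with 1 2 show ?thesis using DERIV_unique by metis
qed

end

subsection \<open>The strong maximum principle\<close>

locale carnot_function = carnot_chart A Exp bracket k V U \<phi> \<rho>
  for A :: "('g::{topological_group_add, t2_space}, 'a::euclidean_space) chart set"
    and Exp :: "'a \<Rightarrow> 'g" and bracket :: "'a \<Rightarrow> 'a \<Rightarrow> 'a" and k :: nat and V :: "nat \<Rightarrow> 'a set"
    and U :: "'g set" and \<phi> :: "'g \<Rightarrow> 'a" and \<rho> :: "'g \<Rightarrow> real" +
  fixes m :: nat and e :: "nat \<Rightarrow> 'a" and f :: "'g \<Rightarrow> real" and B :: "'g set" and c :: real
  assumes onb: "orthonormal_basis_of (V 1) m e"
    and open_B: "open B" and zero_B: "0 \<in> B"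
    and f_C2: "manifold_Ck_on A 2 B f"
    and laplacian: "\<And>p. p \<in> B \<Longrightarrow> horizontal_laplacian Exp m e f p = c"
    and gradient_le: "\<And>p. p \<in> B \<Longrightarrow> right_gradient_sq Exp m e f p \<le> 1"
    and gradient_0: "right_gradient_sq Exp m e f 0 = 1"
begin

definition a :: "nat \<Rightarrow> real" where "a i = right_inv_field Exp (e i) f 0"
definition av :: 'a where "av = (\<Sum>i=1..m. a i *\<^sub>R e i)"
definition u :: "'g \<Rightarrow> real" where "u p = 1 - right_inv_field Exp av f p"
text \<open>The quotient approximates \<open>u\<close> for small \<open>t\<close>. The translation
  by \<open>E (t *\<^sub>R av)\<close> acts from the left, so left-invariant fields pass through
  it.\<close>

definition w :: "real \<Rightarrow> 'g \<Rightarrow> real" where "w t q = 1 - (f (E (t *\<^sub>R av) + q) - f q) / t"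

lemma e_inner: "i \<in> {1..m} \<Longrightarrow> j \<in> {1..m} \<Longrightarrow> e i \<bullet> e j = (if i = j then 1 else 0)"
  and span_e: "span (e ` {1..m}) = V 1"
  using onb by (auto simp: orthonormal_basis_of_def)

lemma e_V1: "i \<in> {1..m} \<Longrightarrow> e i \<in> V 1"
  using span_e span_base[of "e i" "e ` {1..m}"] by blast

lemma a_sq: "(\<Sum>i=1..m. (a i)\<^sup>2) = 1"
  using gradient_0 by (simp add: right_gradient_sq_def a_def)

lemma right_field_av: "p \<in> B \<Longrightarrow> right_inv_field Exp av f p = (\<Sum>i=1..m. a i * right_inv_field Exp (e i) f p)"
proof -
  assume "p \<in> B"
  then have lin: "linear (\<lambda>\<xi>. right_inv_field Exp \<xi> f p)" by (rule right_field_linear[OF open_B f_C2])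
  show ?thesis unfolding av_def linear_sum[OF lin] linear_scale[OF lin] by simp
qed

text \<open>Completing the square with \<open>a\<close> a unit vector. Both terms on the right are
  nonnegative, so \<open>u\<close> is nonnegative, and its vanishing forces the right gradient to
  equal \<open>a\<close>.\<close>

lemma u_expand: "p \<in> B \<Longrightarrow>
    2 * u p = (\<Sum>i=1..m. (right_inv_field Exp (e i) f p - a i)\<^sup>2) + (1 - right_gradient_sq Exp m e f p)"
proof -
  assume p: "p \<in> B"
  have "(\<Sum>i=1..m. (right_inv_field Exp (e i) f p - a i)\<^sup>2) =
      (\<Sum>i=1..m. (right_inv_field Exp (e i) f p)\<^sup>2 + (a i)\<^sup>2 - 2 * (a i * right_inv_field Exp (e i) f p))"
    by (intro sum.cong refl) (simp add: power2_diff mult_ac)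
  also have "\<dots> = right_gradient_sq Exp m e f p + 1 - 2 * right_inv_field Exp av f p"
    by (simp only: sum.distrib sum_subtractf a_sq right_field_av[OF p] sum_distrib_left right_gradient_sq_def)
  finally show ?thesis by (simp add: u_def)
qed

lemma u_nonneg: "p \<in> B \<Longrightarrow> u p \<ge> 0"
proof -
  assume p: "p \<in> B"
  have "0 \<le> 2 * u p" unfolding u_expand[OF p]
    by (intro add_nonneg_nonneg sum_nonneg) (use gradient_le[OF p] in auto)
  then show ?thesis by simp
qed

lemma u_zero_imp: "p \<in> B \<Longrightarrow> u p = 0 \<Longrightarrow> i \<in> {1..m} \<Longrightarrow> right_inv_field Exp (e i) f p = a i"
proof -
  assume p: "p \<in> B" and z: "u p = 0" and i: "i \<in> {1..m}"
  have nn: "0 \<le> (\<Sum>i=1..m. (right_inv_field Exp (e i) f p - a i)\<^sup>2)" by (intro sum_nonneg) simp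
  then have "(\<Sum>i=1..m. (right_inv_field Exp (e i) f p - a i)\<^sup>2) = 0"
    using u_expand[OF p] z gradient_le[OF p] by linarith
  then have "(right_inv_field Exp (e i) f p - a i)\<^sup>2 = 0"
    using i by (subst (asm) sum_nonneg_eq_0_iff) auto
  then show ?thesis by simp
qed

lemma u_0: "u 0 = 0"
  using u_expand[OF zero_B] gradient_0 by (simp add: a_def)

lemma u_cont: "continuous_on B u"
  unfolding u_def[abs_def] by (intro continuous_intros right_field_cont[OF open_B f_C2])

text \<open>By the mean value theorem \<open>w t\<close> is the value of \<open>u\<close> at a point
  slightly shifted by the subgroup of \<open>av\<close>; uniform continuity on a compact product
  makes the approximation uniform in the base point.\<close>

lemma local_approximation:
  assumes p: "p \<in> B"
  obtains r t0 where "r > 0" "t0 > 0" "cball x0 r \<subseteq> N0"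
    "\<And>x t. x \<in> cball x0 r \<Longrightarrow> \<bar>t\<bar> \<le> t0 \<Longrightarrow> E (t *\<^sub>R av) + (p + \<psi> x) \<in> B"
    "\<And>\<eta>. \<eta> > 0 \<Longrightarrow> \<exists>t. 0 < t \<and> t \<le> t0 \<and> (\<forall>x\<in>cball x0 r. \<bar>w t (p + \<psi> x) - u (p + \<psi> x)\<bar> < \<eta>)"
proof -
  define G where "G z = E (fst z *\<^sub>R av) + (p + \<psi> (snd z))" for z :: "real \<times> 'a"
  have Gc: "continuous_on (UNIV \<times> N0) G"
    unfolding G_def
    by (intro continuous_intros continuous_on_compose2[OF E_cont[of UNIV]] continuous_on_compose2[OF cont_\<psi>]) auto
  have "open ((UNIV \<times> N0) \<inter> G -` B)"
    by (intro continuous_open_preimage Gc open_Times open_N0 open_B) simp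
  moreover have "(0, x0) \<in> (UNIV \<times> N0) \<inter> G -` B" using p x0_N0 by (simp add: G_def)
  ultimately obtain O1 O2 where O: "open O1" "open O2" "(0, x0) \<in> O1 \<times> O2" "O1 \<times> O2 \<subseteq> (UNIV \<times> N0) \<inter> G -` B"
    by (rule open_prod_elim)
  obtain t0 where t0: "t0 > 0" "cball 0 t0 \<subseteq> O1" using O by (meson mem_Sigma_iff open_contains_cball)
  obtain r where r: "r > 0" "cball x0 r \<subseteq> O2" using O by (meson mem_Sigma_iff open_contains_cball)
  define K where "K = cball (0::real) t0 \<times> cball x0 r"
  have K: "K \<subseteq> UNIV \<times> N0" "G ` K \<subseteq> B" using O(4) t0 r unfolding K_def by blast+
  have "compact K" unfolding K_def by (intro compact_Times compact_cball)
  moreover have "continuous_on K (\<lambda>z. right_inv_field Exp av f (G z))"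
    by (rule continuous_on_compose2[OF right_field_cont[OF open_B f_C2] continuous_on_subset[OF Gc K(1)] K(2)])
  ultimately have uc: "uniformly_continuous_on K (\<lambda>z. right_inv_field Exp av f (G z))"
    by (rule compact_uniformly_continuous[rotated])
  show thesis
  proof (rule that[OF r(1) t0(1)])
    show "cball x0 r \<subseteq> N0"
    proof
      fix x assume "x \<in> cball x0 r"
      then have "(0, x) \<in> K" using t0(1) by (simp add: K_def)
      then show "x \<in> N0" using K(1) by blast
    qed
    show in_B: "E (t *\<^sub>R av) + (p + \<psi> x) \<in> B" if "x \<in> cball x0 r" "\<bar>t\<bar> \<le> t0" for x t
    proof -
      have "(t, x) \<in> K" using that by (simp add: K_def)
      then have "G (t, x) \<in> B" using K(2) by blast
      then show ?thesis by (simp add: G_def)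
    qed
    fix \<eta> :: real assume "\<eta> > 0"
    then obtain d where d: "d > 0" "\<And>z z'. z \<in> K \<Longrightarrow> z' \<in> K \<Longrightarrow> dist z' z < d \<Longrightarrow>
        \<bar>right_inv_field Exp av f (G z') - right_inv_field Exp av f (G z)\<bar> < \<eta>"
      using uc unfolding uniformly_continuous_on_def by (metis dist_real_def)
    define t where "t = min t0 (d / 2)"
    have t: "0 < t" "t \<le> t0" "t < d" using t0 d by (auto simp: t_def)
    have "\<bar>w t (p + \<psi> x) - u (p + \<psi> x)\<bar> < \<eta>" if x: "x \<in> cball x0 r" for x
    proof -
      define g where "g s = f (E (s *\<^sub>R av) + (p + \<psi> x))" for s
      have "\<exists>z. 0 < z \<and> z < t \<and> g t - g 0 = (t - 0) * right_inv_field Exp av f (E (z *\<^sub>R av) + (p + \<psi> x))"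
        unfolding g_def by (rule MVT2[OF t(1)]) (use t x in \<open>auto intro!: right_field_deriv[OF open_B f_C2] in_B\<close>)
      then obtain z where z: "0 < z" "z < t" "g t - g 0 = t * right_inv_field Exp av f (E (z *\<^sub>R av) + (p + \<psi> x))" by auto
      have zK: "(z, x) \<in> K" "(0, x) \<in> K" using z t x t0(1) by (auto simp: K_def)
      have "dist (z, x) (0, x) < d" using z t by (simp add: dist_Pair_Pair)
      from d(2)[OF zK(2,1) this]
      have "\<bar>right_inv_field Exp av f (E (z *\<^sub>R av) + (p + \<psi> x)) - right_inv_field Exp av f (p + \<psi> x)\<bar> < \<eta>"
        by (simp add: G_def)
      moreover have "w t (p + \<psi> x) = 1 - right_inv_field Exp av f (E (z *\<^sub>R av) + (p + \<psi> x))"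
        using z(3) t(1) by (simp add: w_def g_def)
      ultimately show ?thesis by (simp add: u_def abs_minus_commute)
    qed
    then show "\<exists>t. 0 < t \<and> t \<le> t0 \<and> (\<forall>x\<in>cball x0 r. \<bar>w t (p + \<psi> x) - u (p + \<psi> x)\<bar> < \<eta>)" using t by blast
  qed
qed

section \<open>Barriers and Hopf's lemma\<close>

definition Ld :: "'a \<Rightarrow> 'a \<Rightarrow> 'a \<Rightarrow> 'a" where "Ld v x = frechet_derivative (\<lambda>x. L x v) (at x)"

lemma Ld_deriv: "x \<in> N0 \<Longrightarrow> ((\<lambda>x. L x v) has_derivative Ld v x) (at x)"
  and Ld_cont: "continuous_on N0 (\<lambda>x. Ld v x h)"
proof -
  obtain D where D: "\<forall>x\<in>N0. ((\<lambda>x. L x v) has_derivative D x) (at x)" "\<forall>h. continuous_on N0 (\<lambda>x. D x h)"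
    using L_C1[of v] by (auto simp: One_nat_def)
  have eq: "D x = Ld v x" if "x \<in> N0" for x
    unfolding Ld_def by (rule frechet_derivative_at[OF bspec[OF D(1) that]])
  show "x \<in> N0 \<Longrightarrow> ((\<lambda>x. L x v) has_derivative Ld v x) (at x)" using D(1) eq by metis
  show "continuous_on N0 (\<lambda>x. Ld v x h)"
    by (rule continuous_on_eq[OF D(2)[rule_format]]) (simp add: eq)
qed

text \<open>The acceleration in the chart, at \<open>x\<close>, of the integral curve of the
  left-invariant field with value \<open>v\<close> at the identity.\<close>

definition K2 :: "'a \<Rightarrow> 'a \<Rightarrow> 'a" where "K2 v x = Ld v x (L x v)"

lemma L_cont: "continuous_on N0 (\<lambda>x. L x v)"
  using Ck_on_SucD[OF L_C1[of v, unfolded One_nat_def]] by simp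

lemma K2_cont: "continuous_on N0 (K2 v)"
proof (rule continuous_on_eq)
  show "continuous_on N0 (\<lambda>x. \<Sum>b\<in>Basis. (L x v \<bullet> b) *\<^sub>R Ld v x b)"
    by (intro continuous_intros L_cont Ld_cont)
  show "(\<Sum>b\<in>Basis. (L x v \<bullet> b) *\<^sub>R Ld v x b) = K2 v x" if "x \<in> N0" for x
    unfolding K2_def by (rule linear_euclidean_expand[OF has_derivative_linear[OF Ld_deriv[OF that]], symmetric])
qed

lemma chart_curve_deriv:
  assumes "q + E (s *\<^sub>R \<xi>) \<in> U"
  shows "((\<lambda>s. \<phi> (q + E (s *\<^sub>R \<xi>))) has_vector_derivative L (\<phi> (q + E (s *\<^sub>R \<xi>))) (T \<xi>)) (at s)"
proof (rule shift_vector_derivative)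
  from deriv_along[OF left_chart_deriv[OF assms] E_vel]
  show "((\<lambda>h. \<phi> (q + E ((s + h) *\<^sub>R \<xi>))) has_vector_derivative L (\<phi> (q + E (s *\<^sub>R \<xi>))) (T \<xi>)) (at 0)"
    by (simp add: E_add add.assoc)
qed

lemma chart_curve_second_deriv:
  assumes x: "x \<in> N0"
  shows "((\<lambda>s. L (\<phi> (\<psi> x + E (s *\<^sub>R \<xi>))) (T \<xi>)) has_vector_derivative K2 (T \<xi>) x) (at 0)"
proof -
  have "((\<lambda>s. \<phi> (\<psi> x + E (s *\<^sub>R \<xi>))) has_derivative (\<lambda>h. h *\<^sub>R L x (T \<xi>))) (at 0)"
    using chart_curve_deriv[of "\<psi> x" 0 \<xi>] x by (simp add: \<psi>_U has_vector_derivative_def)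
  from has_derivative_compose[OF this, of "\<lambda>x. L x (T \<xi>)" "Ld (T \<xi>) x"] Ld_deriv[OF x, of "T \<xi>"]
  show ?thesis
    using x by (simp add: K2_def has_vector_derivative_def linear_scale[OF has_derivative_linear[OF Ld_deriv[OF x]]])
qed

text \<open>The term with \<open>\<alpha>\<^sup>2\<close> contains the squared component of the
  velocity normal to the spheres around \<open>y\<close>. For large \<open>\<alpha>\<close> it
  dominates wherever that component is nonzero, which makes the barrier strictly
  subharmonic.\<close>

lemma barrier_deriv:
  fixes \<gamma> \<gamma>' :: "real \<Rightarrow> 'a" and \<alpha> :: real and y :: 'a
  assumes 1: "\<forall>\<^sub>F s in nhds 0. (\<gamma> has_vector_derivative \<gamma>' s) (at s)"
    and 2: "(\<gamma>' has_vector_derivative k2) (at 0)"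
  defines "b \<equiv> \<lambda>s. exp (- \<alpha> * ((\<gamma> s - y) \<bullet> (\<gamma> s - y)))"
  shows "\<forall>\<^sub>F s in nhds 0. (b has_real_derivative - \<alpha> * (2 * ((\<gamma> s - y) \<bullet> \<gamma>' s)) * b s) (at s)"
    and "((\<lambda>s. - \<alpha> * (2 * ((\<gamma> s - y) \<bullet> \<gamma>' s)) * b s) has_real_derivative
      (\<alpha>\<^sup>2 * (2 * ((\<gamma> 0 - y) \<bullet> \<gamma>' 0))\<^sup>2 - \<alpha> * (2 * (\<gamma>' 0 \<bullet> \<gamma>' 0 + (\<gamma> 0 - y) \<bullet> k2))) * b 0) (at 0)"
proof -
  have g: "((\<lambda>s. (\<gamma> s - y) \<bullet> (\<gamma> s - y)) has_real_derivative 2 * ((\<gamma> s - y) \<bullet> \<gamma>' s)) (at s)"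
    if "(\<gamma> has_vector_derivative \<gamma>' s) (at s)" for s
  proof -
    have "((\<lambda>s. \<gamma> s - y) has_vector_derivative \<gamma>' s) (at s)"
      using has_vector_derivative_diff[OF that has_vector_derivative_const[of y]] by simp
    then have "((\<lambda>s. \<gamma> s - y) has_derivative (\<lambda>h. h *\<^sub>R \<gamma>' s)) (at s)" by (simp add: has_vector_derivative_def)
    from has_derivative_inner[OF this this]
    have "((\<lambda>s. (\<gamma> s - y) \<bullet> (\<gamma> s - y)) has_derivative
        (\<lambda>h. (\<gamma> s - y) \<bullet> (h *\<^sub>R \<gamma>' s) + (h *\<^sub>R \<gamma>' s) \<bullet> (\<gamma> s - y))) (at s)" .
    moreover have "(\<lambda>h. (\<gamma> s - y) \<bullet> (h *\<^sub>R \<gamma>' s) + (h *\<^sub>R \<gamma>' s) \<bullet> (\<gamma> s - y)) = (*) (2 * ((\<gamma> s - y) \<bullet> \<gamma>' s))"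
      by (rule ext) (simp add: inner_commute[of "\<gamma>' s"])
    ultimately show ?thesis by (simp only: has_field_derivative_def)
  qed
  have b1: "(b has_real_derivative - \<alpha> * (2 * ((\<gamma> s - y) \<bullet> \<gamma>' s)) * b s) (at s)"
    if "(\<gamma> has_vector_derivative \<gamma>' s) (at s)" for s
    unfolding b_def using DERIV_fun_exp[OF DERIV_cmult[OF g[OF that], of "- \<alpha>"]] by (simp add: mult_ac)
  show "\<forall>\<^sub>F s in nhds 0. (b has_real_derivative - \<alpha> * (2 * ((\<gamma> s - y) \<bullet> \<gamma>' s)) * b s) (at s)"
    using 1 by eventually_elim (rule b1)
  have \<gamma>0: "(\<gamma> has_vector_derivative \<gamma>' 0) (at 0)" using 1 eventually_nhds_x_imp_x by blast
  have "((\<lambda>s. \<gamma> s - y) has_vector_derivative \<gamma>' 0) (at 0)"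
    using has_vector_derivative_diff[OF \<gamma>0 has_vector_derivative_const[of y]] by simp
  then have d: "((\<lambda>s. \<gamma> s - y) has_derivative (\<lambda>h. h *\<^sub>R \<gamma>' 0)) (at 0)" "(\<gamma>' has_derivative (\<lambda>h. h *\<^sub>R k2)) (at 0)"
    using 2 by (simp_all add: has_vector_derivative_def)
  have "((\<lambda>s. (\<gamma> s - y) \<bullet> \<gamma>' s) has_real_derivative \<gamma>' 0 \<bullet> \<gamma>' 0 + (\<gamma> 0 - y) \<bullet> k2) (at 0)"
  proof -
    have "(\<lambda>h. (\<gamma> 0 - y) \<bullet> (h *\<^sub>R k2) + (h *\<^sub>R \<gamma>' 0) \<bullet> \<gamma>' 0) = (*) (\<gamma>' 0 \<bullet> \<gamma>' 0 + (\<gamma> 0 - y) \<bullet> k2)"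
      by (rule ext) (simp add: algebra_simps)
    then show ?thesis using has_derivative_inner[OF d] by (simp only: has_field_derivative_def)
  qed
  from DERIV_mult[OF DERIV_cmult[OF DERIV_cmult[OF this, of 2], of "- \<alpha>"] b1[OF \<gamma>0]]
  show "((\<lambda>s. - \<alpha> * (2 * ((\<gamma> s - y) \<bullet> \<gamma>' s)) * b s) has_real_derivative
      (\<alpha>\<^sup>2 * (2 * ((\<gamma> 0 - y) \<bullet> \<gamma>' 0))\<^sup>2 - \<alpha> * (2 * (\<gamma>' 0 \<bullet> \<gamma>' 0 + (\<gamma> 0 - y) \<bullet> k2))) * b 0) (at 0)"
    by (simp add: power2_eq_square algebra_simps)
qed

lemma w_second_deriv:
  assumes q: "q \<in> B" "E (t *\<^sub>R av) + q \<in> B"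
  shows "\<forall>\<^sub>F s in nhds 0. ((\<lambda>s. w t (q + E (s *\<^sub>R \<xi>))) has_real_derivative
      - (left_inv_field Exp \<xi> f (E (t *\<^sub>R av) + q + E (s *\<^sub>R \<xi>)) - left_inv_field Exp \<xi> f (q + E (s *\<^sub>R \<xi>))) / t) (at s)"
    and "((\<lambda>s. - (left_inv_field Exp \<xi> f (E (t *\<^sub>R av) + q + E (s *\<^sub>R \<xi>)) - left_inv_field Exp \<xi> f (q + E (s *\<^sub>R \<xi>))) / t)
      has_real_derivative - (left_inv_field Exp \<xi> (left_inv_field Exp \<xi> f) (E (t *\<^sub>R av) + q) -
        left_inv_field Exp \<xi> (left_inv_field Exp \<xi> f) q) / t) (at 0)"
proof -
  have "open ((\<lambda>s. q + E (s *\<^sub>R \<xi>)) -` B \<inter> (\<lambda>s. E (t *\<^sub>R av) + q + E (s *\<^sub>R \<xi>)) -` B)"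
    by (intro open_Int open_vimage open_B continuous_intros E_line_cont)
  moreover have "0 \<in> (\<lambda>s. q + E (s *\<^sub>R \<xi>)) -` B \<inter> (\<lambda>s. E (t *\<^sub>R av) + q + E (s *\<^sub>R \<xi>)) -` B"
    using q by simp
  ultimately have "\<forall>\<^sub>F s in nhds 0. q + E (s *\<^sub>R \<xi>) \<in> B \<and> E (t *\<^sub>R av) + q + E (s *\<^sub>R \<xi>) \<in> B"
    unfolding eventually_nhds by blast
  then show "\<forall>\<^sub>F s in nhds 0. ((\<lambda>s. w t (q + E (s *\<^sub>R \<xi>))) has_real_derivative
      - (left_inv_field Exp \<xi> f (E (t *\<^sub>R av) + q + E (s *\<^sub>R \<xi>)) - left_inv_field Exp \<xi> f (q + E (s *\<^sub>R \<xi>))) / t) (at s)"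
  proof eventually_elim
    case (elim s)
    have "((\<lambda>s. 1 - (f (E (t *\<^sub>R av) + q + E (s *\<^sub>R \<xi>)) - f (q + E (s *\<^sub>R \<xi>))) / t) has_real_derivative
      0 - (left_inv_field Exp \<xi> f (E (t *\<^sub>R av) + q + E (s *\<^sub>R \<xi>)) - left_inv_field Exp \<xi> f (q + E (s *\<^sub>R \<xi>))) / t) (at s)"
      by (intro DERIV_diff DERIV_const DERIV_cdivide left_field_deriv(1)[OF open_B f_C2]) (use elim in auto)
    moreover have "(\<lambda>s. w t (q + E (s *\<^sub>R \<xi>))) = (\<lambda>s. 1 - (f (E (t *\<^sub>R av) + q + E (s *\<^sub>R \<xi>)) - f (q + E (s *\<^sub>R \<xi>))) / t)"
      by (simp add: w_def add.assoc)
    ultimately show ?case by (simp only: diff_0 minus_divide_left)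
  qed
  have "((\<lambda>s. - ((left_inv_field Exp \<xi> f (E (t *\<^sub>R av) + q + E (s *\<^sub>R \<xi>)) - left_inv_field Exp \<xi> f (q + E (s *\<^sub>R \<xi>))) / t))
      has_real_derivative - ((left_inv_field Exp \<xi> (left_inv_field Exp \<xi> f) (E (t *\<^sub>R av) + q + E (0 *\<^sub>R \<xi>)) -
        left_inv_field Exp \<xi> (left_inv_field Exp \<xi> f) (q + E (0 *\<^sub>R \<xi>))) / t)) (at 0)"
    by (intro DERIV_minus DERIV_diff DERIV_cdivide left_field_deriv(2)[OF open_B f_C2]) (use q in auto)
  then show "((\<lambda>s. - (left_inv_field Exp \<xi> f (E (t *\<^sub>R av) + q + E (s *\<^sub>R \<xi>)) - left_inv_field Exp \<xi> f (q + E (s *\<^sub>R \<xi>))) / t)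
      has_real_derivative - (left_inv_field Exp \<xi> (left_inv_field Exp \<xi> f) (E (t *\<^sub>R av) + q) -
        left_inv_field Exp \<xi> (left_inv_field Exp \<xi> f) q) / t) (at 0)"
    by (simp only: minus_divide_left scaleR_zero_left E_0 add_0_right)
qed

text \<open>The finite differences \<open>w t\<close> satisfy \<open>\<Delta>\<^sub>H (w t) = 0\<close> because left translations commute with
  the left-invariant fields. Testing them against a barrier at an interior minimum is impossible when the
  horizontal Laplacian of the barrier is positive.\<close>

lemma no_interior_min:
  assumes p: "\<And>x. x \<in> N \<Longrightarrow> p + \<psi> x \<in> B" "\<And>x. x \<in> N \<Longrightarrow> E (t *\<^sub>R av) + (p + \<psi> x) \<in> B"
    and N: "open N" "N \<subseteq> N0" "x \<in> N" and \<epsilon>: "\<epsilon> > 0"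
    and mn: "\<And>z. z \<in> N \<Longrightarrow> w t (p + \<psi> x) - \<epsilon> * exp (- \<alpha> * ((x - y) \<bullet> (x - y))) \<le> w t (p + \<psi> z) - \<epsilon> * exp (- \<alpha> * ((z - y) \<bullet> (z - y)))"
  shows "(\<Sum>i=1..m. \<alpha>\<^sup>2 * (2 * ((x - y) \<bullet> L x (T (e i))))\<^sup>2 -
      \<alpha> * (2 * (L x (T (e i)) \<bullet> L x (T (e i)) + (x - y) \<bullet> K2 (T (e i)) x))) \<le> 0"
proof -
  define q where "q = p + \<psi> x"
  define Q where "Q = E (t *\<^sub>R av) + q"
  have xN0: "x \<in> N0" using N by blast
  have qB: "q \<in> B" "Q \<in> B" using p N(3) by (auto simp: q_def Q_def)
  define S where "S i = \<alpha>\<^sup>2 * (2 * ((x - y) \<bullet> L x (T (e i))))\<^sup>2 -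
      \<alpha> * (2 * (L x (T (e i)) \<bullet> L x (T (e i)) + (x - y) \<bullet> K2 (T (e i)) x))" for i
  define ee where "ee = exp (- \<alpha> * ((x - y) \<bullet> (x - y)))"
  define XX where "XX i q = left_inv_field Exp (e i) (left_inv_field Exp (e i) f) q" for i q
  have "\<epsilon> * (S i * ee) \<le> - (XX i Q - XX i q) / t" for i
  proof -
    define \<gamma> where "\<gamma> s = \<phi> (\<psi> x + E (s *\<^sub>R e i))" for s
    define \<gamma>' where "\<gamma>' s = L (\<gamma> s) (T (e i))" for s
    have \<gamma>0: "\<gamma> 0 = x" "\<gamma>' 0 = L x (T (e i))" using xN0 by (simp_all add: \<gamma>_def \<gamma>'_def)
    have "open ((\<lambda>s. \<psi> x + E (s *\<^sub>R e i)) -` (U \<inter> \<phi> -` N))"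
      by (intro open_vimage continuous_open_preimage cont_\<phi> open_U N continuous_intros E_line_cont)
    moreover have "0 \<in> ((\<lambda>s. \<psi> x + E (s *\<^sub>R e i)) -` (U \<inter> \<phi> -` N))" using xN0 N by (simp add: \<psi>_U)
    ultimately have ev: "\<forall>\<^sub>F s in nhds 0. \<psi> x + E (s *\<^sub>R e i) \<in> U \<and> \<gamma> s \<in> N"
      unfolding eventually_nhds \<gamma>_def by blast
    have c1: "\<forall>\<^sub>F s in nhds 0. (\<gamma> has_vector_derivative \<gamma>' s) (at s)"
      using ev by eventually_elim (auto simp: \<gamma>_def[abs_def] \<gamma>'_def intro!: chart_curve_deriv)
    have c2: "(\<gamma>' has_vector_derivative K2 (T (e i)) x) (at 0)"
      unfolding \<gamma>'_def[abs_def] \<gamma>_def by (rule chart_curve_second_deriv[OF xN0])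
    note b = barrier_deriv[OF c1 c2, of \<alpha> y]
    note wd = w_second_deriv[of q t "e i", OF qB(1) qB(2)[unfolded Q_def]]
    have "0 \<le> - (XX i Q - XX i q) / t - \<epsilon> * (S i * ee)"
    proof (rule second_derivative_test)
      show "((\<lambda>s. - (left_inv_field Exp (e i) f (E (t *\<^sub>R av) + q + E (s *\<^sub>R e i)) - left_inv_field Exp (e i) f (q + E (s *\<^sub>R e i))) / t
          - \<epsilon> * (- \<alpha> * (2 * ((\<gamma> s - y) \<bullet> \<gamma>' s)) * exp (- \<alpha> * ((\<gamma> s - y) \<bullet> (\<gamma> s - y)))))
          has_real_derivative - (XX i Q - XX i q) / t - \<epsilon> * (S i * ee)) (at 0)"
        using DERIV_diff[OF wd(2) DERIV_cmult[OF b(2), of \<epsilon>]] unfolding XX_def S_def ee_def \<gamma>0 Q_def .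
      show "\<forall>\<^sub>F s in nhds 0. ((\<lambda>s. w t (q + E (s *\<^sub>R e i)) - \<epsilon> * exp (- \<alpha> * ((\<gamma> s - y) \<bullet> (\<gamma> s - y)))) has_real_derivative
          - (left_inv_field Exp (e i) f (E (t *\<^sub>R av) + q + E (s *\<^sub>R e i)) - left_inv_field Exp (e i) f (q + E (s *\<^sub>R e i))) / t
          - \<epsilon> * (- \<alpha> * (2 * ((\<gamma> s - y) \<bullet> \<gamma>' s)) * exp (- \<alpha> * ((\<gamma> s - y) \<bullet> (\<gamma> s - y))))) (at s)"
        using wd(1) b(1) by eventually_elim (intro DERIV_diff DERIV_cmult)
      show "\<forall>\<^sub>F s in nhds 0. w t (q + E (0 *\<^sub>R e i)) - \<epsilon> * exp (- \<alpha> * ((\<gamma> 0 - y) \<bullet> (\<gamma> 0 - y)))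
          \<le> w t (q + E (s *\<^sub>R e i)) - \<epsilon> * exp (- \<alpha> * ((\<gamma> s - y) \<bullet> (\<gamma> s - y)))"
        using ev
      proof eventually_elim
        case (elim s)
        then have "\<psi> (\<gamma> s) = \<psi> x + E (s *\<^sub>R e i)" by (simp add: \<gamma>_def)
        then have "w t (p + \<psi> (\<gamma> s)) = w t (q + E (s *\<^sub>R e i))" by (simp add: q_def add.assoc)
        then show ?case using mn[OF conjunct2[OF elim]] by (simp add: \<gamma>0 q_def)
      qed
    qed
    then show ?thesis by simp
  qed
  then have "(\<Sum>i=1..m. \<epsilon> * (S i * ee)) \<le> (\<Sum>i=1..m. - (XX i Q - XX i q) / t)" by (intro sum_mono)
  also have "\<dots> = - ((\<Sum>i=1..m. XX i Q) - (\<Sum>i=1..m. XX i q)) / t"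
    by (simp add: sum_subtractf sum_divide_distrib[symmetric])
  \<comment> \<open>The horizontal Laplacians of \<open>f\<close> at \<open>q\<close> and at its
    translate \<open>Q\<close> both equal \<open>c\<close>.\<close>
  also have "\<dots> = 0"
    using laplacian[OF qB(1)] laplacian[OF qB(2)] by (simp add: horizontal_laplacian_def XX_def)
  finally have "(\<epsilon> * ee) * (\<Sum>i=1..m. S i) \<le> 0" by (simp add: sum_distrib_left mult_ac)
  moreover have "\<epsilon> * ee > 0" using \<epsilon> by (simp add: ee_def)
  ultimately have "(\<Sum>i=1..m. S i) \<le> 0"
    using mult_le_cancel_left_pos[of "\<epsilon> * ee" "\<Sum>i=1..m. S i" 0] by simp
  then show ?thesis by (simp only: S_def)
qed

lemma f_cont: "continuous_on B f"
proof (rule continuous_at_imp_continuous_on, rule ballI)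
  fix q assume q: "q \<in> B"
  have q0: "q + 0 \<in> B" using q by simp
  obtain N where N: "open N" "x0 \<in> N" "N \<subseteq> N0" "Ck_on 2 N (\<lambda>x. f (q + \<psi> x))"
    using translate_Ck[OF open_B f_C2 q0] by auto
  have "Ck_on (Suc 1) N (\<lambda>x. f (q + \<psi> x))" using N(4) by (simp only: Suc_1)
  then have "Ck_on (Suc 0) N (\<lambda>x. f (q + \<psi> x))" using Ck_on_SucD[of 1] by (simp only: One_nat_def)
  then have "continuous_on N (\<lambda>x. f (q + \<psi> x))" using Ck_on_SucD[of 0] by (simp only: Ck_on.simps(1))
  then have c1: "isCont (\<lambda>x. f (q + \<psi> x)) x0" using N by (simp add: continuous_on_eq_continuous_at)
  have "((\<lambda>q'. - q + q') \<longlongrightarrow> - q + q) (at q)" by (intro tendsto_intros)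
  then have lim: "((\<lambda>q'. - q + q') \<longlongrightarrow> 0) (at q)" by simp
  have "((\<lambda>q'. \<phi> (- q + q')) \<longlongrightarrow> x0) (at q)"
    using isCont_tendsto_compose[OF isCont_\<phi>[OF zero_U] lim] by (simp add: x0_def)
  from isCont_tendsto_compose[OF c1 this]
  have *: "((\<lambda>q'. f (q + \<psi> (\<phi> (- q + q')))) \<longlongrightarrow> f q) (at q)" by simp
  have "eventually (\<lambda>q'. - q + q' \<in> U) (at q)" by (rule topological_tendstoD[OF lim open_U zero_U])
  then have "eventually (\<lambda>q'. f (q + \<psi> (\<phi> (- q + q'))) = f q') (at q)"
    by eventually_elim (simp add: add.assoc[symmetric])
  from Lim_transform_eventually[OF * this] show "isCont f q" by (simp add: isCont_def)
qed

text \<open>Hopf's lemma in the form used by Bony: an exterior normal to the zero set of \<open>u\<close> is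
  orthogonal to the horizontal fields.\<close>

lemma normal_orthogonal:
  assumes p: "p \<in> B"
  shows "\<exists>r>0. cball x0 r \<subseteq> N0 \<and> (\<forall>x\<in>cball x0 r. p + \<psi> x \<in> B) \<and>
    (\<forall>y\<in>ball x0 r. \<forall>z \<rho>'. \<rho>' = norm (y - z) \<longrightarrow> u (p + \<psi> y) = 0 \<longrightarrow>
      (\<forall>x\<in>ball x0 r. norm (x - z) \<le> \<rho>' \<longrightarrow> x \<noteq> y \<longrightarrow> u (p + \<psi> x) > 0) \<longrightarrow>
      (\<forall>i\<in>{1..m}. (y - z) \<bullet> L y (T (e i)) = 0))"
proof -
  obtain r t0 where r: "r > 0" "t0 > 0" "cball x0 r \<subseteq> N0"
    and rB: "\<And>x t. x \<in> cball x0 r \<Longrightarrow> \<bar>t\<bar> \<le> t0 \<Longrightarrow> E (t *\<^sub>R av) + (p + \<psi> x) \<in> B"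
    and conv: "\<And>\<eta>. \<eta> > 0 \<Longrightarrow> \<exists>t. 0 < t \<and> t \<le> t0 \<and> (\<forall>x\<in>cball x0 r. \<bar>w t (p + \<psi> x) - u (p + \<psi> x)\<bar> < \<eta>)"
    by (rule local_approximation[OF p]) blast
  have pB: "p + \<psi> x \<in> B" if "x \<in> cball x0 r" for x using rB[OF that, of 0] r by simp
  have ucont: "continuous_on S (\<lambda>x. u (p + \<psi> x))" if "S \<subseteq> cball x0 r" for S
    by (intro continuous_on_compose2[OF u_cont] continuous_intros continuous_on_subset[OF cont_\<psi>])
      (use that r(3) pB in auto)
  have wcont: "continuous_on S (\<lambda>x. w t (p + \<psi> x))" if S: "S \<subseteq> cball x0 r" and t: "\<bar>t\<bar> \<le> t0" for S t
  proof -
    show ?thesis unfolding w_def divide_inverse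
      by (intro continuous_intros continuous_on_compose2[OF f_cont] continuous_on_subset[OF cont_\<psi>])
        (use S r(3) pB rB t in auto)
  qed
  have main: "(y - z) \<bullet> L y (T (e i0)) = 0"
    if y: "y \<in> ball x0 r" and \<rho>': "\<rho>' = norm (y - z)" and uy: "u (p + \<psi> y) = 0"
      and pos: "\<And>x. x \<in> ball x0 r \<Longrightarrow> norm (x - z) \<le> \<rho>' \<Longrightarrow> x \<noteq> y \<Longrightarrow> u (p + \<psi> x) > 0"
      and i0: "i0 \<in> {1..m}" for y z \<rho>' i0
  proof (rule ccontr)
    assume ne: "(y - z) \<bullet> L y (T (e i0)) \<noteq> 0"
    define D where "D i x = 2 * ((x - z) \<bullet> L x (T (e i)))" for i x
    define S where "S i x = 2 * (L x (T (e i)) \<bullet> L x (T (e i)) + (x - z) \<bullet> K2 (T (e i)) x)" for i x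
    \<comment> \<open>If a horizontal field is not orthogonal to the normal, the square of
      \<open>D i0\<close> exceeds half its value at \<open>y\<close> on a small ball.\<close>
    define \<kappa> where "\<kappa> = (D i0 y)\<^sup>2 / 2"
    have \<kappa>: "\<kappa> > 0" using ne by (simp add: \<kappa>_def D_def)
    have Dc: "continuous_on N0 (D i)" for i unfolding D_def[abs_def] by (intro continuous_intros L_cont)
    have Sc: "continuous_on N0 (S i)" for i unfolding S_def[abs_def] by (intro continuous_intros L_cont K2_cont)
    have yN0: "y \<in> N0" using y r(3) by auto
    have "open {x \<in> N0. (D i0 x)\<^sup>2 \<in> {\<kappa><..}}"
      by (intro open_\<psi>_preimage continuous_intros Dc)
    then have "open ({x \<in> N0. (D i0 x)\<^sup>2 \<in> {\<kappa><..}} \<inter> ball x0 r)" by (intro open_Int open_ball)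
    moreover have "y \<in> {x \<in> N0. (D i0 x)\<^sup>2 \<in> {\<kappa><..}} \<inter> ball x0 r" using y yN0 \<kappa> by (simp add: \<kappa>_def)
    ultimately obtain r2 where r2: "r2 > 0" "cball y r2 \<subseteq> {x \<in> N0. (D i0 x)\<^sup>2 \<in> {\<kappa><..}} \<inter> ball x0 r"
      using open_contains_cball[of "{x \<in> N0. (D i0 x)\<^sup>2 \<in> {\<kappa><..}} \<inter> ball x0 r"] by meson
    have "{x \<in> N0. (D i0 x)\<^sup>2 \<in> {\<kappa><..}} \<inter> ball x0 r \<subseteq> N0 \<inter> ball x0 r" by auto
    from order_trans[OF r2(2) this]
    have sub: "cball y r2 \<subseteq> N0" "cball y r2 \<subseteq> ball x0 r" by simp_all
    then have sub3: "cball y r2 \<subseteq> cball x0 r" using ball_subset_cball[of x0 r] by (rule_tac order_trans)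
    note sub = sub sub3
    have \<kappa>le: "(D i0 x)\<^sup>2 \<ge> \<kappa>" if "x \<in> cball y r2" for x using subsetD[OF r2(2) that] by simp
    have "continuous_on (cball y r2) (\<lambda>x. \<Sum>i=1..m. S i x)"
      by (intro continuous_intros continuous_on_subset[OF Sc sub(1)])
    then obtain xm where xm: "\<And>x. x \<in> cball y r2 \<Longrightarrow> (\<Sum>i=1..m. S i x) \<le> (\<Sum>i=1..m. S i xm)"
      using continuous_attains_sup[OF compact_cball, of y r2 "\<lambda>x. \<Sum>i=1..m. S i x"] r2(1) by fastforce
    have "(\<Sum>i=1..m. S i x) \<le> max 1 (\<Sum>i=1..m. S i xm)" if "x \<in> cball y r2" for x
      by (rule max.coboundedI2) (rule xm, rule that)
    then obtain M where M: "M > 0" "\<And>x. x \<in> cball y r2 \<Longrightarrow> (\<Sum>i=1..m. S i x) \<le> M"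
      by (metis less_max_iff_disj zero_less_one)
    \<comment> \<open>Chosen so that
      \<open>\<alpha>\<^sup>2 * \<kappa> - \<alpha> * M = \<alpha>\<close> is positive, against the
      conclusion of \<open>no_interior_min\<close>.\<close>
    define \<alpha> where "\<alpha> = (M + 1) / \<kappa>"
    have \<alpha>: "\<alpha> > 0" "\<alpha> * \<kappa> = M + 1" using M \<kappa> by (simp_all add: \<alpha>_def)
    \<comment> \<open>The barrier is normalised to vanish on the sphere around \<open>z\<close>
      through \<open>y\<close>, and it is negative outside that sphere.\<close>
    define b where "b x = exp (- \<alpha> * ((x - z) \<bullet> (x - z))) - exp (- \<alpha> * \<rho>'\<^sup>2)" for x
    have b1: "b x \<le> 1" for x
    proof -
      have "exp (- \<alpha> * ((x - z) \<bullet> (x - z))) \<le> 1" using \<alpha> by simp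
      then show ?thesis using exp_ge_zero[of "- \<alpha> * \<rho>'\<^sup>2"] unfolding b_def by linarith
    qed
    have by0: "b y = 0" by (simp add: b_def \<rho>' power2_norm_eq_inner)
    have bneg: "b x < 0" if "norm (x - z) > \<rho>'" for x
    proof -
      have "\<rho>'\<^sup>2 < (norm (x - z))\<^sup>2" using that \<rho>' by (intro power_strict_mono) auto
      then show ?thesis using \<alpha>(1) by (simp add: b_def power2_norm_eq_inner)
    qed
    have bc: "continuous_on X b" for X unfolding b_def[abs_def] by (intro continuous_intros)
    define Sp where "Sp = sphere y r2"
    have Spsub: "Sp \<subseteq> cball y r2" by (auto simp: Sp_def)
    \<comment> \<open>On the part \<open>P\<close> of the small sphere that lies in the touching
      ball, \<open>u\<close> has a positive minimum; on the rest the barrier is negative. For small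
      \<open>\<epsilon>\<close> the function \<open>u - \<epsilon> * b\<close> is therefore positive
      on the whole small sphere, while it vanishes at its centre \<open>y\<close>.\<close>
    define P where "P = Sp \<inter> cball z \<rho>'"
    have "compact P" unfolding P_def Sp_def by (intro compact_Int compact_sphere compact_cball)
    have upos: "u (p + \<psi> x) > 0" if "x \<in> P" for x
    proof (rule pos)
      show "x \<in> ball x0 r" using that sub Spsub by (auto simp: P_def)
      show "norm (x - z) \<le> \<rho>'" using that by (auto simp: P_def dist_norm norm_minus_commute)
      show "x \<noteq> y" using that r2(1) by (auto simp: P_def Sp_def)
    qed
    obtain \<mu>0 where \<mu>0: "\<mu>0 > 0" "\<And>x. x \<in> P \<Longrightarrow> \<mu>0 \<le> u (p + \<psi> x)"
    proof (cases "P = {}")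
      case True
      then show ?thesis using that[of 1] by simp
    next
      case False
      have "P \<subseteq> cball x0 r" using sub(3) Spsub by (auto simp: P_def)
      from continuous_attains_inf[OF \<open>compact P\<close> False ucont[OF this]]
      obtain x where "x \<in> P" "\<forall>x'\<in>P. u (p + \<psi> x) \<le> u (p + \<psi> x')" by blast
      then show ?thesis using that[of "u (p + \<psi> x)"] upos by blast
    qed
    define \<epsilon> where "\<epsilon> = \<mu>0 / 2"
    have \<epsilon>: "\<epsilon> > 0" using \<mu>0 by (simp add: \<epsilon>_def)
    define v where "v x = u (p + \<psi> x) - \<epsilon> * b x" for x
    have vpos: "v x > 0" if x: "x \<in> Sp" for x
    proof (cases "x \<in> P")
      case True
      have "\<epsilon> * b x \<le> \<epsilon> * 1" using b1 \<epsilon> by (intro mult_left_mono) auto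
      moreover have "\<epsilon> < \<mu>0" using \<mu>0(1) by (simp add: \<epsilon>_def)
      ultimately show ?thesis using \<mu>0(2)[OF True] unfolding v_def by linarith
    next
      case False
      then have "b x < 0" using x by (intro bneg) (auto simp: P_def dist_norm norm_minus_commute)
      then have "\<epsilon> * b x < 0" using \<epsilon> by (simp add: mult_pos_neg)
      moreover have "u (p + \<psi> x) \<ge> 0" using x Spsub sub(3) by (intro u_nonneg pB) blast
      ultimately show ?thesis by (simp add: v_def)
    qed
    have "Sp \<noteq> {}" using r2(1) by (simp add: Sp_def)
    moreover have "continuous_on Sp v" unfolding v_def[abs_def]
      by (intro continuous_intros bc ucont) (use Spsub sub(3) in blast)
    ultimately obtain xs where xs: "xs \<in> Sp" "\<And>x. x \<in> Sp \<Longrightarrow> v xs \<le> v x"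
      using continuous_attains_inf[of Sp v] compact_sphere unfolding Sp_def by metis
    define \<mu> where "\<mu> = v xs"
    have \<mu>: "\<mu> > 0" "\<And>x. x \<in> Sp \<Longrightarrow> \<mu> \<le> v x" using vpos[OF xs(1)] xs(2) by (auto simp: \<mu>_def)
    \<comment> \<open>The gap \<open>\<mu>\<close> between small sphere and centre survives an error
      below \<open>\<mu> / 2\<close>, so replacing \<open>u\<close> by \<open>w t\<close> still
      leaves the minimum in the interior.\<close>
    obtain t where t: "0 < t" "t \<le> t0" "\<And>x. x \<in> cball x0 r \<Longrightarrow> \<bar>w t (p + \<psi> x) - u (p + \<psi> x)\<bar> < \<mu> / 2"
      using conv[of "\<mu> / 2"] \<mu>(1) by auto
    define W where "W x = w t (p + \<psi> x) - \<epsilon> * b x" for x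
    have Wv: "\<bar>W x - v x\<bar> < \<mu> / 2" if "x \<in> cball y r2" for x
      using t(3)[of x] that sub(3) by (auto simp: W_def v_def)
    have "continuous_on (cball y r2) W" unfolding W_def[abs_def]
      by (intro continuous_intros bc wcont sub(3)) (use t in auto)
    then obtain x where x: "x \<in> cball y r2" "\<And>x'. x' \<in> cball y r2 \<Longrightarrow> W x \<le> W x'"
      using continuous_attains_inf[OF compact_cball, of y r2 W] r2(1) by auto
    have "v y = 0" using uy by0 by (simp add: v_def)
    then have "W y < \<mu> / 2" using Wv[of y] r2(1) by auto
    then have Wx: "W x < \<mu> / 2" using x(2)[of y] r2(1) by simp
    have "x \<notin> Sp"
    proof
      assume "x \<in> Sp"
      then have "\<mu> \<le> v x" by (rule \<mu>(2))
      then show False using Wv[OF x(1)] Wx by linarith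
    qed
    then have xb: "x \<in> ball y r2" using x(1) by (auto simp: Sp_def)
    have "(\<Sum>i=1..m. \<alpha>\<^sup>2 * (2 * ((x - z) \<bullet> L x (T (e i))))\<^sup>2 -
      \<alpha> * (2 * (L x (T (e i)) \<bullet> L x (T (e i)) + (x - z) \<bullet> K2 (T (e i)) x))) \<le> 0"
    proof (rule no_interior_min[where N = "ball y r2" and p = p and t = t and \<epsilon> = \<epsilon>])
      fix x' assume x': "x' \<in> ball y r2"
      then have c: "x' \<in> cball y r2" by simp
      then have c': "x' \<in> cball x0 r" using sub(3) by blast
      show "p + \<psi> x' \<in> B" by (rule pB[OF c'])
      show "E (t *\<^sub>R av) + (p + \<psi> x') \<in> B" by (rule rB[OF c']) (use t in simp)
      show "w t (p + \<psi> x) - \<epsilon> * exp (- \<alpha> * ((x - z) \<bullet> (x - z))) \<le> w t (p + \<psi> x') - \<epsilon> * exp (- \<alpha> * ((x' - z) \<bullet> (x' - z)))"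
        using x(2)[OF c] by (simp add: W_def b_def algebra_simps)
    qed (use xb sub(1) \<epsilon> in auto)
    then have "(\<Sum>i=1..m. \<alpha>\<^sup>2 * (D i x)\<^sup>2 - \<alpha> * S i x) \<le> 0" by (simp only: D_def S_def)
    then have "\<alpha>\<^sup>2 * (\<Sum>i=1..m. (D i x)\<^sup>2) - \<alpha> * (\<Sum>i=1..m. S i x) \<le> 0"
      by (simp add: sum_subtractf sum_distrib_left)
    moreover have "\<alpha>\<^sup>2 * \<kappa> \<le> \<alpha>\<^sup>2 * (\<Sum>i=1..m. (D i x)\<^sup>2)"
    proof (rule mult_left_mono)
      have "(D i0 x)\<^sup>2 \<le> (\<Sum>i=1..m. (D i x)\<^sup>2)" by (rule member_le_sum[OF i0]) auto
      then show "\<kappa> \<le> (\<Sum>i=1..m. (D i x)\<^sup>2)" using \<kappa>le[OF x(1)] by linarith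
    qed simp
    moreover have "\<alpha> * (\<Sum>i=1..m. S i x) \<le> \<alpha> * M" using M(2)[OF x(1)] \<alpha> by (intro mult_left_mono) auto
    moreover have "\<alpha>\<^sup>2 * \<kappa> = \<alpha> * M + \<alpha>" using \<alpha>(2) by (simp add: power2_eq_square mult.assoc distrib_left)
    ultimately show False using \<alpha>(1) by linarith
  qed
  show ?thesis using r pB main by (intro exI[of _ r]) blast
qed

section \<open>Bony's propagation along horizontal curves\<close>

lemma strictly_inside_ball:
  fixes x y g :: 'a
  assumes le: "norm (x - (1 / 2) *\<^sub>R (y + g)) \<le> norm (y - (1 / 2) *\<^sub>R (y + g))" and ne: "x \<noteq> y"
  shows "norm (x - g) < norm (y - g)"
proof -
  define s where "s = x - (1 / 2) *\<^sub>R (y + g)"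
  define h where "h = (1 / 2) *\<^sub>R (y - g)"
  have e1: "y - (1 / 2) *\<^sub>R (y + g) = h"
  proof -
    have "y = (1 / 2) *\<^sub>R y + (1 / 2) *\<^sub>R y" by (simp add: scaleR_add_left[symmetric])
    then show ?thesis by (simp add: h_def algebra_simps)
  qed
  have e2: "x - g = s + h" "x - y = s - h" "y - g = 2 *\<^sub>R h"
  proof -
    have g: "g = (1 / 2) *\<^sub>R g + (1 / 2) *\<^sub>R g" and y: "y = (1 / 2) *\<^sub>R y + (1 / 2) *\<^sub>R y"
      by (simp_all add: scaleR_add_left[symmetric])
    show "x - g = s + h" using g by (simp add: s_def h_def algebra_simps)
    show "x - y = s - h" using y by (simp add: s_def h_def algebra_simps)
    show "y - g = 2 *\<^sub>R h" by (simp add: h_def)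
  qed
  have "norm s \<le> norm h" using le e1 by (simp add: s_def)
  then have sh: "(norm s)\<^sup>2 \<le> (norm h)\<^sup>2" by (intro power_mono) auto
  have sh0: "(norm (s - h))\<^sup>2 > 0" using ne unfolding e2(2)[symmetric] by simp
  \<comment> \<open>The parallelogram identity; strictness comes from
    \<open>x \<noteq> y\<close>.\<close>
  have "(norm (s + h))\<^sup>2 + (norm (s - h))\<^sup>2 = 2 * (norm s)\<^sup>2 + 2 * (norm h)\<^sup>2"
    by (simp add: power2_norm_eq_inner inner_add_left inner_add_right inner_diff_left inner_diff_right)
  then have "(norm (s + h))\<^sup>2 < 4 * (norm h)\<^sup>2" using sh sh0 by linarith
  then have "(norm (s + h))\<^sup>2 < (2 * norm h)\<^sup>2" by (simp add: power_mult_distrib)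
  then have "norm (s + h) < 2 * norm h" by (rule power_less_imp_less_base) simp
  then show ?thesis by (simp add: e2)
qed

text \<open>If the curve left the zero set, compare its squared distance to that set with the
  exponential \<open>R2\<close>. At the last time \<open>s1\<close> where the comparison holds, the
  segment to a nearest zero \<open>y\<close> is normal to the zero set, so horizontal fields at
  \<open>y\<close> are orthogonal to it. The Lipschitz bound on \<open>L\<close> then makes the
  distance grow too slowly to exceed \<open>R2\<close> afterwards.\<close>

lemma zero_set_forward:
  assumes p: "p \<in> B" "u p = 0" and v: "v \<in> V 1"
  shows "\<exists>\<delta>>0. \<forall>s. 0 \<le> s \<and> s < \<delta> \<longrightarrow> u (p + E (s *\<^sub>R v)) = 0"
proof -
  obtain r where r: "r > 0" "cball x0 r \<subseteq> N0" "\<And>x. x \<in> cball x0 r \<Longrightarrow> p + \<psi> x \<in> B"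
    and no: "\<forall>y\<in>ball x0 r. \<forall>z \<rho>'. \<rho>' = norm (y - z) \<longrightarrow> u (p + \<psi> y) = 0 \<longrightarrow>
      (\<forall>x\<in>ball x0 r. norm (x - z) \<le> \<rho>' \<longrightarrow> x \<noteq> y \<longrightarrow> u (p + \<psi> x) > 0) \<longrightarrow>
      (\<forall>i\<in>{1..m}. (y - z) \<bullet> L y (T (e i)) = 0)"
    using normal_orthogonal[OF p(1)] by blast
  obtain K where K: "K > 0" "\<And>x y. x \<in> cball x0 r \<Longrightarrow> y \<in> cball x0 r \<Longrightarrow> norm (L x (T v) - L y (T v)) \<le> K * norm (x - y)"
    using Ck_on_1_lipschitz[OF L_C1 r(2), of "T v"] by blast
  define \<gamma> where "\<gamma> s = \<phi> (E (s *\<^sub>R v))" for s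
  \<comment> \<open>The curve stays within \<open>r / 8\<close> of the zero \<open>x0\<close>, so
    points no farther from it than its nearest zero lie within \<open>r / 4\<close> of
    \<open>x0\<close>, well inside the ball of radius \<open>r / 2\<close> in which \<open>Z\<close>
    records zeros.\<close>
  have "open (U \<inter> \<phi> -` ball x0 (r / 8))" by (intro continuous_open_preimage cont_\<phi> open_U open_ball)
  then have "open ((\<lambda>s. E (s *\<^sub>R v)) -` (U \<inter> \<phi> -` ball x0 (r / 8)))" by (rule open_vimage[OF _ E_line_cont])
  moreover have "0 \<in> (\<lambda>s. E (s *\<^sub>R v)) -` (U \<inter> \<phi> -` ball x0 (r / 8))"
    using zero_U r(1) by (simp add: x0_def)
  ultimately obtain \<delta> where \<delta>: "\<delta> > 0" "ball 0 \<delta> \<subseteq> (\<lambda>s. E (s *\<^sub>R v)) -` (U \<inter> \<phi> -` ball x0 (r / 8))"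
    by (meson open_contains_ball)
  have \<gamma>in: "E (s *\<^sub>R v) \<in> U" "\<gamma> s \<in> ball x0 (r / 8)" if "0 \<le> s" "s < \<delta>" for s
  proof -
    have "s \<in> ball 0 \<delta>" using that by simp
    then show "E (s *\<^sub>R v) \<in> U" "\<gamma> s \<in> ball x0 (r / 8)" using \<delta>(2) by (auto simp: \<gamma>_def)
  qed
  have "u (p + E (s0 *\<^sub>R v)) = 0" if s0: "0 \<le> s0" "s0 < \<delta>" for s0
  proof (rule ccontr)
    assume nz: "u (p + E (s0 *\<^sub>R v)) \<noteq> 0"
    define Z where "Z = {x \<in> cball x0 (r / 2). u (p + \<psi> x) = 0}"
    have r2: "cball x0 (r / 2) \<subseteq> cball x0 r" using r(1) by (intro subset_cball) simp
    have uc: "continuous_on (cball x0 (r / 2)) (\<lambda>x. u (p + \<psi> x))"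
      by (intro continuous_on_compose2[OF u_cont] continuous_intros continuous_on_subset[OF cont_\<psi>])
        (use r r2 in auto)
    have "closed Z"
    proof -
      have "closed (cball x0 (r / 2) \<inter> (\<lambda>x. u (p + \<psi> x)) -` {0})"
        by (rule continuous_closed_preimage[OF uc]) auto
      moreover have "cball x0 (r / 2) \<inter> (\<lambda>x. u (p + \<psi> x)) -` {0} = Z" by (auto simp: Z_def)
      ultimately show ?thesis by simp
    qed
    have x0Z: "x0 \<in> Z" using p r by (simp add: Z_def)
    then have Zne: "Z \<noteq> {}" by blast
    define d where "d s = infdist (\<gamma> s) Z" for s
    have \<gamma>c: "continuous_on {0..s0} \<gamma>" unfolding \<gamma>_def
      by (rule continuous_on_compose2[OF cont_\<phi> E_line_cont]) (use \<gamma>in(1) s0 in auto)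
    then have dc: "continuous_on {0..s0} d" unfolding d_def[abs_def] by (rule continuous_on_infdist)
    have dle: "d s < r / 8" if "0 \<le> s" "s \<le> s0" for s
    proof -
      have "d s \<le> dist (\<gamma> s) x0" unfolding d_def by (rule infdist_le[OF x0Z])
      then show ?thesis using \<gamma>in(2)[of s] that s0 by (simp add: dist_commute)
    qed
    have d0: "d 0 = 0" unfolding d_def using x0Z by (intro infdist_zero) (simp add: \<gamma>_def x0_def[symmetric])
    have "\<gamma> s0 \<notin> Z" using nz \<gamma>in(1)[OF s0] by (simp add: Z_def \<gamma>_def)
    then have ds0: "d s0 > 0"
      using in_closed_iff_infdist_zero[OF \<open>closed Z\<close> Zne, of "\<gamma> s0"] infdist_nonneg[of "\<gamma> s0" Z] by (simp add: d_def)
    \<comment> \<open>Half of the squared distance at \<open>s0\<close>: the comparison with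
      \<open>R2\<close> then fails at \<open>s0\<close>, while it holds at \<open>0\<close>, where
      the distance vanishes.\<close>
    define \<rho>0 where "\<rho>0 = (d s0)\<^sup>2 / 2"
    have \<rho>0: "0 < \<rho>0" "\<rho>0 < (d s0)\<^sup>2" using ds0 by (simp_all add: \<rho>0_def)
    \<comment> \<open>The rate uses \<open>K + 1\<close> rather than the Lipschitz constant
      \<open>K\<close> to make the derivative at \<open>s1\<close> strictly negative.\<close>
    define R2 where "R2 s = \<rho>0 * exp (2 * (K + 1) * (s - s0))" for s
    have R2pos: "R2 s > 0" for s using \<rho>0 by (simp add: R2_def)
    define Q where "Q = {s \<in> {0..s0}. (d s)\<^sup>2 - R2 s \<in> {..0}}"
    have "closed Q"
    proof -
      have "continuous_on {0..s0} (\<lambda>s. (d s)\<^sup>2 - R2 s)" unfolding R2_def by (intro continuous_intros dc)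
      from continuous_closed_preimage[OF this, of "{..0}"] show ?thesis by (simp add: Q_def Int_def vimage_def)
    qed
    moreover have "bounded Q" by (rule bounded_subset[of "{0..s0}"]) (auto simp: Q_def)
    ultimately have "compact Q" by (simp add: compact_eq_bounded_closed)
    moreover have "0 \<in> Q" using s0 d0 R2pos[of 0] by (simp add: Q_def less_imp_le)
    ultimately obtain s1 where s1: "s1 \<in> Q" "\<And>s. s \<in> Q \<Longrightarrow> s \<le> s1"
      using compact_attains_sup[of Q] by blast
    have "s0 \<notin> Q" using \<rho>0 s0 by (simp add: Q_def R2_def)
    then have s1': "0 \<le> s1" "s1 < s0" using s1(1) by (auto simp: Q_def order_le_less)
    have after: "(d s)\<^sup>2 > R2 s" if "s1 < s" "s \<le> s0" for s
    proof (rule ccontr)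
      assume "\<not> (d s)\<^sup>2 > R2 s"
      then have "s \<in> Q" using that s1' by (simp add: Q_def)
      then show False using s1(2) that by fastforce
    qed
    have eq: "(d s1)\<^sup>2 = R2 s1"
    proof (rule antisym)
      show "(d s1)\<^sup>2 \<le> R2 s1" using s1(1) by (simp add: Q_def)
      show "R2 s1 \<le> (d s1)\<^sup>2"
      proof (rule ccontr)
        assume lt: "\<not> R2 s1 \<le> (d s1)\<^sup>2"
        have "continuous_on {s1..s0} (\<lambda>s. (d s)\<^sup>2 - R2 s)"
          unfolding R2_def by (intro continuous_intros continuous_on_subset[OF dc]) (use s1' in auto)
        moreover have "(d s1)\<^sup>2 - R2 s1 \<le> 0" using lt by simp
        moreover have "0 \<le> (d s0)\<^sup>2 - R2 s0" using \<rho>0 by (simp add: R2_def)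
        ultimately obtain s where s: "s1 \<le> s" "s \<le> s0" "(d s)\<^sup>2 - R2 s = 0"
          using IVT'[of "\<lambda>s. (d s)\<^sup>2 - R2 s" s1 0 s0] s1' by auto
        then have "s \<noteq> s1" using lt by auto
        then show False using after[of s] s by simp
      qed
    qed
    define g where "g = \<gamma> s1"
    have gin: "E (s1 *\<^sub>R v) \<in> U" "g \<in> ball x0 (r / 8)" using \<gamma>in[of s1] s1' s0 by (auto simp: g_def)
    obtain y where y: "y \<in> Z" "d s1 = dist g y"
      using infdist_attains_inf[OF \<open>closed Z\<close> Zne, of g] unfolding d_def g_def by blast
    have dpos: "d s1 > 0" using eq R2pos[of s1] y(2) by (metis less_irrefl power_zero_numeral zero_le_dist order_le_less)
    have dgy: "norm (y - g) = d s1" using y(2) by (simp add: dist_norm norm_minus_commute)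
    have near: "x \<in> ball x0 (r / 4)" if "norm (x - g) \<le> d s1" for x
    proof -
      have "dist x0 x \<le> dist x0 g + norm (x - g)" by (metis dist_triangle dist_norm norm_minus_commute)
      then show ?thesis using that dle[of s1] s1' gin(2) by simp
    qed
    \<comment> \<open>The ball around \<open>g\<close> through \<open>y\<close> may touch the zero
      set at several points. The ball of half the radius around the midpoint of \<open>y\<close> and
      \<open>g\<close> touches it only at \<open>y\<close>, as \<open>normal_orthogonal\<close>
      requires.\<close>
    have "(y - (1 / 2) *\<^sub>R (y + g)) \<bullet> L y (T (e i)) = 0" if "i \<in> {1..m}" for i
    proof (rule no[rule_format, OF _ refl])
      show "y \<in> ball x0 r" using near[of y] dgy r(1) by simp
      show "u (p + \<psi> y) = 0" using y(1) by (simp add: Z_def)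
      fix x assume x: "x \<in> ball x0 r" "norm (x - (1 / 2) *\<^sub>R (y + g)) \<le> norm (y - (1 / 2) *\<^sub>R (y + g))" "x \<noteq> y"
      have lt: "norm (x - g) < d s1" using strictly_inside_ball[OF x(2,3)] dgy by simp
      have "x \<notin> Z"
      proof
        assume "x \<in> Z"
        then have "d s1 \<le> dist g x" unfolding d_def g_def by (rule infdist_le)
        then show False using lt by (simp add: dist_norm norm_minus_commute)
      qed
      moreover have "x \<in> cball x0 (r / 2)" using near[of x] lt r(1) by simp
      ultimately have "u (p + \<psi> x) \<noteq> 0" by (simp add: Z_def)
      moreover have "u (p + \<psi> x) \<ge> 0" using x(1) by (intro u_nonneg r(3)) simp
      ultimately show "u (p + \<psi> x) > 0" by simp
    qed (use that in simp)
    moreover have half: "y - (1 / 2) *\<^sub>R (y + g) = (1 / 2) *\<^sub>R (y - g)"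
    proof -
      have "y = (1 / 2) *\<^sub>R y + (1 / 2) *\<^sub>R y" by (simp add: scaleR_add_left[symmetric])
      then show ?thesis by (simp add: algebra_simps)
    qed
    ultimately have orth: "(y - g) \<bullet> L y (T (e i)) = 0" if "i \<in> {1..m}" for i using that by simp
    have yr: "y \<in> cball x0 r" "g \<in> cball x0 r" using near[of y] dgy gin(2) r(1) by auto
    have "v \<in> span (e ` {1..m})" using v span_e by simp
    then have orthv: "(y - g) \<bullet> L y (T v) = 0"
    proof (induction rule: span_induct)
      case base
      have "linear (L y)" using yr r(2) by (intro L_linear) blast
      from linear_compose[OF T_linear this] have lin: "linear (\<lambda>v. L y (T v))" by (simp add: o_def)
      show ?case
        by (rule subspaceI) (simp_all add: linear_0[OF lin] linear_add[OF lin] linear_scale[OF lin] inner_add_right)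
    next
      case (step x)
      then show ?case using orth by blast
    qed
    \<comment> \<open>With \<open>y\<close> fixed instead of the nearest zero at each time,
      \<open>h\<close> is differentiable at \<open>s1\<close>; it bounds the squared distance minus
      \<open>R2\<close> from above, with equality at \<open>s1\<close>.\<close>
    define h where "h s = (\<gamma> s - y) \<bullet> (\<gamma> s - y) - R2 s" for s
    define h' where "h' = 2 * ((g - y) \<bullet> L g (T v)) - 2 * (K + 1) * R2 s1"
    have hd: "(h has_real_derivative h') (at s1)"
    proof -
      have "((\<lambda>s. \<phi> (0 + E (s *\<^sub>R v))) has_vector_derivative L (\<phi> (0 + E (s1 *\<^sub>R v))) (T v)) (at s1)"
        by (rule chart_curve_deriv) (use gin(1) in simp)
      then have "(\<gamma> has_vector_derivative L g (T v)) (at s1)" by (simp add: \<gamma>_def[abs_def] g_def)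
      from has_vector_derivative_diff[OF this has_vector_derivative_const[of y]]
      have "((\<lambda>s. \<gamma> s - y) has_derivative (\<lambda>h. h *\<^sub>R L g (T v))) (at s1)" by (simp add: has_vector_derivative_def)
      from has_derivative_inner[OF this this]
      have "((\<lambda>s. (\<gamma> s - y) \<bullet> (\<gamma> s - y)) has_real_derivative 2 * ((g - y) \<bullet> L g (T v))) (at s1)"
      proof -
        have "(\<lambda>h. (\<gamma> s1 - y) \<bullet> (h *\<^sub>R L g (T v)) + (h *\<^sub>R L g (T v)) \<bullet> (\<gamma> s1 - y)) = (*) (2 * ((g - y) \<bullet> L g (T v)))"
          by (rule ext) (simp add: g_def inner_commute[of "L _ _"])
        then show ?thesis using has_derivative_inner[OF \<open>((\<lambda>s. \<gamma> s - y) has_derivative _) _\<close> \<open>((\<lambda>s. \<gamma> s - y) has_derivative _) _\<close>]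
          by (simp only: has_field_derivative_def)
      qed
      moreover have "(R2 has_real_derivative 2 * (K + 1) * R2 s1) (at s1)"
        unfolding R2_def[abs_def] by (auto intro!: derivative_eq_intros)
      ultimately show ?thesis unfolding h_def[abs_def] h'_def by (rule DERIV_diff)
    qed
    have "h' < 0"
    proof -
      have "(g - y) \<bullet> L g (T v) = (g - y) \<bullet> (L g (T v) - L y (T v))"
        using orthv by (simp add: inner_diff_left inner_diff_right)
      also have "\<dots> \<le> norm (g - y) * norm (L g (T v) - L y (T v))" by (rule norm_cauchy_schwarz)
      also have "\<dots> \<le> norm (g - y) * (K * norm (g - y))" using K(2)[OF yr(2,1)] by (intro mult_left_mono) auto
      also have "\<dots> = K * R2 s1" using dgy eq by (simp add: norm_minus_commute power2_eq_square)
      finally have "h' \<le> 2 * (K * R2 s1) - 2 * (K + 1) * R2 s1" unfolding h'_def by linarith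
      also have "\<dots> = - 2 * R2 s1" by (simp add: algebra_simps)
      also have "\<dots> < 0" using R2pos by simp
      finally show ?thesis .
    qed
    from DERIV_neg_dec_right[OF hd this]
    obtain \<eta> where \<eta>: "\<eta> > 0" "\<And>k. 0 < k \<Longrightarrow> k < \<eta> \<Longrightarrow> h (s1 + k) < h s1" by blast
    define k where "k = min \<eta> (s0 - s1) / 2"
    have k: "0 < k" "k < \<eta>" "s1 + k \<le> s0" using \<eta>(1) s1' by (auto simp: k_def min_def field_simps)
    have "h s1 = 0" using eq dgy by (simp add: h_def g_def[symmetric] power2_norm_eq_inner[symmetric] norm_minus_commute)
    then have "h (s1 + k) < 0" using \<eta>(2)[OF k(1,2)] by simp
    moreover have "(d (s1 + k))\<^sup>2 > R2 (s1 + k)" using after[of "s1 + k"] k by simp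
    moreover have "(d (s1 + k))\<^sup>2 \<le> (dist (\<gamma> (s1 + k)) y)\<^sup>2"
      unfolding d_def by (intro power_mono infdist_le y infdist_nonneg)
    ultimately show False by (simp add: h_def dist_norm power2_norm_eq_inner)
  qed
  then show ?thesis using \<delta>(1) by blast
qed

definition Zu :: "'g set" where "Zu = {p \<in> B. u p = 0}"

text \<open>Along a horizontal segment in \<open>B\<close> the set of zero times is closed by
  continuity of \<open>u\<close> and extends forward by \<open>zero_set_forward\<close>, so it
  reaches time \<open>1\<close>.\<close>

lemma open_Zu: "open Zu"
proof (rule horizontally_invariant_open[OF open_B])
  fix p x assume p: "p \<in> Zu" and x: "x \<in> V 1" and seg: "\<And>s. 0 \<le> s \<Longrightarrow> s \<le> 1 \<Longrightarrow> p + E (s *\<^sub>R x) \<in> B"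
  define J where "J = {s \<in> {0..1}. u (p + E (s *\<^sub>R x)) = 0}"
  have "continuous_on {0..1} (\<lambda>s. u (p + E (s *\<^sub>R x)))"
    by (rule continuous_on_compose2[OF u_cont]) (use seg in \<open>auto intro!: continuous_intros E_line_cont\<close>)
  from continuous_closed_preimage[OF this closed_atLeastAtMost, of "{0}"]
  have "closed J" by (simp add: J_def Int_def vimage_def)
  moreover have "bounded J" by (rule bounded_subset[of "{0..1}"]) (auto simp: J_def)
  ultimately have "compact J" by (simp add: compact_eq_bounded_closed)
  moreover have "0 \<in> J" using p by (simp add: J_def Zu_def)
  ultimately obtain s1 where s1: "s1 \<in> J" "\<And>s. s \<in> J \<Longrightarrow> s \<le> s1" using compact_attains_sup[of J] by blast
  have "s1 = 1"
  proof (rule ccontr)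
    assume "s1 \<noteq> 1"
    then have lt: "0 \<le> s1" "s1 < 1" using s1(1) by (auto simp: J_def)
    obtain \<delta> where \<delta>: "\<delta> > 0" "\<And>s. 0 \<le> s \<Longrightarrow> s < \<delta> \<Longrightarrow> u (p + E (s1 *\<^sub>R x) + E (s *\<^sub>R x)) = 0"
      using zero_set_forward[OF seg _ x, of s1] s1(1) lt by (auto simp: J_def)
    define s where "s = min \<delta> (1 - s1) / 2"
    have s: "0 < s" "s < \<delta>" "s1 + s \<le> 1" using \<delta>(1) lt by (auto simp: s_def min_def field_simps)
    have "u (p + E ((s1 + s) *\<^sub>R x)) = 0" using \<delta>(2)[of s] s by (simp add: E_add add.assoc)
    then have "s1 + s \<in> J" using s lt by (simp add: J_def)
    then show False using s1(2)[of "s1 + s"] s by simp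
  qed
  then show "p + E x \<in> Zu" using s1(1) seg[of 1] by (simp add: J_def Zu_def)
qed (auto simp: Zu_def)

section \<open>Rigidity of \<open>f\<close> on the zero set\<close>

lemma fields_eq_subspace: "q \<in> B \<Longrightarrow> subspace {\<zeta>. right_inv_field Exp \<zeta> f q = \<zeta> \<bullet> av}"
  using linear_0[OF right_field_linear[OF open_B f_C2, of q]] linear_add[OF right_field_linear[OF open_B f_C2, of q]]
    linear_scale[OF right_field_linear[OF open_B f_C2, of q]]
  by (simp add: subspace_def inner_add_left)

lemma field_layer_1:
  assumes x: "x \<in> V 1" and q: "q \<in> Zu"
  shows "right_inv_field Exp x f q = x \<bullet> av"
proof -
  have qB: "q \<in> B" "u q = 0" using q by (auto simp: Zu_def)
  have "x \<in> span (e ` {1..m})" using x by (simp only: span_e)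
  moreover have "span (e ` {1..m}) \<subseteq> {\<zeta>. right_inv_field Exp \<zeta> f q = \<zeta> \<bullet> av}"
  proof (rule span_minimal[OF _ fields_eq_subspace[OF qB(1)]])
    show "e ` {1..m} \<subseteq> {\<zeta>. right_inv_field Exp \<zeta> f q = \<zeta> \<bullet> av}"
    proof (rule image_subsetI)
      fix i assume i: "i \<in> {1..m}"
      have "e i \<bullet> av = (\<Sum>j=1..m. if j = i then a j else 0)"
        unfolding av_def inner_sum_right by (intro sum.cong refl) (use e_inner[OF i] in simp)
      also have "\<dots> = a i" using i by simp
      finally show "e i \<in> {\<zeta>. right_inv_field Exp \<zeta> f q = \<zeta> \<bullet> av}" using u_zero_imp[OF qB i] by simp
    qed
  qed
  ultimately show ?thesis by blast
qed

lemma affine_along_field: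
  assumes x: "\<And>q. q \<in> Zu \<Longrightarrow> right_inv_field Exp x f q = x \<bullet> av"
    and q: "\<And>s. s \<in> closed_segment 0 t \<Longrightarrow> E (s *\<^sub>R x) + q \<in> Zu"
  shows "f (E (t *\<^sub>R x) + q) = f q + t * (x \<bullet> av)"
proof -
  define g where "g s = f (E (s *\<^sub>R x) + q) - s * (x \<bullet> av)" for s
  have "(g has_field_derivative 0) (at s within closed_segment 0 t)" if "s \<in> closed_segment 0 t" for s
  proof -
    have Z: "E (s *\<^sub>R x) + q \<in> Zu" by (rule q[OF that])
    then have "E (s *\<^sub>R x) + q \<in> B" by (simp add: Zu_def)
    note d = right_field_deriv[OF open_B f_C2 this]
    have "(g has_field_derivative (right_inv_field Exp x f (E (s *\<^sub>R x) + q) - 1 * (x \<bullet> av))) (at s)"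
      unfolding g_def by (intro DERIV_diff DERIV_cmult_right DERIV_ident d)
    then have "(g has_field_derivative 0) (at s)" by (simp add: x[OF Z])
    then show ?thesis by (rule has_field_derivative_at_within)
  qed
  then obtain K where "\<And>s. s \<in> closed_segment 0 t \<Longrightarrow> g s = K"
    using has_field_derivative_zero_constant[OF convex_closed_segment, of 0 t g] by blast
  then have "g t = g 0" by simp
  then show ?thesis by (simp add: g_def)
qed

text \<open>Along a product \<open>E (t x) + E (s y) + E (- t x)\<close> the increments of \<open>f\<close> in the direction
  of \<open>x\<close> cancel, so the derivative along \<open>Ad (E (t x)) y\<close> does not depend on \<open>t\<close>.\<close>

lemma field_commutator:
  assumes x: "\<And>q. q \<in> Zu \<Longrightarrow> right_inv_field Exp x f q = x \<bullet> av"
    and y: "\<And>q. q \<in> Zu \<Longrightarrow> right_inv_field Exp y f q = y \<bullet> av"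
    and q: "q \<in> Zu"
  shows "right_inv_field Exp (C x y) f q = 0"
proof -
  define G where "G z = E (fst z *\<^sub>R x) + (E (snd (snd z) *\<^sub>R y) + (E ((- fst (snd z)) *\<^sub>R x) + q))"
    for z :: "real \<times> real \<times> real"
  have "continuous_on UNIV G" unfolding G_def
    by (intro continuous_intros continuous_on_compose2[OF E_cont[of UNIV]]) auto
  from continuous_open_preimage[OF this open_UNIV open_Zu] have "open (G -` Zu)" by simp
  moreover have "(0, 0, 0) \<in> G -` Zu" using q by (simp add: G_def)
  ultimately obtain O1 O' where O: "open O1" "open O'" "(0, 0, 0) \<in> O1 \<times> O'" "O1 \<times> O' \<subseteq> G -` Zu"
    by (rule open_prod_elim)
  have "(0, 0) \<in> O'" using O(3) by simp
  from open_prod_elim[OF O(2) this] obtain O2 O3 where O': "open O2" "open O3" "(0, 0) \<in> O2 \<times> O3" "O2 \<times> O3 \<subseteq> O'"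
    by metis
  have "open (O1 \<inter> O2 \<inter> O3)" "0 \<in> O1 \<inter> O2 \<inter> O3" using O O' by auto
  then obtain \<delta> where \<delta>: "\<delta> > 0" "ball 0 \<delta> \<subseteq> O1 \<inter> O2 \<inter> O3" using open_contains_ball by metis
  have GZ: "G (\<tau>, t, s) \<in> Zu" if "\<bar>\<tau>\<bar> < \<delta>" "\<bar>t\<bar> < \<delta>" "\<bar>s\<bar> < \<delta>" for \<tau> t s
  proof -
    have "\<tau> \<in> O1" "t \<in> O2" "s \<in> O3" using \<delta>(2) that by auto
    then have "(t, s) \<in> O'" using O'(4) by blast
    then have "(\<tau>, t, s) \<in> G -` Zu" using O(4) \<open>\<tau> \<in> O1\<close> by blast
    then show ?thesis by simp
  qed
  have seg: "\<bar>s'\<bar> < \<delta>" if "s' \<in> closed_segment 0 s" "\<bar>s\<bar> < \<delta>" for s' s :: real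
    using that by (auto simp: closed_segment_eq_real_ivl split: if_splits)
  have qB: "q \<in> B" using q by (simp add: Zu_def)
  define l where "l \<zeta> = right_inv_field Exp \<zeta> f q" for \<zeta>
  have lin: "linear l" unfolding l_def[abs_def] by (rule right_field_linear[OF open_B f_C2 qB])
  have const: "l (Ad (E (t *\<^sub>R x)) y) = y \<bullet> av" if t: "\<bar>t\<bar> < \<delta>" for t
  proof -
    have "f (E (s *\<^sub>R Ad (E (t *\<^sub>R x)) y) + q) = f (G (0, t, 0)) + s * (y \<bullet> av) + t * (x \<bullet> av)"
      if s: "\<bar>s\<bar> < \<delta>" for s
    proof -
      have "E (s *\<^sub>R Ad (E (t *\<^sub>R x)) y) + q = E (t *\<^sub>R x) + G (0, t, s)"
        by (simp add: Ad_conj[symmetric] G_def E_minus add.assoc del: add_uminus_conv_diff)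
      also have "f \<dots> = f (G (0, t, s)) + t * (x \<bullet> av)"
      proof (rule affine_along_field[OF x])
        fix \<tau> assume "\<tau> \<in> closed_segment 0 t"
        then show "E (\<tau> *\<^sub>R x) + G (0, t, s) \<in> Zu" using GZ[OF seg t s, of \<tau>] t by (simp add: G_def)
      qed
      also have "G (0, t, s) = E (s *\<^sub>R y) + G (0, t, 0)" by (simp add: G_def)
      also have "f \<dots> = f (G (0, t, 0)) + s * (y \<bullet> av)"
      proof (rule affine_along_field[OF y])
        fix \<tau> assume "\<tau> \<in> closed_segment 0 s"
        then have "\<bar>\<tau>\<bar> < \<delta>" using seg s by blast
        from GZ[OF _ t this, of 0] show "E (\<tau> *\<^sub>R y) + G (0, t, 0) \<in> Zu" using \<delta>(1) by (simp add: G_def)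
      qed
      finally show ?thesis .
    qed
    then have ev: "eventually (\<lambda>s. f (E (s *\<^sub>R Ad (E (t *\<^sub>R x)) y) + q) = f (G (0, t, 0)) + s * (y \<bullet> av) + t * (x \<bullet> av)) (nhds 0)"
      using \<delta>(1) by (auto simp: eventually_nhds_metric dist_real_def)
    have "((\<lambda>s. f (G (0, t, 0)) + s * (y \<bullet> av) + t * (x \<bullet> av)) has_real_derivative y \<bullet> av) (at 0)"
      by (auto intro!: derivative_eq_intros)
    then have "((\<lambda>s. f (E (s *\<^sub>R Ad (E (t *\<^sub>R x)) y) + q)) has_real_derivative y \<bullet> av) (at 0)"
      by (rule iffD2[OF DERIV_cong_ev[OF refl ev refl]])
    moreover have "((\<lambda>s. f (E (s *\<^sub>R Ad (E (t *\<^sub>R x)) y) + q)) has_real_derivative l (Ad (E (t *\<^sub>R x)) y)) (at 0)"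
      using right_field_deriv[OF open_B f_C2, of 0 "Ad (E (t *\<^sub>R x)) y" q] qB by (simp add: l_def)
    ultimately show ?thesis using DERIV_unique by blast
  qed
  have "bounded_linear l" using lin by (simp add: linear_conv_bounded_linear)
  from bounded_linear.has_vector_derivative[OF this Ad_deriv_0]
  have 1: "((\<lambda>t. l (Ad (E (t *\<^sub>R x)) y)) has_vector_derivative l (C x y)) (at 0)" .
  have "eventually (\<lambda>t. l (Ad (E (t *\<^sub>R x)) y) = y \<bullet> av) (nhds 0)"
    using const \<delta>(1) by (auto simp: eventually_nhds_metric dist_real_def)
  then have "((\<lambda>t. l (Ad (E (t *\<^sub>R x)) y)) has_real_derivative 0) (at 0)"
    using DERIV_cong_ev[OF refl _ refl, of "\<lambda>t. l (Ad (E (t *\<^sub>R x)) y)" "\<lambda>_. y \<bullet> av" 0 0] by simp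
  with 1 have "l (C x y) = 0"
    by (simp add: has_real_derivative_iff_has_vector_derivative) (rule vector_derivative_unique_at)
  then show ?thesis by (simp add: l_def)
qed

lemma av_V1: "av \<in> V 1"
  unfolding av_def by (intro subspace_sum[OF layer_subspace[OF layer1]] subspace_scale[OF layer_subspace[OF layer1]] e_V1)

lemma inner_av_layer: "j \<in> {2..k} \<Longrightarrow> y \<in> V j \<Longrightarrow> y \<bullet> av = 0"
  using layers_orthogonal[of j 1 y av] av_V1 by (simp add: orthogonal_def)

text \<open>For \<open>j \<ge> 2\<close> both sides vanish: higher layers are spanned by commutators
  and are orthogonal to \<open>av\<close>. Writing the value as \<open>\<eta> \<bullet> av\<close>
  gives one linear formula for all layers, which suits both the induction and the passage to
  spans.\<close>

lemma field_layer:
  assumes "j \<ge> 1" "j \<le> k" "\<eta> \<in> V j" "q \<in> Zu"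
  shows "right_inv_field Exp \<eta> f q = \<eta> \<bullet> av"
  using assms
proof (induction j arbitrary: \<eta> q rule: dec_induct)
  case base
  then show ?case by (intro field_layer_1)
next
  case (step j)
  have j: "j \<in> {1..<k}" using step by simp
  have qB: "q \<in> B" using step.prems by (simp add: Zu_def)
  have "{C x y | x y. x \<in> V 1 \<and> y \<in> V j} \<subseteq> {\<zeta>. right_inv_field Exp \<zeta> f q = \<zeta> \<bullet> av}"
  proof (rule subsetI, elim CollectE exE conjE)
    fix \<zeta> x y assume xy: "\<zeta> = C x y" "x \<in> V 1" "y \<in> V j"
    have "right_inv_field Exp (C x y) f q = 0"
    proof (rule field_commutator[OF _ _ step.prems(3)])
      show "right_inv_field Exp x f q' = x \<bullet> av" if "q' \<in> Zu" for q' by (rule field_layer_1[OF xy(2) that])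
      show "right_inv_field Exp y f q' = y \<bullet> av" if "q' \<in> Zu" for q'
        using step.IH xy(3) that j by simp
    qed
    moreover have "C x y \<in> V (j + 1)" using C_layer(2)[OF xy(2) _ xy(3)] j by simp
    then have "C x y \<bullet> av = 0" using j by (intro inner_av_layer[of "j + 1"]) auto
    ultimately show "\<zeta> \<in> {\<zeta>. right_inv_field Exp \<zeta> f q = \<zeta> \<bullet> av}" using xy(1) by simp
  qed
  then have "span {C x y | x y. x \<in> V 1 \<and> y \<in> V j} \<subseteq> {\<zeta>. right_inv_field Exp \<zeta> f q = \<zeta> \<bullet> av}"
    by (rule span_minimal[OF _ fields_eq_subspace[OF qB]])
  then have "V (j + 1) \<subseteq> {\<zeta>. right_inv_field Exp \<zeta> f q = \<zeta> \<bullet> av}" by (simp only: layer_Suc_span[OF j])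
  then show ?case using step.prems by auto
qed

lemma field_zero_set:
  assumes q: "q \<in> Zu"
  shows "right_inv_field Exp \<zeta> f q = \<zeta> \<bullet> av"
proof -
  have qB: "q \<in> B" using q by (simp add: Zu_def)
  have "(\<Union>j\<in>{1..k}. V j) \<subseteq> {\<zeta>. right_inv_field Exp \<zeta> f q = \<zeta> \<bullet> av}"
    using field_layer[OF _ _ _ q] by auto
  then have "span (\<Union>j\<in>{1..k}. V j) \<subseteq> {\<zeta>. right_inv_field Exp \<zeta> f q = \<zeta> \<bullet> av}"
    by (rule span_minimal[OF _ fields_eq_subspace[OF qB]])
  then show ?thesis using layers_span by auto
qed

text \<open>By unipotency \<open>Ad p \<eta> - \<eta>\<close> lies in the span of the layers above
  the first, which is orthogonal to \<open>av\<close>.\<close>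

lemma Ad_inner_av: "Ad p \<eta> \<bullet> av = \<eta> \<bullet> av"
proof -
  have "tail 2 \<subseteq> {x. x \<bullet> av = 0}" unfolding tail_def
    by (rule span_minimal) (auto simp: subspace_def inner_add_left inner_av_layer)
  moreover have "Ad p \<eta> - \<eta> \<in> tail (1 + 1)" using unip_all[of p] tail_1 unfolding unip_def by blast
  then have "Ad p \<eta> - \<eta> \<in> tail 2" by (simp only: one_add_one)
  ultimately have "(Ad p \<eta> - \<eta>) \<bullet> av = 0" by auto
  then show ?thesis by (simp add: inner_diff_left)
qed

lemma vel_product: "vel (\<lambda>h. E (h *\<^sub>R \<xi>) + E (h *\<^sub>R \<eta>)) (T (\<xi> + \<eta>))"
proof -
  have "((\<lambda>h. E (h *\<^sub>R \<zeta>)) \<longlongrightarrow> 0) (nhds 0)" "((\<lambda>h. \<phi> (E (h *\<^sub>R \<zeta>))) has_derivative (\<lambda>h. h *\<^sub>R T \<zeta>)) (at 0)" for \<zeta>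
    using E_vel[of \<zeta>] by (simp_all add: vel_def has_vector_derivative_def)
  note d = this
  have "((\<lambda>h. \<phi> (E (h *\<^sub>R \<xi>) + E (h *\<^sub>R \<eta>))) has_derivative (\<lambda>h. h *\<^sub>R T \<xi> + h *\<^sub>R T \<eta>)) (at 0)"
    by (rule product_chart_derivative[OF d d]) simp_all
  moreover have "((\<lambda>h. E (h *\<^sub>R \<xi>) + E (h *\<^sub>R \<eta>)) \<longlongrightarrow> 0 + 0) (nhds 0)" by (intro tendsto_add d)
  ultimately show ?thesis
    by (simp add: vel_def has_vector_derivative_def linear_add[OF T_linear] scaleR_add_right)
qed

text \<open>The path \<open>P v\<close> joins \<open>E \<xi>\<close> to
  \<open>E (\<xi> + v)\<close>. Its increments are curves of velocity \<open>v\<close> between two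
  fixed factors, so \<open>f\<close> has derivative \<open>v \<bullet> av\<close> along it, and
  \<open>E\<close> itself need not be differentiated. Compactness of the parameter interval keeps
  the path in \<open>Zu\<close> for small \<open>v\<close>.\<close>

lemma affine_near:
  assumes \<xi>: "E \<xi> \<in> Zu"
  shows "\<exists>X. open X \<and> 0 \<in> X \<and> (\<forall>v\<in>X. f (E (\<xi> + v)) = f (E \<xi>) + v \<bullet> av)"
proof -
  define P where "P v s = E (s *\<^sub>R (\<xi> + v)) + E ((1 - s) *\<^sub>R \<xi>)" for v s
  have "continuous_on UNIV (\<lambda>z. P (fst z) (snd z))" unfolding P_def
    by (intro continuous_intros continuous_on_compose2[OF E_cont[of UNIV]]) auto
  from continuous_open_preimage[OF this open_UNIV open_Zu]
  have op: "open ((\<lambda>z. P (fst z) (snd z)) -` Zu)" by simp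
  have "P 0 s = E \<xi>" for s using E_add[of s "1 - s" \<xi>] by (simp add: P_def)
  then have sub: "{0} \<times> {0..1} \<subseteq> (\<lambda>z. P (fst z) (snd z)) -` Zu" using \<xi> by auto
  obtain X where X: "0 \<in> X" "open X" "X \<times> {0..1} \<subseteq> (\<lambda>z. P (fst z) (snd z)) -` Zu"
    using Elementary_Topology.tube_lemma[OF compact_Icc op sub] by blast
  have "f (E (\<xi> + v)) = f (E \<xi>) + v \<bullet> av" if v: "v \<in> X" for v
  proof -
    have PZ: "P v s \<in> Zu" if "s \<in> {0..1}" for s
    proof -
      have "(v, s) \<in> (\<lambda>z. P (fst z) (snd z)) -` Zu" using X(3) v that by blast
      then show ?thesis by simp
    qed
    define g where "g s = f (P v s) - s * (v \<bullet> av)" for s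
    have "(g has_field_derivative 0) (at s within {0..1})" if s: "s \<in> {0..1}" for s
    proof -
      define p where "p = E (s *\<^sub>R (\<xi> + v))"
      define q where "q = E ((1 - s) *\<^sub>R \<xi>)"
      have pq: "p + q \<in> Zu" using PZ[OF s] by (simp only: p_def q_def P_def)
      then have pqB: "p + q \<in> B" by (simp add: Zu_def)
      have P: "P v (s + h) = p + (E (h *\<^sub>R (\<xi> + v)) + E (h *\<^sub>R (- \<xi>))) + q" for h
      proof -
        have "E ((1 - (s + h)) *\<^sub>R \<xi>) = E (((- h) + (1 - s)) *\<^sub>R \<xi>)" by (simp add: algebra_simps)
        also have "\<dots> = E (h *\<^sub>R (- \<xi>)) + q" unfolding E_add q_def by simp
        finally show ?thesis unfolding P_def E_add p_def by (simp only: add.assoc)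
      qed
      have "vel (\<lambda>h. E (h *\<^sub>R (\<xi> + v)) + E (h *\<^sub>R (- \<xi>))) (T v)" using vel_product[of "\<xi> + v" "- \<xi>"] by simp
      from curve_deriv_eq_field[OF open_B f_C2 pqB this]
      have "((\<lambda>h. f (P v (s + h))) has_vector_derivative v \<bullet> av) (at 0)"
        by (simp only: P[symmetric] has_real_derivative_iff_has_vector_derivative field_zero_set[OF pq] Ad_inner_av)
      from shift_vector_derivative[where g = "\<lambda>s. f (P v s)", OF this]
      have "((\<lambda>s. f (P v s)) has_real_derivative v \<bullet> av) (at s)"
        by (simp only: has_real_derivative_iff_has_vector_derivative)
      then have "(g has_field_derivative (v \<bullet> av - 1 * (v \<bullet> av))) (at s)"
        unfolding g_def by (intro DERIV_diff DERIV_cmult_right DERIV_ident)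
      then have "(g has_field_derivative 0) (at s)" by simp
      then show ?thesis by (rule has_field_derivative_at_within)
    qed
    then obtain K where "\<And>s. s \<in> {0..1} \<Longrightarrow> g s = K"
      using has_field_derivative_zero_constant[OF convex_real_interval(5), of 0 1 g] by blast
    then have "g 1 = g 0" by simp
    then show ?thesis by (simp add: g_def P_def)
  qed
  then show ?thesis using X by blast
qed

text \<open>The zero set of \<open>u\<close> and its complement in \<open>B\<close> are open, so
  \<open>u\<close> vanishes along the whole dilation curve because it does at \<open>0\<close>. Then
  \<open>affine_near\<close> makes \<open>f (E (D s)) - D s \<bullet> av\<close> locally constant in
  \<open>s\<close>.\<close>

lemma affine_along_dilations:
  assumes B: "\<And>s. s \<in> {0..1} \<Longrightarrow> E (\<Delta> s \<xi>) \<in> B"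
  shows "f (E \<xi>) = f 0 + \<xi> \<bullet> av"
proof -
  define D where "D s = \<Delta> s \<xi>" for s
  have Dc: "continuous_on S D" for S unfolding D_def[abs_def] by (rule dilation_cont)
  have ED: "isCont (\<lambda>s. E (D s)) s" for s
    using continuous_on_compose2[OF E_cont[of UNIV] Dc[of UNIV]] by (simp add: continuous_on_eq_continuous_at)
  have lim: "((\<lambda>s'. E (D s')) \<longlongrightarrow> E (D s)) (at s within {0..1})" for s
    using ED[of s] continuous_at_imp_continuous_at_within[of s "\<lambda>s. E (D s)"] by (simp add: continuous_within)
  have nz: "open {p \<in> B. u p \<noteq> 0}"
    using continuous_open_preimage[OF u_cont open_B, of "- {0}"] by (simp add: open_Compl vimage_def Int_def)
  have Z: "E (D s) \<in> Zu" if s: "s \<in> {0..1}" for s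
  proof -
    have "(u (E (D 0)) = 0) = (u (E (D s)) = 0)"
    proof (rule connected_local_const[where A = "{0..1::real}" and f = "\<lambda>s. u (E (D s)) = 0"])
      show "\<forall>a\<in>{0..1}. eventually (\<lambda>b. (u (E (D a)) = 0) = (u (E (D b)) = 0)) (at a within {0..1})"
      proof
        fix a :: real assume a: "a \<in> {0..1}"
        have aB: "E (D a) \<in> B" using B[OF a] by (simp only: D_def)
        show "eventually (\<lambda>b. (u (E (D a)) = 0) = (u (E (D b)) = 0)) (at a within {0..1})"
        proof (cases "u (E (D a)) = 0")
          case True
          then have "E (D a) \<in> Zu" using aB by (simp add: Zu_def)
          from topological_tendstoD[OF lim open_Zu this] show ?thesis
            by eventually_elim (use True in \<open>simp add: Zu_def\<close>)
        next
          case False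
          then have "E (D a) \<in> {p \<in> B. u p \<noteq> 0}" using aB by simp
          from topological_tendstoD[OF lim nz this] show ?thesis
            by eventually_elim (use False in simp)
        qed
      qed
    qed (use s in auto)
    then show ?thesis using B[OF s] u_0 by (simp add: Zu_def D_def dilation_0)
  qed
  have "f (E (D 0)) - D 0 \<bullet> av = f (E (D 1)) - D 1 \<bullet> av"
  proof (rule connected_local_const[where A = "{0..1::real}" and f = "\<lambda>s. f (E (D s)) - D s \<bullet> av"])
    show "\<forall>a\<in>{0..1}. eventually (\<lambda>b. f (E (D a)) - D a \<bullet> av = f (E (D b)) - D b \<bullet> av) (at a within {0..1})"
    proof
      fix a :: real assume a: "a \<in> {0..1}"
      obtain X where X: "open X" "0 \<in> X" "\<And>v. v \<in> X \<Longrightarrow> f (E (D a + v)) = f (E (D a)) + v \<bullet> av"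
        using affine_near[OF Z[OF a]] by blast
      have "(D \<longlongrightarrow> D a) (at a within {0..1})" using Dc[of "{0..1}"] a by (simp add: continuous_on_def)
      then have "((\<lambda>b. D b - D a) \<longlongrightarrow> D a - D a) (at a within {0..1})" by (intro tendsto_intros)
      then have "((\<lambda>b. D b - D a) \<longlongrightarrow> 0) (at a within {0..1})" by simp
      from topological_tendstoD[OF this X(1,2)]
      show "eventually (\<lambda>b. f (E (D a)) - D a \<bullet> av = f (E (D b)) - D b \<bullet> av) (at a within {0..1})"
      proof eventually_elim
        case (elim b)
        from X(3)[OF elim] show ?case by (simp add: inner_diff_left)
      qed
    qed
  qed auto
  then show ?thesis by (simp add: D_def dilation_0 dilation_1)
qed

text \<open>At the identity the right-invariant derivative and the partial derivative of
  \<open>f \<circ> Exp\<close> are taken along the same curve.\<close>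

lemma inner_av: "\<xi> \<bullet> av = (\<Sum>i=1..m. log_coord e i \<xi> * log_partial_at_identity Exp e i f)"
  unfolding av_def inner_sum_right
proof (rule sum.cong[OF refl])
  fix i
  have "log_partial_at_identity Exp e i f = a i"
    by (simp add: log_partial_at_identity_def a_def right_inv_field_def)
  then show "\<xi> \<bullet> a i *\<^sub>R e i = log_coord e i \<xi> * log_partial_at_identity Exp e i f"
    by (simp add: log_coord_def)
qed

end

section \<open>Connectedness of the group and application to the gauge ball\<close>

lemma simply_connected_imp_connected:
  assumes "simply_connected (S :: 'g::topological_space set)"
  shows "connected S"
proof -
  have "path_component S a b" if ab: "a \<in> S" "b \<in> S" for a b
  proof -
    \<comment> \<open>Simple connectedness is a statement about free homotopies of loops. Two
      constant loops are homotopic, and the homotopy traces a path between their points.\<close>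
    have "homotopic_loops S (\<lambda>_. a) (\<lambda>_. b)"
      using assms[unfolded simply_connected_def, rule_format, of "\<lambda>_. a" "\<lambda>_. b"] ab
      by (simp add: path_def pathstart_def pathfinish_def path_image_def)
    from homotopic_loops_imp_path_component_value[OF this, of 0] show ?thesis by simp
  qed
  then have "path_connected S" by (simp add: path_connected_component)
  then show ?thesis by (rule path_connected_imp_connected)
qed

theorem theorem1p1:
  fixes A :: "('g::{topological_group_add, t2_space}, 'a::euclidean_space) chart set"
    and Exp :: "'a \<Rightarrow> 'g"
    and bracket :: "'a \<Rightarrow> 'a \<Rightarrow> 'a"
    and k m :: nat
    and V :: "nat \<Rightarrow> 'a set"
    and e :: "nat \<Rightarrow> 'a"
    and \<rho> f :: "'g \<Rightarrow> real"
    and r c :: real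
  assumes "carnot_group A Exp bracket k V"
    and "orthonormal_basis_of (V 1) m e"
    and "homogeneous_norm A Exp k V \<rho>"
    and "r > 0"
    and "manifold_Ck_on A 2 (gauge_ball \<rho> r) f"
    and "\<forall>p\<in>gauge_ball \<rho> r. horizontal_laplacian Exp m e f p = c"
    and "\<forall>p\<in>gauge_ball \<rho> r. right_gradient_sq Exp m e f p \<le> 1"
    and "right_gradient_sq Exp m e f 0 = 1"
  shows "(\<forall>p\<in>gauge_ball \<rho> r. \<forall>q\<in>gauge_ball \<rho> r. \<forall>\<xi> \<eta>. p = Exp \<xi> \<longrightarrow> q = Exp \<eta> \<longrightarrow>
            (\<forall>i\<in>{1..m}. log_coord e i \<xi> = log_coord e i \<eta>) \<longrightarrow> f p = f q) \<and>
         (\<forall>p\<in>gauge_ball \<rho> r. \<forall>\<xi>. p = Exp \<xi> \<longrightarrow>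
            f p = f 0 + (\<Sum>i=1..m. log_coord e i \<xi> * log_partial_at_identity Exp e i f))"
proof -
  interpret G: carnot_group A Exp bracket k V by fact
  obtain U \<phi> where "(U, \<phi>) \<in> A" "0 \<in> U" using G.chart_ex by blast
  then interpret carnot_chart A Exp bracket k V U \<phi> \<rho>
    by unfold_locales (use assms(3) simply_connected_imp_connected[OF G.simply_connected] in auto)
  have "open (\<rho> -` {..<r})" by (rule open_vimage[OF open_lessThan \<rho>_cont])
  moreover have "\<rho> -` {..<r} = gauge_ball \<rho> r" by (auto simp: gauge_ball_def)
  ultimately have "open (gauge_ball \<rho> r)" by simp
  moreover have zero: "0 \<in> gauge_ball \<rho> r" using \<rho>_eq_0[of 0] assms(4) by (simp add: gauge_ball_def)
  ultimately interpret carnot_function A Exp bracket k V U \<phi> \<rho> m e f "gauge_ball \<rho> r" c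
    by unfold_locales (use assms in auto)
  have affine: "f (Exp \<xi>) = f 0 + (\<Sum>i=1..m. log_coord e i \<xi> * log_partial_at_identity Exp e i f)"
    if "Exp \<xi> \<in> gauge_ball \<rho> r" for \<xi>
  proof -
    have \<xi>: "\<rho> (E \<xi>) < r" using that by (simp add: gauge_ball_def Exp_E)
    have "f (E \<xi>) = f 0 + \<xi> \<bullet> av"
    \<comment> \<open>A dilation with \<open>s \<le> 1\<close> multiplies the norm by
      \<open>s\<close>, so the curve stays in the gauge ball.\<close>
    proof (rule affine_along_dilations)
      fix s :: real assume s: "s \<in> {0..1}"
      show "E (\<Delta> s \<xi>) \<in> gauge_ball \<rho> r"
      proof (cases "s = 0")
        case True
        then show ?thesis using zero by (simp add: dilation_0)
      next
        case False
        then have "\<rho> (E (\<Delta> s \<xi>)) = s * \<rho> (E \<xi>)" using s by (intro \<rho>_E_dilation) simp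
        also have "\<dots> \<le> 1 * \<rho> (E \<xi>)" using s by (intro mult_right_mono \<rho>_nonneg) simp
        finally show ?thesis using \<xi> by (simp add: gauge_ball_def)
      qed
    qed
    then show ?thesis by (simp only: inner_av Exp_E)
  qed
  show ?thesis
  proof (intro conjI ballI allI impI)
    fix p q \<xi> \<eta>
    assume p: "p \<in> gauge_ball \<rho> r" "p = Exp \<xi>" and q: "q \<in> gauge_ball \<rho> r" "q = Exp \<eta>"
      and eq: "\<forall>i\<in>{1..m}. log_coord e i \<xi> = log_coord e i \<eta>"
    have "(\<Sum>i=1..m. log_coord e i \<xi> * log_partial_at_identity Exp e i f) =
      (\<Sum>i=1..m. log_coord e i \<eta> * log_partial_at_identity Exp e i f)"
      using eq by (intro sum.cong refl) simp
    then show "f p = f q" using affine[of \<xi>] affine[of \<eta>] p q by simp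
  next
    fix p \<xi> assume "p \<in> gauge_ball \<rho> r" "p = Exp \<xi>"
    then show "f p = f 0 + (\<Sum>i=1..m. log_coord e i \<xi> * log_partial_at_identity Exp e i f)"
      using affine[of \<xi>] by simp
  qed
qed

end
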